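(* Let $k$ be a field of characteristic $2$ and let $Q=Q_8$ be the quaternion group with $8$ elements. The class $\gamma_Q\in HH^{3,-1}\hat H^*(Q)$ is non-trivial, and the cokernel of the map $$\hat H^*(Q)[-1]\oplus \hat H^*(Q)[-1]\xrightarrow{\begin{pmatrix} y & x+y\\ x& y\end{pmatrix}}\hat H^*(Q)\oplus\hat H^*(Q)$$ is a graded $\hat H^*(Q)$-module which is not a direct summand of a realisable one.
   Context: All modules are right modules. For a graded module $M$, $M[n]^j=M^{n+j}$. Matrices act by left multiplication on column vectors. For a finite group $G$ and a field $k$, let $\hat P_*$ be a complete projective resolution of the trivial $kG$-module $k$. Tate cohomology is $\hat H^n(G,M)=H^n(\mathrm{Hom}_{kG}(\hat P_*,M))$, $n\in\mathbb Z$. $\hat H^*(G)=\hat H^*(G,k)$ is a graded $k$-algebra and $\hat H^*(G,M)$ is a graded $\hat H^*(G)$-module. A graded $\hat H^*(G)$-module is called realisable if it is isomorphic to $\hat H^*(G,M)$ for some $kG$-module $M$. Write $Q=\langle I,J,K\mid I^2=J^2=K^2,\ IJ=K\rangle$. It is known that $\hat H^*(Q)\cong k[x,y,s^{\pm1}]/(x^2+y^2=xy,\ x^3=y^3=0,\ x^2y=xy^2)$ with $|x|=|y|=1$, $|s|=4$. Here $x,y\in \hat H^1(Q)=\mathrm{Hom}(Q,k)$ are the homomorphisms with $x(I)=1,\ x(J)=0$ and $y(I)=0,\ y(J)=1$. Endomorphism dga: $A^n=\prod_{j}\mathrm{Hom}_{kG}(\hat P_{j+n},\hat P_j)$ with $df=\partial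 f-(-1)^{n}f\partial$ for $f\in A^n$. There is an algebra isomorphism $H^*A\cong \hat H^*(G)$, $[f]\mapsto[\epsilon\circ f_0]$, with $\epsilon:\hat P_0\to k$ the augmentation. Hochschild cohomology: $C^{n,m}(\Lambda)=\mathrm{Hom}_k^m(\Lambda^{\otimes n},\Lambda)$ ($k$-linear maps raising degree by $m$) with $(\delta\varphi)(\lambda_1,\dots,\lambda_{n+1})=(-1)^{m|\lambda_1|}\lambda_1\varphi(\lambda_2,\dots,\lambda_{n+1})+\sum_{i=1}^n(-1)^i\varphi(\dots,\lambda_i\lambda_{i+1},\dots)+(-1)^{n+1}\varphi(\lambda_1,\dots,\lambda_n)\lambda_{n+1}$, and $HH^{s,t}(\Lambda)=H^s(C^{*,t}(\Lambda))$. The canonical class $\gamma_G\in HH^{3,-1}\hat H^*(G)$: choose a $k$-linear degree $0$ map $f_1:H^*A\to A$ sending each class to a representing cocycle, and a $k$-linear $f_2:H^*A\otimes H^*A\to A$ of degree $-1$ with $df_2(x,y)=f_1(xy)-f_1(x)f_1(y)$. Let $m(a,b,c)$ be the class of the cocycle $f_2(a,b)f_1(c)-f_2(a,bc)+f_2(ab,c)-(-1)^{|a|}f_1(a)f_2(b,c)$. Then $m$ is a Hochschild cocycle whose class $\gamma_G$ is independent of the choices. *)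

theory Defs
  imports "HOL-Algebra.Algebra"
begin

text \<open>The fields \<open>mult\<close> and \<open>one\<close> of a \<open>module\<close> record play no role and are left undefined.\<close>

definition linear_maps ::
  "('k, 'c) ring_scheme \<Rightarrow> ('k, 'v, 'd) module_scheme \<Rightarrow> ('k, 'w, 'e) module_scheme \<Rightarrow> ('v \<Rightarrow> 'w) set"
  where
  "linear_maps k V W =
     {f \<in> carrier V \<rightarrow>\<^sub>E carrier W.
        (\<forall>u\<in>carrier V. \<forall>v\<in>carrier V. f (u \<oplus>\<^bsub>V\<^esub> v) = f u \<oplus>\<^bsub>W\<^esub> f v) \<and>
        (\<forall>c\<in>carrier k. \<forall>v\<in>carrier V. f (c \<odot>\<^bsub>V\<^esub> v) = c \<odot>\<^bsub>W\<^esub> f v)}"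

definition quotient_module :: "('k, 'v, 'd) module_scheme \<Rightarrow> 'v set \<Rightarrow> ('k, 'v set) module" where
  "quotient_module V B =
     \<lparr>carrier = {B +>\<^bsub>V\<^esub> v | v. v \<in> carrier V}, monoid.mult = undefined, monoid.one = undefined,
      ring.zero = B, ring.add = (\<lambda>S T. S <+>\<^bsub>V\<^esub> T), module.smult = (\<lambda>c S. B <+>\<^bsub>V\<^esub> ((\<lambda>v. c \<odot>\<^bsub>V\<^esub> v) ` S))\<rparr>"

definition sum_module ::
  "('k, 'v, 'd) module_scheme \<Rightarrow> ('k, 'w, 'e) module_scheme \<Rightarrow> ('k, 'v \<times> 'w) module" where
  "sum_module V W =
     \<lparr>carrier = carrier V \<times> carrier W, monoid.mult = undefined, monoid.one = undefined,
      ring.zero = (\<zero>\<^bsub>V\<^esub>, \<zero>\<^bsub>W\<^esub>), ring.add = (\<lambda>(v, w) (v', w'). (v \<oplus>\<^bsub>V\<^esub> v', w \<oplus>\<^bsub>W\<^esub> w')),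
      module.smult = (\<lambda>c (v, w). (c \<odot>\<^bsub>V\<^esub> v, c \<odot>\<^bsub>W\<^esub> w))\<rparr>"

definition sign_smult :: "('k, 'v, 'd) module_scheme \<Rightarrow> int \<Rightarrow> 'v \<Rightarrow> 'v" where
  "sign_smult V n v = (if even n then v else \<ominus>\<^bsub>V\<^esub> v)"

text \<open>A right \<open>kG\<close>-module is a \<open>k\<close>-module with a \<open>k\<close>-linear right action of \<open>G\<close>.\<close>

record ('k, 'v, 'g) kG_mod = "('k, 'v) module" +
  act :: "'v \<Rightarrow> 'g \<Rightarrow> 'v"

definition kG_module ::
  "('k, 'c) ring_scheme \<Rightarrow> ('g, 'b) monoid_scheme \<Rightarrow> ('k, 'v, 'g) kG_mod \<Rightarrow> bool" where
  "kG_module k G M \<longleftrightarrow>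
     module k M \<and>
     (\<forall>g\<in>carrier G. (\<lambda>v\<in>carrier M. act M v g) \<in> linear_maps k M M) \<and>
     (\<forall>v\<in>carrier M. act M v \<one>\<^bsub>G\<^esub> = v) \<and>
     (\<forall>v\<in>carrier M. \<forall>g\<in>carrier G. \<forall>h\<in>carrier G. act M v (g \<otimes>\<^bsub>G\<^esub> h) = act M (act M v g) h)"

definition kG_homs ::
  "('k, 'c) ring_scheme \<Rightarrow> ('g, 'b) monoid_scheme \<Rightarrow> ('k, 'v, 'g) kG_mod \<Rightarrow> ('k, 'w, 'g) kG_mod
    \<Rightarrow> ('v \<Rightarrow> 'w) set" where
  "kG_homs k G M N =
     {f \<in> linear_maps k M N. \<forall>v\<in>carrier M. \<forall>g\<in>carrier G. f (act M v g) = act N (f v) g}"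

definition hom_module ::
  "('k, 'c) ring_scheme \<Rightarrow> ('g, 'b) monoid_scheme \<Rightarrow> ('k, 'v, 'g) kG_mod \<Rightarrow> ('k, 'w, 'g) kG_mod
    \<Rightarrow> ('k, 'v \<Rightarrow> 'w) module" where
  "hom_module k G M N =
     \<lparr>carrier = kG_homs k G M N, monoid.mult = undefined, monoid.one = undefined,
      ring.zero = (\<lambda>v\<in>carrier M. \<zero>\<^bsub>N\<^esub>), ring.add = (\<lambda>f h. \<lambda>v\<in>carrier M. f v \<oplus>\<^bsub>N\<^esub> h v),
      module.smult = (\<lambda>c f. \<lambda>v\<in>carrier M. c \<odot>\<^bsub>N\<^esub> f v)\<rparr>"

definition trivial_kG :: "('k, 'c) ring_scheme \<Rightarrow> ('k, 'k, 'g) kG_mod" where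
  "trivial_kG k =
     \<lparr>carrier = carrier k, monoid.mult = undefined, monoid.one = undefined, ring.zero = \<zero>\<^bsub>k\<^esub>, ring.add = ring.add k,
      module.smult = monoid.mult k, act = (\<lambda>v g. v)\<rparr>"

text \<open>The free right \<open>kG\<close>-module on a set \<open>B\<close>, whose elements are the finitely supported
  coefficient functions on the \<open>k\<close>-basis \<open>{x g | x \<in> B, g \<in> G}\<close>.\<close>

definition free_kG ::
  "('k, 'c) ring_scheme \<Rightarrow> ('g, 'b) monoid_scheme \<Rightarrow> 'x set \<Rightarrow> ('k, 'x \<times> 'g \<Rightarrow> 'k, 'g) kG_mod" where
  "free_kG k G B =
     \<lparr>carrier = {f \<in> (B \<times> carrier G) \<rightarrow>\<^sub>E carrier k. finite {z \<in> B \<times> carrier G. f z \<noteq> \<zero>\<^bsub>k\<^esub>}},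
      monoid.mult = undefined, monoid.one = undefined,
      ring.zero = (\<lambda>z\<in>B \<times> carrier G. \<zero>\<^bsub>k\<^esub>),
      ring.add = (\<lambda>f h. \<lambda>z\<in>B \<times> carrier G. f z \<oplus>\<^bsub>k\<^esub> h z),
      module.smult = (\<lambda>c f. \<lambda>z\<in>B \<times> carrier G. c \<otimes>\<^bsub>k\<^esub> f z),
      act = (\<lambda>f h. \<lambda>z\<in>B \<times> carrier G. f (fst z, snd z \<otimes>\<^bsub>G\<^esub> inv\<^bsub>G\<^esub> h))\<rparr>"

text \<open>Projective means: direct summand of a free module. It is no restriction to take the free
  module on the underlying set of \<open>M\<close>, as it maps onto \<open>M\<close> and projectivity makes this
  surjection split.\<close>

definition projective_kG ::
  "('k, 'c) ring_scheme \<Rightarrow> ('g, 'b) monoid_scheme \<Rightarrow> ('k, 'v, 'g) kG_mod \<Rightarrow> bool" where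
  "projective_kG k G M \<longleftrightarrow>
     kG_module k G M \<and>
     (\<exists>i\<in>kG_homs k G M (free_kG k G (carrier M)). \<exists>p\<in>kG_homs k G (free_kG k G (carrier M)) M.
        \<forall>v\<in>carrier M. p (i v) = v)"

text \<open>\<open>bd P n\<close> is the differential from degree \<open>n\<close> to degree \<open>n - 1\<close>.\<close>

record ('k, 'p, 'g) kG_complex =
  obj :: "int \<Rightarrow> ('k, 'p, 'g) kG_mod"
  bd :: "int \<Rightarrow> 'p \<Rightarrow> 'p"
  aug :: "'p \<Rightarrow> 'k"

text \<open>An acyclic complex of projectives whose non-negative part is, via the augmentation,
  a projective resolution of the trivial module.\<close>

definition complete_resolution ::
  "('k, 'c) ring_scheme \<Rightarrow> ('g, 'b) monoid_scheme \<Rightarrow> ('k, 'p, 'g) kG_complex \<Rightarrow> bool" where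
  "complete_resolution k G P \<longleftrightarrow>
     (\<forall>n. projective_kG k G (obj P n)) \<and>
     (\<forall>n. bd P n \<in> kG_homs k G (obj P n) (obj P (n - 1))) \<and>
     (\<forall>n. bd P (n + 1) ` carrier (obj P (n + 1)) =
            {v \<in> carrier (obj P n). bd P n v = \<zero>\<^bsub>obj P (n - 1)\<^esub>}) \<and>
     aug P \<in> kG_homs k G (obj P 0) (trivial_kG k) \<and>
     aug P ` carrier (obj P 0) = carrier k \<and>
     bd P 1 ` carrier (obj P 1) = {v \<in> carrier (obj P 0). aug P v = \<zero>\<^bsub>k\<^esub>}"

definition tate_cocycles ::
  "('k, 'c) ring_scheme \<Rightarrow> ('g, 'b) monoid_scheme \<Rightarrow> ('k, 'p, 'g) kG_complex \<Rightarrow> ('k, 'm, 'g) kG_mod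
    \<Rightarrow> int \<Rightarrow> ('p \<Rightarrow> 'm) set" where
  "tate_cocycles k G P M n =
     {\<phi> \<in> kG_homs k G (obj P n) M. \<forall>v\<in>carrier (obj P (n + 1)). \<phi> (bd P (n + 1) v) = \<zero>\<^bsub>M\<^esub>}"

definition tate_coboundaries ::
  "('k, 'c) ring_scheme \<Rightarrow> ('g, 'b) monoid_scheme \<Rightarrow> ('k, 'p, 'g) kG_complex \<Rightarrow> ('k, 'm, 'g) kG_mod
    \<Rightarrow> int \<Rightarrow> ('p \<Rightarrow> 'm) set" where
  "tate_coboundaries k G P M n =
     {compose (carrier (obj P n)) \<psi> (bd P n) | \<psi>. \<psi> \<in> kG_homs k G (obj P (n - 1)) M}"

definition tate_cohomology ::
  "('k, 'c) ring_scheme \<Rightarrow> ('g, 'b) monoid_scheme \<Rightarrow> ('k, 'p, 'g) kG_complex \<Rightarrow> ('k, 'm, 'g) kG_mod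
    \<Rightarrow> int \<Rightarrow> ('k, ('p \<Rightarrow> 'm) set) module" where
  "tate_cohomology k G P M n =
     quotient_module ((hom_module k G (obj P n) M)\<lparr>carrier := tate_cocycles k G P M n\<rparr>)
       (tate_coboundaries k G P M n)"

definition tate_class ::
  "('k, 'c) ring_scheme \<Rightarrow> ('g, 'b) monoid_scheme \<Rightarrow> ('k, 'p, 'g) kG_complex \<Rightarrow> ('k, 'm, 'g) kG_mod
    \<Rightarrow> int \<Rightarrow> ('p \<Rightarrow> 'm) \<Rightarrow> ('p \<Rightarrow> 'm) set" where
  "tate_class k G P M n \<phi> = tate_coboundaries k G P M n +>\<^bsub>hom_module k G (obj P n) M\<^esub> \<phi>"

text \<open>An element \<open>f\<close> of degree \<open>n\<close> has components \<open>f j\<close> from \<open>obj P (j + n)\<close> to \<open>obj P j\<close>.\<close>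

definition endo ::
  "('k, 'c) ring_scheme \<Rightarrow> ('g, 'b) monoid_scheme \<Rightarrow> ('k, 'p, 'g) kG_complex \<Rightarrow> int
    \<Rightarrow> ('k, int \<Rightarrow> 'p \<Rightarrow> 'p) module" where
  "endo k G P n =
     (let H = (\<lambda>j. hom_module k G (obj P (j + n)) (obj P j)) in
      \<lparr>carrier = {f. \<forall>j. f j \<in> carrier (H j)}, monoid.mult = undefined, monoid.one = undefined,
       ring.zero = (\<lambda>j. \<zero>\<^bsub>H j\<^esub>), ring.add = (\<lambda>f h j. f j \<oplus>\<^bsub>H j\<^esub> h j), module.smult = (\<lambda>c f j. c \<odot>\<^bsub>H j\<^esub> f j)\<rparr>)"

definition endo_mult ::
  "('k, 'p, 'g) kG_complex \<Rightarrow> int \<Rightarrow> int \<Rightarrow> (int \<Rightarrow> 'p \<Rightarrow> 'p) \<Rightarrow> (int \<Rightarrow> 'p \<Rightarrow> 'p) \<Rightarrow> int \<Rightarrow> 'p \<Rightarrow> 'p" where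
  "endo_mult P m n f g = (\<lambda>j. compose (carrier (obj P (j + (m + n)))) (f j) (g (j + m)))"

definition endo_diff ::
  "('k, 'p, 'g) kG_complex \<Rightarrow> int \<Rightarrow> (int \<Rightarrow> 'p \<Rightarrow> 'p) \<Rightarrow> int \<Rightarrow> 'p \<Rightarrow> 'p" where
  "endo_diff P n f =
     (\<lambda>j. \<lambda>v\<in>carrier (obj P (j + (n + 1))).
        bd P (j + 1) (f (j + 1) v) \<ominus>\<^bsub>obj P j\<^esub> sign_smult (obj P j) n (f j (bd P (j + n + 1) v)))"

definition endo_cocycles ::
  "('k, 'c) ring_scheme \<Rightarrow> ('g, 'b) monoid_scheme \<Rightarrow> ('k, 'p, 'g) kG_complex \<Rightarrow> int
    \<Rightarrow> (int \<Rightarrow> 'p \<Rightarrow> 'p) set" where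
  "endo_cocycles k G P n =
     {f \<in> carrier (endo k G P n). endo_diff P n f = \<zero>\<^bsub>endo k G P (n + 1)\<^esub>}"

text \<open>The image \<open>[\<epsilon> \<circ> f 0]\<close> of the class of \<open>f\<close> under \<open>H\<^sup>n A \<cong> \<hat>H\<^sup>n(G)\<close>.\<close>

definition endo_class ::
  "('k, 'c) ring_scheme \<Rightarrow> ('g, 'b) monoid_scheme \<Rightarrow> ('k, 'p, 'g) kG_complex \<Rightarrow> int
    \<Rightarrow> (int \<Rightarrow> 'p \<Rightarrow> 'p) \<Rightarrow> ('p \<Rightarrow> 'k) set" where
  "endo_class k G P n f =
     tate_class k G P (trivial_kG k) n (compose (carrier (obj P n)) (aug P) (f 0))"

record ('k, 'a) graded_alg =
  alg_piece :: "int \<Rightarrow> ('k, 'a) module"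
  alg_mult :: "int \<Rightarrow> int \<Rightarrow> 'a \<Rightarrow> 'a \<Rightarrow> 'a"
  alg_one :: 'a

record ('k, 'a, 'm) graded_mod =
  piece :: "int \<Rightarrow> ('k, 'm) module"
  gact :: "int \<Rightarrow> int \<Rightarrow> 'm \<Rightarrow> 'a \<Rightarrow> 'm"

definition graded_module ::
  "('k, 'c) ring_scheme \<Rightarrow> ('k, 'a) graded_alg \<Rightarrow> ('k, 'a, 'm) graded_mod \<Rightarrow> bool" where
  "graded_module k L M \<longleftrightarrow>
     (\<forall>i. module k (piece M i)) \<and>
     (\<forall>i j. \<forall>a\<in>carrier (alg_piece L j).
        (\<lambda>u\<in>carrier (piece M i). gact M i j u a) \<in> linear_maps k (piece M i) (piece M (i + j))) \<and>
     (\<forall>i j. \<forall>u\<in>carrier (piece M i).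
        (\<lambda>a\<in>carrier (alg_piece L j). gact M i j u a)
          \<in> linear_maps k (alg_piece L j) (piece M (i + j))) \<and>
     (\<forall>i j l. \<forall>u\<in>carrier (piece M i). \<forall>a\<in>carrier (alg_piece L j). \<forall>b\<in>carrier (alg_piece L l).
        gact M (i + j) l (gact M i j u a) b = gact M i (j + l) u (alg_mult L j l a b)) \<and>
     (\<forall>i. \<forall>u\<in>carrier (piece M i). gact M i 0 u (alg_one L) = u)"

definition graded_iso ::
  "('k, 'c) ring_scheme \<Rightarrow> ('k, 'a) graded_alg \<Rightarrow> ('k, 'a, 'm) graded_mod \<Rightarrow> ('k, 'a, 'n) graded_mod
    \<Rightarrow> bool" where
  "graded_iso k L M N \<longleftrightarrow>
     (\<exists>f. \<forall>i. f i \<in> linear_maps k (piece M i) (piece N i) \<and>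
            bij_betw (f i) (carrier (piece M i)) (carrier (piece N i)) \<and>
            (\<forall>j. \<forall>u\<in>carrier (piece M i). \<forall>a\<in>carrier (alg_piece L j).
               f (i + j) (gact M i j u a) = gact N i j (f i u) a))"

definition regular_module :: "('k, 'a) graded_alg \<Rightarrow> ('k, 'a, 'a) graded_mod" where
  "regular_module L = \<lparr>piece = alg_piece L, gact = alg_mult L\<rparr>"

definition shift :: "int \<Rightarrow> ('k, 'a, 'm) graded_mod \<Rightarrow> ('k, 'a, 'm) graded_mod" where
  "shift n M = \<lparr>piece = (\<lambda>j. piece M (n + j)), gact = (\<lambda>i j. gact M (n + i) j)\<rparr>"

definition graded_sum ::
  "('k, 'a, 'm) graded_mod \<Rightarrow> ('k, 'a, 'n) graded_mod \<Rightarrow> ('k, 'a, 'm \<times> 'n) graded_mod" where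
  "graded_sum M N =
     \<lparr>piece = (\<lambda>j. sum_module (piece M j) (piece N j)),
      gact = (\<lambda>i j (u, v) a. (gact M i j u a, gact N i j v a))\<rparr>"

text \<open>The cokernel of a graded module homomorphism \<open>f\<close> from \<open>M\<close> to \<open>N\<close>. The union defining the
  action runs over all representatives of the coset \<open>S\<close>, all of which give the same coset.\<close>

definition cokernel ::
  "('k, 'a, 'm) graded_mod \<Rightarrow> ('k, 'a, 'n) graded_mod \<Rightarrow> (int \<Rightarrow> 'm \<Rightarrow> 'n)
    \<Rightarrow> ('k, 'a, 'n set) graded_mod" where
  "cokernel M N f =
     \<lparr>piece = (\<lambda>j. quotient_module (piece N j) (f j ` carrier (piece M j))),
      gact = (\<lambda>i j S a.
        \<Union>u\<in>S. f (i + j) ` carrier (piece M (i + j)) +>\<^bsub>piece N (i + j)\<^esub> gact N i j u a)\<rparr>"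

text \<open>The complement may be taken on the same type as \<open>R\<close>, being isomorphic to a submodule
  of \<open>R\<close>.\<close>

definition direct_summand ::
  "('k, 'c) ring_scheme \<Rightarrow> ('k, 'a) graded_alg \<Rightarrow> ('k, 'a, 'm) graded_mod \<Rightarrow> ('k, 'a, 'r) graded_mod
    \<Rightarrow> bool" where
  "direct_summand k L M R \<longleftrightarrow>
     (\<exists>N :: ('k, 'a, 'r) graded_mod. graded_module k L N \<and> graded_iso k L (graded_sum M N) R)"

text \<open>The right action of \<open>\<hat>H\<^sup>n(G) \<cong> H\<^sup>n A\<close> on \<open>\<hat>H\<^sup>m(G, M)\<close> is \<open>[\<phi>] [g] = [\<phi> \<circ> g m]\<close>. The union
  runs over all representatives \<open>\<phi>\<close> and \<open>g\<close>, all of which give the same class.\<close>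

definition tate_act ::
  "('k, 'c) ring_scheme \<Rightarrow> ('g, 'b) monoid_scheme \<Rightarrow> ('k, 'p, 'g) kG_complex \<Rightarrow> ('k, 'm, 'g) kG_mod
    \<Rightarrow> int \<Rightarrow> int \<Rightarrow> ('p \<Rightarrow> 'm) set \<Rightarrow> ('p \<Rightarrow> 'k) set \<Rightarrow> ('p \<Rightarrow> 'm) set" where
  "tate_act k G P M m n u a =
     (\<Union>\<phi>\<in>u. \<Union>g\<in>{g \<in> endo_cocycles k G P n. endo_class k G P n g = a}.
        tate_class k G P M (m + n) (compose (carrier (obj P (m + n))) \<phi> (g m)))"

definition tate_module ::
  "('k, 'c) ring_scheme \<Rightarrow> ('g, 'b) monoid_scheme \<Rightarrow> ('k, 'p, 'g) kG_complex \<Rightarrow> ('k, 'm, 'g) kG_mod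
    \<Rightarrow> ('k, ('p \<Rightarrow> 'k) set, ('p \<Rightarrow> 'm) set) graded_mod" where
  "tate_module k G P M = \<lparr>piece = tate_cohomology k G P M, gact = tate_act k G P M\<rparr>"

text \<open>The multiplication is the one making \<open>[f] \<mapsto> [\<epsilon> \<circ> f 0]\<close> an algebra isomorphism from \<open>H\<^sup>* A\<close>.\<close>

definition tate_algebra ::
  "('k, 'c) ring_scheme \<Rightarrow> ('g, 'b) monoid_scheme \<Rightarrow> ('k, 'p, 'g) kG_complex
    \<Rightarrow> ('k, ('p \<Rightarrow> 'k) set) graded_alg" where
  "tate_algebra k G P =
     \<lparr>alg_piece = tate_cohomology k G P (trivial_kG k), alg_mult = tate_act k G P (trivial_kG k),
      alg_one = tate_class k G P (trivial_kG k) 0 (aug P)\<rparr>"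

text \<open>The type argument fixes the type of the elements of the \<open>kG\<close>-module realising
  \<open>R\<close>; statements are meant to be polymorphic in it.\<close>

definition realisable ::
  "'m itself \<Rightarrow> ('k, 'c) ring_scheme \<Rightarrow> ('g, 'b) monoid_scheme \<Rightarrow> ('k, 'p, 'g) kG_complex
    \<Rightarrow> ('k, ('p \<Rightarrow> 'k) set, 'r) graded_mod \<Rightarrow> bool" where
  "realisable T k G P R \<longleftrightarrow>
     graded_module k (tate_algebra k G P) R \<and>
     (\<exists>M :: ('k, 'm, 'g) kG_mod.
        kG_module k G M \<and> graded_iso k (tate_algebra k G P) R (tate_module k G P M))"

text \<open>The class in \<open>\<hat>H\<^sup>1(G)\<close> of a homomorphism \<open>\<chi>\<close> from \<open>G\<close> to \<open>k\<close>: choosing \<open>p\<close> with \<open>\<epsilon> p = 1\<close>, the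
  element \<open>p g - p\<close> lies in the kernel of \<open>\<epsilon>\<close> and hence is \<open>\<partial> q\<close> for some \<open>q\<close>; the cocycle \<open>\<phi>\<close>
  corresponds to the homomorphism sending \<open>g\<close> to \<open>\<phi> q\<close>. The set below is a full coset of
  coboundaries.\<close>

definition hom_class ::
  "('k, 'c) ring_scheme \<Rightarrow> ('g, 'b) monoid_scheme \<Rightarrow> ('k, 'p, 'g) kG_complex \<Rightarrow> ('g \<Rightarrow> 'k)
    \<Rightarrow> ('p \<Rightarrow> 'k) set" where
  "hom_class k G P \<chi> =
     {\<phi> \<in> tate_cocycles k G P (trivial_kG k) 1.
        \<forall>g\<in>carrier G. \<forall>p\<in>carrier (obj P 0). \<forall>q\<in>carrier (obj P 1).
          bd P 1 q = act (obj P 0) p g \<ominus>\<^bsub>obj P 0\<^esub> p \<longrightarrow> \<phi> q = \<chi> g \<otimes>\<^bsub>k\<^esub> aug P p}"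

text \<open>A degree \<open>m\<close> map from the \<open>n\<close>-fold tensor power of \<open>L\<close> to \<open>L\<close> is encoded as a multilinear
  function of lists of \<open>n\<close> homogeneous elements, each paired with its degree.\<close>

definition hoch_dom :: "('k, 'a) graded_alg \<Rightarrow> nat \<Rightarrow> (int \<times> 'a) list set" where
  "hoch_dom L n = {xs. length xs = n \<and> (\<forall>(i, a)\<in>set xs. a \<in> carrier (alg_piece L i))}"

definition total_degree :: "(int \<times> 'a) list \<Rightarrow> int" where
  "total_degree xs = sum_list (map fst xs)"

definition hoch_cochains ::
  "('k, 'c) ring_scheme \<Rightarrow> ('k, 'a) graded_alg \<Rightarrow> nat \<Rightarrow> int \<Rightarrow> ((int \<times> 'a) list \<Rightarrow> 'a) set" where
  "hoch_cochains k L n m =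
     {\<phi> \<in> extensional (hoch_dom L n).
        (\<forall>xs\<in>hoch_dom L n. \<phi> xs \<in> carrier (alg_piece L (total_degree xs + m))) \<and>
        (\<forall>us vs i. \<forall>a\<in>carrier (alg_piece L i). \<forall>b\<in>carrier (alg_piece L i).
           us @ (i, a) # vs \<in> hoch_dom L n \<longrightarrow>
           \<phi> (us @ (i, a \<oplus>\<^bsub>alg_piece L i\<^esub> b) # vs) =
             \<phi> (us @ (i, a) # vs)
               \<oplus>\<^bsub>alg_piece L (total_degree (us @ (i, a) # vs) + m)\<^esub> \<phi> (us @ (i, b) # vs)) \<and>
        (\<forall>us vs i. \<forall>a\<in>carrier (alg_piece L i). \<forall>c\<in>carrier k.
           us @ (i, a) # vs \<in> hoch_dom L n \<longrightarrow>
           \<phi> (us @ (i, c \<odot>\<^bsub>alg_piece L i\<^esub> a) # vs) =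
             c \<odot>\<^bsub>alg_piece L (total_degree (us @ (i, a) # vs) + m)\<^esub> \<phi> (us @ (i, a) # vs))}"

definition hoch_module ::
  "('k, 'c) ring_scheme \<Rightarrow> ('k, 'a) graded_alg \<Rightarrow> nat \<Rightarrow> int \<Rightarrow> ('k, (int \<times> 'a) list \<Rightarrow> 'a) module"
  where
  "hoch_module k L n m =
     \<lparr>carrier = hoch_cochains k L n m, monoid.mult = undefined, monoid.one = undefined,
      ring.zero = (\<lambda>xs\<in>hoch_dom L n. \<zero>\<^bsub>alg_piece L (total_degree xs + m)\<^esub>),
      ring.add = (\<lambda>\<phi> \<psi>. \<lambda>xs\<in>hoch_dom L n. \<phi> xs \<oplus>\<^bsub>alg_piece L (total_degree xs + m)\<^esub> \<psi> xs),
      module.smult = (\<lambda>c \<phi>. \<lambda>xs\<in>hoch_dom L n. c \<odot>\<^bsub>alg_piece L (total_degree xs + m)\<^esub> \<phi> xs)\<rparr>"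

text \<open>Replaces the entries number \<open>i\<close> and \<open>i + 1\<close> (counting from 1) by their product.\<close>

definition merge_at :: "('k, 'a) graded_alg \<Rightarrow> nat \<Rightarrow> (int \<times> 'a) list \<Rightarrow> (int \<times> 'a) list" where
  "merge_at L i xs =
     (let (d, a) = xs ! (i - 1); (e, b) = xs ! i
      in take (i - 1) xs @ (d + e, alg_mult L d e a b) # drop (i + 1) xs)"

definition hoch_diff ::
  "('k, 'a) graded_alg \<Rightarrow> nat \<Rightarrow> int \<Rightarrow> ((int \<times> 'a) list \<Rightarrow> 'a) \<Rightarrow> (int \<times> 'a) list \<Rightarrow> 'a" where
  "hoch_diff L n m \<phi> =
     (\<lambda>xs\<in>hoch_dom L (n + 1).
        let V = alg_piece L (total_degree xs + m) in
        sign_smult V (m * fst (hd xs))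
          (alg_mult L (fst (hd xs)) (total_degree (tl xs) + m) (snd (hd xs)) (\<phi> (tl xs)))
        \<oplus>\<^bsub>V\<^esub> (\<Oplus>\<^bsub>V\<^esub>i\<in>{1..n}. sign_smult V (int i) (\<phi> (merge_at L i xs)))
        \<oplus>\<^bsub>V\<^esub> sign_smult V (int n + 1)
          (alg_mult L (total_degree (butlast xs) + m) (fst (last xs)) (\<phi> (butlast xs)) (snd (last xs))))"

definition hoch_cocycles ::
  "('k, 'c) ring_scheme \<Rightarrow> ('k, 'a) graded_alg \<Rightarrow> nat \<Rightarrow> int \<Rightarrow> ((int \<times> 'a) list \<Rightarrow> 'a) set" where
  "hoch_cocycles k L n m =
     {\<phi> \<in> hoch_cochains k L n m. hoch_diff L n m \<phi> = \<zero>\<^bsub>hoch_module k L (n + 1) m\<^esub>}"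

definition hoch_coboundaries ::
  "('k, 'c) ring_scheme \<Rightarrow> ('k, 'a) graded_alg \<Rightarrow> nat \<Rightarrow> int \<Rightarrow> ((int \<times> 'a) list \<Rightarrow> 'a) set" where
  "hoch_coboundaries k L n m =
     (if n = 0 then {\<zero>\<^bsub>hoch_module k L 0 m\<^esub>}
      else hoch_diff L (n - 1) m ` hoch_cochains k L (n - 1) m)"

definition HH ::
  "('k, 'c) ring_scheme \<Rightarrow> ('k, 'a) graded_alg \<Rightarrow> nat \<Rightarrow> int
    \<Rightarrow> ('k, ((int \<times> 'a) list \<Rightarrow> 'a) set) module" where
  "HH k L s t =
     quotient_module ((hoch_module k L s t)\<lparr>carrier := hoch_cocycles k L s t\<rparr>)
       (hoch_coboundaries k L s t)"

text \<open>Throughout, \<open>H\<^sup>* A\<close> is identified with \<open>\<hat>H\<^sup>*(G)\<close> along \<open>[f] \<mapsto> [\<epsilon> \<circ> f 0]\<close>.\<close>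

definition canonical_choice ::
  "('k, 'c) ring_scheme \<Rightarrow> ('g, 'b) monoid_scheme \<Rightarrow> ('k, 'p, 'g) kG_complex
    \<Rightarrow> (int \<Rightarrow> ('p \<Rightarrow> 'k) set \<Rightarrow> (int \<Rightarrow> 'p \<Rightarrow> 'p))
    \<Rightarrow> (int \<Rightarrow> int \<Rightarrow> ('p \<Rightarrow> 'k) set \<Rightarrow> ('p \<Rightarrow> 'k) set \<Rightarrow> (int \<Rightarrow> 'p \<Rightarrow> 'p)) \<Rightarrow> bool" where
  "canonical_choice k G P f1 f2 \<longleftrightarrow>
     (let L = tate_algebra k G P; H = alg_piece L in
      (\<forall>i. f1 i \<in> linear_maps k (H i) (endo k G P i)) \<and>
      (\<forall>i. \<forall>a\<in>carrier (H i). f1 i a \<in> endo_cocycles k G P i \<and> endo_class k G P i (f1 i a) = a) \<and>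
      (\<forall>i j. \<forall>a\<in>carrier (H i). f2 i j a \<in> linear_maps k (H j) (endo k G P (i + j - 1))) \<and>
      (\<forall>i j. \<forall>b\<in>carrier (H j).
         (\<lambda>a\<in>carrier (H i). f2 i j a b) \<in> linear_maps k (H i) (endo k G P (i + j - 1))) \<and>
      (\<forall>i j. \<forall>a\<in>carrier (H i). \<forall>b\<in>carrier (H j).
         endo_diff P (i + j - 1) (f2 i j a b) =
           f1 (i + j) (alg_mult L i j a b)
             \<ominus>\<^bsub>endo k G P (i + j)\<^esub> endo_mult P i j (f1 i a) (f1 j b)))"

definition canonical_cocycle ::
  "('k, 'c) ring_scheme \<Rightarrow> ('g, 'b) monoid_scheme \<Rightarrow> ('k, 'p, 'g) kG_complex
    \<Rightarrow> (int \<Rightarrow> ('p \<Rightarrow> 'k) set \<Rightarrow> (int \<Rightarrow> 'p \<Rightarrow> 'p))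
    \<Rightarrow> (int \<Rightarrow> int \<Rightarrow> ('p \<Rightarrow> 'k) set \<Rightarrow> ('p \<Rightarrow> 'k) set \<Rightarrow> (int \<Rightarrow> 'p \<Rightarrow> 'p))
    \<Rightarrow> (int \<times> ('p \<Rightarrow> 'k) set) list \<Rightarrow> ('p \<Rightarrow> 'k) set" where
  "canonical_cocycle k G P f1 f2 =
     (let L = tate_algebra k G P in
      (\<lambda>xs\<in>hoch_dom L 3.
        let (r, a) = xs ! 0; (s, b) = xs ! 1; (t, c) = xs ! 2;
            E = endo k G P (r + s + t - 1)
        in endo_class k G P (r + s + t - 1)
             (endo_mult P (r + s - 1) t (f2 r s a b) (f1 t c)
               \<ominus>\<^bsub>E\<^esub> f2 r (s + t) a (alg_mult L s t b c)
               \<oplus>\<^bsub>E\<^esub> f2 (r + s) t (alg_mult L r s a b) c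
               \<ominus>\<^bsub>E\<^esub> sign_smult E r (endo_mult P r (s + t - 1) (f1 r a) (f2 s t b c)))))"

text \<open>The class does not depend on the choice of \<open>f1\<close> and \<open>f2\<close>.\<close>

definition canonical_class ::
  "('k, 'c) ring_scheme \<Rightarrow> ('g, 'b) monoid_scheme \<Rightarrow> ('k, 'p, 'g) kG_complex
    \<Rightarrow> ((int \<times> ('p \<Rightarrow> 'k) set) list \<Rightarrow> ('p \<Rightarrow> 'k) set) set" where
  "canonical_class k G P =
     (let L = tate_algebra k G P; (f1, f2) = (SOME (f1, f2). canonical_choice k G P f1 f2) in
      hoch_coboundaries k L 3 (-1) +>\<^bsub>hoch_module k L 3 (-1)\<^esub> canonical_cocycle k G P f1 f2)"

text \<open>A group that satisfies the relations of the presentation, is generated by \<open>I\<close>, \<open>J\<close>, \<open>K\<close> and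
  has 8 elements is isomorphic to the presented group, which itself has 8 elements.\<close>

definition quaternion_group :: "('g, 'b) monoid_scheme \<Rightarrow> 'g \<Rightarrow> 'g \<Rightarrow> 'g \<Rightarrow> bool" where
  "quaternion_group Q I J K \<longleftrightarrow>
     group Q \<and> I \<in> carrier Q \<and> J \<in> carrier Q \<and> K \<in> carrier Q \<and>
     I \<otimes>\<^bsub>Q\<^esub> I = J \<otimes>\<^bsub>Q\<^esub> J \<and> J \<otimes>\<^bsub>Q\<^esub> J = K \<otimes>\<^bsub>Q\<^esub> K \<and> I \<otimes>\<^bsub>Q\<^esub> J = K \<and>
     generate Q {I, J, K} = carrier Q \<and> order Q = 8"

end

theory Submission
  imports Defs
begin

text \<open>In characteristic 2 all signs disappear. Let \<open>B\<close> be the matrix of the theorem. The relations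
  \<open>x y = y x\<close> and \<open>x\<^sup>2 + x y + y\<^sup>2 = 0\<close> give \<open>B\<^sup>2 = 0\<close>, and both claims follow once the matric Massey
  product \<open>\<langle>B, B, B\<rangle>\<close> is known not to contain zero. Indeed, if \<open>m\<close> is the Hochschild coboundary of \<open>g\<close>, then
  \<open>V = f2(B, B) + f1(g(B, B))\<close> bounds the square of \<open>b = f1(B)\<close>, and \<open>b V + V b\<close> is a boundary. If the cokernel of \<open>B\<close>
  is a summand of \<open>\<hat>H\<^sup>*(Q, M)\<close>, its two generators give a row \<open>\<phi>\<close> of classes with \<open>\<phi> B = 0\<close>; the
  juggling formula \<open>\<langle>\<phi>, B, B\<rangle> B = \<phi> \<langle>B, B, B\<rangle>\<close>, projected to the cokernel, shows that \<open>\<langle>B, B, B\<rangle>\<close> meets its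
  own indeterminacy.

  Cochains \<open>V, V', W\<close> witnessing that \<open>\<langle>B, B, B\<rangle>\<close> contains zero deform the differential on four copies
  of \<open>P \<oplus> P\<close>. This yields block unitriangular \<open>8 \<times> 8\<close> matrices for \<open>I\<close> and \<open>J\<close> whose superdiagonal
  blocks are \<open>B(I)\<close> and \<open>B(J)\<close>. Comparing the top right blocks of \<open>I\<^sup>2 = J\<^sup>2 = (I J)\<^sup>2\<close> gives two matrix
  equations with inconsistent traces.\<close>

section \<open>Vector spaces in characteristic two\<close>

text \<open>The matrix is \<open>x\<close> times \<open>a\<close> plus \<open>y\<close> times
  \<open>c\<close>, where \<open>a = B(I)\<close> swaps the two coordinates and
  \<open>c = B(J)\<close> is upper triangular with three entries 1. These satisfy a a = c c = 1 and
  a c + c a = 1, so the square of the matrix is x x + x y + y y times the identity: it is a square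
  root of the quadratic relation, obtained from a two-dimensional module over the Clifford algebra
  of this form. The form has no linear factors over a field without primitive cube roots of unity,
  whereas the two by two square root exists over every field of characteristic two. The obstacle is
  the indeterminacy: \<open>V\<close> and \<open>V'\<close> may be changed independently by
  arbitrary cocycles, so the blocks above the superdiagonal of the 8 by 8 matrices are completely
  unknown. Let E1 be the sum of the corner blocks of I I and J J, and E2 that of J J and (I J)(I J).
  In tr(c E1) + tr(a E2) every unknown block drops out, by cyclicity of the trace and the Clifford
  relations, and the known blocks contribute 1.\<close>

lemma linear_mapsI:
  assumes "\<And>v. v \<in> carrier V \<Longrightarrow> f v \<in> carrier W" "f \<in> extensional (carrier V)"
    and "\<And>u v. u \<in> carrier V \<Longrightarrow> v \<in> carrier V \<Longrightarrow> f (u \<oplus>\<^bsub>V\<^esub> v) = f u \<oplus>\<^bsub>W\<^esub> f v"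
    and "\<And>c v. c \<in> carrier k \<Longrightarrow> v \<in> carrier V \<Longrightarrow> f (c \<odot>\<^bsub>V\<^esub> v) = c \<odot>\<^bsub>W\<^esub> f v"
  shows "f \<in> linear_maps k V W"
  using assms unfolding linear_maps_def by (auto simp: PiE_def)

lemma linear_maps_closed: "f \<in> linear_maps k V W \<Longrightarrow> v \<in> carrier V \<Longrightarrow> f v \<in> carrier W"
  and linear_maps_add: "f \<in> linear_maps k V W \<Longrightarrow> u \<in> carrier V \<Longrightarrow> v \<in> carrier V \<Longrightarrow>
     f (u \<oplus>\<^bsub>V\<^esub> v) = f u \<oplus>\<^bsub>W\<^esub> f v"
  and linear_maps_smult: "f \<in> linear_maps k V W \<Longrightarrow> c \<in> carrier k \<Longrightarrow> v \<in> carrier V \<Longrightarrow>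
     f (c \<odot>\<^bsub>V\<^esub> v) = c \<odot>\<^bsub>W\<^esub> f v"
  and linear_maps_ext: "f \<in> linear_maps k V W \<Longrightarrow> f \<in> extensional (carrier V)"
  unfolding linear_maps_def by (auto simp: PiE_def)

lemmas linear_maps_rules = linear_maps_closed linear_maps_add linear_maps_smult

lemma kG_homsI:
  assumes "\<And>v. v \<in> carrier M \<Longrightarrow> f v \<in> carrier N" "f \<in> extensional (carrier M)"
    and "\<And>u v. u \<in> carrier M \<Longrightarrow> v \<in> carrier M \<Longrightarrow> f (u \<oplus>\<^bsub>M\<^esub> v) = f u \<oplus>\<^bsub>N\<^esub> f v"
    and "\<And>c v. c \<in> carrier k \<Longrightarrow> v \<in> carrier M \<Longrightarrow> f (c \<odot>\<^bsub>M\<^esub> v) = c \<odot>\<^bsub>N\<^esub> f v"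
    and "\<And>g v. g \<in> carrier G \<Longrightarrow> v \<in> carrier M \<Longrightarrow> f (act M v g) = act N (f v) g"
  shows "f \<in> kG_homs k G M N"
  using assms unfolding kG_homs_def by (auto intro!: linear_mapsI)

lemma kG_homs_linear: "f \<in> kG_homs k G M N \<Longrightarrow> f \<in> linear_maps k M N"
  unfolding kG_homs_def by auto

lemma kG_homs_act: "f \<in> kG_homs k G M N \<Longrightarrow> v \<in> carrier M \<Longrightarrow> g \<in> carrier G \<Longrightarrow>
    f (act M v g) = act N (f v) g"
  unfolding kG_homs_def by auto

lemmas kG_homs_rules = linear_maps_rules[OF kG_homs_linear] kG_homs_act
lemmas kG_homs_ext = linear_maps_ext[OF kG_homs_linear]
lemmas kG_homs_closed = linear_maps_closed[OF kG_homs_linear]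
lemmas kG_homs_add = linear_maps_add[OF kG_homs_linear]
lemmas kG_homs_smult = linear_maps_smult[OF kG_homs_linear]

lemma kG_module_module: "kG_module k G M \<Longrightarrow> module k M"
  and kG_module_one: "kG_module k G M \<Longrightarrow> v \<in> carrier M \<Longrightarrow> act M v \<one>\<^bsub>G\<^esub> = v"
  and kG_module_mult: "kG_module k G M \<Longrightarrow> v \<in> carrier M \<Longrightarrow> g \<in> carrier G \<Longrightarrow> h \<in> carrier G \<Longrightarrow>
     act M v (g \<otimes>\<^bsub>G\<^esub> h) = act M (act M v g) h"
  unfolding kG_module_def by auto

lemma kG_module_act_linear:
  assumes "kG_module k G M" "g \<in> carrier G"
  shows "(\<lambda>v\<in>carrier M. act M v g) \<in> linear_maps k M M"
  using assms unfolding kG_module_def by auto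

locale char2 =
  fixes k :: "('k, 'c) ring_scheme"
  assumes field_k: "field k" and char2: "\<one>\<^bsub>k\<^esub> \<oplus>\<^bsub>k\<^esub> \<one>\<^bsub>k\<^esub> = \<zero>\<^bsub>k\<^esub>"
begin

sublocale K: field k by (rule field_k)

lemma act_closed: "kG_module k G M \<Longrightarrow> v \<in> carrier M \<Longrightarrow> g \<in> carrier G \<Longrightarrow> act M v g \<in> carrier M"
  using linear_maps_closed[OF kG_module_act_linear, of k G M g v] by simp

lemma add_closed: "module k V \<Longrightarrow> u \<in> carrier V \<Longrightarrow> v \<in> carrier V \<Longrightarrow> u \<oplus>\<^bsub>V\<^esub> v \<in> carrier V"
  by (simp add: module_def abelian_group_def abelian_monoid.a_closed)

lemma zero_closed: "module k V \<Longrightarrow> \<zero>\<^bsub>V\<^esub> \<in> carrier V"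
  by (simp add: module_def abelian_group_def abelian_monoid.zero_closed)

lemma smult_closed: "module k V \<Longrightarrow> c \<in> carrier k \<Longrightarrow> v \<in> carrier V \<Longrightarrow> c \<odot>\<^bsub>V\<^esub> v \<in> carrier V"
  by (simp add: module.smult_closed)

lemmas vs_closed = add_closed zero_closed smult_closed

lemma act_add: "kG_module k G M \<Longrightarrow> u \<in> carrier M \<Longrightarrow> v \<in> carrier M \<Longrightarrow> g \<in> carrier G \<Longrightarrow>
    act M (u \<oplus>\<^bsub>M\<^esub> v) g = act M u g \<oplus>\<^bsub>M\<^esub> act M v g"
  using linear_maps_add[OF kG_module_act_linear, of k G M g u v] add_closed[OF kG_module_module[of k G M]]
  by simp

lemma act_smult: "kG_module k G M \<Longrightarrow> c \<in> carrier k \<Longrightarrow> v \<in> carrier M \<Longrightarrow> g \<in> carrier G \<Longrightarrow>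
    act M (c \<odot>\<^bsub>M\<^esub> v) g = c \<odot>\<^bsub>M\<^esub> act M v g"
  using linear_maps_smult[OF kG_module_act_linear, of k G M g c v] smult_closed[OF kG_module_module[of k G M]]
  by simp

lemma vs_assoc: "module k V \<Longrightarrow> u \<in> carrier V \<Longrightarrow> v \<in> carrier V \<Longrightarrow> w \<in> carrier V \<Longrightarrow>
    (u \<oplus>\<^bsub>V\<^esub> v) \<oplus>\<^bsub>V\<^esub> w = u \<oplus>\<^bsub>V\<^esub> (v \<oplus>\<^bsub>V\<^esub> w)"
  by (simp add: module_def abelian_group_def abelian_monoid.a_assoc)

lemma vs_comm: "module k V \<Longrightarrow> u \<in> carrier V \<Longrightarrow> v \<in> carrier V \<Longrightarrow> u \<oplus>\<^bsub>V\<^esub> v = v \<oplus>\<^bsub>V\<^esub> u"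
  by (simp add: module_def abelian_group_def abelian_monoid.a_comm)

lemma vs_lcomm: "module k V \<Longrightarrow> u \<in> carrier V \<Longrightarrow> v \<in> carrier V \<Longrightarrow> w \<in> carrier V \<Longrightarrow>
    u \<oplus>\<^bsub>V\<^esub> (v \<oplus>\<^bsub>V\<^esub> w) = v \<oplus>\<^bsub>V\<^esub> (u \<oplus>\<^bsub>V\<^esub> w)"
  by (simp add: module_def abelian_group_def abelian_monoid.a_lcomm)

lemma vs_l_zero: "module k V \<Longrightarrow> u \<in> carrier V \<Longrightarrow> \<zero>\<^bsub>V\<^esub> \<oplus>\<^bsub>V\<^esub> u = u"
  by (simp add: module_def abelian_group_def abelian_monoid.l_zero)

lemma vs_r_zero: "module k V \<Longrightarrow> u \<in> carrier V \<Longrightarrow> u \<oplus>\<^bsub>V\<^esub> \<zero>\<^bsub>V\<^esub> = u"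
  by (simp add: module_def abelian_group_def abelian_monoid.r_zero)

lemma vs_self: assumes "module k V" "u \<in> carrier V" shows "u \<oplus>\<^bsub>V\<^esub> u = \<zero>\<^bsub>V\<^esub>"
proof -
  interpret module k V by fact
  have "u \<oplus>\<^bsub>V\<^esub> u = (\<one>\<^bsub>k\<^esub> \<oplus>\<^bsub>k\<^esub> \<one>\<^bsub>k\<^esub>) \<odot>\<^bsub>V\<^esub> u" using assms(2) by (simp add: smult_l_distr)
  then show ?thesis using assms(2) by (simp add: char2)
qed

lemma vs_self2: "module k V \<Longrightarrow> u \<in> carrier V \<Longrightarrow> v \<in> carrier V \<Longrightarrow> u \<oplus>\<^bsub>V\<^esub> (u \<oplus>\<^bsub>V\<^esub> v) = v"
  by (simp add: vs_assoc[symmetric] vs_self vs_l_zero)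

lemma vs_uminus: assumes "module k V" "u \<in> carrier V" shows "\<ominus>\<^bsub>V\<^esub> u = u"
proof -
  interpret module k V by fact
  show ?thesis using assms M.minus_equality[of u u] vs_self[OF assms] by simp
qed

lemma vs_minus: "module k V \<Longrightarrow> v \<in> carrier V \<Longrightarrow> u \<ominus>\<^bsub>V\<^esub> v = u \<oplus>\<^bsub>V\<^esub> v"
  by (simp add: a_minus_def vs_uminus)

lemma vs_sign: "module k V \<Longrightarrow> v \<in> carrier V \<Longrightarrow> sign_smult V n v = v"
  by (simp add: sign_smult_def vs_uminus)

text \<open>Ordered rewriting with these rules sorts a sum and cancels equal summands, which
  normalises additive expressions in characteristic two. Most computations below end with
  it.\<close>

lemmas vs_ac = vs_closed vs_assoc vs_comm vs_lcomm vs_l_zero vs_r_zero vs_self vs_self2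
lemma vs_eq: "module k V \<Longrightarrow> u \<in> carrier V \<Longrightarrow> v \<in> carrier V \<Longrightarrow> u \<oplus>\<^bsub>V\<^esub> v = \<zero>\<^bsub>V\<^esub> \<longleftrightarrow> u = v"
  by (metis vs_self vs_self2 vs_r_zero)

lemma smult_radd: "module k V \<Longrightarrow> c \<in> carrier k \<Longrightarrow> u \<in> carrier V \<Longrightarrow> v \<in> carrier V \<Longrightarrow>
    c \<odot>\<^bsub>V\<^esub> (u \<oplus>\<^bsub>V\<^esub> v) = c \<odot>\<^bsub>V\<^esub> u \<oplus>\<^bsub>V\<^esub> c \<odot>\<^bsub>V\<^esub> v"
  by (simp add: module.smult_r_distr)

lemma smult_ladd: "module k V \<Longrightarrow> c \<in> carrier k \<Longrightarrow> d \<in> carrier k \<Longrightarrow> v \<in> carrier V \<Longrightarrow>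
    (c \<oplus>\<^bsub>k\<^esub> d) \<odot>\<^bsub>V\<^esub> v = c \<odot>\<^bsub>V\<^esub> v \<oplus>\<^bsub>V\<^esub> d \<odot>\<^bsub>V\<^esub> v"
  by (simp add: module.smult_l_distr)

lemma smult_mult: "module k V \<Longrightarrow> c \<in> carrier k \<Longrightarrow> d \<in> carrier k \<Longrightarrow> v \<in> carrier V \<Longrightarrow>
    (c \<otimes>\<^bsub>k\<^esub> d) \<odot>\<^bsub>V\<^esub> v = c \<odot>\<^bsub>V\<^esub> (d \<odot>\<^bsub>V\<^esub> v)"
  by (simp add: module.smult_assoc1)

lemma smult_1: "module k V \<Longrightarrow> v \<in> carrier V \<Longrightarrow> \<one>\<^bsub>k\<^esub> \<odot>\<^bsub>V\<^esub> v = v"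
  by (simp add: module.smult_one)

lemma smult_0: "module k V \<Longrightarrow> v \<in> carrier V \<Longrightarrow> \<zero>\<^bsub>k\<^esub> \<odot>\<^bsub>V\<^esub> v = \<zero>\<^bsub>V\<^esub>"
  by (rule module.smult_l_null)

lemma smult_zero: "module k V \<Longrightarrow> c \<in> carrier k \<Longrightarrow> c \<odot>\<^bsub>V\<^esub> \<zero>\<^bsub>V\<^esub> = \<zero>\<^bsub>V\<^esub>"
  by (rule module.smult_r_null)

lemmas vs_smult = smult_radd smult_ladd smult_mult smult_1 smult_0 smult_zero

text \<open>When every element is its own negative, the law \<open>u + u = 0\<close> takes the place
  of the existence of inverses in the axioms of an abelian group.\<close>

lemma vs_moduleI:
  assumes "\<And>u v. u \<in> carrier V \<Longrightarrow> v \<in> carrier V \<Longrightarrow> u \<oplus>\<^bsub>V\<^esub> v \<in> carrier V"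
    and "\<zero>\<^bsub>V\<^esub> \<in> carrier V"
    and "\<And>c v. c \<in> carrier k \<Longrightarrow> v \<in> carrier V \<Longrightarrow> c \<odot>\<^bsub>V\<^esub> v \<in> carrier V"
    and "\<And>u v w. u \<in> carrier V \<Longrightarrow> v \<in> carrier V \<Longrightarrow> w \<in> carrier V \<Longrightarrow>
      (u \<oplus>\<^bsub>V\<^esub> v) \<oplus>\<^bsub>V\<^esub> w = u \<oplus>\<^bsub>V\<^esub> (v \<oplus>\<^bsub>V\<^esub> w)"
    and "\<And>u v. u \<in> carrier V \<Longrightarrow> v \<in> carrier V \<Longrightarrow> u \<oplus>\<^bsub>V\<^esub> v = v \<oplus>\<^bsub>V\<^esub> u"
    and "\<And>u. u \<in> carrier V \<Longrightarrow> \<zero>\<^bsub>V\<^esub> \<oplus>\<^bsub>V\<^esub> u = u"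
    and "\<And>u. u \<in> carrier V \<Longrightarrow> u \<oplus>\<^bsub>V\<^esub> u = \<zero>\<^bsub>V\<^esub>"
    and "\<And>c u v. c \<in> carrier k \<Longrightarrow> u \<in> carrier V \<Longrightarrow> v \<in> carrier V \<Longrightarrow>
      c \<odot>\<^bsub>V\<^esub> (u \<oplus>\<^bsub>V\<^esub> v) = c \<odot>\<^bsub>V\<^esub> u \<oplus>\<^bsub>V\<^esub> c \<odot>\<^bsub>V\<^esub> v"
    and "\<And>c d v. c \<in> carrier k \<Longrightarrow> d \<in> carrier k \<Longrightarrow> v \<in> carrier V \<Longrightarrow>
      (c \<oplus>\<^bsub>k\<^esub> d) \<odot>\<^bsub>V\<^esub> v = c \<odot>\<^bsub>V\<^esub> v \<oplus>\<^bsub>V\<^esub> d \<odot>\<^bsub>V\<^esub> v"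
    and "\<And>c d v. c \<in> carrier k \<Longrightarrow> d \<in> carrier k \<Longrightarrow> v \<in> carrier V \<Longrightarrow>
      (c \<otimes>\<^bsub>k\<^esub> d) \<odot>\<^bsub>V\<^esub> v = c \<odot>\<^bsub>V\<^esub> (d \<odot>\<^bsub>V\<^esub> v)"
    and "\<And>v. v \<in> carrier V \<Longrightarrow> \<one>\<^bsub>k\<^esub> \<odot>\<^bsub>V\<^esub> v = v"
  shows "module k V"
proof (intro moduleI abelian_groupI K.is_cring)
  show "\<exists>y\<in>carrier V. y \<oplus>\<^bsub>V\<^esub> x = \<zero>\<^bsub>V\<^esub>" if "x \<in> carrier V" for x
    using assms(7)[OF that] that by blast
qed (use assms in auto)

lemma K_self: assumes "u \<in> carrier k" shows "u \<oplus>\<^bsub>k\<^esub> u = \<zero>\<^bsub>k\<^esub>"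
proof -
  have "u \<oplus>\<^bsub>k\<^esub> u = (\<one>\<^bsub>k\<^esub> \<oplus>\<^bsub>k\<^esub> \<one>\<^bsub>k\<^esub>) \<otimes>\<^bsub>k\<^esub> u"
    using assms by (simp add: K.l_distr del: char2)
  then show ?thesis using assms by (simp add: char2)
qed

lemma module_trivial: "module k (trivial_kG k)"
  by (rule vs_moduleI)
    (auto simp: trivial_kG_def K.a_assoc K.a_comm K.a_lcomm K.m_assoc K.l_distr K.r_distr K_self)

lemma K_self2: "u \<in> carrier k \<Longrightarrow> v \<in> carrier k \<Longrightarrow> u \<oplus>\<^bsub>k\<^esub> (u \<oplus>\<^bsub>k\<^esub> v) = v"
  using vs_self2[OF module_trivial, of u v] by (simp add: trivial_kG_def)

lemma lin_zero:
  assumes "f \<in> linear_maps k V W" "module k V" "module k W"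
  shows "f \<zero>\<^bsub>V\<^esub> = \<zero>\<^bsub>W\<^esub>"
proof -
  have "f \<zero>\<^bsub>V\<^esub> = f (\<zero>\<^bsub>k\<^esub> \<odot>\<^bsub>V\<^esub> \<zero>\<^bsub>V\<^esub>)" using assms by (simp add: smult_zero)
  also have "\<dots> = \<zero>\<^bsub>k\<^esub> \<odot>\<^bsub>W\<^esub> f \<zero>\<^bsub>V\<^esub>" using assms by (simp add: linear_maps_smult zero_closed)
  finally show ?thesis using assms by (simp add: smult_0 zero_closed linear_maps_closed)
qed

lemmas hom_zero = lin_zero[OF kG_homs_linear]

lemma act_zero: assumes "kG_module k G M" "g \<in> carrier G" shows "act M \<zero>\<^bsub>M\<^esub> g = \<zero>\<^bsub>M\<^esub>"
  using lin_zero[OF kG_module_act_linear[OF assms]] assms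
  by (simp add: kG_module_module zero_closed)

section \<open>Subspaces, cosets and quotient modules\<close>

definition subspace :: "('k, 'v, 'd) module_scheme \<Rightarrow> 'v set \<Rightarrow> bool" where
  "subspace V B \<longleftrightarrow> B \<subseteq> carrier V \<and> \<zero>\<^bsub>V\<^esub> \<in> B \<and> (\<forall>u\<in>B. \<forall>v\<in>B. u \<oplus>\<^bsub>V\<^esub> v \<in> B) \<and>
     (\<forall>c\<in>carrier k. \<forall>v\<in>B. c \<odot>\<^bsub>V\<^esub> v \<in> B)"

lemma module_subspace:
  assumes "module k V" "subspace V B"
  shows "module k (V\<lparr>carrier := B\<rparr>)"
  using assms unfolding subspace_def
  by (intro vs_moduleI) (auto simp: vs_assoc vs_l_zero vs_self vs_smult subset_iff intro: vs_comm)

lemma module_sum: "module k V \<Longrightarrow> module k W \<Longrightarrow> module k (sum_module V W)"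
  by (rule vs_moduleI) (auto simp: sum_module_def vs_ac vs_smult)

definition coset :: "('k, 'v, 'd) module_scheme \<Rightarrow> 'v set \<Rightarrow> 'v \<Rightarrow> 'v set" where
  "coset V B v = B +>\<^bsub>V\<^esub> v"

lemma coset_def': "coset V B v = (\<lambda>b. b \<oplus>\<^bsub>V\<^esub> v) ` B"
  unfolding coset_def a_r_coset_def' by auto

context
  fixes V :: "('k, 'v, 'd) module_scheme" and B
  assumes V: "module k V" and B: "subspace V B"
begin

lemma subspace_in: "b \<in> B \<Longrightarrow> b \<in> carrier V"
  using B unfolding subspace_def by auto

lemma subspace_add: "u \<in> B \<Longrightarrow> v \<in> B \<Longrightarrow> u \<oplus>\<^bsub>V\<^esub> v \<in> B"
  using B unfolding subspace_def by auto

lemma subspace_smult: "c \<in> carrier k \<Longrightarrow> v \<in> B \<Longrightarrow> c \<odot>\<^bsub>V\<^esub> v \<in> B"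
  using B unfolding subspace_def by auto

lemma subspace_zero: "\<zero>\<^bsub>V\<^esub> \<in> B"
  using B unfolding subspace_def by auto

lemma mem_coset: assumes "u \<in> carrier V" shows "w \<in> coset V B u \<longleftrightarrow> w \<in> carrier V \<and> w \<oplus>\<^bsub>V\<^esub> u \<in> B"
proof
  assume "w \<in> coset V B u"
  then obtain b where "b \<in> B" "w = b \<oplus>\<^bsub>V\<^esub> u" unfolding coset_def' by auto
  then show "w \<in> carrier V \<and> w \<oplus>\<^bsub>V\<^esub> u \<in> B"
    using assms subspace_in[of b] V by (simp add: vs_ac)
next
  assume *: "w \<in> carrier V \<and> w \<oplus>\<^bsub>V\<^esub> u \<in> B"
  then have "w = (w \<oplus>\<^bsub>V\<^esub> u) \<oplus>\<^bsub>V\<^esub> u" using assms V by (simp add: vs_ac)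
  with * show "w \<in> coset V B u" unfolding coset_def' by blast
qed

lemma coset_self: "u \<in> carrier V \<Longrightarrow> u \<in> coset V B u"
  using V by (simp add: mem_coset vs_self subspace_zero)

lemma coset_eq: assumes "u \<in> carrier V" "v \<in> carrier V"
  shows "coset V B u = coset V B v \<longleftrightarrow> u \<oplus>\<^bsub>V\<^esub> v \<in> B"
proof
  assume "coset V B u = coset V B v"
  then show "u \<oplus>\<^bsub>V\<^esub> v \<in> B" using coset_self[OF assms(1)] mem_coset[OF assms(2)] by auto
next
  assume uv: "u \<oplus>\<^bsub>V\<^esub> v \<in> B"
  have "w \<oplus>\<^bsub>V\<^esub> u \<in> B \<longleftrightarrow> w \<oplus>\<^bsub>V\<^esub> v \<in> B" if w: "w \<in> carrier V" for w
  proof -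
    have "w \<oplus>\<^bsub>V\<^esub> u = (w \<oplus>\<^bsub>V\<^esub> v) \<oplus>\<^bsub>V\<^esub> (u \<oplus>\<^bsub>V\<^esub> v)" "w \<oplus>\<^bsub>V\<^esub> v = (w \<oplus>\<^bsub>V\<^esub> u) \<oplus>\<^bsub>V\<^esub> (u \<oplus>\<^bsub>V\<^esub> v)"
      using w assms V by (simp_all add: vs_ac)
    then show ?thesis using subspace_add uv by metis
  qed
  then show "coset V B u = coset V B v" using mem_coset assms by auto
qed

lemma coset_zero: "coset V B \<zero>\<^bsub>V\<^esub> = B"
proof -
  have "b \<oplus>\<^bsub>V\<^esub> \<zero>\<^bsub>V\<^esub> = b" if "b \<in> B" for b using that V by (simp add: vs_r_zero subspace_in)
  then show ?thesis unfolding coset_def' by auto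
qed

lemma coset_mem_eq: "u \<in> carrier V \<Longrightarrow> w \<in> coset V B u \<Longrightarrow> coset V B w = coset V B u"
  using mem_coset coset_eq by auto

lemma coset_add: assumes "u \<in> carrier V" "v \<in> carrier V"
  shows "coset V B u <+>\<^bsub>V\<^esub> coset V B v = coset V B (u \<oplus>\<^bsub>V\<^esub> v)"
proof -
  have *: "(b \<oplus>\<^bsub>V\<^esub> u) \<oplus>\<^bsub>V\<^esub> (b' \<oplus>\<^bsub>V\<^esub> v) = (b \<oplus>\<^bsub>V\<^esub> b') \<oplus>\<^bsub>V\<^esub> (u \<oplus>\<^bsub>V\<^esub> v)" if "b \<in> B" "b' \<in> B" for b b'
    using that assms V subspace_in by (simp add: vs_ac)
  have **: "b \<oplus>\<^bsub>V\<^esub> (u \<oplus>\<^bsub>V\<^esub> v) = (b \<oplus>\<^bsub>V\<^esub> u) \<oplus>\<^bsub>V\<^esub> (\<zero>\<^bsub>V\<^esub> \<oplus>\<^bsub>V\<^esub> v)" if "b \<in> B" for b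
    using that assms V subspace_in by (simp add: vs_ac)
  show ?thesis
  proof (intro equalityI subsetI)
    fix w assume "w \<in> coset V B u <+>\<^bsub>V\<^esub> coset V B v"
    then obtain b b' where "b \<in> B" "b' \<in> B" "w = (b \<oplus>\<^bsub>V\<^esub> u) \<oplus>\<^bsub>V\<^esub> (b' \<oplus>\<^bsub>V\<^esub> v)"
      unfolding set_add_def' coset_def' by blast
    then show "w \<in> coset V B (u \<oplus>\<^bsub>V\<^esub> v)" unfolding coset_def' using * subspace_add by blast
  next
    fix w assume "w \<in> coset V B (u \<oplus>\<^bsub>V\<^esub> v)"
    then obtain b where "b \<in> B" "w = (b \<oplus>\<^bsub>V\<^esub> u) \<oplus>\<^bsub>V\<^esub> (\<zero>\<^bsub>V\<^esub> \<oplus>\<^bsub>V\<^esub> v)" unfolding coset_def' using ** by blast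
    then show "w \<in> coset V B u <+>\<^bsub>V\<^esub> coset V B v" unfolding set_add_def' coset_def'
      using subspace_zero by blast
  qed
qed

text \<open>The summand \<open>B\<close> in the scalar multiplication of a quotient matters for
  \<open>c = 0\<close>: there the image of a coset is the single point zero, and adding
  \<open>B\<close> turns it into a coset again.\<close>

lemma coset_smult: assumes "c \<in> carrier k" "u \<in> carrier V"
  shows "B <+>\<^bsub>V\<^esub> ((\<lambda>v. c \<odot>\<^bsub>V\<^esub> v) ` coset V B u) = coset V B (c \<odot>\<^bsub>V\<^esub> u)"
proof -
  have *: "b \<oplus>\<^bsub>V\<^esub> c \<odot>\<^bsub>V\<^esub> (b' \<oplus>\<^bsub>V\<^esub> u) = (b \<oplus>\<^bsub>V\<^esub> c \<odot>\<^bsub>V\<^esub> b') \<oplus>\<^bsub>V\<^esub> c \<odot>\<^bsub>V\<^esub> u" if "b \<in> B" "b' \<in> B" for b b'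
    using that assms V subspace_in by (simp add: vs_ac vs_smult)
  have **: "b \<oplus>\<^bsub>V\<^esub> c \<odot>\<^bsub>V\<^esub> u = b \<oplus>\<^bsub>V\<^esub> c \<odot>\<^bsub>V\<^esub> (\<zero>\<^bsub>V\<^esub> \<oplus>\<^bsub>V\<^esub> u)" if "b \<in> B" for b
    using that assms V subspace_in by (simp add: vs_ac)
  show ?thesis
  proof (intro equalityI subsetI)
    fix w assume "w \<in> B <+>\<^bsub>V\<^esub> ((\<lambda>v. c \<odot>\<^bsub>V\<^esub> v) ` coset V B u)"
    then obtain b b' where "b \<in> B" "b' \<in> B" "w = b \<oplus>\<^bsub>V\<^esub> c \<odot>\<^bsub>V\<^esub> (b' \<oplus>\<^bsub>V\<^esub> u)"
      unfolding set_add_def' coset_def' by blast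
    then show "w \<in> coset V B (c \<odot>\<^bsub>V\<^esub> u)" unfolding coset_def'
      using * subspace_add subspace_smult assms(1) by blast
  next
    fix w assume "w \<in> coset V B (c \<odot>\<^bsub>V\<^esub> u)"
    then obtain b where "b \<in> B" "w = b \<oplus>\<^bsub>V\<^esub> c \<odot>\<^bsub>V\<^esub> (\<zero>\<^bsub>V\<^esub> \<oplus>\<^bsub>V\<^esub> u)" unfolding coset_def' using ** by blast
    then show "w \<in> B <+>\<^bsub>V\<^esub> ((\<lambda>v. c \<odot>\<^bsub>V\<^esub> v) ` coset V B u)" unfolding set_add_def' coset_def'
      using subspace_zero by blast
  qed
qed

lemma quotient_carrier: "carrier (quotient_module V B) = coset V B ` carrier V"
  unfolding quotient_module_def coset_def by auto

lemma quotient_add: "u \<in> carrier V \<Longrightarrow> v \<in> carrier V \<Longrightarrow>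
    coset V B u \<oplus>\<^bsub>quotient_module V B\<^esub> coset V B v = coset V B (u \<oplus>\<^bsub>V\<^esub> v)"
  unfolding quotient_module_def by (simp add: coset_add)

lemma quotient_smult: "c \<in> carrier k \<Longrightarrow> u \<in> carrier V \<Longrightarrow>
    c \<odot>\<^bsub>quotient_module V B\<^esub> coset V B u = coset V B (c \<odot>\<^bsub>V\<^esub> u)"
  unfolding quotient_module_def by (simp add: coset_smult)

lemma quotient_zero: "\<zero>\<^bsub>quotient_module V B\<^esub> = coset V B \<zero>\<^bsub>V\<^esub>"
  unfolding coset_zero by (simp add: quotient_module_def)

lemma module_quotient: "module k (quotient_module V B)"
  by (rule vs_moduleI)
    (use V in \<open>auto simp: quotient_carrier quotient_add quotient_smult quotient_zero vs_ac vs_smult\<close>)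

end

text \<open>Zorn's lemma for partial graphs: among the subspaces of \<open>U\<close> times
  \<open>V\<close> that contain \<open>S0\<close>, lie in the relation \<open>T\<close> and are
  single valued, a maximal one is defined everywhere. Lifting along a linear map and extending a
  linear map are both instances.\<close>

lemma linear_selection:
  fixes U :: "('k, 'u, 'd) module_scheme" and V :: "('k, 'v, 'e) module_scheme"
  assumes U: "module k U" and V: "module k V"
    and T: "subspace (sum_module U V) T" and total: "\<And>u. u \<in> carrier U \<Longrightarrow> \<exists>v. (u, v) \<in> T"
    and S0: "subspace (sum_module U V) S0" "S0 \<subseteq> T" and single: "\<And>v. (\<zero>\<^bsub>U\<^esub>, v) \<in> S0 \<Longrightarrow> v = \<zero>\<^bsub>V\<^esub>"
  shows "\<exists>h\<in>linear_maps k U V. (\<forall>u\<in>carrier U. (u, h u) \<in> T) \<and> (\<forall>(u, v)\<in>S0. h u = v)"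
proof -
  let ?W = "sum_module U V"
  have W: "module k ?W" using U V by (rule module_sum)
  have [simp]: "carrier ?W = carrier U \<times> carrier V" "\<zero>\<^bsub>?W\<^esub> = (\<zero>\<^bsub>U\<^esub>, \<zero>\<^bsub>V\<^esub>)"
    "(u, v) \<oplus>\<^bsub>?W\<^esub> (u', v') = (u \<oplus>\<^bsub>U\<^esub> u', v \<oplus>\<^bsub>V\<^esub> v')"
    "smult ?W c (u, v) = (c \<odot>\<^bsub>U\<^esub> u, c \<odot>\<^bsub>V\<^esub> v)"
    for u v u' v' c by (auto simp: sum_module_def)
  \<comment> \<open>A subspace of a product is single valued as soon as it is single valued over
    zero.\<close>
  define Fam where "Fam = {S. subspace ?W S \<and> S0 \<subseteq> S \<and> S \<subseteq> T \<and> (\<forall>v. (\<zero>\<^bsub>U\<^esub>, v) \<in> S \<longrightarrow> v = \<zero>\<^bsub>V\<^esub>)}"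
  have "\<exists>S\<in>Fam. (\<forall>Y\<in>Fam. (S \<subseteq> Y \<longrightarrow> Y = S))"
  proof (rule subset_Zorn_nonempty)
    show "Fam \<noteq> {}" using S0 single unfolding Fam_def by blast
    fix Ch assume ne: "Ch \<noteq> {}" and ch: "subset.chain Fam Ch"
    then have sub: "\<And>S. S \<in> Ch \<Longrightarrow> S \<in> Fam" unfolding subset.chain_def by auto
    have two: "\<exists>S\<in>Ch. p \<in> S \<and> q \<in> S" if pq: "p \<in> \<Union>Ch" "q \<in> \<Union>Ch" for p q
    proof -
      obtain A B where "A \<in> Ch" "p \<in> A" "B \<in> Ch" "q \<in> B" using pq by blast
      moreover from this have "A \<subseteq> B \<or> B \<subseteq> A" using ch unfolding subset_chain_def by blast
      ultimately show ?thesis by blast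
    qed
    have "subspace ?W (\<Union>Ch)"
      unfolding subspace_def
    proof (intro conjI ballI)
      show "\<Union>Ch \<subseteq> carrier ?W" using sub unfolding Fam_def subspace_def by blast
      show "\<zero>\<^bsub>?W\<^esub> \<in> \<Union>Ch" using sub ne unfolding Fam_def subspace_def by blast
      show "p \<oplus>\<^bsub>?W\<^esub> q \<in> \<Union>Ch" if "p \<in> \<Union>Ch" "q \<in> \<Union>Ch" for p q
        using two[OF that] sub unfolding Fam_def subspace_def by blast
      show "c \<odot>\<^bsub>?W\<^esub> p \<in> \<Union>Ch" if "c \<in> carrier k" "p \<in> \<Union>Ch" for c p
        using that sub unfolding Fam_def subspace_def by blast
    qed
    moreover have "S0 \<subseteq> \<Union>Ch" "\<Union>Ch \<subseteq> T" "\<forall>v. (\<zero>\<^bsub>U\<^esub>, v) \<in> \<Union>Ch \<longrightarrow> v = \<zero>\<^bsub>V\<^esub>"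
      using sub ne unfolding Fam_def by blast+
    ultimately show "\<Union>Ch \<in> Fam" unfolding Fam_def by simp
  qed
  then obtain S where S: "S \<in> Fam" and max: "\<And>Y. Y \<in> Fam \<Longrightarrow> S \<subseteq> Y \<Longrightarrow> Y = S" by blast
  have Ssub: "subspace ?W S" and S0S: "S0 \<subseteq> S" and ST: "S \<subseteq> T"
    and Sz: "\<And>v. (\<zero>\<^bsub>U\<^esub>, v) \<in> S \<Longrightarrow> v = \<zero>\<^bsub>V\<^esub>"
    using S unfolding Fam_def by auto
  note Sin = subspace_in[OF W Ssub] and Sadd = subspace_add[OF W Ssub]
    and Ssm = subspace_smult[OF W Ssub] and S0' = subspace_zero[OF W Ssub]
  note Tin = subspace_in[OF W T] and Tadd = subspace_add[OF W T] and Tsm = subspace_smult[OF W T]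
  have dom: "\<exists>v. (u, v) \<in> S" if u: "u \<in> carrier U" for u
  proof (rule ccontr)
    \<comment> \<open>If \<open>u\<close> is missing from the domain of the maximal
      \<open>S\<close>, any \<open>v\<close> related to it by \<open>T\<close> allows the line
      through \<open>(u, v)\<close> to be adjoined. The enlarged subspace \<open>Y\<close>
      contradicts maximality.\<close>
    assume no: "\<nexists>v. (u, v) \<in> S"
    obtain v where v: "(u, v) \<in> T" using total u by blast
    then have vV: "v \<in> carrier V" using Tin by fastforce
    define Y where "Y = {(a \<oplus>\<^bsub>U\<^esub> c \<odot>\<^bsub>U\<^esub> u, b \<oplus>\<^bsub>V\<^esub> c \<odot>\<^bsub>V\<^esub> v) | a b c. (a, b) \<in> S \<and> c \<in> carrier k}"
    have XI: "(a \<oplus>\<^bsub>U\<^esub> c \<odot>\<^bsub>U\<^esub> u, b \<oplus>\<^bsub>V\<^esub> c \<odot>\<^bsub>V\<^esub> v) \<in> Y" if "(a, b) \<in> S" "c \<in> carrier k" for a b c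
      using that unfolding Y_def by blast
    have car: "a \<in> carrier U" "b \<in> carrier V" if "(a, b) \<in> S" for a b using Sin[OF that] by auto
    have SX: "S \<subseteq> Y"
    proof
      fix p assume "p \<in> S"
      moreover obtain a b where "p = (a, b)" by force
      ultimately show "p \<in> Y" using XI[of a b "\<zero>\<^bsub>k\<^esub>"] car[of a b] u vV U V by (simp add: smult_0 vs_r_zero)
    qed
    have "subspace ?W Y" unfolding subspace_def
    proof (intro conjI ballI)
      show "Y \<subseteq> carrier ?W" using car u vV U V by (auto simp: Y_def vs_closed)
      show "\<zero>\<^bsub>?W\<^esub> \<in> Y" using SX S0' by auto
      show "p \<oplus>\<^bsub>?W\<^esub> q \<in> Y" if pq: "p \<in> Y" "q \<in> Y" for p q
      proof -
        obtain a b c a' b' c' where p: "p = (a \<oplus>\<^bsub>U\<^esub> c \<odot>\<^bsub>U\<^esub> u, b \<oplus>\<^bsub>V\<^esub> c \<odot>\<^bsub>V\<^esub> v)" "(a, b) \<in> S" "c \<in> carrier k"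
          and q: "q = (a' \<oplus>\<^bsub>U\<^esub> c' \<odot>\<^bsub>U\<^esub> u, b' \<oplus>\<^bsub>V\<^esub> c' \<odot>\<^bsub>V\<^esub> v)" "(a', b') \<in> S" "c' \<in> carrier k"
          using pq unfolding Y_def by blast
        have "(a \<oplus>\<^bsub>U\<^esub> a', b \<oplus>\<^bsub>V\<^esub> b') \<in> S" using Sadd[OF p(2) q(2)] by simp
        from XI[OF this, of "c \<oplus>\<^bsub>k\<^esub> c'"] show ?thesis
          using p q car[OF p(2)] car[OF q(2)] u vV U V by (simp add: vs_ac vs_smult)
      qed
      show "d \<odot>\<^bsub>?W\<^esub> p \<in> Y" if d: "d \<in> carrier k" "p \<in> Y" for d p
      proof -
        obtain a b c where p: "p = (a \<oplus>\<^bsub>U\<^esub> c \<odot>\<^bsub>U\<^esub> u, b \<oplus>\<^bsub>V\<^esub> c \<odot>\<^bsub>V\<^esub> v)" "(a, b) \<in> S" "c \<in> carrier k"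
          using d unfolding Y_def by blast
        have "(d \<odot>\<^bsub>U\<^esub> a, d \<odot>\<^bsub>V\<^esub> b) \<in> S" using Ssm[OF d(1) p(2)] by simp
        from XI[OF this, of "d \<otimes>\<^bsub>k\<^esub> c"] show ?thesis
          using p d car[OF p(2)] u vV U V by (simp add: vs_ac vs_smult)
      qed
    qed
    moreover have "Y \<subseteq> T"
    proof
      fix p assume "p \<in> Y"
      then obtain a b c where p: "p = (a \<oplus>\<^bsub>U\<^esub> c \<odot>\<^bsub>U\<^esub> u, b \<oplus>\<^bsub>V\<^esub> c \<odot>\<^bsub>V\<^esub> v)" "(a, b) \<in> S" "c \<in> carrier k"
        unfolding Y_def by blast
      have "(a, b) \<oplus>\<^bsub>?W\<^esub> c \<odot>\<^bsub>?W\<^esub> (u, v) \<in> T" using Tadd Tsm ST p v by blast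
      then show "p \<in> T" using p by simp
    qed
    moreover have "w = \<zero>\<^bsub>V\<^esub>" if w: "(\<zero>\<^bsub>U\<^esub>, w) \<in> Y" for w
    proof -
      obtain a b c where p: "\<zero>\<^bsub>U\<^esub> = a \<oplus>\<^bsub>U\<^esub> c \<odot>\<^bsub>U\<^esub> u" "w = b \<oplus>\<^bsub>V\<^esub> c \<odot>\<^bsub>V\<^esub> v" "(a, b) \<in> S" "c \<in> carrier k"
        using w unfolding Y_def by blast
      have eq: "a = c \<odot>\<^bsub>U\<^esub> u" using vs_eq[OF U, of a "c \<odot>\<^bsub>U\<^esub> u"] p car[OF p(3)] u U by (simp add: vs_closed)
      \<comment> \<open>Otherwise division by \<open>c\<close> would place \<open>u\<close> in the
        domain of \<open>S\<close>.\<close>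
      have "c = \<zero>\<^bsub>k\<^esub>"
      proof (rule ccontr)
        assume "c \<noteq> \<zero>\<^bsub>k\<^esub>"
        then have ci: "inv\<^bsub>k\<^esub> c \<in> carrier k" "inv\<^bsub>k\<^esub> c \<otimes>\<^bsub>k\<^esub> c = \<one>\<^bsub>k\<^esub>" using p K.field_Units by auto
        then have "inv\<^bsub>k\<^esub> c \<odot>\<^bsub>U\<^esub> a = u" using eq u U p by (simp add: smult_mult[symmetric] smult_1)
        moreover have "(inv\<^bsub>k\<^esub> c \<odot>\<^bsub>U\<^esub> a, inv\<^bsub>k\<^esub> c \<odot>\<^bsub>V\<^esub> b) \<in> S" using Ssm[OF ci(1) p(3)] by simp
        ultimately show False using no by auto
      qed
      then have "a = \<zero>\<^bsub>U\<^esub>" "w = b"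
        unfolding eq p(2) using u vV car(2)[OF p(3)]
          by (simp_all add: smult_0[OF U] smult_0[OF V] vs_r_zero[OF V])
      then show ?thesis using Sz p(3) by blast
    qed
    ultimately have "Y \<in> Fam" using SX S0S unfolding Fam_def by blast
    then have "Y = S" using max SX by blast
    moreover have "(u, v) \<in> Y"
      using XI[OF S0'[simplified] K.one_closed] u vV U V by (simp add: smult_1 vs_ac)
    ultimately show False using no by blast
  qed
  have uniq: "v = v'" if uv: "(u, v) \<in> S" "(u, v') \<in> S" for u v v'
  proof -
    have c: "u \<in> carrier U" "v \<in> carrier V" "v' \<in> carrier V" using Sin[OF uv(1)] Sin[OF uv(2)] by auto
    have "(\<zero>\<^bsub>U\<^esub>, v \<oplus>\<^bsub>V\<^esub> v') \<in> S" using Sadd[OF uv] c by (simp add: vs_self[OF U])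
    then show ?thesis using Sz vs_eq[OF V] c by blast
  qed
  define h where "h = (\<lambda>u\<in>carrier U. THE v. (u, v) \<in> S)"
  have hS: "(u, h u) \<in> S" if u: "u \<in> carrier U" for u
  proof -
    obtain v where v: "(u, v) \<in> S" using dom u by blast
    then have "(THE v. (u, v) \<in> S) = v" using uniq by blast
    then show ?thesis using v u unfolding h_def by simp
  qed
  have hI: "h u = v" if "(u, v) \<in> S" for u v
    using hS[of u] uniq[OF _ that, of "h u"] Sin[OF that] by simp
  have "h \<in> linear_maps k U V"
  proof (rule linear_mapsI)
    show "h u \<in> carrier V" if "u \<in> carrier U" for u using Sin[OF hS[OF that]] by auto
    show "h \<in> extensional (carrier U)" unfolding h_def by simp
    show "h (u \<oplus>\<^bsub>U\<^esub> v) = h u \<oplus>\<^bsub>V\<^esub> h v" if "u \<in> carrier U" "v \<in> carrier U" for u v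
      using Sadd[OF hS hS, OF that] by (intro hI) simp
    show "h (c \<odot>\<^bsub>U\<^esub> u) = c \<odot>\<^bsub>V\<^esub> h u" if "c \<in> carrier k" "u \<in> carrier U" for c u
      using Ssm[OF that(1) hS[OF that(2)]] by (intro hI) simp
  qed
  moreover have "\<forall>u\<in>carrier U. (u, h u) \<in> T" using hS ST by blast
  moreover have "\<forall>(u, v)\<in>S0. h u = v" using hI S0S by blast
  ultimately show ?thesis by blast
qed

text \<open>The relation \<open>T\<close> is the pullback of \<open>f\<close> and \<open>g\<close>,
  and only the value at zero is prescribed.\<close>

lemma linear_lift:
  assumes "module k S" "module k L" "module k N" "f \<in> linear_maps k S N" "g \<in> linear_maps k L N"
    and im: "\<And>s. s \<in> carrier S \<Longrightarrow> \<exists>l\<in>carrier L. g l = f s"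
  shows "\<exists>h\<in>linear_maps k S L. \<forall>s\<in>carrier S. g (h s) = f s"
proof -
  let ?T = "{(s, l) \<in> carrier S \<times> carrier L. g l = f s}" and ?Z = "{(\<zero>\<^bsub>S\<^esub>, \<zero>\<^bsub>L\<^esub>)}"
  note z = lin_zero[OF assms(4,1,3)] lin_zero[OF assms(5,2,3)]
  note r = linear_maps_rules[OF assms(4)] linear_maps_rules[OF assms(5)]
  have T: "subspace (sum_module S L) ?T"
    unfolding subspace_def
  proof (intro conjI ballI)
    show "?T \<subseteq> carrier (sum_module S L)" by (auto simp: sum_module_def)
    show "\<zero>\<^bsub>sum_module S L\<^esub> \<in> ?T" using z assms(1,2) by (simp add: sum_module_def zero_closed)
    show "u \<oplus>\<^bsub>sum_module S L\<^esub> v \<in> ?T" if "u \<in> ?T" "v \<in> ?T" for u v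
      using that r assms(1,2) by (cases u; cases v) (simp add: sum_module_def add_closed)
    show "c \<odot>\<^bsub>sum_module S L\<^esub> v \<in> ?T" if "c \<in> carrier k" "v \<in> ?T" for c v
      using that r assms(1,2) by (cases v) (simp add: sum_module_def smult_closed)
  qed
  have Z: "subspace (sum_module S L) ?Z"
    using assms(1,2) by (simp add: subspace_def sum_module_def zero_closed vs_l_zero smult_zero)
  have ZT: "?Z \<subseteq> ?T" using assms(1,2) z by (simp add: zero_closed)
  have tot: "\<exists>l. (s, l) \<in> ?T" if "s \<in> carrier S" for s using im[OF that] that by blast
  have sgl: "l = \<zero>\<^bsub>L\<^esub>" if "(\<zero>\<^bsub>S\<^esub>, l) \<in> ?Z" for l using that by simp
  have "\<exists>h\<in>linear_maps k S L. (\<forall>u\<in>carrier S. (u, h u) \<in> ?T) \<and> (\<forall>(u, v)\<in>?Z. h u = v)"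
    by (rule linear_selection[OF assms(1,2) T tot Z ZT sgl])
  then obtain h where h: "h \<in> linear_maps k S L" "\<forall>u\<in>carrier S. (u, h u) \<in> ?T" by blast
  have "g (h s) = f s" if "s \<in> carrier S" for s using h(2) that by blast
  then show ?thesis using h(1) by blast
qed

text \<open>The prescribed part consists of the pairs \<open>(d s, f s)\<close>; it is single valued
  because the kernel of \<open>d\<close> lies in that of \<open>f\<close>. The relation
  \<open>T\<close> imposes nothing further.\<close>

lemma linear_extension:
  assumes "module k S" "module k L" "module k N" "d \<in> linear_maps k S L" "f \<in> linear_maps k S N"
    and ker: "\<And>s. s \<in> carrier S \<Longrightarrow> d s = \<zero>\<^bsub>L\<^esub> \<Longrightarrow> f s = \<zero>\<^bsub>N\<^esub>"
  shows "\<exists>h\<in>linear_maps k L N. \<forall>s\<in>carrier S. h (d s) = f s"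
proof -
  note r = linear_maps_rules[OF assms(4)] linear_maps_rules[OF assms(5)]
  let ?S = "(\<lambda>s. (d s, f s)) ` carrier S"
  have 1: "subspace (sum_module L N) (carrier L \<times> carrier N)"
    unfolding subspace_def sum_module_def using assms by (auto simp: vs_closed)
  have 2: "subspace (sum_module L N) ?S"
    unfolding subspace_def
  proof (intro conjI ballI)
    show "?S \<subseteq> carrier (sum_module L N)" using r by (auto simp: sum_module_def)
    have "\<zero>\<^bsub>sum_module L N\<^esub> = (d \<zero>\<^bsub>S\<^esub>, f \<zero>\<^bsub>S\<^esub>)"
      using assms by (simp add: sum_module_def lin_zero[OF assms(4)] lin_zero[OF assms(5)])
    then show "\<zero>\<^bsub>sum_module L N\<^esub> \<in> ?S" using assms(1) by (auto simp: zero_closed)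
    show "u \<oplus>\<^bsub>sum_module L N\<^esub> v \<in> ?S" if uv: "u \<in> ?S" "v \<in> ?S" for u v
    proof -
      obtain s t where "s \<in> carrier S" "t \<in> carrier S" "u = (d s, f s)" "v = (d t, f t)" using uv by auto
      moreover from this have "u \<oplus>\<^bsub>sum_module L N\<^esub> v = (d (s \<oplus>\<^bsub>S\<^esub> t), f (s \<oplus>\<^bsub>S\<^esub> t))"
        using r by (simp add: sum_module_def)
      ultimately show ?thesis using add_closed[OF assms(1)] by auto
    qed
    show "c \<odot>\<^bsub>sum_module L N\<^esub> v \<in> ?S" if cv: "c \<in> carrier k" "v \<in> ?S" for c v
    proof -
      obtain t where "t \<in> carrier S" "v = (d t, f t)" using cv by auto
      moreover from this have "c \<odot>\<^bsub>sum_module L N\<^esub> v = (d (c \<odot>\<^bsub>S\<^esub> t), f (c \<odot>\<^bsub>S\<^esub> t))"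
        using r cv by (simp add: sum_module_def)
      ultimately show ?thesis using smult_closed[OF assms(1)] cv by auto
    qed
  qed
  have 3: "\<exists>v. (u, v) \<in> carrier L \<times> carrier N" if "u \<in> carrier L" for u
    using that zero_closed[OF assms(3)] by auto
  have 4: "?S \<subseteq> carrier L \<times> carrier N" using r by auto
  have 5: "v = \<zero>\<^bsub>N\<^esub>" if "(\<zero>\<^bsub>L\<^esub>, v) \<in> ?S" for v using that ker by auto
  have "\<exists>h\<in>linear_maps k L N. (\<forall>u\<in>carrier L. (u, h u) \<in> carrier L \<times> carrier N) \<and> (\<forall>(u, v)\<in>?S. h u = v)"
    by (rule linear_selection[OF assms(2,3) 1 3 2 4 5])
  then obtain h where h: "h \<in> linear_maps k L N" "\<forall>(u, v)\<in>?S. h u = v" by blast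
  have "h (d s) = f s" if "s \<in> carrier S" for s using h(2) that by auto
  then show ?thesis using h(1) by blast
qed

end

section \<open>Averaging and projective modules\<close>

context char2
begin

lemma lin_finsum:
  assumes f: "f \<in> linear_maps k V W" and V: "module k V" and W: "module k W"
    and "finite A" "\<And>a. a \<in> A \<Longrightarrow> t a \<in> carrier V"
  shows "f (\<Oplus>\<^bsub>V\<^esub>a\<in>A. t a) = (\<Oplus>\<^bsub>W\<^esub>a\<in>A. f (t a))"
proof -
  interpret V: module k V by fact
  interpret W: module k W by fact
  show ?thesis using assms(4,5)
  proof (induction A rule: finite_induct)
    case empty
    then show ?case using lin_zero[OF f V W] by simp
  next
    case (insert x A)
    have "(\<Oplus>\<^bsub>V\<^esub>a\<in>insert x A. t a) = t x \<oplus>\<^bsub>V\<^esub> (\<Oplus>\<^bsub>V\<^esub>a\<in>A. t a)"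
      using insert by (intro V.finsum_insert) auto
    moreover have "(\<Oplus>\<^bsub>W\<^esub>a\<in>insert x A. f (t a)) = f (t x) \<oplus>\<^bsub>W\<^esub> (\<Oplus>\<^bsub>W\<^esub>a\<in>A. f (t a))"
      using insert linear_maps_closed[OF f] by (intro W.finsum_insert) auto
    moreover have "(\<Oplus>\<^bsub>V\<^esub>a\<in>A. t a) \<in> carrier V" using insert by (intro V.finsum_closed) auto
    ultimately show ?case using insert linear_maps_add[OF f] by simp
  qed
qed

lemma lin_compose:
  assumes "f \<in> linear_maps k U V" "g \<in> linear_maps k V W" "module k U"
  shows "compose (carrier U) g f \<in> linear_maps k U W"
  using assms(3)
  by (intro linear_mapsI)
    (simp_all add: compose_def vs_closed linear_maps_rules[OF assms(1)] linear_maps_rules[OF assms(2)])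

end

locale char2_group = char2 k + Gr: group G
  for k :: "('k, 'c) ring_scheme" and G :: "('g, 'b) monoid_scheme" +
  assumes finite_G: "finite (carrier G)"
begin

lemma kG_moduleI:
  assumes "module k M"
    and "\<And>v g. v \<in> carrier M \<Longrightarrow> g \<in> carrier G \<Longrightarrow> act M v g \<in> carrier M"
    and "\<And>u v g. u \<in> carrier M \<Longrightarrow> v \<in> carrier M \<Longrightarrow> g \<in> carrier G \<Longrightarrow>
      act M (u \<oplus>\<^bsub>M\<^esub> v) g = act M u g \<oplus>\<^bsub>M\<^esub> act M v g"
    and "\<And>c v g. c \<in> carrier k \<Longrightarrow> v \<in> carrier M \<Longrightarrow> g \<in> carrier G \<Longrightarrow>
      act M (c \<odot>\<^bsub>M\<^esub> v) g = c \<odot>\<^bsub>M\<^esub> act M v g"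
    and "\<And>v. v \<in> carrier M \<Longrightarrow> act M v \<one>\<^bsub>G\<^esub> = v"
    and "\<And>v g h. v \<in> carrier M \<Longrightarrow> g \<in> carrier G \<Longrightarrow> h \<in> carrier G \<Longrightarrow>
      act M v (g \<otimes>\<^bsub>G\<^esub> h) = act M (act M v g) h"
  shows "kG_module k G M"
  using assms unfolding kG_module_def by (auto intro!: linear_mapsI simp: vs_closed)

lemma kG_trivial: "kG_module k G (trivial_kG k)"
  by (intro kG_moduleI module_trivial) (simp_all add: trivial_kG_def)

lemma kG_homs_compose:
  assumes "f \<in> kG_homs k G L M" "h \<in> kG_homs k G M N" "kG_module k G L"
  shows "compose (carrier L) h f \<in> kG_homs k G L N"
  using assms(3) kG_module_module[OF assms(3)]
  by (intro kG_homsI)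
    (simp_all add: compose_def vs_closed act_closed[of G] kG_homs_rules[OF assms(1)] kG_homs_rules[OF assms(2)])

lemma kG_homs_add_closed:
  assumes "f \<in> kG_homs k G M N" "h \<in> kG_homs k G M N" "kG_module k G M" "kG_module k G N"
  shows "(\<lambda>v\<in>carrier M. f v \<oplus>\<^bsub>N\<^esub> h v) \<in> kG_homs k G M N"
  using assms(3,4) kG_module_module[OF assms(3)] kG_module_module[OF assms(4)]
  by (intro kG_homsI)
    (simp_all add: vs_ac vs_smult act_closed[of G] act_add[of G] kG_homs_rules[OF assms(1)]
      kG_homs_rules[OF assms(2)])

lemma kG_homs_smult_closed:
  assumes "f \<in> kG_homs k G M N" "c \<in> carrier k" "kG_module k G M" "kG_module k G N"
  shows "(\<lambda>v\<in>carrier M. c \<odot>\<^bsub>N\<^esub> f v) \<in> kG_homs k G M N"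
  using assms(2-4) kG_module_module[OF assms(3)] kG_module_module[OF assms(4)]
  by (intro kG_homsI)
    (simp_all add: vs_closed smult_radd act_closed[of G] act_smult[of G] kG_homs_rules[OF assms(1)]
      smult_mult[symmetric] K.m_comm)

lemma kG_homs_zero_closed:
  assumes "kG_module k G M" "kG_module k G N"
  shows "(\<lambda>v\<in>carrier M. \<zero>\<^bsub>N\<^esub>) \<in> kG_homs k G M N"
  using assms kG_module_module[OF assms(1)] kG_module_module[OF assms(2)]
  by (intro kG_homsI) (simp_all add: vs_ac smult_zero act_closed[of G] act_zero)

lemma module_hom:
  assumes "kG_module k G M" "kG_module k G N"
  shows "module k (hom_module k G M N)"
proof -
  have N: "module k N" using assms kG_module_module by auto
  note c = kG_homs_closed[of _ k G M N]
  have x: "f v = undefined" if "f \<in> kG_homs k G M N" "v \<notin> carrier M" for f v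
    using kG_homs_ext[OF that(1)] that(2) by (rule extensional_arb)
  show ?thesis
  proof (rule vs_moduleI)
    fix u v assume "u \<in> carrier (hom_module k G M N)" "v \<in> carrier (hom_module k G M N)"
    then show "u \<oplus>\<^bsub>hom_module k G M N\<^esub> v \<in> carrier (hom_module k G M N)"
      by (simp add: hom_module_def kG_homs_add_closed assms)
  next
    fix c v assume "c \<in> carrier k" "v \<in> carrier (hom_module k G M N)"
    then show "c \<odot>\<^bsub>hom_module k G M N\<^esub> v \<in> carrier (hom_module k G M N)"
      by (simp add: hom_module_def kG_homs_smult_closed assms)
  next
    show "\<zero>\<^bsub>hom_module k G M N\<^esub> \<in> carrier (hom_module k G M N)"
      by (simp add: hom_module_def kG_homs_zero_closed assms)
  qed (auto simp: hom_module_def fun_eq_iff restrict_def x N c vs_self vs_l_zero vs_r_zero vs_smult vs_assoc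
    vs_comm vs_lcomm vs_closed)
qed

text \<open>The trace of a linear map over \<open>G\<close>, written for right modules: each summand
  is a conjugate of \<open>h\<close> by a group element. It turns \<open>k\<close>-linear solutions
  of lifting and extension problems into equivariant ones.\<close>

definition tr :: "('k, 'v, 'g) kG_mod \<Rightarrow> ('k, 'w, 'g) kG_mod \<Rightarrow> ('v \<Rightarrow> 'w) \<Rightarrow> 'v \<Rightarrow> 'w" where
  "tr M N h = (\<lambda>v\<in>carrier M. \<Oplus>\<^bsub>N\<^esub>g\<in>carrier G. act N (h (act M v (inv\<^bsub>G\<^esub> g))) g)"

context
  fixes M :: "('k, 'v, 'g) kG_mod" and N :: "('k, 'w, 'g) kG_mod" and h
  assumes M: "kG_module k G M" and N: "kG_module k G N" and h: "h \<in> linear_maps k M N"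
begin

lemma tr_term_closed: "v \<in> carrier M \<Longrightarrow> g \<in> carrier G \<Longrightarrow> act N (h (act M v (inv\<^bsub>G\<^esub> g))) g \<in> carrier N"
  using act_closed[OF M] act_closed[OF N] linear_maps_closed[OF h] by simp

lemma tr_hom: "tr M N h \<in> kG_homs k G M N"
proof -
  interpret NN: module k N using N kG_module_module by auto
  have MM: "module k M" using M kG_module_module by auto
  note hr = linear_maps_rules[OF h]
  note ac = act_closed[OF M] act_closed[OF N] act_add[OF M] act_add[OF N] act_smult[OF M] act_smult[OF N]
  show ?thesis
  proof (rule kG_homsI)
    show "tr M N h v \<in> carrier N" if "v \<in> carrier M" for v
      using that tr_term_closed unfolding tr_def by (auto intro!: NN.finsum_closed)
    show "tr M N h \<in> extensional (carrier M)" unfolding tr_def by simp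
    show "tr M N h (u \<oplus>\<^bsub>M\<^esub> v) = tr M N h u \<oplus>\<^bsub>N\<^esub> tr M N h v" if uv: "u \<in> carrier M" "v \<in> carrier M" for u v
    proof -
      have "tr M N h (u \<oplus>\<^bsub>M\<^esub> v) = (\<Oplus>\<^bsub>N\<^esub>g\<in>carrier G. act N (h (act M (u \<oplus>\<^bsub>M\<^esub> v) (inv\<^bsub>G\<^esub> g))) g)"
        using uv MM by (simp add: tr_def vs_closed)
      also have "\<dots> = (\<Oplus>\<^bsub>N\<^esub>g\<in>carrier G. act N (h (act M u (inv\<^bsub>G\<^esub> g))) g \<oplus>\<^bsub>N\<^esub> act N (h (act M v (inv\<^bsub>G\<^esub> g))) g)"
        using uv MM tr_term_closed by (intro NN.finsum_cong') (auto simp: ac hr vs_closed)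
      also have "\<dots> = tr M N h u \<oplus>\<^bsub>N\<^esub> tr M N h v"
        using uv tr_term_closed by (simp add: tr_def NN.finsum_addf)
      finally show ?thesis .
    qed
    show "tr M N h (c \<odot>\<^bsub>M\<^esub> v) = c \<odot>\<^bsub>N\<^esub> tr M N h v" if cv: "c \<in> carrier k" "v \<in> carrier M" for c v
    proof -
      have "tr M N h (c \<odot>\<^bsub>M\<^esub> v) = (\<Oplus>\<^bsub>N\<^esub>g\<in>carrier G. act N (h (act M (c \<odot>\<^bsub>M\<^esub> v) (inv\<^bsub>G\<^esub> g))) g)"
        using cv MM by (simp add: tr_def vs_closed)
      also have "\<dots> = (\<Oplus>\<^bsub>N\<^esub>g\<in>carrier G. c \<odot>\<^bsub>N\<^esub> act N (h (act M v (inv\<^bsub>G\<^esub> g))) g)"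
        using cv MM tr_term_closed by (intro NN.finsum_cong') (auto simp: ac hr vs_closed)
      also have "\<dots> = c \<odot>\<^bsub>N\<^esub> tr M N h v"
        using cv tr_term_closed finite_G by (simp add: tr_def NN.finsum_smult_ldistr)
      finally show ?thesis .
    qed
    show "tr M N h (act M v x) = act N (tr M N h v) x" if x: "x \<in> carrier G" and v: "v \<in> carrier M" for x v
    proof -
      let ?t = "\<lambda>g. act N (h (act M v (inv\<^bsub>G\<^esub> g))) g" and ?s = "\<lambda>g. act N (h (act M (act M v x) (inv\<^bsub>G\<^esub> g))) g"
      have im: "(\<lambda>g. g \<otimes>\<^bsub>G\<^esub> x) ` carrier G = carrier G"
      proof
        show "carrier G \<subseteq> (\<lambda>g. g \<otimes>\<^bsub>G\<^esub> x) ` carrier G"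
        proof
          fix g assume g: "g \<in> carrier G"
          then have "g = (g \<otimes>\<^bsub>G\<^esub> inv\<^bsub>G\<^esub> x) \<otimes>\<^bsub>G\<^esub> x" using x by (simp add: Gr.m_assoc)
          then show "g \<in> (\<lambda>g. g \<otimes>\<^bsub>G\<^esub> x) ` carrier G" using g x by blast
        qed
      qed (use x in auto)
      \<comment> \<open>Right translation by \<open>x\<close> permutes \<open>G\<close>. After the
        substitution, \<open>x\<close> and its inverse cancel inside \<open>h\<close>, and one
        factor \<open>x\<close> comes out as the outer action.\<close>
      have "tr M N h (act M v x) = finsum N ?s ((\<lambda>g. g \<otimes>\<^bsub>G\<^esub> x) ` carrier G)"
        using v x ac(1) unfolding tr_def im by simp
      also have "\<dots> = (\<Oplus>\<^bsub>N\<^esub>g\<in>carrier G. ?s (g \<otimes>\<^bsub>G\<^esub> x))"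
        using v x ac tr_term_closed by (intro NN.finsum_reindex) (auto simp: im inj_on_def)
      also have "\<dots> = (\<Oplus>\<^bsub>N\<^esub>g\<in>carrier G. (\<lambda>w\<in>carrier N. act N w x) (?t g))"
      proof (rule NN.finsum_cong')
        fix g assume g: "g \<in> carrier G"
        have "act M (act M v x) (inv\<^bsub>G\<^esub> (g \<otimes>\<^bsub>G\<^esub> x)) = act M v (inv\<^bsub>G\<^esub> g)"
          using g x v by (simp add: kG_module_mult[OF M, symmetric] Gr.inv_mult_group Gr.m_assoc[symmetric])
        then show "?s (g \<otimes>\<^bsub>G\<^esub> x) = (\<lambda>w\<in>carrier N. act N w x) (?t g)"
          using g x v ac hr by (simp add: kG_module_mult[OF N])
      qed (use v x ac tr_term_closed in auto)
      also have "\<dots> = (\<lambda>w\<in>carrier N. act N w x) (\<Oplus>\<^bsub>N\<^esub>g\<in>carrier G. ?t g)"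
        using lin_finsum[OF kG_module_act_linear[OF N x] NN.module_axioms NN.module_axioms finite_G, of ?t]
          tr_term_closed[OF v] by simp
      also have "\<dots> = act N (tr M N h v) x"
        using tr_term_closed[OF v] v by (auto simp: tr_def intro!: NN.finsum_closed)
      finally show ?thesis .
    qed
  qed
qed

text \<open>An equivariant map passes through the sum and through the action of each group element,
  so the trace is natural in the target; the next lemma is its counterpart for the source.\<close>

lemma tr_compose_left:
  assumes L: "kG_module k G L" and f: "f \<in> kG_homs k G N L" and v: "v \<in> carrier M"
  shows "f (tr M N h v) = tr M L (\<lambda>u\<in>carrier M. f (h u)) v"
proof -
  interpret LL: module k L using L kG_module_module by auto
  have "f (tr M N h v) = (\<Oplus>\<^bsub>L\<^esub>g\<in>carrier G. f (act N (h (act M v (inv\<^bsub>G\<^esub> g))) g))"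
    using lin_finsum[OF kG_homs_linear[OF f] kG_module_module[OF N] kG_module_module[OF L] finite_G]
      tr_term_closed v by (simp add: tr_def)
  also have "\<dots> = tr M L (\<lambda>u\<in>carrier M. f (h u)) v"
    unfolding tr_def using v act_closed[OF M] act_closed[OF N] act_closed[OF L] linear_maps_closed[OF h]
      kG_homs_rules[OF f]
    by (auto intro!: LL.finsum_cong')
  finally show ?thesis .
qed

lemma tr_compose_right:
  assumes L: "kG_module k G L" and f: "f \<in> kG_homs k G L M" and v: "v \<in> carrier L"
  shows "tr M N h (f v) = tr L N (\<lambda>u\<in>carrier L. h (f u)) v"
proof -
  interpret NN: module k N using N kG_module_module by auto
  show ?thesis
    unfolding tr_def using v act_closed[OF M] act_closed[OF N] act_closed[OF L] linear_maps_closed[OF h]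
      kG_homs_rules[OF f]
    by (auto intro!: NN.finsum_cong')
qed

end

section \<open>Free modules and Higman's criterion\<close>

lemma module_free: "module k (free_kG k G B)"
proof -
  have supp: "finite {z \<in> B \<times> carrier G. (f z \<oplus>\<^bsub>k\<^esub> h z) \<noteq> \<zero>\<^bsub>k\<^esub>}"
    if "finite {z \<in> B \<times> carrier G. f z \<noteq> \<zero>\<^bsub>k\<^esub>}" "finite {z \<in> B \<times> carrier G. h z \<noteq> \<zero>\<^bsub>k\<^esub>}" for f h
    by (rule finite_subset[OF _ finite_UnI[OF that]]) auto
  have supp': "finite {z \<in> B \<times> carrier G. (c \<otimes>\<^bsub>k\<^esub> f z) \<noteq> \<zero>\<^bsub>k\<^esub>}"
    if "finite {z \<in> B \<times> carrier G. f z \<noteq> \<zero>\<^bsub>k\<^esub>}" "c \<in> carrier k" for f c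
    by (rule finite_subset[OF _ that(1)]) (use that in auto)
  have r: "{z. fst z \<in> B \<and> snd z \<in> carrier G \<and> p z \<and> q z} = {z \<in> B \<times> carrier G. p z \<and> q z}" for p q
    by auto
  let ?F = "free_kG k G B"
  have m: "u \<oplus>\<^bsub>?F\<^esub> v \<in> carrier ?F" "c \<odot>\<^bsub>?F\<^esub> u \<in> carrier ?F"
    "u \<oplus>\<^bsub>?F\<^esub> v \<oplus>\<^bsub>?F\<^esub> w = u \<oplus>\<^bsub>?F\<^esub> (v \<oplus>\<^bsub>?F\<^esub> w)"
    "u \<oplus>\<^bsub>?F\<^esub> v = v \<oplus>\<^bsub>?F\<^esub> u" "u \<oplus>\<^bsub>?F\<^esub> u = \<zero>\<^bsub>?F\<^esub>"
    "c \<odot>\<^bsub>?F\<^esub> (u \<oplus>\<^bsub>?F\<^esub> v) = c \<odot>\<^bsub>?F\<^esub> u \<oplus>\<^bsub>?F\<^esub> c \<odot>\<^bsub>?F\<^esub> v"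
    "(c \<oplus>\<^bsub>k\<^esub> d) \<odot>\<^bsub>?F\<^esub> u = c \<odot>\<^bsub>?F\<^esub> u \<oplus>\<^bsub>?F\<^esub> d \<odot>\<^bsub>?F\<^esub> u"
    "(c \<otimes>\<^bsub>k\<^esub> d) \<odot>\<^bsub>?F\<^esub> u = c \<odot>\<^bsub>?F\<^esub> (d \<odot>\<^bsub>?F\<^esub> u)"
    "\<zero>\<^bsub>?F\<^esub> \<oplus>\<^bsub>?F\<^esub> u = u" "\<one>\<^bsub>k\<^esub> \<odot>\<^bsub>?F\<^esub> u = u"
    if cd: "c \<in> carrier k" "d \<in> carrier k" and uvw: "u \<in> carrier ?F" "v \<in> carrier ?F" "w \<in> carrier ?F"
      for u v w c d
  proof -
    have u: "u \<in> (B \<times> carrier G) \<rightarrow>\<^sub>E carrier k" "finite {z \<in> B \<times> carrier G. u z \<noteq> \<zero>\<^bsub>k\<^esub>}"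
      and v: "v \<in> (B \<times> carrier G) \<rightarrow>\<^sub>E carrier k" "finite {z \<in> B \<times> carrier G. v z \<noteq> \<zero>\<^bsub>k\<^esub>}"
      and w: "w \<in> (B \<times> carrier G) \<rightarrow>\<^sub>E carrier k"
      using uvw by (auto simp: free_kG_def)
    note mem = PiE_mem[OF u(1)] PiE_mem[OF v(1)] PiE_mem[OF w(1)]
    have ext: "restrict u (B \<times> carrier G) = u" using u(1) by (auto simp: PiE_def extensional_restrict)
    have "finite {z \<in> B \<times> carrier G. (\<lambda>z\<in>B \<times> carrier G. u z \<oplus>\<^bsub>k\<^esub> v z) z \<noteq> \<zero>\<^bsub>k\<^esub>}"
      by (rule finite_subset[OF _ supp[OF u(2) v(2)]]) auto
    then show "u \<oplus>\<^bsub>?F\<^esub> v \<in> carrier ?F" using mem by (auto simp: free_kG_def)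
    have "finite {z \<in> B \<times> carrier G. (\<lambda>z\<in>B \<times> carrier G. c \<otimes>\<^bsub>k\<^esub> u z) z \<noteq> \<zero>\<^bsub>k\<^esub>}"
      by (rule finite_subset[OF _ supp'[OF u(2) cd(1)]]) auto
    then show "c \<odot>\<^bsub>?F\<^esub> u \<in> carrier ?F" using mem cd by (auto simp: free_kG_def)
    show "u \<oplus>\<^bsub>?F\<^esub> v \<oplus>\<^bsub>?F\<^esub> w = u \<oplus>\<^bsub>?F\<^esub> (v \<oplus>\<^bsub>?F\<^esub> w)"
      "u \<oplus>\<^bsub>?F\<^esub> v = v \<oplus>\<^bsub>?F\<^esub> u" "u \<oplus>\<^bsub>?F\<^esub> u = \<zero>\<^bsub>?F\<^esub>"
      "c \<odot>\<^bsub>?F\<^esub> (u \<oplus>\<^bsub>?F\<^esub> v) = c \<odot>\<^bsub>?F\<^esub> u \<oplus>\<^bsub>?F\<^esub> c \<odot>\<^bsub>?F\<^esub> v"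
      "(c \<oplus>\<^bsub>k\<^esub> d) \<odot>\<^bsub>?F\<^esub> u = c \<odot>\<^bsub>?F\<^esub> u \<oplus>\<^bsub>?F\<^esub> d \<odot>\<^bsub>?F\<^esub> u"
      "(c \<otimes>\<^bsub>k\<^esub> d) \<odot>\<^bsub>?F\<^esub> u = c \<odot>\<^bsub>?F\<^esub> (d \<odot>\<^bsub>?F\<^esub> u)"
      using mem cd by (auto simp: free_kG_def fun_eq_iff restrict_def K.a_assoc K.a_comm K.a_lcomm K_self
        K.r_distr K.l_distr K.m_assoc)
    have "\<zero>\<^bsub>?F\<^esub> \<oplus>\<^bsub>?F\<^esub> u = restrict u (B \<times> carrier G)" "\<one>\<^bsub>k\<^esub> \<odot>\<^bsub>?F\<^esub> u = restrict u (B \<times> carrier G)"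
      using mem by (auto simp: free_kG_def fun_eq_iff restrict_def)
    then show "\<zero>\<^bsub>?F\<^esub> \<oplus>\<^bsub>?F\<^esub> u = u" "\<one>\<^bsub>k\<^esub> \<odot>\<^bsub>?F\<^esub> u = u" using ext by simp_all
  qed
  note m1 = m[OF K.zero_closed K.zero_closed]
  have "\<zero>\<^bsub>?F\<^esub> \<in> carrier ?F" by (auto simp: free_kG_def)
  then show ?thesis
    by (intro vs_moduleI) (blast intro: m1 m)+
qed

text \<open>One direction of Higman's criterion: the identity of a projective module is the trace of
  a linear map. On a free module the projection onto the coefficients at the neutral element has
  trace 1; a retract inherits this by sandwiching that projection between \<open>i\<close> and
  \<open>p\<close>.\<close>

lemma higman:
  assumes N: "projective_kG k G N"
  shows "\<exists>\<theta>\<in>linear_maps k N N. \<forall>v\<in>carrier N. tr N N \<theta> v = v"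
proof -
  let ?F = "free_kG k G (carrier N)" and ?Z = "carrier N \<times> carrier G" and ?T =
    "trivial_kG k :: ('k, 'k, 'g) kG_mod"
  have M: "kG_module k G N" using N unfolding projective_kG_def by auto
  obtain i p where i: "i \<in> kG_homs k G N ?F" and p: "p \<in> kG_homs k G ?F N"
    and pi: "\<And>v. v \<in> carrier N \<Longrightarrow> p (i v) = v"
    using N unfolding projective_kG_def by blast
  interpret NN: module k N using M kG_module_module by auto
  interpret FF: module k ?F by (rule module_free)
  interpret TT: module k ?T by (rule module_trivial)
  \<comment> \<open>The conjugate of \<open>e\<close> by \<open>g\<close> is the projection onto the
    coefficients at \<open>g\<close>, and these projections add up to the identity.\<close>
  define e where "e f = (\<lambda>z\<in>?Z. if snd z = \<one>\<^bsub>G\<^esub> then f z else \<zero>\<^bsub>k\<^esub>)" for f :: "'a \<times> 'g \<Rightarrow> 'k"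
  have Fmem: "f z \<in> carrier k" if "f \<in> carrier ?F" "z \<in> ?Z" for f z
    using that PiE_mem[of f ?Z "\<lambda>_. carrier k" z] unfolding free_kG_def by auto
  have e_closed: "e f \<in> carrier ?F" if f: "f \<in> carrier ?F" for f
  proof -
    have "finite {z \<in> ?Z. e f z \<noteq> \<zero>\<^bsub>k\<^esub>}"
      by (rule finite_subset[of _ "{z \<in> ?Z. f z \<noteq> \<zero>\<^bsub>k\<^esub>}"]) (use f in \<open>auto simp: free_kG_def e_def\<close>)
    then show ?thesis using Fmem[OF f] by (auto simp: free_kG_def e_def)
  qed
  have a_closed: "act ?F f g \<in> carrier ?F" if f: "f \<in> carrier ?F" and g: "g \<in> carrier G" for f g
  proof -
    have "{z \<in> ?Z. act ?F f g z \<noteq> \<zero>\<^bsub>k\<^esub>} \<subseteq> (\<lambda>z. (fst z, snd z \<otimes>\<^bsub>G\<^esub> g)) ` {z \<in> ?Z. f z \<noteq> \<zero>\<^bsub>k\<^esub>}"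
    proof
      fix z assume "z \<in> {z \<in> ?Z. act ?F f g z \<noteq> \<zero>\<^bsub>k\<^esub>}"
      then have "z = (fst (fst z, snd z \<otimes>\<^bsub>G\<^esub> inv\<^bsub>G\<^esub> g), snd (fst z, snd z \<otimes>\<^bsub>G\<^esub> inv\<^bsub>G\<^esub> g) \<otimes>\<^bsub>G\<^esub> g)"
        "(fst z, snd z \<otimes>\<^bsub>G\<^esub> inv\<^bsub>G\<^esub> g) \<in> {z \<in> ?Z. f z \<noteq> \<zero>\<^bsub>k\<^esub>}"
        using g by (auto simp: free_kG_def Gr.m_assoc)
      then show "z \<in> (\<lambda>z. (fst z, snd z \<otimes>\<^bsub>G\<^esub> g)) ` {z \<in> ?Z. f z \<noteq> \<zero>\<^bsub>k\<^esub>}" by (rule image_eqI)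
    qed
    then have "finite {z \<in> ?Z. act ?F f g z \<noteq> \<zero>\<^bsub>k\<^esub>}"
      by (rule finite_subset) (use f in \<open>auto simp: free_kG_def\<close>)
    then show ?thesis using Fmem[OF f] g by (auto simp: free_kG_def)
  qed
  define \<theta> where "\<theta> = (\<lambda>v\<in>carrier N. p (e (i v)))"
  note ir = kG_homs_rules[OF i] and pr = kG_homs_rules[OF p]
  have e_add: "e (f \<oplus>\<^bsub>?F\<^esub> h) = e f \<oplus>\<^bsub>?F\<^esub> e h" for f h
    by (auto simp: free_kG_def e_def fun_eq_iff)
  have e_smult: "e (c \<odot>\<^bsub>?F\<^esub> f) = c \<odot>\<^bsub>?F\<^esub> e f" if "c \<in> carrier k" for f c
    using that by (auto simp: free_kG_def e_def fun_eq_iff)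
  have \<theta>: "\<theta> \<in> linear_maps k N N"
    by (rule linear_mapsI) (simp_all add: \<theta>_def ir pr e_closed e_add e_smult)
  have "tr N N \<theta> v = v" if v: "v \<in> carrier N" for v
  proof -
    let ?t = "\<lambda>g. act ?F (e (act ?F (i v) (inv\<^bsub>G\<^esub> g))) g"
    have t: "?t g \<in> carrier ?F" if "g \<in> carrier G" for g
      using that v by (simp add: a_closed e_closed ir)
    have "tr N N \<theta> v = (\<Oplus>\<^bsub>N\<^esub>g\<in>carrier G. p (?t g))"
      unfolding tr_def using v t by (auto intro!: NN.finsum_cong' simp: \<theta>_def ir pr act_closed[OF M] a_closed
        e_closed)
    also have "\<dots> = p (\<Oplus>\<^bsub>?F\<^esub>g\<in>carrier G. ?t g)"
      using lin_finsum[OF kG_homs_linear[OF p] FF.module_axioms NN.module_axioms finite_G, of ?t] t by simp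
    also have "(\<Oplus>\<^bsub>?F\<^esub>g\<in>carrier G. ?t g) = i v"
    proof (rule extensionalityI[of _ ?Z])
      have "(\<Oplus>\<^bsub>?F\<^esub>g\<in>carrier G. ?t g) \<in> carrier ?F" using t by (auto intro!: FF.finsum_closed)
      then show "(\<Oplus>\<^bsub>?F\<^esub>g\<in>carrier G. ?t g) \<in> extensional ?Z" by (auto simp: free_kG_def PiE_def)
      have iv: "i v \<in> carrier ?F" using v ir by simp
      then show "i v \<in> extensional ?Z" by (auto simp: free_kG_def PiE_def)
      fix z assume z: "z \<in> ?Z"
      \<comment> \<open>Evaluation at \<open>z\<close> is linear, so the sum can be computed
        coefficient by coefficient; the only surviving summand is that of the group element
        \<open>snd z\<close>.\<close>
      let ?ev = "\<lambda>f\<in>carrier ?F. f z"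
      have ev: "?ev \<in> linear_maps k ?F ?T"
        using z Fmem FF.a_closed FF.smult_closed
        by (intro linear_mapsI) (simp_all add: trivial_kG_def, simp_all add: free_kG_def)
      have "(\<Oplus>\<^bsub>?F\<^esub>g\<in>carrier G. ?t g) z = ?ev (\<Oplus>\<^bsub>?F\<^esub>g\<in>carrier G. ?t g)"
        using t by (auto intro!: FF.finsum_closed)
      also have "\<dots> = (\<Oplus>\<^bsub>?T\<^esub>g\<in>carrier G. ?ev (?t g))"
        by (rule lin_finsum[OF ev FF.module_axioms module_trivial finite_G]) (rule t)
      also have "\<dots> = (\<Oplus>\<^bsub>?T\<^esub>g\<in>carrier G. if snd z = g then i v (fst z, g) else \<zero>\<^bsub>?T\<^esub>)"
      proof (rule TT.finsum_cong')
        fix g assume g: "g \<in> carrier G"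
        have "(snd z \<otimes>\<^bsub>G\<^esub> inv\<^bsub>G\<^esub> g = \<one>\<^bsub>G\<^esub>) = (snd z = g)"
          using g z by (auto simp: mem_Times_iff Gr.r_inv) (metis Gr.inv_closed Gr.inv_equality Gr.inv_inv)
        then show "?ev (?t g) = (if snd z = g then i v (fst z, g) else \<zero>\<^bsub>?T\<^esub>)"
          using t[OF g] g z by (auto simp: free_kG_def e_def trivial_kG_def mem_Times_iff Gr.m_assoc)
      qed (use Fmem[OF iv] z in \<open>auto simp: trivial_kG_def\<close>)
      also have "\<dots> = i v (fst z, snd z)"
        using z finite_G Fmem[OF iv] by (intro TT.finsum_singleton) (auto simp: trivial_kG_def)
      finally show "(\<Oplus>\<^bsub>?F\<^esub>g\<in>carrier G. ?t g) z = i v z" by simp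
    qed
    finally show ?thesis using pi v by simp
  qed
  then show ?thesis using \<theta> by blast
qed

lemma projective_module: "projective_kG k G N \<Longrightarrow> kG_module k G N"
  unfolding projective_kG_def by auto

lemma tr_cong:
  assumes "\<And>v. v \<in> carrier M \<Longrightarrow> h v = h' v" "\<And>v. v \<in> carrier M \<Longrightarrow> h' v \<in> carrier N"
    and M: "kG_module k G M" and N: "kG_module k G N"
  shows "tr M N h = tr M N h'"
proof -
  interpret NN: module k N using N kG_module_module by auto
  show ?thesis
    unfolding tr_def
    by (intro restrict_ext NN.finsum_cong') (auto simp: assms(1,2) act_closed[OF M] act_closed[OF N])
qed

text \<open>Lift \<open>f\<close> linearly to \<open>l\<close>, precompose with
  \<open>\<theta>\<close> and average: q tr(l \<theta>) = tr(f \<theta>) = f tr(\<theta>) = f. Only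
  the image of \<open>f\<close> has to lie in that of \<open>q\<close>, which suits maps onto
  cycles.\<close>

lemma projective_lift:
  assumes N: "projective_kG k G N" and L: "kG_module k G L" and L': "kG_module k G L'"
    and f: "f \<in> kG_homs k G N L'" and q: "q \<in> kG_homs k G L L'"
    and im: "\<And>v. v \<in> carrier N \<Longrightarrow> \<exists>l\<in>carrier L. q l = f v"
  shows "\<exists>h\<in>kG_homs k G N L. \<forall>v\<in>carrier N. q (h v) = f v"
proof -
  have M: "kG_module k G N" by (rule projective_module[OF N])
  obtain \<theta> where \<theta>: "\<theta> \<in> linear_maps k N N" "\<And>v. v \<in> carrier N \<Longrightarrow> tr N N \<theta> v = v" using higman[OF N] by blast
  obtain l where l: "l \<in> linear_maps k N L" "\<And>v. v \<in> carrier N \<Longrightarrow> q (l v) = f v"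
    using linear_lift[OF kG_module_module[OF M] kG_module_module[OF L] kG_module_module[OF L']
        kG_homs_linear[OF f] kG_homs_linear[OF q] im] by blast
  let ?h = "compose (carrier N) l \<theta>"
  have h: "?h \<in> linear_maps k N L" by (rule lin_compose[OF \<theta>(1) l(1) kG_module_module[OF M]])
  have "q (tr N L ?h v) = f v" if v: "v \<in> carrier N" for v
  proof -
    have "q (tr N L ?h v) = tr N L' (\<lambda>u\<in>carrier N. q (?h u)) v" by (rule tr_compose_left[OF M L h L' q v])
    also have "tr N L' (\<lambda>u\<in>carrier N. q (?h u)) = tr N L' (\<lambda>u\<in>carrier N. f (\<theta> u))"
      by (rule tr_cong[OF _ _ M L']) (simp_all add: compose_def l linear_maps_closed[OF \<theta>(1)]
        kG_homs_closed[OF f])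
    also have "\<dots> v = f (tr N N \<theta> v)" by (rule tr_compose_left[OF M M \<theta>(1) L' f v, symmetric])
    finally show ?thesis using \<theta>(2) v by simp
  qed
  then show ?thesis using tr_hom[OF M L h] by blast
qed

text \<open>The dual argument, with \<open>\<theta>\<close> composed after a linear extension: over
  the group algebra of a finite group projective modules are injective. This is what carries
  constructions on a complete resolution into negative degrees.\<close>

lemma projective_extend:
  assumes N: "projective_kG k G N" and S: "kG_module k G S" and S': "kG_module k G S'"
    and d: "d \<in> kG_homs k G S S'" and f: "f \<in> kG_homs k G S N"
    and ker: "\<And>s. s \<in> carrier S \<Longrightarrow> d s = \<zero>\<^bsub>S'\<^esub> \<Longrightarrow> f s = \<zero>\<^bsub>N\<^esub>"
  shows "\<exists>h\<in>kG_homs k G S' N. \<forall>s\<in>carrier S. h (d s) = f s"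
proof -
  have M: "kG_module k G N" by (rule projective_module[OF N])
  obtain \<theta> where \<theta>: "\<theta> \<in> linear_maps k N N" "\<And>v. v \<in> carrier N \<Longrightarrow> tr N N \<theta> v = v" using higman[OF N] by blast
  obtain l where l: "l \<in> linear_maps k S' N" "\<And>s. s \<in> carrier S \<Longrightarrow> l (d s) = f s"
    using linear_extension[OF kG_module_module[OF S] kG_module_module[OF S'] kG_module_module[OF M]
        kG_homs_linear[OF d] kG_homs_linear[OF f] ker] by blast
  let ?h = "compose (carrier S') \<theta> l"
  have h: "?h \<in> linear_maps k S' N" by (rule lin_compose[OF l(1) \<theta>(1) kG_module_module[OF S']])
  have "tr S' N ?h (d s) = f s" if s: "s \<in> carrier S" for s
  proof -
    have "tr S' N ?h (d s) = tr S N (\<lambda>u\<in>carrier S. ?h (d u)) s" by (rule tr_compose_right[OF S' M h S d s])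
    also have "tr S N (\<lambda>u\<in>carrier S. ?h (d u)) = tr S N (\<lambda>u\<in>carrier S. \<theta> (f u))"
      by (rule tr_cong[OF _ _ S M])
        (simp_all add: compose_def l kG_homs_closed[OF d] kG_homs_closed[OF f] linear_maps_closed[OF \<theta>(1)])
    also have "\<dots> s = tr N N \<theta> (f s)" by (rule tr_compose_right[OF M M \<theta>(1) S f s, symmetric])
    finally show ?thesis using \<theta>(2) kG_homs_closed[OF f s] by simp
  qed
  then show ?thesis using tr_hom[OF S' M h] by blast
qed

end

section \<open>The endomorphism dga of a complete resolution\<close>

text \<open>Dependent choice over the integers in both directions. The choices are links, that is
  pairs of neighbouring values, and both half-infinite sequences start from the same link
  \<open>(a, b)\<close>, so they fit together at 0.\<close>

lemma int_chain:
  assumes base: "R 0 a b"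
    and up: "\<And>j x y. R j x y \<Longrightarrow> \<exists>z. R (j + 1) y z" and down: "\<And>j x y. R j x y \<Longrightarrow> \<exists>z. R (j - 1) z x"
  shows "\<exists>h :: int \<Rightarrow> 'x. h 0 = a \<and> (\<forall>j. R j (h j) (h (j + 1)))"
proof -
  have "\<exists>f. \<forall>n. (R (int n) (fst (f n)) (snd (f n)) \<and> (n = 0 \<longrightarrow> f n = (a, b))) \<and> fst (f (Suc n)) = snd (f n)"
  proof (rule dependent_nat_choice)
    fix x n assume "R (int n) (fst x) (snd x) \<and> (n = 0 \<longrightarrow> x = (a, b))"
    then obtain z where "R (int n + 1) (snd x) z" using up by blast
    then show "\<exists>y. (R (int (Suc n)) (fst y) (snd y) \<and> (Suc n = 0 \<longrightarrow> y = (a, b))) \<and> fst y = snd x"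
      by (intro exI[of _ "(snd x, z)"]) (simp add: add.commute)
  qed (use base in auto)
  then obtain f where f: "\<And>n. R (int n) (fst (f n)) (snd (f n))" "f 0 = (a, b)" "\<And>n. fst (f (Suc n)) =
      snd (f n)"
    by blast
  have "\<exists>g. \<forall>n. (R (- int n) (fst (g n)) (snd (g n)) \<and> (n = 0 \<longrightarrow> g n = (a, b))) \<and> snd (g (Suc n)) = fst (g n)"
  proof (rule dependent_nat_choice)
    fix x n assume "R (- int n) (fst x) (snd x) \<and> (n = 0 \<longrightarrow> x = (a, b))"
    then obtain z where z: "R (- int n - 1) z (fst x)" using down by blast
    have "- int n - 1 = - int (Suc n)" by simp
    with z have "R (- int (Suc n)) z (fst x)" by metis
    then show "\<exists>y. (R (- int (Suc n)) (fst y) (snd y) \<and> (Suc n = 0 \<longrightarrow> y = (a, b))) \<and> snd y = fst x"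
      by (intro exI[of _ "(z, fst x)"]) simp
  qed (use base in auto)
  then obtain g where g: "\<And>n. R (- int n) (fst (g n)) (snd (g n))" "g 0 = (a, b)" "\<And>n. snd (g (Suc n)) =
      fst (g n)"
    by blast
  define h where "h j = (if j \<ge> 0 then fst (f (nat j)) else fst (g (nat (- j))))" for j :: int
  have "R j (h j) (h (j + 1))" for j
  proof (cases "j \<ge> 0")
    case True
    then have "nat (j + 1) = Suc (nat j)" by simp
    with True f(1)[of "nat j"] f(3)[of "nat j"] show ?thesis by (simp add: h_def)
  next
    case False
    \<comment> \<open>For negative \<open>j\<close> the value \<open>h j\<close> is the left end of
      the link number \<open>m + 1\<close> going down, and \<open>h (j + 1)\<close> is the left end
      of link number \<open>m\<close>. For \<open>m = 0\<close> the latter is \<open>h 0\<close>,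
      defined by the upward sequence, and both sequences give \<open>a\<close>.\<close>
    define m where "m = nat (- j - 1)"
    have j: "nat (- j) = Suc m" "- int (Suc m) = j" "nat (- (j + 1)) = m" "j + 1 \<ge> 0 \<longleftrightarrow> m = 0"
      using False by (auto simp: m_def)
    have "R j (fst (g (Suc m))) (fst (g m))" using g(1)[of "Suc m"] g(3)[of m] j(2) by simp
    moreover have "h (j + 1) = fst (g m)" using j f(2) g(2) by (auto simp: h_def)
    ultimately show ?thesis using False j by (simp add: h_def)
  qed
  moreover have "h 0 = a" using f(2) by (simp add: h_def)
  ultimately show ?thesis by blast
qed

locale tate = char2_group k G
  for k :: "('k, 'c) ring_scheme" and G :: "('g, 'b) monoid_scheme" +
  fixes P :: "('k, 'p, 'g) kG_complex"
  assumes resolution: "complete_resolution k G P"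
begin

abbreviation "Ob n \<equiv> obj P n"
abbreviation "T \<equiv> trivial_kG k :: ('k, 'k, 'g) kG_mod"
abbreviation "E n \<equiv> endo k G P n"
abbreviation "dd n \<equiv> endo_diff P n"
abbreviation "mul m n \<equiv> endo_mult P m n"

lemma Ob_projective: "projective_kG k G (Ob n)"
  using resolution unfolding complete_resolution_def by auto

lemma Ob_kG [simp]: "kG_module k G (Ob n)"
  using projective_module[OF Ob_projective] .

lemma Ob_module [simp]: "module k (Ob n)"
  using kG_module_module[OF Ob_kG] .

lemma T_kG [simp]: "kG_module k G T" and T_module [simp]: "module k T"
  by (rule kG_trivial, rule module_trivial)

lemma bd_hom: "m = n - 1 \<Longrightarrow> bd P n \<in> kG_homs k G (Ob n) (Ob m)"
  using resolution unfolding complete_resolution_def by auto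

lemma aug_hom: "aug P \<in> kG_homs k G (Ob 0) T"
  using resolution unfolding complete_resolution_def by auto

lemma T_simps [simp]: "carrier T = carrier k" "\<zero>\<^bsub>T\<^esub> = \<zero>\<^bsub>k\<^esub>" "u \<oplus>\<^bsub>T\<^esub> v = u \<oplus>\<^bsub>k\<^esub> v"
  "c \<odot>\<^bsub>T\<^esub> v = c \<otimes>\<^bsub>k\<^esub> v" "act T v g = v"
  by (simp_all add: trivial_kG_def)

lemma bd_closed: "v \<in> carrier (Ob n) \<Longrightarrow> m = n - 1 \<Longrightarrow> bd P n v \<in> carrier (Ob m)"
  using kG_homs_closed[OF bd_hom] by blast

lemma bd_add: "u \<in> carrier (Ob n) \<Longrightarrow> v \<in> carrier (Ob n) \<Longrightarrow>
    bd P n (u \<oplus>\<^bsub>Ob n\<^esub> v) = bd P n u \<oplus>\<^bsub>Ob (n - 1)\<^esub> bd P n v"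
  by (rule kG_homs_add[OF bd_hom[OF refl]])

lemma bd_smult: "c \<in> carrier k \<Longrightarrow> v \<in> carrier (Ob n) \<Longrightarrow> bd P n (c \<odot>\<^bsub>Ob n\<^esub> v) = c \<odot>\<^bsub>Ob (n - 1)\<^esub> bd P n v"
  by (rule kG_homs_smult[OF bd_hom[OF refl]])

lemma bd_act: "v \<in> carrier (Ob n) \<Longrightarrow> g \<in> carrier G \<Longrightarrow> bd P n (act (Ob n) v g) = act (Ob (n - 1)) (bd P n v) g"
  by (rule kG_homs_act[OF bd_hom[OF refl]])

lemma bd_exact: "bd P (n + 1) ` carrier (Ob (n + 1)) = {v \<in> carrier (Ob n). bd P n v = \<zero>\<^bsub>Ob (n - 1)\<^esub>}"
  using resolution unfolding complete_resolution_def by auto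

lemma bd_bd: "w \<in> carrier (Ob m) \<Longrightarrow> m = n + 1 \<Longrightarrow> l = n - 1 \<Longrightarrow> bd P n (bd P m w) = \<zero>\<^bsub>Ob l\<^esub>"
  using bd_exact[of n] by blast

lemma bd_lift: assumes "v \<in> carrier (Ob n)" "bd P n v = \<zero>\<^bsub>Ob (n - 1)\<^esub>" "m = n + 1"
  shows "\<exists>w\<in>carrier (Ob m). bd P m w = v"
proof -
  have "v \<in> bd P (n + 1) ` carrier (Ob (n + 1))" using bd_exact[of n] assms by simp
  then show ?thesis using assms(3) by auto
qed

lemma aug_rules: "v \<in> carrier (Ob 0) \<Longrightarrow> aug P v \<in> carrier k"
  "u \<in> carrier (Ob 0) \<Longrightarrow> v \<in> carrier (Ob 0) \<Longrightarrow> aug P (u \<oplus>\<^bsub>Ob 0\<^esub> v) = aug P u \<oplus>\<^bsub>k\<^esub> aug P v"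
  "c \<in> carrier k \<Longrightarrow> v \<in> carrier (Ob 0) \<Longrightarrow> aug P (c \<odot>\<^bsub>Ob 0\<^esub> v) = c \<otimes>\<^bsub>k\<^esub> aug P v"
  "v \<in> carrier (Ob 0) \<Longrightarrow> g \<in> carrier G \<Longrightarrow> aug P (act (Ob 0) v g) = aug P v"
  using kG_homs_rules[OF aug_hom] by simp_all

lemma aug_surj: assumes "c \<in> carrier k" shows "\<exists>v\<in>carrier (Ob 0). aug P v = c"
proof -
  have "aug P ` carrier (Ob 0) = carrier k" using resolution unfolding complete_resolution_def by auto
  then have "c \<in> aug P ` carrier (Ob 0)" using assms by simp
  then show ?thesis by auto
qed

lemma aug_exact: "bd P 1 ` carrier (Ob 1) = {v \<in> carrier (Ob 0). aug P v = \<zero>\<^bsub>k\<^esub>}"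
  using resolution unfolding complete_resolution_def by blast

lemma aug_bd: "w \<in> carrier (Ob 1) \<Longrightarrow> aug P (bd P 1 w) = \<zero>\<^bsub>k\<^esub>"
  using aug_exact by blast

lemma aug_lift: assumes "v \<in> carrier (Ob 0)" "aug P v = \<zero>\<^bsub>k\<^esub>"
  shows "\<exists>w\<in>carrier (Ob 1). bd P 1 w = v"
proof -
  have "v \<in> bd P 1 ` carrier (Ob 1)" using aug_exact assms by simp
  then show ?thesis by auto
qed

section \<open>Components, product and differential of the endomorphism algebra\<close>

lemma endo_carrier: "f \<in> carrier (E n) \<longleftrightarrow> (\<forall>j. f j \<in> kG_homs k G (Ob (j + n)) (Ob j))"
  by (simp add: endo_def Let_def hom_module_def)

lemma endo_hom: "f \<in> carrier (E n) \<Longrightarrow> m = j + n \<Longrightarrow> f j \<in> kG_homs k G (Ob m) (Ob j)"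
  using endo_carrier by blast

lemma endo_closed: "f \<in> carrier (E n) \<Longrightarrow> v \<in> carrier (Ob (j + n)) \<Longrightarrow> f j v \<in> carrier (Ob j)"
  using kG_homs_closed[OF endo_hom] by blast

lemma endo_add: "f \<in> carrier (E n) \<Longrightarrow> u \<in> carrier (Ob (j + n)) \<Longrightarrow> v \<in> carrier (Ob (j + n)) \<Longrightarrow>
    m = j + n \<Longrightarrow> f j (u \<oplus>\<^bsub>Ob m\<^esub> v) = f j u \<oplus>\<^bsub>Ob j\<^esub> f j v"
  using kG_homs_add[OF endo_hom] by blast

lemma endo_smult: "f \<in> carrier (E n) \<Longrightarrow> c \<in> carrier k \<Longrightarrow> v \<in> carrier (Ob (j + n)) \<Longrightarrow>
    m = j + n \<Longrightarrow> f j (c \<odot>\<^bsub>Ob m\<^esub> v) = c \<odot>\<^bsub>Ob j\<^esub> f j v"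
  using kG_homs_smult[OF endo_hom] by blast

lemma endo_act: "f \<in> carrier (E n) \<Longrightarrow> v \<in> carrier (Ob (j + n)) \<Longrightarrow> g \<in> carrier G \<Longrightarrow>
    m = j + n \<Longrightarrow> f j (act (Ob m) v g) = act (Ob j) (f j v) g"
  using kG_homs_act[OF endo_hom] by blast

lemma endo_zero: "f \<in> carrier (E n) \<Longrightarrow> m = j + n \<Longrightarrow> f j \<zero>\<^bsub>Ob m\<^esub> = \<zero>\<^bsub>Ob j\<^esub>"
  using hom_zero[OF endo_hom Ob_module Ob_module] by blast

lemma endo_eqI:
  assumes "f \<in> carrier (E n)" "h \<in> carrier (E n)"
    and "\<And>j v. v \<in> carrier (Ob (j + n)) \<Longrightarrow> f j v = h j v"
  shows "f = h"
proof
  fix j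
  show "f j = h j"
    by (rule extensionalityI[OF kG_homs_ext kG_homs_ext, OF endo_hom endo_hom, OF assms(1) refl assms(2) refl])
      (rule assms(3))
qed

lemma module_endo: "module k (E n)"
proof -
  have H: "module k (hom_module k G (Ob (j + n)) (Ob j))" for j by (rule module_hom) simp_all
  show ?thesis
    by (rule vs_moduleI)
      (auto simp: endo_def Let_def fun_eq_iff vs_closed[OF H] vs_l_zero[OF H] vs_self[OF H] vs_smult[OF H]
        intro: vs_assoc[OF H, THEN fun_cong] vs_comm[OF H, THEN fun_cong])
qed

lemma endo_add_app: "v \<in> carrier (Ob (j + n)) \<Longrightarrow> (f \<oplus>\<^bsub>E n\<^esub> h) j v = f j v \<oplus>\<^bsub>Ob j\<^esub> h j v"
  by (simp add: endo_def Let_def hom_module_def)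

lemma endo_smult_app: "v \<in> carrier (Ob (j + n)) \<Longrightarrow> (c \<odot>\<^bsub>E n\<^esub> f) j v = c \<odot>\<^bsub>Ob j\<^esub> f j v"
  by (simp add: endo_def Let_def hom_module_def)

lemma endo_zero_app: "v \<in> carrier (Ob (j + n)) \<Longrightarrow> \<zero>\<^bsub>E n\<^esub> j v = \<zero>\<^bsub>Ob j\<^esub>"
  by (simp add: endo_def Let_def hom_module_def)

lemma diff_app:
  assumes f: "f \<in> carrier (E n)" and v: "v \<in> carrier (Ob (j + n + 1))"
  shows "dd n f j v = bd P (j + 1) (f (j + 1) v) \<oplus>\<^bsub>Ob j\<^esub> f j (bd P (j + n + 1) v)"
proof -
  have "f j (bd P (j + n + 1) v) \<in> carrier (Ob j)"
    using v by (intro endo_closed[OF f] bd_closed) auto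
  then show ?thesis using v unfolding endo_diff_def by (simp add: vs_sign vs_minus add.assoc)
qed

text \<open>Here and below the degree of a result is a variable tied to the others by an equation,
  so that a rule applies whichever integer expression for the degree is at hand.\<close>

lemma diff_closed:
  assumes f: "f \<in> carrier (E n)" and m: "m = n + 1"
  shows "dd n f \<in> carrier (E m)"
  unfolding endo_carrier
proof
  fix j
  have 1: "compose (carrier (Ob (j + m))) (bd P (j + 1)) (f (j + 1)) \<in> kG_homs k G (Ob (j + m)) (Ob j)"
    by (rule kG_homs_compose[OF endo_hom[OF f] bd_hom]) (simp_all add: m)
  have 2: "compose (carrier (Ob (j + m))) (f j) (bd P (j + m)) \<in> kG_homs k G (Ob (j + m)) (Ob j)"
    by (rule kG_homs_compose[OF bd_hom[OF refl] endo_hom[OF f]]) (simp_all add: m)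
  have "dd n f j = (\<lambda>v\<in>carrier (Ob (j + m)). compose (carrier (Ob (j + m))) (bd P (j + 1)) (f (j + 1)) v
      \<oplus>\<^bsub>Ob j\<^esub> compose (carrier (Ob (j + m))) (f j) (bd P (j + m)) v)"
  proof (rule extensionalityI[of _ "carrier (Ob (j + m))"])
    show "dd n f j \<in> extensional (carrier (Ob (j + m)))" by (simp add: endo_diff_def m)
    show "dd n f j v = (\<lambda>v\<in>carrier (Ob (j + m)). compose (carrier (Ob (j + m))) (bd P (j + 1)) (f (j + 1)) v
      \<oplus>\<^bsub>Ob j\<^esub> compose (carrier (Ob (j + m))) (f j) (bd P (j + m)) v) v" if "v \<in> carrier (Ob (j + m))" for v
      using diff_app[OF f, of v j] that by (simp add: compose_def m add.assoc)
  qed auto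
  then show "dd n f j \<in> kG_homs k G (Ob (j + m)) (Ob j)"
    using kG_homs_add_closed[OF 1 2] by simp
qed

lemma mul_app: "v \<in> carrier (Ob (j + (m + n))) \<Longrightarrow> mul m n f g j v = f j (g (j + m) v)"
  by (simp add: endo_mult_def compose_def)

lemma mul_closed:
  assumes "f \<in> carrier (E m)" "g \<in> carrier (E n)" "l = m + n"
  shows "mul m n f g \<in> carrier (E l)"
  unfolding endo_carrier endo_mult_def assms(3)
  by (intro allI kG_homs_compose[OF endo_hom[OF assms(2)] endo_hom[OF assms(1)]]) simp_all

lemma mul_add_left:
  assumes "f \<in> carrier (E m)" "f' \<in> carrier (E m)" "g \<in> carrier (E n)" "l = m + n"
  shows "mul m n (f \<oplus>\<^bsub>E m\<^esub> f') g = mul m n f g \<oplus>\<^bsub>E l\<^esub> mul m n f' g"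
  by (rule endo_eqI[of _ l])
    (use assms in \<open>auto simp: mul_app endo_add_app add.assoc endo_closed intro!: mul_closed add_closed
      module_endo\<close>)

lemma mul_add_right:
  assumes "f \<in> carrier (E m)" "g \<in> carrier (E n)" "g' \<in> carrier (E n)" "l = m + n"
  shows "mul m n f (g \<oplus>\<^bsub>E n\<^esub> g') = mul m n f g \<oplus>\<^bsub>E l\<^esub> mul m n f g'"
  by (rule endo_eqI[of _ l])
    (use assms in \<open>auto simp: mul_app endo_add_app add.assoc endo_closed endo_add intro!: mul_closed add_closed
      module_endo\<close>)

lemma mul_smult_left:
  assumes "f \<in> carrier (E m)" "c \<in> carrier k" "g \<in> carrier (E n)" "l = m + n"
  shows "mul m n (c \<odot>\<^bsub>E m\<^esub> f) g = c \<odot>\<^bsub>E l\<^esub> mul m n f g"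
  by (rule endo_eqI[of _ l])
    (use assms in \<open>auto simp: mul_app endo_smult_app add.assoc endo_closed intro!: mul_closed smult_closed
      module_endo\<close>)

lemma mul_smult_right:
  assumes "f \<in> carrier (E m)" "c \<in> carrier k" "g \<in> carrier (E n)" "l = m + n"
  shows "mul m n f (c \<odot>\<^bsub>E n\<^esub> g) = c \<odot>\<^bsub>E l\<^esub> mul m n f g"
  by (rule endo_eqI[of _ l])
    (use assms in \<open>auto simp: mul_app endo_smult_app add.assoc endo_closed endo_smult intro!: mul_closed
      smult_closed module_endo\<close>)

lemma mul_assoc:
  assumes "f \<in> carrier (E m)" "g \<in> carrier (E n)" "h \<in> carrier (E r)" "s = m + n" "t = n + r"
  shows "mul s r (mul m n f g) h = mul m t f (mul n r g h)"
  by (rule endo_eqI[of _ "m + n + r"])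
    (use assms in \<open>auto simp: mul_app add.assoc endo_closed intro!: mul_closed\<close>)

lemma diff_add:
  assumes "f \<in> carrier (E n)" "h \<in> carrier (E n)" "m = n + 1"
  shows "dd n (f \<oplus>\<^bsub>E n\<^esub> h) = dd n f \<oplus>\<^bsub>E m\<^esub> dd n h"
proof (rule endo_eqI[of _ m])
  have fh: "f \<oplus>\<^bsub>E n\<^esub> h \<in> carrier (E n)" using assms by (simp add: add_closed module_endo)
  show "dd n (f \<oplus>\<^bsub>E n\<^esub> h) \<in> carrier (E m)" "dd n f \<oplus>\<^bsub>E m\<^esub> dd n h \<in> carrier (E m)"
    using assms fh by (auto intro!: diff_closed add_closed module_endo)
  fix j v assume v: "v \<in> carrier (Ob (j + m))"
  have v': "v \<in> carrier (Ob (j + n + 1))" "v \<in> carrier (Ob (j + 1 + n))" using v assms(3)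
    by (simp_all add: algebra_simps)
  have b: "bd P (j + n + 1) v \<in> carrier (Ob (j + n))" using v'(1) by (rule bd_closed) simp
  have c: "f (j + 1) v \<in> carrier (Ob (j + 1))" "h (j + 1) v \<in> carrier (Ob (j + 1))"
    "f j (bd P (j + n + 1) v) \<in> carrier (Ob j)" "h j (bd P (j + n + 1) v) \<in> carrier (Ob j)"
    using assms v' b by (simp_all add: endo_closed)
  have d: "bd P (j + 1) (f (j + 1) v) \<in> carrier (Ob j)" "bd P (j + 1) (h (j + 1) v) \<in> carrier (Ob j)"
    using c by (simp_all add: bd_closed)
  show "dd n (f \<oplus>\<^bsub>E n\<^esub> h) j v = (dd n f \<oplus>\<^bsub>E m\<^esub> dd n h) j v"
    using v v' b c d by (simp add: diff_app assms(1,2) fh endo_add_app bd_add vs_ac)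
qed

text \<open>Both products on the right contain the mixed term in which the boundary stands between
  \<open>f\<close> and \<open>g\<close>; it cancels, and the outer two terms form the differential
  of the product.\<close>

lemma leibniz:
  assumes f: "f \<in> carrier (E m)" and g: "g \<in> carrier (E n)"
    and l: "l = m + n" "m' = m + 1" "n' = n + 1" "l' = m + n + 1"
  shows "dd l (mul m n f g) = mul m' n (dd m f) g \<oplus>\<^bsub>E l'\<^esub> mul m n' f (dd n g)"
proof (rule endo_eqI[of _ l'])
  have df: "dd m f \<in> carrier (E m')" and dg: "dd n g \<in> carrier (E n')" using f g l by (auto intro: diff_closed)
  have fg: "mul m n f g \<in> carrier (E l)" using f g l by (auto intro: mul_closed)
  show "dd l (mul m n f g) \<in> carrier (E l')" using fg l by (auto intro: diff_closed)
  have c1: "mul m' n (dd m f) g \<in> carrier (E l')" "mul m n' f (dd n g) \<in> carrier (E l')"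
    using f g df dg l by (auto intro!: mul_closed)
  then show "mul m' n (dd m f) g \<oplus>\<^bsub>E l'\<^esub> mul m n' f (dd n g) \<in> carrier (E l')"
    by (simp add: add_closed module_endo)
  fix j v assume v: "v \<in> carrier (Ob (j + l'))"
  have v1: "v \<in> carrier (Ob (j + l + 1))" "v \<in> carrier (Ob (j + 1 + (m + n)))" "v \<in> carrier (Ob (j + (m' + n)))"
    "v \<in> carrier (Ob (j + (m + n')))" "v \<in> carrier (Ob (j + m + n + 1))" "v \<in> carrier (Ob (j + 1 + m + n))"
    "v \<in> carrier (Ob (j + m + 1 + n))"
    using v l by (simp_all add: algebra_simps)
  let ?b = "bd P (j + l + 1) v" and ?w = "g (j + m + 1) v"
  have b: "?b \<in> carrier (Ob (j + (m + n)))" "?b \<in> carrier (Ob (j + m + n))"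
    using v1(1) l by (auto intro!: bd_closed)
  have w: "?w \<in> carrier (Ob (j + m + 1))" using v1 by (intro endo_closed[OF g]) simp
  have w': "?w \<in> carrier (Ob (j + 1 + m))" using w by (simp add: algebra_simps)
  have bw: "bd P (j + m + 1) ?w \<in> carrier (Ob (j + m))" using w by (auto intro: bd_closed)
  have gb: "g (j + m) ?b \<in> carrier (Ob (j + m))" using b by (intro endo_closed[OF g]) simp
  have cc: "f (j + 1) ?w \<in> carrier (Ob (j + 1))" "f j (bd P (j + m + 1) ?w) \<in> carrier (Ob j)"
    "f j (g (j + m) ?b) \<in> carrier (Ob j)"
    using w' bw gb by (auto intro: endo_closed[OF f])
  have cd: "bd P (j + 1) (f (j + 1) ?w) \<in> carrier (Ob j)" using cc(1) by (auto intro: bd_closed)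
  have L: "dd l (mul m n f g) j v = bd P (j + 1) (f (j + 1) ?w) \<oplus>\<^bsub>Ob j\<^esub> f j (g (j + m) ?b)"
    using diff_app[OF fg v1(1)] mul_app[OF v1(2), of f g] mul_app[OF b(1), of f g] by (simp add: algebra_simps)
  have R1: "mul m' n (dd m f) g j v = bd P (j + 1) (f (j + 1) ?w) \<oplus>\<^bsub>Ob j\<^esub> f j (bd P (j + m + 1) ?w)"
    using mul_app[OF v1(3), of "dd m f" g] diff_app[OF f w] l by (simp add: add.assoc)
  have "dd n g (j + m) v = bd P (j + m + 1) ?w \<oplus>\<^bsub>Ob (j + m)\<^esub> g (j + m) ?b"
    using diff_app[OF g v1(5)] l by (simp add: add.assoc)
  then have R2: "mul m n' f (dd n g) j v = f j (bd P (j + m + 1) ?w) \<oplus>\<^bsub>Ob j\<^esub> f j (g (j + m) ?b)"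
    using mul_app[OF v1(4), of f "dd n g"] bw gb by (simp add: endo_add[OF f])
  show "dd l (mul m n f g) j v = (mul m' n (dd m f) g \<oplus>\<^bsub>E l'\<^esub> mul m n' f (dd n g)) j v"
    using v cc cd by (simp add: endo_add_app L R1 R2 vs_ac)
qed

text \<open>Without signs, a cocycle of any degree, even or odd, is a family that commutes with the
  boundary maps.\<close>

lemma diff_eq_zero_iff:
  assumes f: "f \<in> carrier (E n)" and m: "m = n + 1"
  shows "dd n f = \<zero>\<^bsub>E m\<^esub> \<longleftrightarrow> (\<forall>j. \<forall>v\<in>carrier (Ob (j + m)). bd P (j + 1) (f (j + 1) v) = f j (bd P (j + m) v))"
proof -
  have c: "bd P (j + 1) (f (j + 1) v) \<in> carrier (Ob j)" "f j (bd P (j + m) v) \<in> carrier (Ob j)"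
    if "v \<in> carrier (Ob (j + m))" for j v
  proof -
    have "f (j + 1) v \<in> carrier (Ob (j + 1))" using that m
      by (intro endo_closed[OF f]) (simp add: algebra_simps)
    then show "bd P (j + 1) (f (j + 1) v) \<in> carrier (Ob j)" by (auto intro: bd_closed)
    have "bd P (j + m) v \<in> carrier (Ob (j + n))" using that m by (auto intro: bd_closed)
    then show "f j (bd P (j + m) v) \<in> carrier (Ob j)" by (rule endo_closed[OF f])
  qed
  have app: "dd n f j v = bd P (j + 1) (f (j + 1) v) \<oplus>\<^bsub>Ob j\<^esub> f j (bd P (j + m) v)" if "v \<in> carrier (Ob (j + m))"
    for j v
    using diff_app[OF f, of v j] that m by (simp add: add.assoc)
  have "dd n f = \<zero>\<^bsub>E m\<^esub> \<longleftrightarrow> (\<forall>j. \<forall>v\<in>carrier (Ob (j + m)). dd n f j v = \<zero>\<^bsub>Ob j\<^esub>)"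
    using endo_eqI[OF diff_closed[OF f m] zero_closed[OF module_endo]] endo_zero_app by metis
  also have "\<dots> \<longleftrightarrow> (\<forall>j. \<forall>v\<in>carrier (Ob (j + m)). bd P (j + 1) (f (j + 1) v) = f j (bd P (j + m) v))"
    using app c vs_eq[OF Ob_module] by (intro iff_allI ball_cong refl) simp
  finally show ?thesis .
qed

lemma cocycle_iff: "f \<in> endo_cocycles k G P n \<longleftrightarrow> f \<in> carrier (E n) \<and> dd n f = \<zero>\<^bsub>E (n + 1)\<^esub>"
  by (simp add: endo_cocycles_def)

lemma cocycle_bd:
  assumes "f \<in> endo_cocycles k G P n" "v \<in> carrier (Ob l)" "l = j + n" "i = j - 1"
  shows "bd P j (f j v) = f i (bd P l v)"
  using assms diff_eq_zero_iff[of f n "n + 1"] unfolding cocycle_iff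
  by (auto dest!: spec[of _ "j - 1"])

text \<open>For \<open>f = 0\<close> this extends cocycles on \<open>P\<close> to chain maps.\<close>

lemma endo_solve:
  assumes f: "f \<in> endo_cocycles k G P n" and \<psi>: "\<psi> \<in> kG_homs k G (Ob (n - 1)) T"
    and eq: "\<And>v. v \<in> carrier (Ob n) \<Longrightarrow> \<psi> (bd P n v) = aug P (f 0 v)"
  shows "\<exists>h\<in>carrier (E (n - 1)). dd (n - 1) h = f \<and> (\<forall>v\<in>carrier (Ob (n - 1)). aug P (h 0 v) = \<psi> v)"
proof -
  have fE: "f \<in> carrier (E n)" using f unfolding cocycle_iff by simp
  note fc = endo_closed[OF fE]
  \<comment> \<open>\<open>R j a b\<close> says that \<open>a\<close> and \<open>b\<close> are
    admissible as \<open>h j\<close> and \<open>h (j + 1)\<close> and that the equation for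
    \<open>f\<close> holds in the component \<open>j\<close>, which involves exactly these
    two.\<close>
  define R where "R j a b \<longleftrightarrow> a \<in> kG_homs k G (Ob (j + n - 1)) (Ob j) \<and>
      b \<in> kG_homs k G (Ob (j + n)) (Ob (j + 1)) \<and>
      (\<forall>v\<in>carrier (Ob (j + n)). bd P (j + 1) (b v) \<oplus>\<^bsub>Ob j\<^esub> a (bd P (j + n) v) = f j v)" for j a b
  \<comment> \<open>Any lift of \<open>\<psi>\<close> along the augmentation can serve as the
    component in degree zero; the final clause of the conclusion records this choice.\<close>
  obtain h0 where h0: "h0 \<in> kG_homs k G (Ob (n - 1)) (Ob 0)" "\<And>v. v \<in> carrier (Ob (n - 1)) \<Longrightarrow> aug P (h0 v) = \<psi> v"
    using projective_lift[OF Ob_projective Ob_kG T_kG \<psi> aug_hom] aug_surj kG_homs_closed[OF \<psi>] by auto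
  have step: "\<exists>b\<in>kG_homs k G (Ob (j + n)) (Ob (j + 1)). \<forall>v\<in>carrier (Ob (j + n)). bd P (j + 1) (b v) \<oplus>\<^bsub>Ob j\<^esub> a
      (bd P (j + n) v) = f j v"
    if a: "a \<in> kG_homs k G (Ob (j + n - 1)) (Ob j)"
      and ex: "\<And>v. v \<in> carrier (Ob (j + n)) \<Longrightarrow> \<exists>w\<in>carrier (Ob (j + 1)). bd P (j + 1) w =
          f j v \<oplus>\<^bsub>Ob j\<^esub> a (bd P (j + n) v)"
    for j a
  proof -
    have ab: "compose (carrier (Ob (j + n))) a (bd P (j + n)) \<in> kG_homs k G (Ob (j + n)) (Ob j)"
      by (rule kG_homs_compose[OF bd_hom[OF refl] a]) simp
    have \<phi>: "(\<lambda>v\<in>carrier (Ob (j + n)). f j v \<oplus>\<^bsub>Ob j\<^esub> compose (carrier (Ob (j + n))) a (bd P (j + n)) v) \<in>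
        kG_homs k G (Ob (j + n)) (Ob j)"
      by (rule kG_homs_add_closed[OF endo_hom[OF fE refl] ab]) simp_all
    have bj: "bd P (j + 1) \<in> kG_homs k G (Ob (j + 1)) (Ob j)" by (rule bd_hom) simp
    obtain b where b: "b \<in> kG_homs k G (Ob (j + n)) (Ob (j + 1))"
      "\<And>v. v \<in> carrier (Ob (j + n)) \<Longrightarrow> bd P (j + 1) (b v) = f j v \<oplus>\<^bsub>Ob j\<^esub> a (bd P (j + n) v)"
      using projective_lift[OF Ob_projective Ob_kG Ob_kG \<phi> bj] ex by (auto simp: compose_def)
    have "bd P (j + 1) (b v) \<oplus>\<^bsub>Ob j\<^esub> a (bd P (j + n) v) = f j v" if v: "v \<in> carrier (Ob (j + n))" for v
    proof -
      have "a (bd P (j + n) v) \<in> carrier (Ob j)" using v by (auto intro!: kG_homs_closed[OF a] bd_closed)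
      then show ?thesis using b(2)[OF v] fc[OF v] by (simp add: vs_ac)
    qed
    then show ?thesis using b(1) by blast
  qed
  \<comment> \<open>The hypothesis relating \<open>\<psi>\<close> to \<open>f\<close> says that the
    defect in component 0 is killed by the augmentation, so exactness of the augmented resolution
    applies.\<close>
  have base: "\<exists>b. R 0 h0 b"
  proof -
    have "\<exists>w\<in>carrier (Ob (0 + 1)). bd P (0 + 1) w = f 0 v \<oplus>\<^bsub>Ob 0\<^esub> h0 (bd P (0 + n) v)" if v:
      "v \<in> carrier (Ob (0 + n))" for v
    proof -
      have b: "bd P n v \<in> carrier (Ob (n - 1))" using v by (auto intro: bd_closed)
      have "h0 (bd P n v) \<in> carrier (Ob 0)" "f 0 v \<in> carrier (Ob 0)" using kG_homs_closed[OF h0(1) b] fc[OF v]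
        by auto
      moreover from this have "aug P (f 0 v \<oplus>\<^bsub>Ob 0\<^esub> h0 (bd P n v)) = \<zero>\<^bsub>k\<^esub>"
        using eq[of v] h0(2)[OF b] v aug_rules by (simp add: K_self)
      ultimately show ?thesis using aug_lift by (simp add: add_closed)
    qed
    then show ?thesis using step[of h0 0] h0 unfolding R_def by auto
  qed
  \<comment> \<open>The defect in the next component is a cycle, because \<open>f\<close> is a
    cocycle and the equation already holds in component \<open>j\<close>; projectivity then lifts it
    through the boundary map.\<close>
  have up: "\<exists>c. R (j + 1) b c" if "R j a b" for j a b
  proof -
    have a: "a \<in> kG_homs k G (Ob (j + n - 1)) (Ob j)" and b: "b \<in> kG_homs k G (Ob (j + n)) (Ob (j + 1))"
      and r: "\<And>v. v \<in> carrier (Ob (j + n)) \<Longrightarrow> bd P (j + 1) (b v) \<oplus>\<^bsub>Ob j\<^esub> a (bd P (j + n) v) = f j v"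
      using that unfolding R_def by auto
    have b': "b \<in> kG_homs k G (Ob (j + 1 + n - 1)) (Ob (j + 1))" using b by (simp add: algebra_simps)
    have "\<exists>w\<in>carrier (Ob (j + 1 + 1)). bd P (j + 1 + 1) w = f (j + 1) v \<oplus>\<^bsub>Ob (j + 1)\<^esub> b (bd P (j + 1 + n) v)"
      if v: "v \<in> carrier (Ob (j + 1 + n))" for v
    proof -
      let ?b = "bd P (j + 1 + n) v"
      have bv: "?b \<in> carrier (Ob (j + n))" using v by (auto intro: bd_closed)
      have c: "b ?b \<in> carrier (Ob (j + 1))" "f (j + 1) v \<in> carrier (Ob (j + 1))" "f j ?b \<in> carrier (Ob j)"
        using kG_homs_closed[OF b bv] fc[OF v] fc[OF bv] by auto
      have d: "bd P (j + 1) (b ?b) \<in> carrier (Ob j)" using c by (auto intro: bd_closed)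
      have "bd P (j + n) ?b = \<zero>\<^bsub>Ob (j + n - 1)\<^esub>" using v by (auto intro: bd_bd)
      then have "bd P (j + 1) (b ?b) = f j ?b"
        using r[OF bv] hom_zero[OF a] d by (simp add: vs_r_zero)
      moreover have "bd P (j + 1) (f (j + 1) v) = f j ?b" using v by (intro cocycle_bd[OF f]) auto
      ultimately have "bd P (j + 1) (f (j + 1) v \<oplus>\<^bsub>Ob (j + 1)\<^esub> b ?b) = \<zero>\<^bsub>Ob (j + 1 - 1)\<^esub>"
        using c by (simp add: bd_add vs_self)
      then show ?thesis by (rule bd_lift[OF add_closed[OF Ob_module c(2,1)]]) simp
    qed
    from step[OF b' this] show ?thesis using b' unfolding R_def by auto
  qed
  \<comment> \<open>Going down, \<open>c\<close> is prescribed on boundaries, which is an extension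
    problem. The prescription is consistent: an \<open>s\<close> with zero boundary is itself the
    boundary of some \<open>w\<close>, and the boundary of the equation at \<open>w\<close> shows
    that \<open>bd (a s)\<close> and \<open>f (j - 1) s\<close> agree.\<close>
  have down: "\<exists>c. R (j - 1) c a" if "R j a b" for j a b
  proof -
    have a: "a \<in> kG_homs k G (Ob (j + n - 1)) (Ob j)" and b: "b \<in> kG_homs k G (Ob (j + n)) (Ob (j + 1))"
      and r: "\<And>v. v \<in> carrier (Ob (j + n)) \<Longrightarrow> bd P (j + 1) (b v) \<oplus>\<^bsub>Ob j\<^esub> a (bd P (j + n) v) = f j v"
      using that unfolding R_def by auto
    let ?S = "Ob (j + n - 1)"
    have ba: "compose (carrier ?S) (bd P j) a \<in> kG_homs k G ?S (Ob (j - 1))"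
      by (rule kG_homs_compose[OF a bd_hom[OF refl]]) simp
    have fj: "f (j - 1) \<in> kG_homs k G ?S (Ob (j - 1))" by (rule endo_hom[OF fE]) simp
    have \<phi>: "(\<lambda>v\<in>carrier ?S. compose (carrier ?S) (bd P j) a v \<oplus>\<^bsub>Ob (j - 1)\<^esub> f (j - 1) v) \<in> kG_homs k G
        ?S (Ob (j - 1))"
      by (rule kG_homs_add_closed[OF ba fj]) simp_all
    have ac: "a v \<in> carrier (Ob j)" "f (j - 1) v \<in> carrier (Ob (j - 1))" "bd P j (a v) \<in> carrier (Ob (j - 1))"
      if "v \<in> carrier ?S" for v
      using kG_homs_closed[OF a that] kG_homs_closed[OF fj that] by (auto intro: bd_closed)
    have ker: "(\<lambda>v\<in>carrier ?S. compose (carrier ?S) (bd P j) a v \<oplus>\<^bsub>Ob (j - 1)\<^esub> f (j - 1) v) s = \<zero>\<^bsub>Ob (j - 1)\<^esub>"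
      if s: "s \<in> carrier ?S" "bd P (j + n - 1) s = \<zero>\<^bsub>Ob (j + n - 1 - 1)\<^esub>" for s
    proof -
      obtain w where w: "w \<in> carrier (Ob (j + n))" "bd P (j + n) w = s" using bd_lift[OF s, of "j + n"] by auto
      have bw: "b w \<in> carrier (Ob (j + 1))" "bd P (j + 1) (b w) \<in> carrier (Ob j)"
        using kG_homs_closed[OF b w(1)] by (auto intro: bd_closed)
      have "a s = f j w \<oplus>\<^bsub>Ob j\<^esub> bd P (j + 1) (b w)"
        unfolding r[OF w(1), symmetric] w(2) using bw ac(1)[OF s(1)] by (simp add: vs_ac)
      then have "bd P j (a s) = bd P j (f j w) \<oplus>\<^bsub>Ob (j - 1)\<^esub> bd P j (bd P (j + 1) (b w))"
        using bw fc[OF w(1)] by (simp add: bd_add)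
      also have "bd P j (bd P (j + 1) (b w)) = \<zero>\<^bsub>Ob (j - 1)\<^esub>" using bw by (auto intro: bd_bd)
      also have "bd P j (f j w) = f (j - 1) s" using cocycle_bd[OF f w(1)] w(2) by simp
      finally show ?thesis using s ac[OF s(1)] by (simp add: compose_def vs_ac)
    qed
    obtain c where c: "c \<in> kG_homs k G (Ob (j + n - 1 - 1)) (Ob (j - 1))"
      "\<And>s. s \<in> carrier ?S \<Longrightarrow> c (bd P (j + n - 1) s) = bd P j (a s) \<oplus>\<^bsub>Ob (j - 1)\<^esub> f (j - 1) s"
      using projective_extend[OF Ob_projective Ob_kG Ob_kG bd_hom[OF refl] \<phi> ker] by (auto simp: compose_def)
    have "bd P j (a v) \<oplus>\<^bsub>Ob (j - 1)\<^esub> c (bd P (j + n - 1) v) = f (j - 1) v" if v: "v \<in> carrier ?S" for v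
      using c(2)[OF v] ac[OF v] by (simp add: vs_ac)
    moreover have "j - 1 + n - 1 = j + n - 1 - 1" "j - 1 + n = j + n - 1" "j - 1 + 1 = j" by simp_all
    ultimately show ?thesis using a c(1) unfolding R_def by metis
  qed
  obtain b where "R 0 h0 b" using base by blast
  then obtain h where h: "h 0 = h0" "\<And>j. R j (h j) (h (j + 1))"
    using int_chain[of R h0 b] up down by blast
  have hE: "h \<in> carrier (E (n - 1))"
    unfolding endo_carrier using h(2) unfolding R_def by (auto simp: add_diff_eq)
  have "dd (n - 1) h = f"
  proof (rule endo_eqI[OF diff_closed[OF hE] fE])
    fix j v assume v: "v \<in> carrier (Ob (j + n))"
    then show "dd (n - 1) h j v = f j v" using h(2)[of j] diff_app[OF hE, of v j] unfolding R_def by simp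
  qed simp
  then show ?thesis using hE h(1) h0(2) by blast
qed

section \<open>Tate cohomology\<close>

abbreviation "tcl M n \<equiv> tate_class k G P M n"
abbreviation "HM M n \<equiv> tate_cohomology k G P M n"
abbreviation "tact M m n \<equiv> tate_act k G P M m n"
abbreviation "H n \<equiv> tate_cohomology k G P T n"
abbreviation "Z n \<equiv> endo_cocycles k G P n"
abbreviation "ecl n \<equiv> endo_class k G P n"

text \<open>Cosets depend only on the addition, so those formed in the ambient Hom module agree with
  those formed in its submodule of cocycles.\<close>

lemma coset_update: "coset (V\<lparr>carrier := S\<rparr>) B v = coset V B v"
  by (simp add: coset_def')

lemma tcocycle_iff: "\<phi> \<in> tate_cocycles k G P M n \<longleftrightarrow>
    \<phi> \<in> kG_homs k G (Ob n) M \<and> (\<forall>v\<in>carrier (Ob (n + 1)). \<phi> (bd P (n + 1) v) = \<zero>\<^bsub>M\<^esub>)"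
  by (simp add: tate_cocycles_def)

lemma tcocycle_bd: "\<phi> \<in> tate_cocycles k G P M n \<Longrightarrow> m = n + 1 \<Longrightarrow> v \<in> carrier (Ob m) \<Longrightarrow> \<phi> (bd P m v) = \<zero>\<^bsub>M\<^esub>"
  by (simp add: tcocycle_iff)

lemma tcocycle_hom: "\<phi> \<in> tate_cocycles k G P M n \<Longrightarrow> \<phi> \<in> kG_homs k G (Ob n) M"
  by (simp add: tcocycle_iff)

lemma tcoboundary_iff: "\<phi> \<in> tate_coboundaries k G P M n \<longleftrightarrow>
    (\<exists>\<psi>\<in>kG_homs k G (Ob (n - 1)) M. \<phi> = compose (carrier (Ob n)) \<psi> (bd P n))"
  by (auto simp: tate_coboundaries_def)

context
  fixes M :: "('k, 'm, 'g) kG_mod"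
  assumes M: "kG_module k G M"
begin

lemma M_module: "module k M"
  by (rule kG_module_module[OF M])

abbreviation "TZ n \<equiv> (hom_module k G (Ob n) M)\<lparr>carrier := tate_cocycles k G P M n\<rparr>"
abbreviation "TB n \<equiv> tate_coboundaries k G P M n"

lemma TZ_subspace: "subspace (hom_module k G (Ob n) M) (tate_cocycles k G P M n)"
proof -
  have "bd P (n + 1) v \<in> carrier (Ob n)" if "v \<in> carrier (Ob (n + 1))" for v
    using that by (simp add: bd_closed)
  then show ?thesis
    unfolding subspace_def
    by (auto simp: tcocycle_iff hom_module_def kG_homs_add_closed kG_homs_smult_closed kG_homs_zero_closed
        M M_module vs_ac smult_zero)
qed

lemma TZ_module: "module k (TZ n)"
  by (rule module_subspace[OF module_hom TZ_subspace]) (simp_all add: M)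

lemma TB_subspace: "subspace (TZ n) (TB n)"
proof -
  have c: "bd P n v \<in> carrier (Ob (n - 1))" if "v \<in> carrier (Ob n)" for v
    using that by (simp add: bd_closed)
  have cz: "compose (carrier (Ob n)) \<psi> (bd P n) \<in> tate_cocycles k G P M n" if "\<psi> \<in> kG_homs k G (Ob (n - 1)) M"
    for \<psi>
    unfolding tcocycle_iff
    by (rule conjI[OF kG_homs_compose[OF bd_hom[OF refl] that Ob_kG]])
      (use that in \<open>auto simp: compose_def bd_closed bd_bd hom_zero M_module\<close>)
  have z: "(\<lambda>v\<in>carrier (Ob n). \<zero>\<^bsub>M\<^esub>) = compose (carrier (Ob n)) (\<lambda>v\<in>carrier (Ob (n - 1)). \<zero>\<^bsub>M\<^esub>) (bd P n)"
    using c by (auto simp: compose_def fun_eq_iff)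
  have a: "(\<lambda>v\<in>carrier (Ob n). compose (carrier (Ob n)) \<psi> (bd P n) v \<oplus>\<^bsub>M\<^esub> compose (carrier (Ob n)) \<psi>' (bd P n)
      v)
      = compose (carrier (Ob n)) (\<lambda>v\<in>carrier (Ob (n - 1)). \<psi> v \<oplus>\<^bsub>M\<^esub> \<psi>' v) (bd P n)" for \<psi> \<psi>'
    using c by (auto simp: compose_def fun_eq_iff)
  have s: "(\<lambda>v\<in>carrier (Ob n). x \<odot>\<^bsub>M\<^esub> compose (carrier (Ob n)) \<psi> (bd P n) v)
      = compose (carrier (Ob n)) (\<lambda>v\<in>carrier (Ob (n - 1)). x \<odot>\<^bsub>M\<^esub> \<psi> v) (bd P n)" for \<psi> x
    using c by (auto simp: compose_def fun_eq_iff)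
  show ?thesis
    unfolding subspace_def
  proof (intro conjI ballI)
    show "TB n \<subseteq> carrier (TZ n)" using cz by (auto simp: tcoboundary_iff)
    show "\<zero>\<^bsub>TZ n\<^esub> \<in> TB n" using z kG_homs_zero_closed[OF Ob_kG M] by (auto simp: tcoboundary_iff hom_module_def)
    show "u \<oplus>\<^bsub>TZ n\<^esub> v \<in> TB n" if uv: "u \<in> TB n" "v \<in> TB n" for u v
    proof -
      obtain \<psi> \<psi>' where "\<psi> \<in> kG_homs k G (Ob (n - 1)) M" "\<psi>' \<in> kG_homs k G (Ob (n - 1)) M"
        "u = compose (carrier (Ob n)) \<psi> (bd P n)" "v = compose (carrier (Ob n)) \<psi>' (bd P n)"
        using uv unfolding tcoboundary_iff by blast
      then show ?thesis using a[of \<psi> \<psi>'] kG_homs_add_closed[of \<psi> "Ob (n - 1)" M \<psi>'] M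
        unfolding tcoboundary_iff by (auto simp: hom_module_def)
    qed
    show "x \<odot>\<^bsub>TZ n\<^esub> v \<in> TB n" if xv: "x \<in> carrier k" "v \<in> TB n" for x v
    proof -
      obtain \<psi> where "\<psi> \<in> kG_homs k G (Ob (n - 1)) M" "v = compose (carrier (Ob n)) \<psi> (bd P n)"
        using xv unfolding tcoboundary_iff by blast
      then show ?thesis using s[of x \<psi>] kG_homs_smult_closed[of \<psi> "Ob (n - 1)" M x] M xv
        unfolding tcoboundary_iff by (auto simp: hom_module_def)
    qed
  qed
qed

lemma tcl_coset: "tcl M n \<phi> = coset (TZ n) (TB n) \<phi>"
  unfolding tate_class_def coset_update by (simp add: coset_def)

lemma HM_def': "HM M n = quotient_module (TZ n) (TB n)"
  unfolding tate_cohomology_def ..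

lemma HM_module: "module k (HM M n)"
  unfolding HM_def' by (rule module_quotient[OF TZ_module TB_subspace])

lemma HM_carrier: "carrier (HM M n) = tcl M n ` tate_cocycles k G P M n"
  unfolding HM_def' quotient_carrier[OF TZ_module TB_subspace] by (auto simp: tcl_coset)

lemma tcl_closed: "\<phi> \<in> tate_cocycles k G P M n \<Longrightarrow> tcl M n \<phi> \<in> carrier (HM M n)"
  unfolding HM_carrier by simp

lemma tcl_add: "\<phi> \<in> tate_cocycles k G P M n \<Longrightarrow> \<psi> \<in> tate_cocycles k G P M n \<Longrightarrow>
    tcl M n \<phi> \<oplus>\<^bsub>HM M n\<^esub> tcl M n \<psi> = tcl M n (\<lambda>v\<in>carrier (Ob n). \<phi> v \<oplus>\<^bsub>M\<^esub> \<psi> v)"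
  unfolding HM_def' tcl_coset using quotient_add[OF TZ_module TB_subspace, of \<phi> n \<psi>]
    by (simp add: hom_module_def)

lemma tcl_smult: "c \<in> carrier k \<Longrightarrow> \<phi> \<in> tate_cocycles k G P M n \<Longrightarrow>
    c \<odot>\<^bsub>HM M n\<^esub> tcl M n \<phi> = tcl M n (\<lambda>v\<in>carrier (Ob n). c \<odot>\<^bsub>M\<^esub> \<phi> v)"
  unfolding HM_def' tcl_coset using quotient_smult[OF TZ_module TB_subspace, of c \<phi> n]
    by (simp add: hom_module_def)

lemma tcl_zero: "\<zero>\<^bsub>HM M n\<^esub> = tcl M n (\<lambda>v\<in>carrier (Ob n). \<zero>\<^bsub>M\<^esub>)"
  unfolding HM_def' tcl_coset using quotient_zero[OF TZ_module TB_subspace, of n] by (simp add: hom_module_def)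

lemma tcl_eq:
  assumes "\<phi> \<in> tate_cocycles k G P M n" "\<phi>' \<in> tate_cocycles k G P M n"
  shows "tcl M n \<phi> = tcl M n \<phi>' \<longleftrightarrow>
    (\<exists>\<psi>\<in>kG_homs k G (Ob (n - 1)) M. \<forall>v\<in>carrier (Ob n). \<phi> v \<oplus>\<^bsub>M\<^esub> \<phi>' v = \<psi> (bd P n v))"
proof -
  have "tcl M n \<phi> = tcl M n \<phi>' \<longleftrightarrow> (\<lambda>v\<in>carrier (Ob n). \<phi> v \<oplus>\<^bsub>M\<^esub> \<phi>' v) \<in> TB n"
    unfolding tcl_coset using coset_eq[OF TZ_module TB_subspace, of \<phi> n \<phi>'] assms by (simp add: hom_module_def)
  also have "\<dots> \<longleftrightarrow> (\<exists>\<psi>\<in>kG_homs k G (Ob (n - 1)) M. \<forall>v\<in>carrier (Ob n). \<phi> v \<oplus>\<^bsub>M\<^esub> \<phi>' v = \<psi> (bd P n v))"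
    unfolding tcoboundary_iff compose_def by (intro bex_cong refl) (auto simp: fun_eq_iff restrict_def)
  finally show ?thesis .
qed

lemma tcl_mem: "\<phi> \<in> tate_cocycles k G P M n \<Longrightarrow> \<phi>' \<in> tcl M n \<phi> \<Longrightarrow>
    \<phi>' \<in> tate_cocycles k G P M n \<and> tcl M n \<phi>' = tcl M n \<phi>"
  unfolding tcl_coset
  using mem_coset[OF TZ_module TB_subspace, of \<phi> n \<phi>'] coset_mem_eq[OF TZ_module TB_subspace, of \<phi> n \<phi>'] by simp

lemma tcl_self: "\<phi> \<in> tate_cocycles k G P M n \<Longrightarrow> \<phi> \<in> tcl M n \<phi>"
  unfolding tcl_coset using coset_self[OF TZ_module TB_subspace, of \<phi> n] by simp

lemma tcl_zeroI:
  assumes "\<phi> \<in> tate_cocycles k G P M n" "\<psi> \<in> kG_homs k G (Ob (n - 1)) M" "\<And>v. v \<in> carrier (Ob n) \<Longrightarrow> \<phi> v =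
      \<psi> (bd P n v)"
  shows "tcl M n \<phi> = \<zero>\<^bsub>HM M n\<^esub>"
proof -
  have z: "(\<lambda>v\<in>carrier (Ob n). \<zero>\<^bsub>M\<^esub>) \<in> tate_cocycles k G P M n"
    using kG_homs_zero_closed[OF Ob_kG M] by (auto simp: tcocycle_iff bd_closed)
  have "\<phi> v \<oplus>\<^bsub>M\<^esub> (\<lambda>v\<in>carrier (Ob n). \<zero>\<^bsub>M\<^esub>) v = \<psi> (bd P n v)" if "v \<in> carrier (Ob n)" for v
    using that assms(3)[OF that] kG_homs_closed[OF tcocycle_hom[OF assms(1)] that]
      by (simp add: vs_r_zero M_module)
  then show ?thesis unfolding tcl_zero tcl_eq[OF assms(1) z] using assms(2) by blast
qed

lemma tcl_zeroD:
  assumes "\<phi> \<in> tate_cocycles k G P M n" "tcl M n \<phi> = \<zero>\<^bsub>HM M n\<^esub>"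
  shows "\<exists>\<psi>\<in>kG_homs k G (Ob (n - 1)) M. \<forall>v\<in>carrier (Ob n). \<phi> v = \<psi> (bd P n v)"
proof -
  have z: "(\<lambda>v\<in>carrier (Ob n). \<zero>\<^bsub>M\<^esub>) \<in> tate_cocycles k G P M n"
    using kG_homs_zero_closed[OF Ob_kG M] by (auto simp: tcocycle_iff bd_closed)
  obtain \<psi> where p: "\<psi> \<in> kG_homs k G (Ob (n - 1)) M"
    "\<And>v. v \<in> carrier (Ob n) \<Longrightarrow> \<phi> v \<oplus>\<^bsub>M\<^esub> (\<lambda>v\<in>carrier (Ob n). \<zero>\<^bsub>M\<^esub>) v = \<psi> (bd P n v)"
    using assms(2) unfolding tcl_zero tcl_eq[OF assms(1) z] by blast
  have "\<phi> v = \<psi> (bd P n v)" if "v \<in> carrier (Ob n)" for v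
    using that p(2)[OF that] kG_homs_closed[OF tcocycle_hom[OF assms(1)] that] by (simp add: vs_r_zero M_module)
  then show ?thesis using p(1) by blast
qed

text \<open>A cocycle of the endomorphism algebra commutes with boundaries, so composition with it
  preserves the cocycle condition. This is the action on the level of representatives.\<close>

lemma pull_closed:
  assumes "\<phi> \<in> tate_cocycles k G P M m" "g \<in> Z n" "l = m + n"
  shows "compose (carrier (Ob l)) \<phi> (g m) \<in> tate_cocycles k G P M l"
  unfolding tcocycle_iff
proof (intro conjI ballI)
  have gE: "g \<in> carrier (E n)" using assms(2) by (simp add: cocycle_iff)
  show "compose (carrier (Ob l)) \<phi> (g m) \<in> kG_homs k G (Ob l) M"
    by (rule kG_homs_compose[OF endo_hom[OF gE assms(3)] tcocycle_hom[OF assms(1)]]) simp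
  fix v assume v: "v \<in> carrier (Ob (l + 1))"
  have v': "v \<in> carrier (Ob (m + 1 + n))" using v assms(3) by (simp add: algebra_simps)
  have "g m (bd P (l + 1) v) = bd P (m + 1) (g (m + 1) v)"
    using cocycle_bd[OF assms(2) v, of "m + 1" m] assms(3) by simp
  moreover have "g (m + 1) v \<in> carrier (Ob (m + 1))" using endo_closed[OF gE v'] .
  ultimately show "compose (carrier (Ob l)) \<phi> (g m) (bd P (l + 1) v) = \<zero>\<^bsub>M\<^esub>"
    using v tcocycle_bd[OF assms(1)] by (simp add: compose_def bd_closed)
qed

end

section \<open>The isomorphism from the cohomology of the endomorphism algebra to Tate
  cohomology\<close>

lemma aug_cocycle: "aug P \<in> tate_cocycles k G P T 0"
  by (simp add: tcocycle_iff aug_hom aug_bd)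

lemma ecl_def': "ecl n g = tcl T n (compose (carrier (Ob n)) (aug P) (g 0))"
  by (simp add: endo_class_def)

lemma aug_pull: "g \<in> Z n \<Longrightarrow> compose (carrier (Ob n)) (aug P) (g 0) \<in> tate_cocycles k G P T n"
  using pull_closed[OF T_kG aug_cocycle, of g n n] by simp

lemma cocycle_endo: "f \<in> Z n \<Longrightarrow> f \<in> carrier (E n)"
  by (simp add: cocycle_iff)

lemma cocycle_add: "f \<in> Z n \<Longrightarrow> g \<in> Z n \<Longrightarrow> f \<oplus>\<^bsub>E n\<^esub> g \<in> Z n"
  by (simp add: cocycle_iff diff_add add_closed[OF module_endo] vs_l_zero[OF module_endo]
    zero_closed[OF module_endo])

lemma diff_smult:
  assumes "f \<in> carrier (E n)" "c \<in> carrier k" "m = n + 1"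
  shows "dd n (c \<odot>\<^bsub>E n\<^esub> f) = c \<odot>\<^bsub>E m\<^esub> dd n f"
proof (rule endo_eqI[of _ m])
  have cf: "c \<odot>\<^bsub>E n\<^esub> f \<in> carrier (E n)" using assms by (simp add: smult_closed module_endo)
  show "dd n (c \<odot>\<^bsub>E n\<^esub> f) \<in> carrier (E m)" "c \<odot>\<^bsub>E m\<^esub> dd n f \<in> carrier (E m)"
    using assms cf by (auto intro!: diff_closed smult_closed module_endo)
  fix j v assume v: "v \<in> carrier (Ob (j + m))"
  have v': "v \<in> carrier (Ob (j + n + 1))" "v \<in> carrier (Ob (j + 1 + n))" using v assms(3)
    by (simp_all add: algebra_simps)
  have b: "bd P (j + n + 1) v \<in> carrier (Ob (j + n))" using v'(1) by (rule bd_closed) simp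
  have c: "f (j + 1) v \<in> carrier (Ob (j + 1))" "f j (bd P (j + n + 1) v) \<in> carrier (Ob j)"
    using assms v' b by (simp_all add: endo_closed)
  have d: "bd P (j + 1) (f (j + 1) v) \<in> carrier (Ob j)" using c by (simp add: bd_closed)
  show "dd n (c \<odot>\<^bsub>E n\<^esub> f) j v = (c \<odot>\<^bsub>E m\<^esub> dd n f) j v"
    using v v' b c d assms(2) by (simp add: diff_app assms(1) cf endo_smult_app bd_smult smult_radd)
qed

lemma cocycle_smult: "f \<in> Z n \<Longrightarrow> c \<in> carrier k \<Longrightarrow> c \<odot>\<^bsub>E n\<^esub> f \<in> Z n"
  by (simp add: cocycle_iff diff_smult smult_closed[OF module_endo] smult_zero[OF module_endo])

lemma mul_zero_left: assumes "g \<in> carrier (E n)" "l = m + n" shows "mul m n \<zero>\<^bsub>E m\<^esub> g = \<zero>\<^bsub>E l\<^esub>"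
  by (rule endo_eqI[of _ l])
    (use assms in \<open>auto simp: mul_app endo_zero_app add.assoc endo_closed intro!: mul_closed zero_closed
      module_endo\<close>)

lemma mul_zero_right: assumes "g \<in> carrier (E m)" "l = m + n" shows "mul m n g \<zero>\<^bsub>E n\<^esub> = \<zero>\<^bsub>E l\<^esub>"
  by (rule endo_eqI[of _ l])
    (use assms in \<open>auto simp: mul_app endo_zero_app add.assoc endo_closed endo_zero intro!: mul_closed
      zero_closed module_endo\<close>)

lemma cocycle_mul:
  assumes "f \<in> Z m" "g \<in> Z n" "l = m + n" shows "mul m n f g \<in> Z l"
  using assms leibniz[of f m g n l "m + 1" "n + 1" "l + 1"] mul_zero_left[of g n "l + 1" "m + 1"]
    mul_zero_right[of f m "l + 1" "n + 1"]
  by (simp add: cocycle_iff mul_closed vs_l_zero[OF module_endo] zero_closed[OF module_endo])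

lemma cocycle_zero: "\<zero>\<^bsub>E n\<^esub> \<in> Z n"
  using diff_eq_zero_iff[OF zero_closed[OF module_endo] refl, of n]
  by (auto simp: cocycle_iff zero_closed[OF module_endo] endo_zero_app add.commute add.left_commute bd_closed
      hom_zero[OF bd_hom[OF refl] Ob_module Ob_module])

lemma ecl_closed: "f \<in> Z n \<Longrightarrow> ecl n f \<in> carrier (H n)"
  unfolding ecl_def' by (intro tcl_closed[OF T_kG] aug_pull)

lemma ecl_add:
  assumes "f \<in> Z n" "g \<in> Z n" shows "ecl n (f \<oplus>\<^bsub>E n\<^esub> g) = ecl n f \<oplus>\<^bsub>H n\<^esub> ecl n g"
  unfolding ecl_def' tcl_add[OF T_kG aug_pull[OF assms(1)] aug_pull[OF assms(2)]]
  using endo_closed[OF cocycle_endo[OF assms(1)], of _ 0] endo_closed[OF cocycle_endo[OF assms(2)], of _ 0]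
  by (intro arg_cong[of _ _ "tcl T n"]) (auto simp: compose_def fun_eq_iff endo_add_app aug_rules)

lemma ecl_smult:
  assumes "f \<in> Z n" "c \<in> carrier k" shows "ecl n (c \<odot>\<^bsub>E n\<^esub> f) = c \<odot>\<^bsub>H n\<^esub> ecl n f"
  unfolding ecl_def' tcl_smult[OF T_kG assms(2) aug_pull[OF assms(1)]]
  using endo_closed[OF cocycle_endo[OF assms(1)], of _ 0] assms(2)
  by (intro arg_cong[of _ _ "tcl T n"]) (auto simp: compose_def fun_eq_iff endo_smult_app aug_rules)

text \<open>Surjectivity: \<open>endo_solve\<close> with zero right-hand side and prescribed
  augmentation. The lift reproduces \<open>\<phi>\<close> itself and not only its class, which
  allows values of \<open>\<phi>\<close> to be read off later.\<close>

lemma cocycle_lift: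
  assumes p: "\<phi> \<in> tate_cocycles k G P T n"
  shows "\<exists>f\<in>Z n. ecl n f = tcl T n \<phi> \<and> (\<forall>v\<in>carrier (Ob n). aug P (f 0 v) = \<phi> v)"
proof -
  have ph: "\<phi> \<in> kG_homs k G (Ob (n + 1 - 1)) T" using tcocycle_hom[OF p] by simp
  have "\<phi> (bd P (n + 1) v) = aug P (\<zero>\<^bsub>E (n + 1)\<^esub> 0 v)" if "v \<in> carrier (Ob (n + 1))" for v
    using tcocycle_bd[OF p refl that] that hom_zero[OF aug_hom Ob_module T_module] by (simp add: endo_zero_app)
  from endo_solve[OF cocycle_zero ph this] obtain h where h: "h \<in> carrier (E n)" "dd n h = \<zero>\<^bsub>E (n + 1)\<^esub>"
    "\<And>v. v \<in> carrier (Ob n) \<Longrightarrow> aug P (h 0 v) = \<phi> v" by auto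
  have "compose (carrier (Ob n)) (aug P) (h 0) = \<phi>"
    using h(3) kG_homs_ext[OF tcocycle_hom[OF p]] by (auto simp: compose_def fun_eq_iff extensional_def)
  then show ?thesis using h by (intro bexI[of _ h]) (auto simp: ecl_def' cocycle_iff)
qed

lemma ecl_surj:
  assumes "a \<in> carrier (H n)"
  shows "\<exists>f\<in>Z n. ecl n f = a"
  using assms cocycle_lift unfolding HM_carrier[OF T_kG] by blast
text \<open>Injectivity. A primitive of the augmented component of \<open>f\<close> extends by
  \<open>endo_solve\<close> to a primitive of the whole family. Conversely, the augmentation kills
  boundaries, so composing it with \<open>h 0\<close> gives a primitive below.\<close>

lemma ecl_eq_zero:
  assumes "f \<in> Z n" shows "ecl n f = \<zero>\<^bsub>H n\<^esub> \<longleftrightarrow> (\<exists>h\<in>carrier (E (n - 1)). dd (n - 1) h = f)"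
proof
  assume "ecl n f = \<zero>\<^bsub>H n\<^esub>"
  then obtain \<psi> where p: "\<psi> \<in> kG_homs k G (Ob (n - 1)) T"
    "\<And>v. v \<in> carrier (Ob n) \<Longrightarrow> compose (carrier (Ob n)) (aug P) (f 0) v = \<psi> (bd P n v)"
    using tcl_zeroD[OF T_kG aug_pull[OF assms]] unfolding ecl_def' by blast
  have "\<psi> (bd P n v) = aug P (f 0 v)" if "v \<in> carrier (Ob n)" for v
    using p(2)[OF that] that by (simp add: compose_def)
  from endo_solve[OF assms p(1) this] show "\<exists>h\<in>carrier (E (n - 1)). dd (n - 1) h = f" by blast
next
  assume "\<exists>h\<in>carrier (E (n - 1)). dd (n - 1) h = f"
  then obtain h where h: "h \<in> carrier (E (n - 1))" "dd (n - 1) h = f" by blast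
  have hh: "h 0 \<in> kG_homs k G (Ob (n - 1)) (Ob 0)" by (rule endo_hom[OF h(1)]) simp
  have c: "compose (carrier (Ob (n - 1))) (aug P) (h 0) \<in> kG_homs k G (Ob (n - 1)) T"
    by (rule kG_homs_compose[OF hh aug_hom]) simp
  show "ecl n f = \<zero>\<^bsub>H n\<^esub>"
    unfolding ecl_def'
  proof (rule tcl_zeroI[OF T_kG aug_pull[OF assms] c])
    fix v assume v: "v \<in> carrier (Ob n)"
    have b: "bd P n v \<in> carrier (Ob (n - 1))" using v by (simp add: bd_closed)
    have hv: "h 1 v \<in> carrier (Ob 1)" using endo_closed[OF h(1), of v 1] v by simp
    have hb: "h 0 (bd P n v) \<in> carrier (Ob 0)" using kG_homs_closed[OF hh b] .
    have "f 0 v = bd P 1 (h 1 v) \<oplus>\<^bsub>Ob 0\<^esub> h 0 (bd P n v)" using diff_app[OF h(1), of v 0] h(2) v by simp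
    then show "compose (carrier (Ob n)) (aug P) (f 0) v =
        compose (carrier (Ob (n - 1))) (aug P) (h 0) (bd P n v)"
      using v b hv hb aug_rules by (simp add: compose_def bd_closed aug_bd)
  qed
qed

lemma ecl_eq:
  assumes "f \<in> Z n" "g \<in> Z n"
  shows "ecl n f = ecl n g \<longleftrightarrow> (\<exists>h\<in>carrier (E (n - 1)). dd (n - 1) h = f \<oplus>\<^bsub>E n\<^esub> g)"
  using ecl_eq_zero[OF cocycle_add[OF assms]] ecl_add[OF assms]
    vs_eq[OF HM_module[OF T_kG] ecl_closed[OF assms(1)] ecl_closed[OF assms(2)]] by simp

section \<open>The action of Tate cohomology on classes\<close>

context
  fixes M :: "('k, 'm, 'g) kG_mod"
  assumes M: "kG_module k G M"
begin

text \<open>Write \<phi> g + \<phi>' g' as (\<phi> + \<phi>') g + \<phi>' (g + g'). The first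
  summand is \<psi> bd g = \<psi> g bd; in the second, g + g' = bd h + h bd and \<phi>' bd = 0.
  Hence \<psi> g + \<phi>' h is a primitive.\<close>

lemma pull_eq:
  assumes \<phi>: "\<phi> \<in> tate_cocycles k G P M m" "\<phi>' \<in> tate_cocycles k G P M m" "tcl M m \<phi> = tcl M m \<phi>'"
    and g: "g \<in> Z n" "g' \<in> Z n" "ecl n g = ecl n g'" and l: "l = m + n"
  shows "tcl M l (compose (carrier (Ob l)) \<phi> (g m)) = tcl M l (compose (carrier (Ob l)) \<phi>' (g' m))"
proof -
  note Mm = kG_module_module[OF M]
  obtain \<psi> where p: "\<psi> \<in> kG_homs k G (Ob (m - 1)) M" "\<And>v. v \<in> carrier (Ob m) \<Longrightarrow> \<phi> v \<oplus>\<^bsub>M\<^esub> \<phi>' v = \<psi> (bd P m v)"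
    using \<phi>(3) unfolding tcl_eq[OF M \<phi>(1,2)] by blast
  obtain h where h: "h \<in> carrier (E (n - 1))" "dd (n - 1) h = g \<oplus>\<^bsub>E n\<^esub> g'" using g(3) ecl_eq[OF g(1,2)] by blast
  have gE: "g \<in> carrier (E n)" "g' \<in> carrier (E n)" using g cocycle_endo by auto
  have 1: "compose (carrier (Ob (l - 1))) \<psi> (g (m - 1)) \<in> kG_homs k G (Ob (l - 1)) M"
    by (rule kG_homs_compose[OF endo_hom[OF gE(1)] p(1)]) (simp_all add: l)
  have 2: "compose (carrier (Ob (l - 1))) \<phi>' (h m) \<in> kG_homs k G (Ob (l - 1)) M"
    by (rule kG_homs_compose[OF endo_hom[OF h(1)] tcocycle_hom[OF \<phi>(2)]]) (simp_all add: l)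
  have "compose (carrier (Ob l)) \<phi> (g m) v \<oplus>\<^bsub>M\<^esub> compose (carrier (Ob l)) \<phi>' (g' m) v
      = (\<lambda>w\<in>carrier (Ob (l - 1)). compose (carrier (Ob (l - 1))) \<psi> (g (m - 1)) w \<oplus>\<^bsub>M\<^esub> compose
        (carrier (Ob (l - 1))) \<phi>' (h m) w) (bd P l v)"
    if v: "v \<in> carrier (Ob l)" for v
  proof -
    have v': "v \<in> carrier (Ob (m + n))" "v \<in> carrier (Ob (m + 1 + (n - 1)))" using v l
      by (simp_all add: algebra_simps)
    have b: "bd P l v \<in> carrier (Ob (l - 1))" "bd P l v \<in> carrier (Ob (m + (n - 1)))" using v l
      by (simp_all add: bd_closed)
    have c: "g m v \<in> carrier (Ob m)" "g' m v \<in> carrier (Ob m)" "h (m + 1) v \<in> carrier (Ob (m + 1))"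
      "h m (bd P l v) \<in> carrier (Ob m)"
      using endo_closed[OF gE(1) v'(1)] endo_closed[OF gE(2) v'(1)] endo_closed[OF h(1) v'(2)]
        endo_closed[OF h(1) b(2)] by auto
    have "(g \<oplus>\<^bsub>E n\<^esub> g') m v = bd P (m + 1) (h (m + 1) v) \<oplus>\<^bsub>Ob m\<^esub> h m (bd P l v)"
      using diff_app[OF h(1), of v m] h(2) v' l by simp
    then have gg: "g m v \<oplus>\<^bsub>Ob m\<^esub> g' m v = bd P (m + 1) (h (m + 1) v) \<oplus>\<^bsub>Ob m\<^esub> h m (bd P l v)"
      using v' by (simp add: endo_add_app)
    note r = kG_homs_rules[OF tcocycle_hom[OF \<phi>(1)]] kG_homs_rules[OF tcocycle_hom[OF \<phi>(2)]]
    have bh: "bd P (m + 1) (h (m + 1) v) \<in> carrier (Ob m)" using c by (simp add: bd_closed)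
    have "\<phi>' (g m v) \<oplus>\<^bsub>M\<^esub> \<phi>' (g' m v) = \<phi>' (bd P (m + 1) (h (m + 1) v) \<oplus>\<^bsub>Ob m\<^esub> h m (bd P l v))"
      using gg c r by metis
    also have "\<dots> = \<phi>' (h m (bd P l v))" using c bh r tcocycle_bd[OF \<phi>(2) refl] by (simp add: vs_l_zero Mm)
    finally have A: "\<phi>' (g m v) \<oplus>\<^bsub>M\<^esub> \<phi>' (g' m v) = \<phi>' (h m (bd P l v))" .
    have "\<phi> (g m v) \<oplus>\<^bsub>M\<^esub> \<phi>' (g m v) = \<psi> (bd P m (g m v))" by (rule p(2)[OF c(1)])
    also have "bd P m (g m v) = g (m - 1) (bd P l v)" by (rule cocycle_bd[OF g(1) v]) (simp_all add: l)
    finally have B: "\<phi> (g m v) \<oplus>\<^bsub>M\<^esub> \<phi>' (g m v) = \<psi> (g (m - 1) (bd P l v))" .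
    have "\<phi> (g m v) \<oplus>\<^bsub>M\<^esub> \<phi>' (g' m v) = (\<phi> (g m v) \<oplus>\<^bsub>M\<^esub> \<phi>' (g m v)) \<oplus>\<^bsub>M\<^esub> (\<phi>' (g m v) \<oplus>\<^bsub>M\<^esub> \<phi>' (g' m v))"
      using c r by (simp add: vs_ac Mm)
    then show ?thesis using v b A B by (simp add: compose_def)
  qed
  then show ?thesis
    unfolding tcl_eq[OF M pull_closed[OF M \<phi>(1) g(1) l] pull_closed[OF M \<phi>(2) g(2) l]]
    using kG_homs_add_closed[OF 1 2 Ob_kG M] by blast
qed

text \<open>By \<open>pull_eq\<close> all members of the union that defines the action coincide, and
  the given representatives show that it is not empty.\<close>

lemma tact_eq:
  assumes "\<phi> \<in> tate_cocycles k G P M m" "g \<in> Z n"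
  shows "tact M m n (tcl M m \<phi>) (ecl n g) = tcl M (m + n) (compose (carrier (Ob (m + n))) \<phi> (g m))"
proof -
  have "tcl M (m + n) (compose (carrier (Ob (m + n))) \<phi>' (g' m)) =
      tcl M (m + n) (compose (carrier (Ob (m + n))) \<phi> (g m))"
    if "\<phi>' \<in> tcl M m \<phi>" "g' \<in> {g' \<in> Z n. ecl n g' = ecl n g}" for \<phi>' g'
    using tcl_mem[OF M assms(1) that(1)] that(2) assms by (intro pull_eq) auto
  moreover have "\<phi> \<in> tcl M m \<phi>" using tcl_self[OF M assms(1)] .
  moreover have "g \<in> {g' \<in> Z n. ecl n g' = ecl n g}" using assms by simp
  ultimately show ?thesis unfolding tate_act_def by blast
qed

lemma tact_cases:
  assumes "u \<in> carrier (HM M m)" "a \<in> carrier (H n)"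
  obtains \<phi> g where "\<phi> \<in> tate_cocycles k G P M m" "g \<in> Z n" "u = tcl M m \<phi>" "a = ecl n g"
    "tact M m n u a = tcl M (m + n) (compose (carrier (Ob (m + n))) \<phi> (g m))"
proof -
  obtain \<phi> where 1: "\<phi> \<in> tate_cocycles k G P M m" "u = tcl M m \<phi>" using assms(1) unfolding HM_carrier[OF M]
    by blast
  obtain g where 2: "g \<in> Z n" "ecl n g = a" using ecl_surj[OF assms(2)] by blast
  show thesis using that[OF 1(1) 2(1) 1(2)] tact_eq[OF 1(1) 2(1)] 1 2 by simp
qed

lemma tact_closed:
  assumes "u \<in> carrier (HM M m)" "a \<in> carrier (H n)" "l = m + n"
  shows "tact M m n u a \<in> carrier (HM M l)"
  by (rule tact_cases[OF assms(1,2)]) (use assms(3) in \<open>auto intro!: tcl_closed[OF M] pull_closed[OF M]\<close>)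

lemma tact_add_left:
  assumes u: "u \<in> carrier (HM M m)" and v: "v \<in> carrier (HM M m)" and a: "a \<in> carrier (H n)" and l: "l = m + n"
  shows "tact M m n (u \<oplus>\<^bsub>HM M m\<^esub> v) a = tact M m n u a \<oplus>\<^bsub>HM M l\<^esub> tact M m n v a"
proof -
  obtain \<phi> where p: "\<phi> \<in> tate_cocycles k G P M m" "u = tcl M m \<phi>" using u unfolding HM_carrier[OF M] by blast
  obtain \<phi>' where p': "\<phi>' \<in> tate_cocycles k G P M m" "v = tcl M m \<phi>'" using v unfolding HM_carrier[OF M]
    by blast
  obtain g where g: "g \<in> Z n" "a = ecl n g" using ecl_surj[OF a] by blast
  have pp: "(\<lambda>v\<in>carrier (Ob m). \<phi> v \<oplus>\<^bsub>M\<^esub> \<phi>' v) \<in> tate_cocycles k G P M m"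
    using add_closed[OF TZ_module[OF M], of \<phi> m \<phi>'] p p' by (simp add: hom_module_def)
  show ?thesis
    unfolding p(2) p'(2) g(2) tcl_add[OF M p(1) p'(1)] tact_eq[OF p(1) g(1)] tact_eq[OF p'(1) g(1)]
      tact_eq[OF pp g(1)] l
      tcl_add[OF M pull_closed[OF M p(1) g(1) refl] pull_closed[OF M p'(1) g(1) refl]]
    using endo_closed[OF cocycle_endo[OF g(1)]]
    by (intro arg_cong[of _ _ "tcl M (m + n)"]) (auto simp: compose_def fun_eq_iff)
qed

lemma tact_smult_left:
  assumes u: "u \<in> carrier (HM M m)" and c: "c \<in> carrier k" and a: "a \<in> carrier (H n)" and l: "l = m + n"
  shows "tact M m n (c \<odot>\<^bsub>HM M m\<^esub> u) a = c \<odot>\<^bsub>HM M l\<^esub> tact M m n u a"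
proof -
  obtain \<phi> where p: "\<phi> \<in> tate_cocycles k G P M m" "u = tcl M m \<phi>" using u unfolding HM_carrier[OF M] by blast
  obtain g where g: "g \<in> Z n" "a = ecl n g" using ecl_surj[OF a] by blast
  have pp: "(\<lambda>v\<in>carrier (Ob m). c \<odot>\<^bsub>M\<^esub> \<phi> v) \<in> tate_cocycles k G P M m"
    using smult_closed[OF TZ_module[OF M], of c \<phi> m] p c by (simp add: hom_module_def)
  show ?thesis
    unfolding p(2) g(2) tcl_smult[OF M c p(1)] tact_eq[OF p(1) g(1)] tact_eq[OF pp g(1)] l
      tcl_smult[OF M c pull_closed[OF M p(1) g(1) refl]]
    using endo_closed[OF cocycle_endo[OF g(1)]]
    by (intro arg_cong[of _ _ "tcl M (m + n)"]) (auto simp: compose_def fun_eq_iff)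
qed

lemma tact_add_right:
  assumes u: "u \<in> carrier (HM M m)" and a: "a \<in> carrier (H n)" and b: "b \<in> carrier (H n)" and l: "l = m + n"
  shows "tact M m n u (a \<oplus>\<^bsub>H n\<^esub> b) = tact M m n u a \<oplus>\<^bsub>HM M l\<^esub> tact M m n u b"
proof -
  obtain \<phi> where p: "\<phi> \<in> tate_cocycles k G P M m" "u = tcl M m \<phi>" using u unfolding HM_carrier[OF M] by blast
  obtain f where f: "f \<in> Z n" "a = ecl n f" using ecl_surj[OF a] by blast
  obtain g where g: "g \<in> Z n" "b = ecl n g" using ecl_surj[OF b] by blast
  show ?thesis
    unfolding p(2) f(2) g(2) ecl_add[OF f(1) g(1), symmetric] tact_eq[OF p(1) f(1)] tact_eq[OF p(1) g(1)]
      tact_eq[OF p(1) cocycle_add[OF f(1) g(1)]] l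
      tcl_add[OF M pull_closed[OF M p(1) f(1) refl] pull_closed[OF M p(1) g(1) refl]]
    using endo_closed[OF cocycle_endo[OF g(1)]] endo_closed[OF cocycle_endo[OF f(1)]]
      kG_homs_rules[OF tcocycle_hom[OF p(1)]]
    by (intro arg_cong[of _ _ "tcl M (m + n)"]) (auto simp: compose_def fun_eq_iff endo_add_app)
qed

lemma tact_smult_right:
  assumes u: "u \<in> carrier (HM M m)" and a: "a \<in> carrier (H n)" and c: "c \<in> carrier k" and l: "l = m + n"
  shows "tact M m n u (c \<odot>\<^bsub>H n\<^esub> a) = c \<odot>\<^bsub>HM M l\<^esub> tact M m n u a"
proof -
  obtain \<phi> where p: "\<phi> \<in> tate_cocycles k G P M m" "u = tcl M m \<phi>" using u unfolding HM_carrier[OF M] by blast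
  obtain f where f: "f \<in> Z n" "a = ecl n f" using ecl_surj[OF a] by blast
  show ?thesis
    unfolding p(2) f(2) ecl_smult[OF f(1) c, symmetric] tact_eq[OF p(1) f(1)]
      tact_eq[OF p(1) cocycle_smult[OF f(1) c]] l tcl_smult[OF M c pull_closed[OF M p(1) f(1) refl]]
    using endo_closed[OF cocycle_endo[OF f(1)]] kG_homs_rules[OF tcocycle_hom[OF p(1)]] c
    by (intro arg_cong[of _ _ "tcl M (m + n)"]) (auto simp: compose_def fun_eq_iff endo_smult_app)
qed

end

text \<open>The product of classes is represented by composition of chain maps, so identities
  between classes can be checked in the endomorphism algebra.\<close>

lemma ecl_mul:
  assumes f: "f \<in> Z m" and g: "g \<in> Z n" and l: "l = m + n"
  shows "tact T m n (ecl m f) (ecl n g) = ecl l (mul m n f g)"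
proof -
  have "compose (carrier (Ob (m + n))) (compose (carrier (Ob m)) (aug P) (f 0)) (g m)
      = compose (carrier (Ob (m + n))) (aug P) (mul m n f g 0)"
    using endo_closed[OF cocycle_endo[OF g]] by (auto simp: compose_def fun_eq_iff mul_app)
  then show ?thesis unfolding ecl_def'[of m f] tact_eq[OF T_kG aug_pull[OF f] g] l by (simp add: ecl_def')
qed

lemma tact_assoc:
  assumes M: "kG_module k G M"
    and u: "u \<in> carrier (HM M i)" and a: "a \<in> carrier (H j)" and b: "b \<in> carrier (H l)"
    and ij: "ij = i + j" and jl: "jl = j + l"
  shows "tact M ij l (tact M i j u a) b = tact M i jl u (tact T j l a b)"
proof -
  obtain \<phi> where p: "\<phi> \<in> tate_cocycles k G P M i" "u = tcl M i \<phi>" using u unfolding HM_carrier[OF M] by blast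
  obtain f where f: "f \<in> Z j" "a = ecl j f" using ecl_surj[OF a] by blast
  obtain g where g: "g \<in> Z l" "b = ecl l g" using ecl_surj[OF b] by blast
  have "compose (carrier (Ob (i + (j + l)))) (compose (carrier (Ob (i + j))) \<phi> (f i)) (g (i + j))
      = compose (carrier (Ob (i + (j + l)))) \<phi> (mul j l f g i)"
    using endo_closed[OF cocycle_endo[OF g(1)]] by (auto simp: compose_def fun_eq_iff mul_app add.assoc)
  then show ?thesis
    unfolding p(2) f(2) g(2) ecl_mul[OF f(1) g(1) refl] ij jl tact_eq[OF M p(1) f(1)]
      tact_eq[OF M p(1) cocycle_mul[OF f(1) g(1) refl]] tact_eq[OF M pull_closed[OF M p(1) f(1) refl] g(1)]
    by (simp add: add.assoc)
qed

definition endo_one :: "int \<Rightarrow> 'p \<Rightarrow> 'p" where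
  "endo_one = (\<lambda>j. \<lambda>v\<in>carrier (Ob j). v)"

lemma endo_one_cocycle: "endo_one \<in> Z 0"
proof -
  have e: "endo_one \<in> carrier (E 0)"
    unfolding endo_carrier endo_one_def by (auto intro!: kG_homsI simp: vs_closed act_closed[OF Ob_kG])
  show ?thesis
    unfolding cocycle_iff diff_eq_zero_iff[OF e refl] using e
    by (auto simp: endo_one_def add.commute bd_closed)
qed

lemma ecl_one: "ecl 0 endo_one = tcl T 0 (aug P)"
proof -
  have "compose (carrier (Ob 0)) (aug P) (endo_one 0) = aug P"
    using kG_homs_ext[OF aug_hom] by (auto simp: endo_one_def compose_def fun_eq_iff extensional_def)
  then show ?thesis by (simp add: ecl_def')
qed

lemma tact_one:
  assumes M: "kG_module k G M" and u: "u \<in> carrier (HM M i)"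
  shows "tact M i 0 u (tcl T 0 (aug P)) = u"
proof -
  obtain \<phi> where p: "\<phi> \<in> tate_cocycles k G P M i" "u = tcl M i \<phi>" using u unfolding HM_carrier[OF M] by blast
  have "compose (carrier (Ob i)) \<phi> (endo_one i) = \<phi>"
    using kG_homs_ext[OF tcocycle_hom[OF p(1)]]
      by (auto simp: endo_one_def compose_def fun_eq_iff extensional_def)
  then show ?thesis unfolding p(2) ecl_one[symmetric] tact_eq[OF M p(1) endo_one_cocycle] by simp
qed

lemma one_closed: "tcl T 0 (aug P) \<in> carrier (H 0)"
  by (rule tcl_closed[OF T_kG aug_cocycle])

lemma one_tact: assumes a: "a \<in> carrier (H n)" shows "tact T 0 n (tcl T 0 (aug P)) a = a"
proof -
  obtain f where f: "f \<in> Z n" "a = ecl n f" using ecl_surj[OF a] by blast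
  show ?thesis unfolding f(2) tact_eq[OF T_kG aug_cocycle f(1)] by (simp add: ecl_def')
qed

abbreviation "L \<equiv> tate_algebra k G P"

lemma L_simps: "alg_piece L n = H n" "alg_mult L m n = tact T m n" "alg_one L = tcl T 0 (aug P)"
  by (simp_all add: tate_algebra_def)

lemma H_module [simp]: "module k (H n)"
  by (rule HM_module[OF T_kG])

section \<open>Cokernels of two by two matrices\<close>

context
  fixes p q r s
  assumes pqrs: "p \<in> carrier (H 1)" "q \<in> carrier (H 1)" "r \<in> carrier (H 1)" "s \<in> carrier (H 1)"
begin

text \<open>The index \<open>j\<close> is the degree in the target. In this degree the shifted
  source is \<open>H (j - 1)\<close>, on which the entries, of degree one, act from the
  left.\<close>

definition matrix_map :: "int \<Rightarrow> ('p \<Rightarrow> 'k) set \<times> ('p \<Rightarrow> 'k) set \<Rightarrow> ('p \<Rightarrow> 'k) set \<times> ('p \<Rightarrow> 'k) set" where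
  "matrix_map j = (\<lambda>(u, v). (tact T 1 (j - 1) p u \<oplus>\<^bsub>H j\<^esub> tact T 1 (j - 1) q v,
     tact T 1 (j - 1) r u \<oplus>\<^bsub>H j\<^esub> tact T 1 (j - 1) s v))"

abbreviation "W j \<equiv> sum_module (H j) (H j)"
abbreviation "MI j \<equiv> matrix_map j ` (carrier (H (j - 1)) \<times> carrier (H (j - 1)))"
abbreviation "ccl j w \<equiv> coset (W j) (MI j) w"
abbreviation "C \<equiv> cokernel (graded_sum (shift (-1) (regular_module L)) (shift (-1) (regular_module L)))
  (graded_sum (regular_module L) (regular_module L)) matrix_map"

lemma W_module: "module k (W j)"
  by (rule module_sum) simp_all

lemma W_simps: "carrier (W j) = carrier (H j) \<times> carrier (H j)" "\<zero>\<^bsub>W j\<^esub> = (\<zero>\<^bsub>H j\<^esub>, \<zero>\<^bsub>H j\<^esub>)"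
  "(u, v) \<oplus>\<^bsub>W j\<^esub> (u', v') = (u \<oplus>\<^bsub>H j\<^esub> u', v \<oplus>\<^bsub>H j\<^esub> v')" "c \<odot>\<^bsub>W j\<^esub> (u, v) = (c \<odot>\<^bsub>H j\<^esub> u, c \<odot>\<^bsub>H j\<^esub> v)"
  by (simp_all add: sum_module_def)

lemma tact1_closed: "x \<in> carrier (H 1) \<Longrightarrow> u \<in> carrier (H (j - 1)) \<Longrightarrow> tact T 1 (j - 1) x u \<in> carrier (H j)"
  by (rule tact_closed[OF T_kG]) simp_all

lemma matrix_map_linear: "restrict (matrix_map j) (carrier (W (j - 1))) \<in> linear_maps k (W (j - 1)) (W j)"
  using pqrs tact1_closed
  by (intro linear_mapsI)
    (auto simp: W_simps matrix_map_def vs_closed tact_add_right[OF T_kG, where l = j] tact_smult_right[OF T_kG,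
      where l = j]
      vs_ac vs_smult)

lemma MI_subspace: "subspace (W j) (MI j)"
proof -
  let ?f = "restrict (matrix_map j) (carrier (W (j - 1)))"
  have MI: "MI j = ?f ` carrier (W (j - 1))" by (auto simp: W_simps)
  note r = linear_maps_rules[OF matrix_map_linear]
  show ?thesis
    unfolding subspace_def MI
  proof (intro conjI ballI)
    show "?f ` carrier (W (j - 1)) \<subseteq> carrier (W j)" using r(1) by blast
    show "\<zero>\<^bsub>W j\<^esub> \<in> ?f ` carrier (W (j - 1))"
      using lin_zero[OF matrix_map_linear W_module W_module] zero_closed[OF W_module] by (metis imageI)
    show "u \<oplus>\<^bsub>W j\<^esub> v \<in> ?f ` carrier (W (j - 1))" if "u \<in> ?f ` carrier (W (j - 1))"
      "v \<in> ?f ` carrier (W (j - 1))" for u v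
      using that r(2) add_closed[OF W_module] by (elim imageE) (metis imageI)
    show "c \<odot>\<^bsub>W j\<^esub> v \<in> ?f ` carrier (W (j - 1))" if "c \<in> carrier k" "v \<in> ?f ` carrier (W (j - 1))" for c v
      using that r(3) smult_closed[OF W_module] by (elim imageE) (metis imageI)
  qed
qed

text \<open>Left multiplication by the matrix commutes with the right action, by associativity in
  each entry. This makes the action on the cokernel independent of representatives.\<close>

lemma matrix_map_tact:
  assumes u: "u \<in> carrier (H (i - 1))" "v \<in> carrier (H (i - 1))" and a: "a \<in> carrier (H j)"
  shows "matrix_map (i + j) (tact T (i - 1) j u a, tact T (i - 1) j v a) =
    (case matrix_map i (u, v) of (x, y) \<Rightarrow> (tact T i j x a, tact T i j y a))"
proof -
  have t: "tact T 1 (i + j - 1) x (tact T (i - 1) j w a) = tact T i j (tact T 1 (i - 1) x w) a"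
    if "x \<in> carrier (H 1)" "w \<in> carrier (H (i - 1))" for x w
    using tact_assoc[OF T_kG that a, of i "i + j - 1"] by simp
  show ?thesis
    using pqrs u a tact1_closed by (simp add: matrix_map_def t tact_add_left[OF T_kG, where l = "i + j"])
qed

lemma C_piece: "piece C j = quotient_module (W j) (MI j)"
  by (simp add: cokernel_def graded_sum_def shift_def regular_module_def L_simps sum_module_def)

lemma C_gact:
  assumes u: "u \<in> carrier (H i)" "v \<in> carrier (H i)" and a: "a \<in> carrier (H j)"
  shows "gact C i j (ccl i (u, v)) a = ccl (i + j) (tact T i j u a, tact T i j v a)"
proof -
  have eq: "ccl (i + j) (tact T i j u' a, tact T i j v' a) = ccl (i + j) (tact T i j u a, tact T i j v a)"
    if "(u', v') \<in> ccl i (u, v)" for u' v'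
  proof -
    have w: "u' \<in> carrier (H i)" "v' \<in> carrier (H i)" "(u' \<oplus>\<^bsub>H i\<^esub> u, v' \<oplus>\<^bsub>H i\<^esub> v) \<in> MI i"
      using that mem_coset[OF W_module MI_subspace, of "(u, v)" i "(u', v')"] u by (simp_all add: W_simps)
    obtain x y where xy: "x \<in> carrier (H (i - 1))" "y \<in> carrier (H (i - 1))"
      "(u' \<oplus>\<^bsub>H i\<^esub> u, v' \<oplus>\<^bsub>H i\<^esub> v) = matrix_map i (x, y)"
      using w(3) by blast
    have "matrix_map (i + j) (tact T (i - 1) j x a, tact T (i - 1) j y a) =
        (tact T i j u' a \<oplus>\<^bsub>H (i + j)\<^esub> tact T i j u a, tact T i j v' a \<oplus>\<^bsub>H (i + j)\<^esub> tact T i j v a)"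
      unfolding matrix_map_tact[OF xy(1,2) a] xy(3)[symmetric]
      using w u a by (simp add: tact_add_left[OF T_kG, where l = "i + j"])
    moreover have "tact T (i - 1) j x a \<in> carrier (H (i + j - 1))" "tact T (i - 1) j y a \<in>
        carrier (H (i + j - 1))"
      using xy a by (auto intro!: tact_closed[OF T_kG])
    ultimately have "(tact T i j u' a \<oplus>\<^bsub>H (i + j)\<^esub> tact T i j u a, tact T i j v' a \<oplus>\<^bsub>H (i + j)\<^esub> tact T i j v a)
        \<in> MI (i + j)"
      by (metis (no_types, lifting) SigmaI image_eqI)
    then show ?thesis
      using coset_eq[OF W_module MI_subspace, of "(tact T i j u' a, tact T i j v' a)" "i + j" "(tact T i j u a,
          tact T i j v a)"]
        w u a by (simp add: W_simps tact_closed[OF T_kG])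
  qed
  have self: "(u, v) \<in> ccl i (u, v)" using u by (intro coset_self[OF W_module MI_subspace]) (simp add: W_simps)
  have "gact C i j (ccl i (u, v)) a = (\<Union>w\<in>ccl i (u, v). ccl (i + j) (tact T i j (fst w) a,
      tact T i j (snd w) a))"
    by (auto simp: cokernel_def graded_sum_def shift_def regular_module_def L_simps coset_def case_prod_beta
      sum_module_def
        algebra_simps)
  also have "\<dots> = ccl (i + j) (tact T i j u a, tact T i j v a)"
  proof -
    have "ccl (i + j) (tact T i j (fst w) a, tact T i j (snd w) a) =
        ccl (i + j) (tact T i j u a, tact T i j v a)"
      if "w \<in> ccl i (u, v)" for w
      using eq[of "fst w" "snd w"] that by simp
    then have "(\<Union>w\<in>ccl i (u, v). ccl (i + j) (tact T i j (fst w) a, tact T i j (snd w) a))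
        = (\<Union>w\<in>ccl i (u, v). ccl (i + j) (tact T i j u a, tact T i j v a))" by (rule SUP_cong[OF refl])
    then show ?thesis using self by blast
  qed
  finally show ?thesis .
qed

lemma C_carrier: "carrier (piece C j) = (\<lambda>w. ccl j w) ` (carrier (H j) \<times> carrier (H j))"
  unfolding C_piece quotient_carrier[OF W_module MI_subspace] by (simp add: W_simps)

lemma C_add: "u \<in> carrier (H j) \<Longrightarrow> v \<in> carrier (H j) \<Longrightarrow> u' \<in> carrier (H j) \<Longrightarrow> v' \<in> carrier (H j) \<Longrightarrow>
    ccl j (u, v) \<oplus>\<^bsub>piece C j\<^esub> ccl j (u', v') = ccl j (u \<oplus>\<^bsub>H j\<^esub> u', v \<oplus>\<^bsub>H j\<^esub> v')"
  unfolding C_piece using quotient_add[OF W_module MI_subspace, of "(u, v)" j "(u', v')"] by (simp add: W_simps)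

lemma C_smult: "c \<in> carrier k \<Longrightarrow> u \<in> carrier (H j) \<Longrightarrow> v \<in> carrier (H j) \<Longrightarrow>
    c \<odot>\<^bsub>piece C j\<^esub> ccl j (u, v) = ccl j (c \<odot>\<^bsub>H j\<^esub> u, c \<odot>\<^bsub>H j\<^esub> v)"
  unfolding C_piece using quotient_smult[OF W_module MI_subspace, of c "(u, v)" j] by (simp add: W_simps)

lemma C_eq: "u \<in> carrier (H j) \<Longrightarrow> v \<in> carrier (H j) \<Longrightarrow> u' \<in> carrier (H j) \<Longrightarrow> v' \<in> carrier (H j) \<Longrightarrow>
    ccl j (u, v) = ccl j (u', v') \<longleftrightarrow> (u \<oplus>\<^bsub>H j\<^esub> u', v \<oplus>\<^bsub>H j\<^esub> v') \<in> MI j"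
  using coset_eq[OF W_module MI_subspace, of "(u, v)" j "(u', v')"] by (simp add: W_simps)

lemma C_module: "module k (piece C j)"
  unfolding C_piece by (rule module_quotient[OF W_module MI_subspace])

lemma C_closed: "u \<in> carrier (H j) \<Longrightarrow> v \<in> carrier (H j) \<Longrightarrow> ccl j (u, v) \<in> carrier (piece C j)"
  unfolding C_carrier by blast

lemma C_cases:
  assumes "w \<in> carrier (piece C j)"
  obtains u v where "u \<in> carrier (H j)" "v \<in> carrier (H j)" "w = ccl j (u, v)"
  using assms unfolding C_carrier by blast

lemma C_graded: "graded_module k L C"
proof -
  note tc = tact_closed[OF T_kG]
  have 1: "(\<lambda>u\<in>carrier (piece C i). gact C i j u a) \<in> linear_maps k (piece C i) (piece C (i + j))"
    if a: "a \<in> carrier (H j)" for i j a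
  proof (rule linear_mapsI)
    fix w assume w: "w \<in> carrier (piece C i)"
    then obtain u v where uv: "u \<in> carrier (H i)" "v \<in> carrier (H i)" "w = ccl i (u, v)" by (rule C_cases)
    show "(\<lambda>u\<in>carrier (piece C i). gact C i j u a) w \<in> carrier (piece C (i + j))"
      using w unfolding uv(3) using uv(1,2) a by (simp add: C_gact C_closed tc)
    { fix c assume c: "c \<in> carrier k"
      show "(\<lambda>u\<in>carrier (piece C i). gact C i j u a) (c \<odot>\<^bsub>piece C i\<^esub> w) =
          c \<odot>\<^bsub>piece C (i + j)\<^esub> (\<lambda>u\<in>carrier (piece C i). gact C i j u a) w"
        using uv(1,2) a c unfolding uv(3)
        by (simp add: C_gact C_closed tc C_smult smult_closed tact_smult_left[OF T_kG, where l = "i + j"]) }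
    fix w' assume w': "w' \<in> carrier (piece C i)"
    then obtain u' v' where uv': "u' \<in> carrier (H i)" "v' \<in> carrier (H i)" "w' = ccl i (u', v')"
      by (rule C_cases)
    show "(\<lambda>u\<in>carrier (piece C i). gact C i j u a) (w \<oplus>\<^bsub>piece C i\<^esub> w') =
      (\<lambda>u\<in>carrier (piece C i). gact C i j u a) w \<oplus>\<^bsub>piece C (i + j)\<^esub> (\<lambda>u\<in>carrier (piece C i). gact C i j u a) w'"
      using uv(1,2) uv'(1,2) a unfolding uv(3) uv'(3)
      by (simp add: C_gact C_closed tc C_add add_closed tact_add_left[OF T_kG, where l = "i + j"])
  qed simp
  have 2: "(\<lambda>a\<in>carrier (H j). gact C i j w a) \<in> linear_maps k (H j) (piece C (i + j))"
    if w: "w \<in> carrier (piece C i)" for i j w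
  proof -
    obtain u v where uv: "u \<in> carrier (H i)" "v \<in> carrier (H i)" "w = ccl i (u, v)" using w by (rule C_cases)
    show ?thesis
      using uv(1,2) unfolding uv(3)
      by (intro linear_mapsI)
        (simp_all add: C_gact C_closed tc C_add C_smult vs_closed tact_add_right[OF T_kG, where l = "i + j"]
          tact_smult_right[OF T_kG, where l = "i + j"])
  qed
  have 3: "gact C (i + j) l (gact C i j w a) b = gact C i (j + l) w (tact T j l a b)"
    if w: "w \<in> carrier (piece C i)" and a: "a \<in> carrier (H j)" and b: "b \<in> carrier (H l)" for i j l w a b
  proof -
    obtain u v where uv: "u \<in> carrier (H i)" "v \<in> carrier (H i)" "w = ccl i (u, v)" using w by (rule C_cases)
    show ?thesis
      using uv(1,2) a b unfolding uv(3)
      by (simp add: C_gact tc tact_assoc[OF T_kG, where jl = "j + l"] add.assoc)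
  qed
  have 4: "gact C i 0 w (tcl T 0 (aug P)) = w" if w: "w \<in> carrier (piece C i)" for i w
  proof -
    obtain u v where uv: "u \<in> carrier (H i)" "v \<in> carrier (H i)" "w = ccl i (u, v)" using w by (rule C_cases)
    show ?thesis using uv(1,2) unfolding uv(3) by (simp add: C_gact one_closed tact_one)
  qed
  show ?thesis
    unfolding graded_module_def L_simps using C_module 1 2 3 4 by blast
qed

end

text \<open>\<open>f1\<close> is a linear section of the map from cocycles to classes.
  \<open>f2\<close> is a linear section of the differential onto its image, composed with the
  bilinear defect \<open>D\<close> of multiplicativity; this order of composition makes
  \<open>f2\<close> bilinear.\<close>

lemma canonical_choice_exists: "\<exists>f1 f2. canonical_choice k G P f1 f2"
proof -
  have mE: "module k (E n)" for n by (rule module_endo)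
  have Zs: "subspace (E n) (Z n)" for n
    unfolding subspace_def using cocycle_endo cocycle_zero cocycle_add cocycle_smult by blast
  have mZ: "module k ((E n)\<lparr>carrier := Z n\<rparr>)" for n by (rule module_subspace[OF mE Zs])
  have "\<exists>h\<in>linear_maps k (H i) ((E i)\<lparr>carrier := Z i\<rparr>). \<forall>a\<in>carrier (H i). restrict (ecl i) (Z i) (h a) =
      (\<lambda>a\<in>carrier (H i). a) a" for i
  proof (rule linear_lift[OF H_module mZ H_module])
    show "(\<lambda>a\<in>carrier (H i). a) \<in> linear_maps k (H i) (H i)" by (rule linear_mapsI) (simp_all add: vs_closed)
    show "restrict (ecl i) (Z i) \<in> linear_maps k ((E i)\<lparr>carrier := Z i\<rparr>) (H i)"
      by (rule linear_mapsI) (simp_all add: ecl_closed ecl_add ecl_smult cocycle_add cocycle_smult)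
    show "\<exists>l\<in>carrier ((E i)\<lparr>carrier := Z i\<rparr>). restrict (ecl i) (Z i) l = (\<lambda>a\<in>carrier (H i). a) a"
      if "a \<in> carrier (H i)" for a
      using ecl_surj[OF that] that by (auto intro!: bexI)
  qed
  then obtain f1 where f1: "\<And>i. f1 i \<in> linear_maps k (H i) ((E i)\<lparr>carrier := Z i\<rparr>)"
    "\<And>i a. a \<in> carrier (H i) \<Longrightarrow> restrict (ecl i) (Z i) (f1 i a) = (\<lambda>a\<in>carrier (H i). a) a" by metis
  have f1Z: "f1 i a \<in> Z i" and f1cl: "ecl i (f1 i a) = a" if "a \<in> carrier (H i)" for i a
    using linear_maps_closed[OF f1(1) that] f1(2)[OF that] that by simp_all
  have f1lin: "f1 i \<in> linear_maps k (H i) (E i)" for i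
    using linear_maps_rules[OF f1(1)[of i]] linear_maps_ext[OF f1(1)[of i]] cocycle_endo
      by (intro linear_mapsI) simp_all
  note f1r = linear_maps_rules[OF f1lin]
  define Bd where "Bd n = dd (n - 1) ` carrier (E (n - 1))" for n
  have dE: "dd (n - 1) h \<in> carrier (E n)" if "h \<in> carrier (E (n - 1))" for h n
    by (rule diff_closed[OF that]) simp
  have dadd: "dd (n - 1) (f \<oplus>\<^bsub>E (n - 1)\<^esub> h) = dd (n - 1) f \<oplus>\<^bsub>E n\<^esub> dd (n - 1) h"
    if "f \<in> carrier (E (n - 1))" "h \<in> carrier (E (n - 1))" for f h n by (rule diff_add[OF that]) simp
  have dsm: "dd (n - 1) (c \<odot>\<^bsub>E (n - 1)\<^esub> f) = c \<odot>\<^bsub>E n\<^esub> dd (n - 1) f"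
    if "f \<in> carrier (E (n - 1))" "c \<in> carrier k" for f c n by (rule diff_smult[OF that]) simp
  have Bds: "subspace (E n) (Bd n)" for n
    unfolding subspace_def
  proof (intro conjI ballI)
    show "Bd n \<subseteq> carrier (E n)" using dE unfolding Bd_def by blast
    have "dd (n - 1) \<zero>\<^bsub>E (n - 1)\<^esub> = \<zero>\<^bsub>E n\<^esub>" using cocycle_zero[of "n - 1"] by (simp add: cocycle_iff)
    then show "\<zero>\<^bsub>E n\<^esub> \<in> Bd n" unfolding Bd_def using zero_closed[OF mE] by (metis imageI)
    show "u \<oplus>\<^bsub>E n\<^esub> v \<in> Bd n" if "u \<in> Bd n" "v \<in> Bd n" for u v
      using that dadd add_closed[OF mE] unfolding Bd_def by (elim imageE) (metis imageI)
    show "c \<odot>\<^bsub>E n\<^esub> v \<in> Bd n" if "c \<in> carrier k" "v \<in> Bd n" for c v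
      using that dsm smult_closed[OF mE] unfolding Bd_def by (elim imageE) (metis imageI)
  qed
  have mB: "module k ((E n)\<lparr>carrier := Bd n\<rparr>)" for n by (rule module_subspace[OF mE Bds])
  have BdE: "b \<in> carrier (E n)" if "b \<in> Bd n" for b n using that Bds unfolding subspace_def by blast
  \<comment> \<open>A linear section of the differential onto the boundaries.\<close>
  have sec: "\<exists>s\<in>linear_maps k ((E n)\<lparr>carrier := Bd n\<rparr>) (E (n - 1)). \<forall>b\<in>carrier ((E n)\<lparr>carrier := Bd n\<rparr>).
      restrict (dd (n - 1)) (carrier (E (n - 1))) (s b) = (\<lambda>b\<in>Bd n. b) b" for n
  proof (rule linear_lift[OF mB mE mE])
    show "(\<lambda>b\<in>Bd n. b) \<in> linear_maps k ((E n)\<lparr>carrier := Bd n\<rparr>) (E n)"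
      using Bds[of n] unfolding subspace_def by (intro linear_mapsI) auto
    show "restrict (dd (n - 1)) (carrier (E (n - 1))) \<in> linear_maps k (E (n - 1)) (E n)"
      by (rule linear_mapsI) (simp_all add: dE dadd dsm vs_closed mE)
    show "\<exists>l\<in>carrier (E (n - 1)). restrict (dd (n - 1)) (carrier (E (n - 1))) l = (\<lambda>b\<in>Bd n. b) b"
      if "b \<in> carrier ((E n)\<lparr>carrier := Bd n\<rparr>)" for b
      using that by (auto simp: Bd_def)
  qed
  have "\<exists>s. s \<in> linear_maps k ((E n)\<lparr>carrier := Bd n\<rparr>) (E (n - 1)) \<and> (\<forall>b\<in>Bd n. dd (n - 1) (s b) = b)" for n
  proof -
    obtain s where s: "s \<in> linear_maps k ((E n)\<lparr>carrier := Bd n\<rparr>) (E (n - 1))"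
      "\<And>b. b \<in> Bd n \<Longrightarrow> restrict (dd (n - 1)) (carrier (E (n - 1))) (s b) = b"
      using sec[of n] by auto
    have "dd (n - 1) (s b) = b" if "b \<in> Bd n" for b
      using s(2)[OF that] linear_maps_closed[OF s(1), of b] that by simp
    then show ?thesis using s(1) by blast
  qed
  then have "\<exists>s. \<forall>n. s n \<in> linear_maps k ((E n)\<lparr>carrier := Bd n\<rparr>) (E (n - 1)) \<and>
      (\<forall>b\<in>Bd n. dd (n - 1) (s n b) = b)"
    by (intro choice) blast
  then obtain s where s: "\<And>n. s n \<in> linear_maps k ((E n)\<lparr>carrier := Bd n\<rparr>) (E (n - 1))"
    "\<And>n b. b \<in> Bd n \<Longrightarrow> dd (n - 1) (s n b) = b" by blast
  have sE: "s n b \<in> carrier (E (n - 1))" and sd: "dd (n - 1) (s n b) = b" if "b \<in> Bd n" for n b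
    using linear_maps_closed[OF s(1)[of n], of b] s(2)[OF that] that by simp_all
  have sadd: "s n (b \<oplus>\<^bsub>E n\<^esub> b') = s n b \<oplus>\<^bsub>E (n - 1)\<^esub> s n b'" if "b \<in> Bd n" "b' \<in> Bd n" for n b b'
    using linear_maps_add[OF s(1)[of n], of b b'] that by simp
  have ssm: "s n (c \<odot>\<^bsub>E n\<^esub> b) = c \<odot>\<^bsub>E (n - 1)\<^esub> s n b" if "b \<in> Bd n" "c \<in> carrier k" for n b c
    using linear_maps_smult[OF s(1)[of n], of c b] that by simp
  \<comment> \<open>The failure of \<open>f1\<close> to be multiplicative. It is a boundary, because
    both summands are cocycles representing the product of \<open>a\<close> and
    \<open>b\<close>.\<close>
  define D where "D i j a b = f1 (i + j) (tact T i j a b) \<oplus>\<^bsub>E (i + j)\<^esub> mul i j (f1 i a) (f1 j b)" for i j a b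
  have DB: "D i j a b \<in> Bd (i + j)" if a: "a \<in> carrier (H i)" and b: "b \<in> carrier (H j)" for i j a b
  proof -
    have ab: "tact T i j a b \<in> carrier (H (i + j))" by (rule tact_closed[OF T_kG a b refl])
    have m: "mul i j (f1 i a) (f1 j b) \<in> Z (i + j)" by (rule cocycle_mul[OF f1Z[OF a] f1Z[OF b] refl])
    have "ecl (i + j) (f1 (i + j) (tact T i j a b)) = ecl (i + j) (mul i j (f1 i a) (f1 j b))"
      unfolding f1cl[OF ab] using ecl_mul[OF f1Z[OF a] f1Z[OF b] refl] unfolding f1cl[OF a] f1cl[OF b] .
    then show ?thesis using ecl_eq[OF f1Z[OF ab] m] unfolding D_def Bd_def by (metis imageI)
  qed
  have Dl: "D i j (a \<oplus>\<^bsub>H i\<^esub> a') b = D i j a b \<oplus>\<^bsub>E (i + j)\<^esub> D i j a' b" "D i j (c \<odot>\<^bsub>H i\<^esub> a) b =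
      c \<odot>\<^bsub>E (i + j)\<^esub> D i j a b"
    "D i j a (b \<oplus>\<^bsub>H j\<^esub> b') = D i j a b \<oplus>\<^bsub>E (i + j)\<^esub> D i j a b'" "D i j a (c \<odot>\<^bsub>H j\<^esub> b) =
        c \<odot>\<^bsub>E (i + j)\<^esub> D i j a b"
    if h: "a \<in> carrier (H i)" "a' \<in> carrier (H i)" "b \<in> carrier (H j)" "b' \<in> carrier (H j)" "c \<in> carrier k"
      for i j a a' b b' c
  proof -
    note t = tact_closed[OF T_kG _ _ refl] mul_closed[OF _ _ refl]
      tact_add_left[OF T_kG _ _ _ refl] tact_add_right[OF T_kG _ _ _ refl] tact_smult_left[OF T_kG _ _ _ refl]
        tact_smult_right[OF T_kG _ _ _ refl]
      mul_add_left[OF _ _ _ refl] mul_add_right[OF _ _ _ refl] mul_smult_left[OF _ _ _ refl]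
        mul_smult_right[OF _ _ _ refl]
    show "D i j (a \<oplus>\<^bsub>H i\<^esub> a') b = D i j a b \<oplus>\<^bsub>E (i + j)\<^esub> D i j a' b" using h by (simp add: D_def t f1r vs_ac mE)
    show "D i j a (b \<oplus>\<^bsub>H j\<^esub> b') = D i j a b \<oplus>\<^bsub>E (i + j)\<^esub> D i j a b'" using h by (simp add: D_def t f1r vs_ac mE)
    show "D i j (c \<odot>\<^bsub>H i\<^esub> a) b = c \<odot>\<^bsub>E (i + j)\<^esub> D i j a b" using h by (simp add: D_def t f1r smult_radd mE)
    show "D i j a (c \<odot>\<^bsub>H j\<^esub> b) = c \<odot>\<^bsub>E (i + j)\<^esub> D i j a b" using h by (simp add: D_def t f1r smult_radd mE)
  qed
  define f2 where "f2 i j a = (\<lambda>b\<in>carrier (H j). s (i + j) (D i j a b))" for i j a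
  have "canonical_choice k G P f1 f2"
    unfolding canonical_choice_def Let_def L_simps
  proof (intro conjI allI ballI)
    fix i j
    show "f1 i \<in> linear_maps k (H i) (E i)" by (rule f1lin)
    fix a assume a: "a \<in> carrier (H i)"
    show "f1 i a \<in> Z i" "ecl i (f1 i a) = a" using f1Z f1cl a by auto
    show "f2 i j a \<in> linear_maps k (H j) (E (i + j - 1))"
      using a unfolding f2_def
      by (intro linear_mapsI) (simp_all add: sE DB Dl(3)[OF a a _ _ K.zero_closed]
        Dl(4)[OF a a _ zero_closed[OF H_module]] sadd ssm vs_closed)
    fix b assume b: "b \<in> carrier (H j)"
    have "f1 (i + j) (tact T i j a b) \<ominus>\<^bsub>E (i + j)\<^esub> mul i j (f1 i a) (f1 j b) = D i j a b"
      unfolding D_def using f1r a b by (intro vs_minus[OF mE] mul_closed) auto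
    then show "dd (i + j - 1) (f2 i j a b) = f1 (i + j) (tact T i j a b) \<ominus>\<^bsub>E (i + j)\<^esub> mul i j (f1 i a) (f1 j b)"
      using sd[OF DB[OF a b]] b by (simp add: f2_def)
  next
    fix i j b assume b: "b \<in> carrier (H j)"
    show "(\<lambda>a\<in>carrier (H i). f2 i j a b) \<in> linear_maps k (H i) (E (i + j - 1))"
      using b unfolding f2_def
      by (intro linear_mapsI) (simp_all add: sE DB Dl(1)[OF _ _ b b K.zero_closed]
        Dl(2)[OF _ zero_closed[OF H_module] b b] sadd ssm vs_closed)
  qed
  then show ?thesis by blast
qed

end

section \<open>The canonical class\<close>

text \<open>Multilinearity of a cochain is stated at an arbitrary splitting of a list; for lists of
  length three this means one of three slots.\<close>

lemma hoch_dom_split: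
  assumes "us @ (i, a) # vs \<in> hoch_dom A 3"
  shows "(\<exists>s b t c. us = [] \<and> vs = [(s, b), (t, c)]) \<or> (\<exists>r b t c. us = [(r, b)] \<and> vs = [(t, c)])
    \<or> (\<exists>r b s c. us = [(r, b), (s, c)] \<and> vs = [])"
proof -
  have len: "length us + length vs = 2" using assms by (simp add: hoch_dom_def)
  show ?thesis
  proof (cases us)
    case Nil
    then have "length vs = Suc (Suc 0)" using len by simp
    then show ?thesis using Nil by (auto simp: length_Suc_conv)
  next
    case (Cons x us')
    show ?thesis
    proof (cases us')
      case Nil
      then have "length vs = Suc 0" using len Cons by simp
      then show ?thesis using Nil Cons by (cases x) (auto simp: length_Suc_conv)
    next
      case (Cons y us'')
      then have "us'' = []" "vs = []" using len \<open>us = x # us'\<close> by auto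
      then show ?thesis using Cons \<open>us = x # us'\<close> by (cases x; cases y) auto
    qed
  qed
qed

lemma hoch_dom_4:
  assumes "xs \<in> hoch_dom A 4"
  obtains r a s b t c u e where "xs = [(r, a), (s, b), (t, c), (u, e)]" "a \<in> carrier (alg_piece A r)"
    "b \<in> carrier (alg_piece A s)" "c \<in> carrier (alg_piece A t)" "e \<in> carrier (alg_piece A u)"
proof -
  have "length xs = Suc (Suc (Suc (Suc 0)))" using assms by (simp add: hoch_dom_def)
  then obtain w x y z where "xs = [w, x, y, z]" by (auto simp: length_Suc_conv)
  then show thesis using that assms by (cases w; cases x; cases y; cases z) (auto simp: hoch_dom_def)
qed

section \<open>Hochschild coboundaries on lists of homogeneous elements\<close>

context tate
begin

lemma tact_zero_left: "a \<in> carrier (H n) \<Longrightarrow> l = m + n \<Longrightarrow> tact T m n \<zero>\<^bsub>H m\<^esub> a = \<zero>\<^bsub>H l\<^esub>"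
  using tact_add_left[OF T_kG zero_closed[OF H_module] zero_closed[OF H_module], of a n l m]
    tact_closed[OF T_kG zero_closed[OF H_module], of a n l m]
  by (simp add: vs_self zero_closed)

lemma tact_zero_right: "a \<in> carrier (H m) \<Longrightarrow> l = m + n \<Longrightarrow> tact T m n a \<zero>\<^bsub>H n\<^esub> = \<zero>\<^bsub>H l\<^esub>"
  using tact_add_right[OF T_kG _ zero_closed[OF H_module] zero_closed[OF H_module], of a m l n]
    tact_closed[OF T_kG _ zero_closed[OF H_module], of a m l n]
  by (simp add: vs_self zero_closed)

lemma finsum_2:
  assumes "module k V" "g 1 \<in> carrier V" "g 2 \<in> carrier V"
  shows "finsum V g {1..2::nat} = g 1 \<oplus>\<^bsub>V\<^esub> g 2"
proof -
  interpret V: module k V by fact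
  have e: "{1..2::nat} = {1, 2}" by auto
  show ?thesis unfolding e using assms(2,3) by (simp add: Pi_def)
qed

lemma finsum_3:
  assumes "module k V" "g 1 \<in> carrier V" "g 2 \<in> carrier V" "g 3 \<in> carrier V"
  shows "finsum V g {1..3::nat} = g 1 \<oplus>\<^bsub>V\<^esub> (g 2 \<oplus>\<^bsub>V\<^esub> g 3)"
proof -
  interpret V: module k V by fact
  have e: "{1..3::nat} = {1, 2, 3}" by auto
  show ?thesis unfolding e using assms(2-4) by (simp add: Pi_def)
qed

lemma hoch_closed:
  assumes "\<phi> \<in> hoch_cochains k L n m" "xs \<in> hoch_dom L n" "l = total_degree xs + m"
  shows "\<phi> xs \<in> carrier (H l)"
  using assms unfolding hoch_cochains_def L_simps by blast

text \<open>The four terms arise in degrees given by different integer expressions; the variable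
  \<open>N\<close> places them in one module, where the sum can be reordered.\<close>

lemma hoch_diff_2:
  assumes \<phi>: "\<phi> \<in> hoch_cochains k L 2 m"
    and a: "a \<in> carrier (H r)" and b: "b \<in> carrier (H s)" and c: "c \<in> carrier (H t)" and N: "N = r + s + t + m"
  shows "hoch_diff L 2 m \<phi> [(r, a), (s, b), (t, c)] =
    tact T r (s + t + m) a (\<phi> [(s, b), (t, c)]) \<oplus>\<^bsub>H N\<^esub> (\<phi> [(r + s, tact T r s a b), (t, c)] \<oplus>\<^bsub>H N\<^esub>
      (\<phi> [(r, a), (s + t, tact T s t b c)] \<oplus>\<^bsub>H N\<^esub> tact T (r + s + m) t (\<phi> [(r, a), (s, b)]) c))"
proof -
  note tc = tact_closed[OF T_kG]
  have N': "total_degree [(r, a), (s, b), (t, c)] + m = N" by (simp add: total_degree_def N)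
  have 1: "\<phi> [(s, b), (t, c)] \<in> carrier (H (s + t + m))" "\<phi> [(r, a), (s, b)] \<in> carrier (H (r + s + m))"
    using a b c by (auto intro!: hoch_closed[OF \<phi>] simp: hoch_dom_def total_degree_def L_simps)
  have 2: "\<phi> [(r + s, tact T r s a b), (t, c)] \<in> carrier (H N)" "\<phi> [(r, a), (s + t, tact T s t b c)] \<in>
      carrier (H N)"
    using a b c tc by (auto intro!: hoch_closed[OF \<phi>] simp: hoch_dom_def total_degree_def L_simps N)
  have 3: "tact T r (s + t + m) a (\<phi> [(s, b), (t, c)]) \<in> carrier (H N)"
    "tact T (r + s + m) t (\<phi> [(r, a), (s, b)]) c \<in> carrier (H N)"
    using 1 a c by (auto intro!: tc simp: N)
  let ?g = "\<lambda>i. sign_smult (H N) (int i) (\<phi> (merge_at L i [(r, a), (s, b), (t, c)]))"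
  have m: "merge_at L 1 [(r, a), (s, b), (t, c)] = [(r + s, tact T r s a b), (t, c)]"
    "merge_at L 2 [(r, a), (s, b), (t, c)] = [(r, a), (s + t, tact T s t b c)]"
    by (simp_all add: merge_at_def L_simps)
  have g: "?g 1 = \<phi> [(r + s, tact T r s a b), (t, c)]" "?g 2 = \<phi> [(r, a), (s + t, tact T s t b c)]"
    unfolding m using 2 by (simp_all add: vs_sign[OF H_module])
  have S: "finsum (H N) ?g {1..2} = ?g 1 \<oplus>\<^bsub>H N\<^esub> ?g 2"
    by (rule finsum_2[OF H_module]) (use g 2 in auto)
  have dom: "[(r, a), (s, b), (t, c)] \<in> hoch_dom L (2 + 1)" using a b c by (simp add: hoch_dom_def L_simps)
  have "hoch_diff L 2 m \<phi> [(r, a), (s, b), (t, c)] =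
    sign_smult (H N) (m * r) (tact T r (s + t + m) a (\<phi> [(s, b), (t, c)])) \<oplus>\<^bsub>H N\<^esub> finsum (H N) ?g {1..2} \<oplus>\<^bsub>H N\<^esub>
      sign_smult (H N) 3 (tact T (r + s + m) t (\<phi> [(r, a), (s, b)]) c)"
    unfolding hoch_diff_def restrict_apply'[OF dom] Let_def L_simps N'
    by (simp add: total_degree_def)
  then show ?thesis unfolding S g using 2 3 by (simp add: vs_sign[OF H_module] vs_ac)
qed

lemma hoch_diff_3:
  assumes \<phi>: "\<phi> \<in> hoch_cochains k L 3 m"
    and a: "a \<in> carrier (H r)" and b: "b \<in> carrier (H s)" and c: "c \<in> carrier (H t)" and e: "e \<in> carrier (H u)"
    and N: "N = r + s + t + u + m"
  shows "hoch_diff L 3 m \<phi> [(r, a), (s, b), (t, c), (u, e)] =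
    tact T r (s + t + u + m) a (\<phi> [(s, b), (t, c), (u, e)]) \<oplus>\<^bsub>H N\<^esub> (\<phi> [(r + s, tact T r s a b), (t, c), (u, e)]
      \<oplus>\<^bsub>H N\<^esub>
      (\<phi> [(r, a), (s + t, tact T s t b c), (u, e)] \<oplus>\<^bsub>H N\<^esub> (\<phi> [(r, a), (s, b), (t + u, tact T t u c e)] \<oplus>\<^bsub>H N\<^esub>
        tact T (r + s + t + m) u (\<phi> [(r, a), (s, b), (t, c)]) e)))"
proof -
  note tc = tact_closed[OF T_kG]
  let ?xs = "[(r, a), (s, b), (t, c), (u, e)]"
  have N': "total_degree ?xs + m = N" by (simp add: total_degree_def N)
  have 1: "\<phi> [(s, b), (t, c), (u, e)] \<in> carrier (H (s + t + u + m))" "\<phi> [(r, a), (s, b), (t, c)] \<in>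
      carrier (H (r + s + t + m))"
    using a b c e by (auto intro!: hoch_closed[OF \<phi>] simp: hoch_dom_def total_degree_def L_simps)
  have 2: "\<phi> [(r + s, tact T r s a b), (t, c), (u, e)] \<in> carrier (H N)"
    "\<phi> [(r, a), (s + t, tact T s t b c), (u, e)] \<in> carrier (H N)"
    "\<phi> [(r, a), (s, b), (t + u, tact T t u c e)] \<in> carrier (H N)"
    using a b c e tc by (auto intro!: hoch_closed[OF \<phi>] simp: hoch_dom_def total_degree_def L_simps N)
  have 3: "tact T r (s + t + u + m) a (\<phi> [(s, b), (t, c), (u, e)]) \<in> carrier (H N)"
    "tact T (r + s + t + m) u (\<phi> [(r, a), (s, b), (t, c)]) e \<in> carrier (H N)"
    using 1 a e by (auto intro!: tc simp: N)
  let ?g = "\<lambda>i. sign_smult (H N) (int i) (\<phi> (merge_at L i ?xs))"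
  have m: "merge_at L 1 ?xs = [(r + s, tact T r s a b), (t, c), (u, e)]"
    "merge_at L 2 ?xs = [(r, a), (s + t, tact T s t b c), (u, e)]"
    "merge_at L 3 ?xs = [(r, a), (s, b), (t + u, tact T t u c e)]"
    by (simp_all add: merge_at_def L_simps)
  have g: "?g 1 = \<phi> [(r + s, tact T r s a b), (t, c), (u, e)]" "?g 2 =
      \<phi> [(r, a), (s + t, tact T s t b c), (u, e)]"
    "?g 3 = \<phi> [(r, a), (s, b), (t + u, tact T t u c e)]"
    unfolding m using 2 by (simp_all add: vs_sign[OF H_module])
  have S: "finsum (H N) ?g {1..3} = ?g 1 \<oplus>\<^bsub>H N\<^esub> (?g 2 \<oplus>\<^bsub>H N\<^esub> ?g 3)"
    by (rule finsum_3[OF H_module]) (use g 2 in auto)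
  have dom: "?xs \<in> hoch_dom L (3 + 1)" using a b c e by (simp add: hoch_dom_def L_simps)
  have "hoch_diff L 3 m \<phi> ?xs =
    sign_smult (H N) (m * r) (tact T r (s + t + u + m) a (\<phi> [(s, b), (t, c), (u, e)])) \<oplus>\<^bsub>H N\<^esub> finsum (H N) ?g
      {1..3} \<oplus>\<^bsub>H N\<^esub>
      sign_smult (H N) 4 (tact T (r + s + t + m) u (\<phi> [(r, a), (s, b), (t, c)]) e)"
    unfolding hoch_diff_def restrict_apply'[OF dom] Let_def L_simps N'
    by (simp add: total_degree_def add.assoc)
  then show ?thesis unfolding S g using 2 3 by (simp add: vs_sign[OF H_module] vs_ac)
qed

section \<open>The representing cocycles of the canonical class\<close>

context
  fixes f1 f2
  assumes choice: "canonical_choice k G P f1 f2"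
begin

lemma f1_linear: "f1 i \<in> linear_maps k (H i) (E i)"
  and f1_cocycle: "a \<in> carrier (H i) \<Longrightarrow> f1 i a \<in> Z i"
  and f1_class: "a \<in> carrier (H i) \<Longrightarrow> ecl i (f1 i a) = a"
  using choice unfolding canonical_choice_def Let_def L_simps by blast+

lemma f2_linear_right: "a \<in> carrier (H i) \<Longrightarrow> f2 i j a \<in> linear_maps k (H j) (E (i + j - 1))"
  using choice unfolding canonical_choice_def Let_def L_simps by blast

lemma f2_linear_left: "b \<in> carrier (H j) \<Longrightarrow> (\<lambda>a\<in>carrier (H i). f2 i j a b) \<in> linear_maps k (H i) (E (i + j - 1))"
  using choice unfolding canonical_choice_def Let_def L_simps by blast

lemmas f1_closed = linear_maps_closed[OF f1_linear]

lemma f2_closed: "a \<in> carrier (H i) \<Longrightarrow> b \<in> carrier (H j) \<Longrightarrow> n = i + j - 1 \<Longrightarrow> f2 i j a b \<in> carrier (E n)"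
  using linear_maps_closed[OF f2_linear_right] by blast

lemma f2_diff:
  assumes a: "a \<in> carrier (H i)" and b: "b \<in> carrier (H j)" and n: "n = i + j - 1" "l = i + j"
  shows "dd n (f2 i j a b) = f1 l (tact T i j a b) \<oplus>\<^bsub>E l\<^esub> mul i j (f1 i a) (f1 j b)"
proof -
  have "dd n (f2 i j a b) = f1 l (tact T i j a b) \<ominus>\<^bsub>E l\<^esub> mul i j (f1 i a) (f1 j b)"
    using choice a b unfolding canonical_choice_def Let_def L_simps n by blast
  also have "\<dots> = f1 l (tact T i j a b) \<oplus>\<^bsub>E l\<^esub> mul i j (f1 i a) (f1 j b)"
    using a b n by (intro vs_minus[OF module_endo] mul_closed f1_closed) auto
  finally show ?thesis .
qed

lemma f2_add_right: "a \<in> carrier (H i) \<Longrightarrow> b \<in> carrier (H j) \<Longrightarrow> b' \<in> carrier (H j) \<Longrightarrow> n = i + j - 1 \<Longrightarrow>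
    f2 i j a (b \<oplus>\<^bsub>H j\<^esub> b') = f2 i j a b \<oplus>\<^bsub>E n\<^esub> f2 i j a b'"
  using linear_maps_add[OF f2_linear_right] by blast

lemma f2_smult_right: "a \<in> carrier (H i) \<Longrightarrow> b \<in> carrier (H j) \<Longrightarrow> c \<in> carrier k \<Longrightarrow> n = i + j - 1 \<Longrightarrow>
    f2 i j a (c \<odot>\<^bsub>H j\<^esub> b) = c \<odot>\<^bsub>E n\<^esub> f2 i j a b"
  using linear_maps_smult[OF f2_linear_right] by blast

lemma f2_add_left: "a \<in> carrier (H i) \<Longrightarrow> a' \<in> carrier (H i) \<Longrightarrow> b \<in> carrier (H j) \<Longrightarrow> n = i + j - 1 \<Longrightarrow>
    f2 i j (a \<oplus>\<^bsub>H i\<^esub> a') b = f2 i j a b \<oplus>\<^bsub>E n\<^esub> f2 i j a' b"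
  using linear_maps_add[OF f2_linear_left[of b j i], of a a'] by (simp add: add_closed)

lemma f2_smult_left: "a \<in> carrier (H i) \<Longrightarrow> c \<in> carrier k \<Longrightarrow> b \<in> carrier (H j) \<Longrightarrow> n = i + j - 1 \<Longrightarrow>
    f2 i j (c \<odot>\<^bsub>H i\<^esub> a) b = c \<odot>\<^bsub>E n\<^esub> f2 i j a b"
  using linear_maps_smult[OF f2_linear_left[of b j i], of c a] by (simp add: smult_closed)

text \<open>The cocycle whose class is \<open>m(a, b, c)\<close>, kept on the level of chains: the
  Hochschild coboundary of \<open>m\<close> will be recognised there as an explicit
  boundary.\<close>

definition Mc where
  "Mc r s t a b c = mul (r + s - 1) t (f2 r s a b) (f1 t c) \<oplus>\<^bsub>E (r + s + t - 1)\<^esub> f2 r (s + t) a (tact T s t b c)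
     \<oplus>\<^bsub>E (r + s + t - 1)\<^esub> f2 (r + s) t (tact T r s a b) c \<oplus>\<^bsub>E (r + s + t - 1)\<^esub> mul r (s + t - 1) (f1 r a)
       (f2 s t b c)"

lemma Mc_terms:
  assumes "a \<in> carrier (H r)" "b \<in> carrier (H s)" "c \<in> carrier (H t)" "N = r + s + t - 1"
  shows "mul (r + s - 1) t (f2 r s a b) (f1 t c) \<in> carrier (E N)" "f2 r (s + t) a (tact T s t b c) \<in>
      carrier (E N)"
    "f2 (r + s) t (tact T r s a b) c \<in> carrier (E N)" "mul r (s + t - 1) (f1 r a) (f2 s t b c) \<in> carrier (E N)"
  using assms by (auto intro!: mul_closed f2_closed f1_closed tact_closed[OF T_kG])

lemma Mc_closed:
  assumes "a \<in> carrier (H r)" "b \<in> carrier (H s)" "c \<in> carrier (H t)" "N = r + s + t - 1"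
  shows "Mc r s t a b c \<in> carrier (E N)"
  unfolding Mc_def using Mc_terms[OF assms(1-3) refl] assms(4) by (simp add: add_closed module_endo)

lemma Mc_add:
  assumes "a \<in> carrier (H r)" "b \<in> carrier (H s)" "c \<in> carrier (H t)" "N = r + s + t - 1"
  shows "a' \<in> carrier (H r) \<Longrightarrow> Mc r s t (a \<oplus>\<^bsub>H r\<^esub> a') b c = Mc r s t a b c \<oplus>\<^bsub>E N\<^esub> Mc r s t a' b c"
    "b' \<in> carrier (H s) \<Longrightarrow> Mc r s t a (b \<oplus>\<^bsub>H s\<^esub> b') c = Mc r s t a b c \<oplus>\<^bsub>E N\<^esub> Mc r s t a b' c"
    "c' \<in> carrier (H t) \<Longrightarrow> Mc r s t a b (c \<oplus>\<^bsub>H t\<^esub> c') = Mc r s t a b c \<oplus>\<^bsub>E N\<^esub> Mc r s t a b c'"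
proof -
  note lin = linear_maps_rules[OF f1_linear] f2_closed[OF _ _ refl] f2_add_left[OF _ _ _ refl]
    f2_add_right[OF _ _ _ refl]
    tact_closed[OF T_kG _ _ refl] tact_add_left[OF T_kG _ _ _ refl] tact_add_right[OF T_kG _ _ _ refl]
    mul_add_left[OF _ _ _ assms(4)[unfolded add_diff_eq[symmetric]]]
  have n: "N = r + s - 1 + t" "N = r + (s + t - 1)" "r + (s + t) - 1 = N" "r + s + t - 1 = N" using assms(4)
    by simp_all
  note ml = mul_add_left[OF _ _ _ n(1)] mul_add_left[OF _ _ _ n(2)] mul_add_right[OF _ _ _ n(1)]
    mul_add_right[OF _ _ _ n(2)]
  note M = Mc_terms[OF _ _ _ assms(4)]
  show "Mc r s t (a \<oplus>\<^bsub>H r\<^esub> a') b c = Mc r s t a b c \<oplus>\<^bsub>E N\<^esub> Mc r s t a' b c" if a': "a' \<in> carrier (H r)"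
    using M[OF assms(1-3)] M[OF a' assms(2,3)] assms(1-3) a' unfolding Mc_def
    by (simp add: lin ml n vs_ac module_endo)
  show "Mc r s t a (b \<oplus>\<^bsub>H s\<^esub> b') c = Mc r s t a b c \<oplus>\<^bsub>E N\<^esub> Mc r s t a b' c" if a': "b' \<in> carrier (H s)"
    using M[OF assms(1-3)] M[OF assms(1) a' assms(3)] assms(1-3) a' unfolding Mc_def
    by (simp add: lin ml n vs_ac module_endo)
  show "Mc r s t a b (c \<oplus>\<^bsub>H t\<^esub> c') = Mc r s t a b c \<oplus>\<^bsub>E N\<^esub> Mc r s t a b c'" if a': "c' \<in> carrier (H t)"
    using M[OF assms(1-3)] M[OF assms(1,2) a'] assms(1-3) a' unfolding Mc_def
    by (simp add: lin ml n vs_ac module_endo)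
qed

lemma Mc_smult:
  assumes "a \<in> carrier (H r)" "b \<in> carrier (H s)" "c \<in> carrier (H t)" "N = r + s + t - 1" "x \<in> carrier k"
  shows "Mc r s t (x \<odot>\<^bsub>H r\<^esub> a) b c = x \<odot>\<^bsub>E N\<^esub> Mc r s t a b c"
    "Mc r s t a (x \<odot>\<^bsub>H s\<^esub> b) c = x \<odot>\<^bsub>E N\<^esub> Mc r s t a b c"
    "Mc r s t a b (x \<odot>\<^bsub>H t\<^esub> c) = x \<odot>\<^bsub>E N\<^esub> Mc r s t a b c"
proof -
  note lin = linear_maps_rules[OF f1_linear] f2_closed[OF _ _ refl] f2_smult_left[OF _ _ _ refl]
    f2_smult_right[OF _ _ _ refl]
    tact_closed[OF T_kG _ _ refl] tact_smult_left[OF T_kG _ _ _ refl] tact_smult_right[OF T_kG _ _ _ refl]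
  have n: "N = r + s - 1 + t" "N = r + (s + t - 1)" "r + (s + t) - 1 = N" "r + s + t - 1 = N" using assms(4)
    by simp_all
  note ml = mul_smult_left[OF _ _ _ n(1)] mul_smult_left[OF _ _ _ n(2)] mul_smult_right[OF _ _ _ n(1)]
    mul_smult_right[OF _ _ _ n(2)]
  note M = Mc_terms[OF assms(1-4)]
  show "Mc r s t (x \<odot>\<^bsub>H r\<^esub> a) b c = x \<odot>\<^bsub>E N\<^esub> Mc r s t a b c"
    "Mc r s t a (x \<odot>\<^bsub>H s\<^esub> b) c = x \<odot>\<^bsub>E N\<^esub> Mc r s t a b c"
    "Mc r s t a b (x \<odot>\<^bsub>H t\<^esub> c) = x \<odot>\<^bsub>E N\<^esub> Mc r s t a b c"
    using M assms(1-3,5) unfolding Mc_def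
    by (simp_all add: lin ml n vs_closed smult_radd module_endo)
qed

text \<open>The differentials of the four terms involve only f1(ab) f1(c), f1(a) f1(b) f1(c), f1(a)
  f1(bc) and f1(abc), named \<open>y1\<close> to \<open>y4\<close>, and each of these occurs
  twice.\<close>

lemma Mc_cocycle:
  assumes a: "a \<in> carrier (H r)" and b: "b \<in> carrier (H s)" and c: "c \<in> carrier (H t)" and N: "N =
      r + s + t - 1"
  shows "Mc r s t a b c \<in> Z N"
proof -
  let ?O = "N + 1"
  note tc = tact_closed[OF T_kG _ _ refl]
  have abc: "tact T (r + s) t (tact T r s a b) c = tact T r (s + t) a (tact T s t b c)"
    by (rule tact_assoc[OF T_kG a b c refl refl])
  have n: "r + s + t - 1 = N" using N by simp
  note M = Mc_terms[OF a b c N]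
  have mE: "module k (E m)" for m by (rule module_endo)
  have z: "dd i (f1 i x) = \<zero>\<^bsub>E (i + 1)\<^esub>" if "x \<in> carrier (H i)" for i x
    using f1_cocycle[OF that] by (simp add: cocycle_iff)
  let ?A = "f1 r a" and ?B = "f1 s b" and ?D = "f1 t c"
  have cl: "?A \<in> carrier (E r)" "?B \<in> carrier (E s)" "?D \<in> carrier (E t)" "f1 (r + s) (tact T r s a b) \<in>
      carrier (E (r + s))"
    "f1 (s + t) (tact T s t b c) \<in> carrier (E (s + t))" "f1 (r + (s + t)) (tact T r (s + t) a (tact T s t b c))
        \<in> carrier (E ?O)"
    using a b c tc N f1_closed[OF tc[OF a tc[OF b c]]] by (auto intro: f1_closed simp: add.assoc)
  define y1 where "y1 = mul (r + s) t (f1 (r + s) (tact T r s a b)) ?D"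
  define y2 where "y2 = mul r (s + t) ?A (mul s t ?B ?D)"
  define y3 where "y3 = mul r (s + t) ?A (f1 (s + t) (tact T s t b c))"
  define y4 where "y4 = f1 (r + (s + t)) (tact T r (s + t) a (tact T s t b c))"
  have y: "y1 \<in> carrier (E ?O)" "y2 \<in> carrier (E ?O)" "y3 \<in> carrier (E ?O)" "y4 \<in> carrier (E ?O)"
    unfolding y1_def y2_def y3_def y4_def using cl N by (auto intro!: mul_closed)
  have d1: "dd N (mul (r + s - 1) t (f2 r s a b) ?D) = y1 \<oplus>\<^bsub>E ?O\<^esub> y2"
  proof -
    have "dd N (mul (r + s - 1) t (f2 r s a b) ?D) = mul (r + s) t (dd (r + s - 1) (f2 r s a b)) ?D \<oplus>\<^bsub>E ?O\<^esub>
        mul (r + s - 1) (t + 1) (f2 r s a b) (dd t ?D)"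
      by (rule leibniz) (use a b N cl in \<open>auto intro: f2_closed\<close>)
    also have "dd t ?D = \<zero>\<^bsub>E (t + 1)\<^esub>" by (rule z[OF c])
    also have "mul (r + s - 1) (t + 1) (f2 r s a b) \<zero>\<^bsub>E (t + 1)\<^esub> = \<zero>\<^bsub>E ?O\<^esub>"
      by (rule mul_zero_right) (use a b N in \<open>auto intro: f2_closed\<close>)
    also have "dd (r + s - 1) (f2 r s a b) = f1 (r + s) (tact T r s a b) \<oplus>\<^bsub>E (r + s)\<^esub> mul r s ?A ?B"
      by (rule f2_diff[OF a b]) simp_all
    also have "mul (r + s) t (f1 (r + s) (tact T r s a b) \<oplus>\<^bsub>E (r + s)\<^esub> mul r s ?A ?B) ?D =
        y1 \<oplus>\<^bsub>E ?O\<^esub> mul (r + s) t (mul r s ?A ?B) ?D"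
      unfolding y1_def by (rule mul_add_left) (use cl N in \<open>auto intro: mul_closed\<close>)
    also have "mul (r + s) t (mul r s ?A ?B) ?D = y2" unfolding y2_def by (rule mul_assoc[OF cl(1-3)]) simp_all
    finally show ?thesis using y by (simp add: vs_ac mE)
  qed
  have d2: "dd N (f2 r (s + t) a (tact T s t b c)) = y4 \<oplus>\<^bsub>E ?O\<^esub> y3"
    unfolding y3_def y4_def using f2_diff[OF a tc[OF b c], of N ?O] N by (simp add: add.assoc)
  have d3: "dd N (f2 (r + s) t (tact T r s a b) c) = y4 \<oplus>\<^bsub>E ?O\<^esub> y1"
    unfolding y1_def y4_def using f2_diff[OF tc[OF a b] c, of N ?O] N by (simp add: abc add.assoc)
  have d4: "dd N (mul r (s + t - 1) ?A (f2 s t b c)) = y3 \<oplus>\<^bsub>E ?O\<^esub> y2"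
  proof -
    have "dd N (mul r (s + t - 1) ?A (f2 s t b c)) = mul (r + 1) (s + t - 1) (dd r ?A) (f2 s t b c) \<oplus>\<^bsub>E ?O\<^esub>
        mul r (s + t) ?A (dd (s + t - 1) (f2 s t b c))"
      by (rule leibniz) (use b c N cl in \<open>auto intro: f2_closed\<close>)
    also have "dd r ?A = \<zero>\<^bsub>E (r + 1)\<^esub>" by (rule z[OF a])
    also have "mul (r + 1) (s + t - 1) \<zero>\<^bsub>E (r + 1)\<^esub> (f2 s t b c) = \<zero>\<^bsub>E ?O\<^esub>"
      by (rule mul_zero_left) (use b c N in \<open>auto intro: f2_closed\<close>)
    also have "dd (s + t - 1) (f2 s t b c) = f1 (s + t) (tact T s t b c) \<oplus>\<^bsub>E (s + t)\<^esub> mul s t ?B ?D"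
      by (rule f2_diff[OF b c]) simp_all
    also have "mul r (s + t) ?A (f1 (s + t) (tact T s t b c) \<oplus>\<^bsub>E (s + t)\<^esub> mul s t ?B ?D) = y3 \<oplus>\<^bsub>E ?O\<^esub> y2"
      unfolding y3_def y2_def by (rule mul_add_right) (use cl N in \<open>auto intro: mul_closed\<close>)
    finally show ?thesis using y by (simp add: vs_ac mE)
  qed
  have "dd N (Mc r s t a b c) = \<zero>\<^bsub>E ?O\<^esub>"
    unfolding Mc_def n using M y by (simp add: diff_add add_closed mE d1 d2 d3 d4 vs_ac)
  then show ?thesis using Mc_closed[OF a b c N] by (simp add: cocycle_iff)
qed

abbreviation "cc \<equiv> canonical_cocycle k G P f1 f2"

lemma cc_app:
  assumes a: "a \<in> carrier (H r)" and b: "b \<in> carrier (H s)" and c: "c \<in> carrier (H t)"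
  shows "cc [(r, a), (s, b), (t, c)] = ecl (r + s + t - 1) (Mc r s t a b c)"
proof -
  have dom: "[(r, a), (s, b), (t, c)] \<in> hoch_dom L 3" using a b c by (simp add: hoch_dom_def L_simps)
  note M = Mc_terms[OF a b c refl]
  show ?thesis
    unfolding canonical_cocycle_def Let_def restrict_apply'[OF dom] L_simps
    using M by (simp add: Mc_def vs_minus vs_sign module_endo)
qed

lemma cc_cochain: "cc \<in> hoch_cochains k L 3 (-1)"
  unfolding hoch_cochains_def L_simps
proof (intro CollectI conjI allI ballI impI)
  show "cc \<in> extensional (hoch_dom L 3)" by (simp add: canonical_cocycle_def Let_def)
  show "cc xs \<in> carrier (H (total_degree xs + - 1))" if xs: "xs \<in> hoch_dom L 3" for xs
  proof -
    have "length xs = Suc (Suc (Suc 0))" using xs by (simp add: hoch_dom_def)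
    then obtain x y z where "xs = [x, y, z]" by (auto simp: length_Suc_conv)
    then obtain r a s b t c where xs': "xs = [(r, a), (s, b), (t, c)]" by (cases x; cases y; cases z) auto
    have abc: "a \<in> carrier (H r)" "b \<in> carrier (H s)" "c \<in> carrier (H t)" using xs unfolding xs'
      by (auto simp: hoch_dom_def L_simps)
    have "ecl (r + s + t - 1) (Mc r s t a b c) \<in> carrier (H (r + s + t - 1))"
      by (rule ecl_closed[OF Mc_cocycle[OF abc refl]])
    then show ?thesis unfolding xs' cc_app[OF abc] by (simp add: total_degree_def algebra_simps)
  qed
  fix us vs i
  fix a assume a: "a \<in> carrier (H i)"
  { fix b assume b: "b \<in> carrier (H i)" and dom: "us @ (i, a) # vs \<in> hoch_dom L 3"
    have ab: "a \<oplus>\<^bsub>H i\<^esub> b \<in> carrier (H i)" using a b by (simp add: add_closed)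
    show "cc (us @ (i, a \<oplus>\<^bsub>H i\<^esub> b) # vs) = cc (us @ (i, a) # vs) \<oplus>\<^bsub>H (total_degree (us @ (i, a) # vs) + - 1)\<^esub> cc
        (us @ (i, b) # vs)"
      using hoch_dom_split[OF dom]
    proof (elim disjE exE conjE)
      fix s c t d assume e: "us = []" "vs = [(s, c), (t, d)]"
      have m: "c \<in> carrier (H s)" "d \<in> carrier (H t)" using dom unfolding e by (auto simp: hoch_dom_def L_simps)
      show ?thesis
        unfolding e append_Nil using a b ab m ecl_add[OF Mc_cocycle[OF a m refl] Mc_cocycle[OF b m refl]]
          Mc_add(1)[OF a m refl b]
        by (simp add: cc_app total_degree_def algebra_simps)
    next
      fix s c t d assume e: "us = [(s, c)]" "vs = [(t, d)]"
      have m: "c \<in> carrier (H s)" "d \<in> carrier (H t)" using dom unfolding e by (auto simp: hoch_dom_def L_simps)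
      show ?thesis
        unfolding e append_Cons append_Nil
          using a b ab m ecl_add[OF Mc_cocycle[OF m(1) a m(2) refl] Mc_cocycle[OF m(1) b m(2) refl]]
          Mc_add(2)[OF m(1) a m(2) refl b]
        by (simp add: cc_app total_degree_def algebra_simps)
    next
      fix s c t d assume e: "us = [(s, c), (t, d)]" "vs = []"
      have m: "c \<in> carrier (H s)" "d \<in> carrier (H t)" using dom unfolding e by (auto simp: hoch_dom_def L_simps)
      show ?thesis
        unfolding e append_Cons append_Nil
          using a b ab m ecl_add[OF Mc_cocycle[OF m a refl] Mc_cocycle[OF m b refl]] Mc_add(3)[OF m a refl b]
        by (simp add: cc_app total_degree_def algebra_simps)
    qed }
  { fix x assume x: "x \<in> carrier k" and dom: "us @ (i, a) # vs \<in> hoch_dom L 3"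
    have xa: "x \<odot>\<^bsub>H i\<^esub> a \<in> carrier (H i)" using a x by (simp add: smult_closed)
    show "cc (us @ (i, x \<odot>\<^bsub>H i\<^esub> a) # vs) = x \<odot>\<^bsub>H (total_degree (us @ (i, a) # vs) + - 1)\<^esub> cc (us @ (i, a) # vs)"
      using hoch_dom_split[OF dom]
    proof (elim disjE exE conjE)
      fix s c t d assume e: "us = []" "vs = [(s, c), (t, d)]"
      have m: "c \<in> carrier (H s)" "d \<in> carrier (H t)" using dom unfolding e by (auto simp: hoch_dom_def L_simps)
      show ?thesis
        unfolding e append_Nil using a x xa m ecl_smult[OF Mc_cocycle[OF a m refl] x] Mc_smult(1)[OF a m refl x]
        by (simp add: cc_app total_degree_def algebra_simps)
    next
      fix s c t d assume e: "us = [(s, c)]" "vs = [(t, d)]"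
      have m: "c \<in> carrier (H s)" "d \<in> carrier (H t)" using dom unfolding e by (auto simp: hoch_dom_def L_simps)
      show ?thesis
        unfolding e append_Cons append_Nil using a x xa m ecl_smult[OF Mc_cocycle[OF m(1) a m(2) refl] x]
          Mc_smult(2)[OF m(1) a m(2) refl x]
        by (simp add: cc_app total_degree_def algebra_simps)
    next
      fix s c t d assume e: "us = [(s, c), (t, d)]" "vs = []"
      have m: "c \<in> carrier (H s)" "d \<in> carrier (H t)" using dom unfolding e by (auto simp: hoch_dom_def L_simps)
      show ?thesis
        unfolding e append_Cons append_Nil using a x xa m ecl_smult[OF Mc_cocycle[OF m a refl] x]
          Mc_smult(3)[OF m a refl x]
        by (simp add: cc_app total_degree_def algebra_simps)
    qed }
qed

text \<open>Up to terms that cancel in pairs, the Hochschild coboundary of the canonical cocycle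
  is represented by the boundary of \<open>f2(a, b) f2(c, e)\<close>.\<close>

lemma cc_diff:
  assumes a: "a \<in> carrier (H r)" and b: "b \<in> carrier (H s)" and c: "c \<in> carrier (H t)" and e:
    "e \<in> carrier (H u)"
  shows "hoch_diff L 3 (-1) cc [(r, a), (s, b), (t, c), (u, e)] = \<zero>\<^bsub>H (r + s + t + u - 1)\<^esub>"
proof -
  define N where "N = r + s + t + u - 1"
  have mE: "module k (E m)" for m by (rule module_endo)
  note tc = tact_closed[OF T_kG _ _ refl]
  define ab bc ce where "ab = tact T r s a b" and "bc = tact T s t b c" and "ce = tact T t u c e"
  define abc bce where "abc = tact T (r + s) t ab c" and "bce = tact T (s + t) u bc e"
  have abc': "tact T r (s + t) a bc = abc" and bce': "tact T s (t + u) b ce = bce"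
    using tact_assoc[OF T_kG a b c refl refl] tact_assoc[OF T_kG b c e refl refl]
      by (simp_all add: abc_def bce_def ab_def bc_def ce_def)
  have mem: "ab \<in> carrier (H (r + s))" "bc \<in> carrier (H (s + t))" "ce \<in> carrier (H (t + u))"
    "abc \<in> carrier (H (r + s + t))" "bce \<in> carrier (H (s + t + u))"
    using a b c e by (simp_all add: ab_def bc_def ce_def abc_def bce_def tc)
  \<comment> \<open>The five summands of the coboundary consist of twenty terms, of twelve kinds.
    All kinds occur twice except \<open>x4\<close>, \<open>x8\<close>, \<open>x11\<close> and
    \<open>x12\<close>.\<close>
  define x1 where "x1 = mul r (s + t + u - 1) (f1 r a) (mul (s + t - 1) u (f2 s t b c) (f1 u e))"
  define x2 where "x2 = mul r (s + t + u - 1) (f1 r a) (f2 s (t + u) b ce)"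
  define x3 where "x3 = mul r (s + t + u - 1) (f1 r a) (f2 (s + t) u bc e)"
  define x4 where "x4 = mul r (s + t + u - 1) (f1 r a) (mul s (t + u - 1) (f1 s b) (f2 t u c e))"
  define x5 where "x5 = mul (r + s + t - 1) u (f2 (r + s) t ab c) (f1 u e)"
  define x6 where "x6 = f2 (r + s) (t + u) ab ce"
  define x7 where "x7 = f2 (r + s + t) u abc e"
  define x8 where "x8 = mul (r + s) (t + u - 1) (f1 (r + s) ab) (f2 t u c e)"
  define x9 where "x9 = mul (r + s + t - 1) u (f2 r (s + t) a bc) (f1 u e)"
  define x10 where "x10 = f2 r (s + t + u) a bce"
  define x11 where "x11 = mul (r + s - 1) (t + u) (f2 r s a b) (f1 (t + u) ce)"
  define x12 where "x12 = mul (r + s + t - 1) u (mul (r + s - 1) t (f2 r s a b) (f1 t c)) (f1 u e)"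
  note c2 = f2_closed[OF _ _ refl] and c1 = f1_closed
  have x: "x1 \<in> carrier (E N)" "x2 \<in> carrier (E N)" "x3 \<in> carrier (E N)" "x4 \<in> carrier (E N)"
    "x5 \<in> carrier (E N)"
    "x6 \<in> carrier (E N)" "x7 \<in> carrier (E N)" "x8 \<in> carrier (E N)" "x9 \<in> carrier (E N)" "x10 \<in> carrier (E N)"
    "x11 \<in> carrier (E N)" "x12 \<in> carrier (E N)"
    unfolding x1_def x2_def x3_def x4_def x5_def x6_def x7_def x8_def x9_def x10_def x11_def x12_def N_def
    using a b c e mem by (auto intro!: mul_closed f2_closed f1_closed)
  have M1: "mul r (s + t + u - 1) (f1 r a) (Mc s t u b c e) = x1 \<oplus>\<^bsub>E N\<^esub> x2 \<oplus>\<^bsub>E N\<^esub> x3 \<oplus>\<^bsub>E N\<^esub> x4"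
  proof -
    have l: "N = r + (s + t + u - 1)" by (simp add: N_def)
    note M = Mc_terms[OF b c e refl]
    show ?thesis unfolding Mc_def x1_def x2_def x3_def x4_def ce_def bc_def
      using M c1[OF a] by (simp add: mul_add_right[OF _ _ _ l] add_closed mE)
  qed
  have M2: "Mc (r + s) t u ab c e = x5 \<oplus>\<^bsub>E N\<^esub> x6 \<oplus>\<^bsub>E N\<^esub> x7 \<oplus>\<^bsub>E N\<^esub> x8"
    unfolding Mc_def x5_def x6_def x7_def x8_def ce_def abc_def N_def ..
  have M3: "Mc r (s + t) u a bc e = x9 \<oplus>\<^bsub>E N\<^esub> x10 \<oplus>\<^bsub>E N\<^esub> x7 \<oplus>\<^bsub>E N\<^esub> x3"
    unfolding Mc_def x9_def x10_def x7_def x3_def bce_def N_def abc' by (simp add: add.assoc)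
  have M4: "Mc r s (t + u) a b ce = x11 \<oplus>\<^bsub>E N\<^esub> x10 \<oplus>\<^bsub>E N\<^esub> x6 \<oplus>\<^bsub>E N\<^esub> x2"
    unfolding Mc_def x11_def x10_def x6_def x2_def ab_def[symmetric] N_def bce' by (simp add: add.assoc)
  have M5: "mul (r + s + t - 1) u (Mc r s t a b c) (f1 u e) = x12 \<oplus>\<^bsub>E N\<^esub> x9 \<oplus>\<^bsub>E N\<^esub> x5 \<oplus>\<^bsub>E N\<^esub> x1"
  proof -
    have l: "N = r + s + t - 1 + u" by (simp add: N_def)
    have "mul (r + s + t - 1) u (mul r (s + t - 1) (f1 r a) (f2 s t b c)) (f1 u e) = x1"
      unfolding x1_def by (rule mul_assoc) (use a b c e in \<open>auto intro: c1 c2\<close>)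
    note this[symmetric]
    moreover note M = Mc_terms[OF a b c refl]
    ultimately show ?thesis unfolding Mc_def x12_def x9_def x5_def ab_def bc_def
      using M c1[OF e] by (simp add: mul_add_left[OF _ _ _ l] add_closed mE)
  qed
  \<comment> \<open>The four terms without partner are those that the Leibniz rule produces from the
    product of two values of \<open>f2\<close>.\<close>
  have D: "dd (N - 1) (mul (r + s - 1) (t + u - 1) (f2 r s a b) (f2 t u c e)) =
      x8 \<oplus>\<^bsub>E N\<^esub> x4 \<oplus>\<^bsub>E N\<^esub> (x11 \<oplus>\<^bsub>E N\<^esub> x12)"
  proof -
    have "dd (N - 1) (mul (r + s - 1) (t + u - 1) (f2 r s a b) (f2 t u c e)) =
        mul (r + s) (t + u - 1) (dd (r + s - 1) (f2 r s a b)) (f2 t u c e) \<oplus>\<^bsub>E N\<^esub>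
        mul (r + s - 1) (t + u) (f2 r s a b) (dd (t + u - 1) (f2 t u c e))"
      by (rule leibniz) (use a b c e in \<open>auto intro: c2 simp: N_def\<close>)
    also have "dd (r + s - 1) (f2 r s a b) = f1 (r + s) ab \<oplus>\<^bsub>E (r + s)\<^esub> mul r s (f1 r a) (f1 s b)"
      unfolding ab_def by (rule f2_diff[OF a b]) simp_all
    also have "mul (r + s) (t + u - 1) (f1 (r + s) ab \<oplus>\<^bsub>E (r + s)\<^esub> mul r s (f1 r a) (f1 s b)) (f2 t u c e) =
        x8 \<oplus>\<^bsub>E N\<^esub> mul (r + s) (t + u - 1) (mul r s (f1 r a) (f1 s b)) (f2 t u c e)"
      unfolding x8_def by (rule mul_add_left) (use a b c e mem in \<open>auto intro: c1 c2 mul_closed simp: N_def\<close>)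
    also have "mul (r + s) (t + u - 1) (mul r s (f1 r a) (f1 s b)) (f2 t u c e) = x4"
      unfolding x4_def by (rule mul_assoc) (use a b c e in \<open>auto intro: c1 c2\<close>)
    also have "dd (t + u - 1) (f2 t u c e) = f1 (t + u) ce \<oplus>\<^bsub>E (t + u)\<^esub> mul t u (f1 t c) (f1 u e)"
      unfolding ce_def by (rule f2_diff[OF c e]) simp_all
    also have "mul (r + s - 1) (t + u) (f2 r s a b) (f1 (t + u) ce \<oplus>\<^bsub>E (t + u)\<^esub> mul t u (f1 t c) (f1 u e)) =
        x11 \<oplus>\<^bsub>E N\<^esub> mul (r + s - 1) (t + u) (f2 r s a b) (mul t u (f1 t c) (f1 u e))"
      unfolding x11_def by (rule mul_add_right) (use a b c e mem in \<open>auto intro: c1 c2 mul_closed simp: N_def\<close>)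
    also have "mul (r + s - 1) (t + u) (f2 r s a b) (mul t u (f1 t c) (f1 u e)) = x12"
      unfolding x12_def by (rule mul_assoc[symmetric]) (use a b c e in \<open>auto intro: c1 c2\<close>)
    finally show ?thesis .
  qed
  note MZ = Mc_cocycle[OF b c e refl] Mc_cocycle[OF a b c refl]
  have MZ2: "Mc (r + s) t u ab c e \<in> Z N" "Mc r (s + t) u a bc e \<in> Z N" "Mc r s (t + u) a b ce \<in> Z N"
    using a b c e mem by (auto intro!: Mc_cocycle simp: N_def)
  have MZ1: "mul r (s + t + u - 1) (f1 r a) (Mc s t u b c e) \<in> Z N"
    "mul (r + s + t - 1) u (Mc r s t a b c) (f1 u e) \<in> Z N"
    by (rule cocycle_mul[OF f1_cocycle[OF a] MZ(1)], simp add: N_def, rule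
      cocycle_mul[OF MZ(2) f1_cocycle[OF e]], simp add: N_def)
  have e1: "tact T r (s + t + u + - 1) a (cc [(s, b), (t, c), (u, e)]) =
      ecl N (mul r (s + t + u - 1) (f1 r a) (Mc s t u b c e))"
    using ecl_mul[OF f1_cocycle[OF a] MZ(1), of N] by (simp add: cc_app[OF b c e] f1_class[OF a] N_def)
  have e5: "tact T (r + s + t + - 1) u (cc [(r, a), (s, b), (t, c)]) e =
      ecl N (mul (r + s + t - 1) u (Mc r s t a b c) (f1 u e))"
    using ecl_mul[OF MZ(2) f1_cocycle[OF e], of N] by (simp add: cc_app[OF a b c] f1_class[OF e] N_def)
  have e2: "cc [(r + s, ab), (t, c), (u, e)] = ecl N (Mc (r + s) t u ab c e)"
    using cc_app[OF mem(1) c e] by (simp add: N_def)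
  have e3: "cc [(r, a), (s + t, bc), (u, e)] = ecl N (Mc r (s + t) u a bc e)"
    using cc_app[OF a mem(2) e] by (simp add: N_def add.assoc)
  have e4: "cc [(r, a), (s, b), (t + u, ce)] = ecl N (Mc r s (t + u) a b ce)"
    using cc_app[OF a b mem(3)] by (simp add: N_def add.assoc)
  let ?S = "mul r (s + t + u - 1) (f1 r a) (Mc s t u b c e) \<oplus>\<^bsub>E N\<^esub>
      (Mc (r + s) t u ab c e \<oplus>\<^bsub>E N\<^esub> (Mc r (s + t) u a bc e \<oplus>\<^bsub>E N\<^esub>
      (Mc r s (t + u) a b ce \<oplus>\<^bsub>E N\<^esub> mul (r + s + t - 1) u (Mc r s t a b c) (f1 u e))))"
  have SZ: "?S \<in> Z N" using MZ1 MZ2 by (intro cocycle_add)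
  have "hoch_diff L 3 (-1) cc [(r, a), (s, b), (t, c), (u, e)] = ecl N ?S"
    using MZ1 MZ2 hoch_diff_3[OF cc_cochain a b c e, of N]
    by (simp add: ecl_add cocycle_add e1[simplified] e2 e3 e4 e5[simplified] ab_def[symmetric] bc_def[symmetric]
      ce_def[symmetric] N_def[symmetric])
  also have "?S = dd (N - 1) (mul (r + s - 1) (t + u - 1) (f2 r s a b) (f2 t u c e))"
    unfolding M1 M2 M3 M4 M5 D using x by (simp add: vs_ac mE)
  also have "ecl N \<dots> = \<zero>\<^bsub>H N\<^esub>"
  proof -
    have "mul (r + s - 1) (t + u - 1) (f2 r s a b) (f2 t u c e) \<in> carrier (E (N - 1))"
      by (rule mul_closed) (use a b c e in \<open>auto intro: c2 simp: N_def\<close>)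
    moreover have "dd (N - 1) (mul (r + s - 1) (t + u - 1) (f2 r s a b) (f2 t u c e)) \<in> Z N"
      using SZ unfolding M1 M2 M3 M4 M5 D using x by (simp add: vs_ac mE)
    ultimately show ?thesis using ecl_eq_zero by blast
  qed
  finally show ?thesis unfolding N_def .
qed

lemma cc_cocycle: "cc \<in> hoch_cocycles k L 3 (-1)"
proof -
  have "hoch_diff L 3 (-1) cc = \<zero>\<^bsub>hoch_module k L (3 + 1) (-1)\<^esub>"
  proof (rule extensionalityI[of _ "hoch_dom L (3 + 1)"])
    show "hoch_diff L 3 (-1) cc \<in> extensional (hoch_dom L (3 + 1))" by (simp add: hoch_diff_def)
    show "\<zero>\<^bsub>hoch_module k L (3 + 1) (-1)\<^esub> \<in> extensional (hoch_dom L (3 + 1))" by (simp add: hoch_module_def)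
    fix xs assume xs: "xs \<in> hoch_dom L (3 + 1)"
    then have "xs \<in> hoch_dom L 4" by simp
    then obtain r a s b t c u e where xs': "xs = [(r, a), (s, b), (t, c), (u, e)]" "a \<in> carrier (H r)"
      "b \<in> carrier (H s)" "c \<in> carrier (H t)" "e \<in> carrier (H u)"
      using hoch_dom_4[of xs L] unfolding L_simps by metis
    have "\<zero>\<^bsub>hoch_module k L (3 + 1) (-1)\<^esub> xs = \<zero>\<^bsub>H (r + s + t + u - 1)\<^esub>"
      using xs unfolding hoch_module_def by (simp add: L_simps xs'(1) total_degree_def algebra_simps)
    then show "hoch_diff L 3 (-1) cc xs = \<zero>\<^bsub>hoch_module k L (3 + 1) (-1)\<^esub> xs"
      unfolding xs'(1) using cc_diff[OF xs'(2-5)] by simp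
  qed
  then show ?thesis using cc_cochain unfolding hoch_cocycles_def by simp
qed

end

section \<open>Matric Massey products\<close>

text \<open>The class is defined through a choice operator; since choices exist, the chosen pair
  satisfies its defining conditions.\<close>

lemma canonical_class_choice:
  obtains f1 f2 where "canonical_choice k G P f1 f2"
    "canonical_class k G P = hoch_coboundaries k L 3 (-1) +>\<^bsub>hoch_module k L 3 (-1)\<^esub> canonical_cocycle k G P f1
        f2"
proof -
  obtain f1 f2 where f: "(SOME (f1, f2). canonical_choice k G P f1 f2) = (f1, f2)" by (meson surj_pair)
  have "\<exists>x. case x of (f1, f2) \<Rightarrow> canonical_choice k G P f1 f2" using canonical_choice_exists by auto
  then have "case (SOME (f1, f2). canonical_choice k G P f1 f2) of (f1, f2) \<Rightarrow> canonical_choice k G P f1 f2"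
    by (rule someI_ex)
  then have "canonical_choice k G P f1 f2" unfolding f by simp
  moreover have "canonical_class k G P = hoch_coboundaries k L 3 (-1) +>\<^bsub>hoch_module k L 3 (-1)\<^esub>
      canonical_cocycle k G P f1 f2"
    unfolding canonical_class_def Let_def f by simp
  ultimately show thesis by (rule that)
qed

lemma canonical_class_closed: "canonical_class k G P \<in> carrier (HH k L 3 (-1))"
proof -
  obtain f1 f2 where f: "canonical_choice k G P f1 f2"
    "canonical_class k G P = hoch_coboundaries k L 3 (-1) +>\<^bsub>hoch_module k L 3 (-1)\<^esub> canonical_cocycle k G P f1
        f2"
    by (rule canonical_class_choice)
  show ?thesis
    using cc_cocycle[OF f(1)] unfolding f(2) HH_def quotient_module_def a_r_coset_def' by auto
qed

lemma hoch_zero_cochain: "\<zero>\<^bsub>hoch_module k L n m\<^esub> \<in> hoch_cochains k L n m"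
proof -
  have "us @ (i, a \<oplus>\<^bsub>H i\<^esub> b) # vs \<in> hoch_dom L n" "us @ (i, b) # vs \<in> hoch_dom L n"
    if "us @ (i, a) # vs \<in> hoch_dom L n" "a \<in> carrier (H i)" "b \<in> carrier (H i)" for us i a b vs
    using that by (auto simp: hoch_dom_def L_simps add_closed)
  moreover have "us @ (i, c \<odot>\<^bsub>H i\<^esub> a) # vs \<in> hoch_dom L n"
    if "us @ (i, a) # vs \<in> hoch_dom L n" "a \<in> carrier (H i)" "c \<in> carrier k" for us i a c vs
    using that by (auto simp: hoch_dom_def L_simps smult_closed)
  ultimately show ?thesis
    unfolding hoch_cochains_def L_simps
    by (simp add: hoch_module_def L_simps zero_closed vs_self smult_zero total_degree_def)
qed

lemma canonical_class_zero:
  assumes "canonical_class k G P = \<zero>\<^bsub>HH k L 3 (-1)\<^esub>"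
  obtains f1 f2 g where "canonical_choice k G P f1 f2" "g \<in> hoch_cochains k L 2 (-1)"
    "\<And>r s t a b c. a \<in> carrier (H r) \<Longrightarrow> b \<in> carrier (H s) \<Longrightarrow> c \<in> carrier (H t) \<Longrightarrow>
      canonical_cocycle k G P f1 f2 [(r, a), (s, b), (t, c)] = hoch_diff L 2 (-1) g [(r, a), (s, b), (t, c)]"
proof -
  obtain f1 f2 where f: "canonical_choice k G P f1 f2"
    "canonical_class k G P = hoch_coboundaries k L 3 (-1) +>\<^bsub>hoch_module k L 3 (-1)\<^esub> canonical_cocycle k G P f1
        f2"
    by (rule canonical_class_choice)
  let ?z = "\<zero>\<^bsub>hoch_module k L 2 (-1)\<^esub>"
  have B: "hoch_coboundaries k L 3 (-1) = hoch_diff L 2 (-1) ` hoch_cochains k L 2 (-1)"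
    by (simp add: hoch_coboundaries_def)
  have "hoch_coboundaries k L 3 (-1) = hoch_coboundaries k L 3 (-1) +>\<^bsub>hoch_module k L 3 (-1)\<^esub> canonical_cocycle
      k G P f1 f2"
    using assms unfolding f(2) by (simp add: HH_def quotient_module_def)
  \<comment> \<open>The coboundary of the zero cochain is a definite element of the coboundaries.
    Since the coset equals the coboundaries, adding the canonical cocycle to this element gives a
    coboundary again, and its own values are computed to be zero afterwards.\<close>
  moreover have "hoch_diff L 2 (-1) ?z \<in> hoch_coboundaries k L 3 (-1)"
    unfolding B by (intro imageI hoch_zero_cochain)
  ultimately have "hoch_diff L 2 (-1) ?z \<oplus>\<^bsub>hoch_module k L 3 (-1)\<^esub> canonical_cocycle k G P f1 f2 \<in>
      hoch_coboundaries k L 3 (-1)"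
    unfolding a_r_coset_def' by blast
  then obtain g where g: "g \<in> hoch_cochains k L 2 (-1)"
    "hoch_diff L 2 (-1) ?z \<oplus>\<^bsub>hoch_module k L 3 (-1)\<^esub> canonical_cocycle k G P f1 f2 = hoch_diff L 2 (-1) g"
    unfolding B by blast
  have "canonical_cocycle k G P f1 f2 [(r, a), (s, b), (t, c)] = hoch_diff L 2 (-1) g [(r, a), (s, b), (t, c)]"
    if a: "a \<in> carrier (H r)" and b: "b \<in> carrier (H s)" and c: "c \<in> carrier (H t)" for r s t a b c
  proof -
    let ?N = "r + s + t + -1" and ?xs = "[(r, a), (s, b), (t, c)]"
    note tc = tact_closed[OF T_kG]
    have dom: "?xs \<in> hoch_dom L 3" using a b c by (simp add: hoch_dom_def L_simps)
    have td: "total_degree ?xs + -1 = ?N" by (simp add: total_degree_def)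
    have z: "?z [(s, b), (t, c)] = \<zero>\<^bsub>H (s + t + -1)\<^esub>" "?z [(r, a), (s, b)] = \<zero>\<^bsub>H (r + s + -1)\<^esub>"
      "?z [(r + s, tact T r s a b), (t, c)] = \<zero>\<^bsub>H ?N\<^esub>" "?z [(r, a), (s + t, tact T s t b c)] = \<zero>\<^bsub>H ?N\<^esub>"
      using a b c tc by (simp_all add: hoch_module_def hoch_dom_def L_simps total_degree_def add.assoc)
    have "hoch_diff L 2 (-1) ?z ?xs = \<zero>\<^bsub>H ?N\<^esub>"
      unfolding hoch_diff_2[OF hoch_zero_cochain a b c refl] z
      using a c by (simp add: tact_zero_left[where l = ?N] tact_zero_right[where l = ?N] vs_self zero_closed)
    moreover have "(hoch_diff L 2 (-1) ?z \<oplus>\<^bsub>hoch_module k L 3 (-1)\<^esub> canonical_cocycle k G P f1 f2) ?xs =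
        hoch_diff L 2 (-1) ?z ?xs \<oplus>\<^bsub>H ?N\<^esub> canonical_cocycle k G P f1 f2 ?xs"
      using dom by (simp add: hoch_module_def L_simps total_degree_def algebra_simps)
    moreover have "canonical_cocycle k G P f1 f2 ?xs \<in> carrier (H ?N)"
      using hoch_closed[OF cc_cochain[OF f(1)] dom td[symmetric]] .
    ultimately show ?thesis unfolding g(2) by (simp add: vs_l_zero)
  qed
  then show thesis by (rule that[OF f(1) g(1)])
qed

text \<open>Square matrices of size two are indexed by \<open>bool\<close>.\<close>

definition mat_mul :: "(bool \<Rightarrow> bool \<Rightarrow> int \<Rightarrow> 'p \<Rightarrow> 'p) \<Rightarrow> (bool \<Rightarrow> bool \<Rightarrow> int \<Rightarrow> 'p \<Rightarrow> 'p) \<Rightarrow> bool \<Rightarrow> bool \<Rightarrow> int \<Rightarrow> 'p \<Rightarrow>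
    'p" where
  "mat_mul b c i l = mul 1 1 (b i False) (c False l) \<oplus>\<^bsub>E 2\<^esub> mul 1 1 (b i True) (c True l)"

text \<open>The threefold matric Massey product of \<open>b\<close> contains zero.\<close>

definition massey_vanishes :: "(bool \<Rightarrow> bool \<Rightarrow> int \<Rightarrow> 'p \<Rightarrow> 'p) \<Rightarrow> bool" where
  "massey_vanishes b \<longleftrightarrow> (\<exists>V V' W. \<forall>i l. V i l \<in> carrier (E 1) \<and> V' i l \<in> carrier (E 1) \<and> W i l \<in> carrier (E 1) \<and>
     dd 1 (V i l) = mat_mul b b i l \<and> dd 1 (V' i l) = mat_mul b b i l \<and>
     dd 1 (W i l) = mat_mul b V i l \<oplus>\<^bsub>E 2\<^esub> mat_mul V' b i l)"

lemma mat_mul_closed: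
  "(\<And>i l. b i l \<in> carrier (E 1)) \<Longrightarrow> (\<And>i l. c i l \<in> carrier (E 1)) \<Longrightarrow> mat_mul b c i l \<in> carrier (E 2)"
  unfolding mat_mul_def by (intro add_closed module_endo mul_closed) simp_all

lemma mat_mul_cocycle:
  "(\<And>i l. b i l \<in> Z 1) \<Longrightarrow> (\<And>i l. c i l \<in> Z 1) \<Longrightarrow> mat_mul b c i l \<in> Z 2"
  unfolding mat_mul_def by (intro cocycle_add cocycle_mul) simp_all

lemma ecl_mat_mul:
  assumes "\<And>i l. b i l \<in> Z 1" "\<And>i l. c i l \<in> Z 1"
  shows "ecl 2 (mat_mul b c i l) = tact T 1 1 (ecl 1 (b i False)) (ecl 1 (c False l)) \<oplus>\<^bsub>H 2\<^esub> tact T 1 1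
      (ecl 1 (b i True)) (ecl 1 (c True l))"
proof -
  have m: "mul 1 1 (b i j) (c j l) \<in> Z 2" for j by (rule cocycle_mul) (simp_all add: assms)
  have e: "tact T 1 1 (ecl 1 (b i j)) (ecl 1 (c j l)) = ecl 2 (mul 1 1 (b i j) (c j l))" for j
    by (rule ecl_mul) (simp_all add: assms)
  show ?thesis unfolding mat_mul_def e using ecl_add[OF m m] .
qed

lemma mat_mul_add:
  assumes "\<And>i l. b i l \<in> carrier (E 1)" "\<And>i l. c i l \<in> carrier (E 1)" "\<And>i l. c' i l \<in> carrier (E 1)"
  shows "mat_mul b (\<lambda>i l. c i l \<oplus>\<^bsub>E 1\<^esub> c' i l) i l = mat_mul b c i l \<oplus>\<^bsub>E 2\<^esub> mat_mul b c' i l"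
    "mat_mul (\<lambda>i l. c i l \<oplus>\<^bsub>E 1\<^esub> c' i l) b i l = mat_mul c b i l \<oplus>\<^bsub>E 2\<^esub> mat_mul c' b i l"
proof -
  have m: "mul 1 1 x y \<in> carrier (E 2)" if "x \<in> carrier (E 1)" "y \<in> carrier (E 1)" for x y
    using that by (rule mul_closed) simp
  show "mat_mul b (\<lambda>i l. c i l \<oplus>\<^bsub>E 1\<^esub> c' i l) i l = mat_mul b c i l \<oplus>\<^bsub>E 2\<^esub> mat_mul b c' i l"
    "mat_mul (\<lambda>i l. c i l \<oplus>\<^bsub>E 1\<^esub> c' i l) b i l = mat_mul c b i l \<oplus>\<^bsub>E 2\<^esub> mat_mul c' b i l"
    unfolding mat_mul_def using assms
    by (simp_all add: mul_add_left[where l = 2] mul_add_right[where l = 2] m vs_ac module_endo)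
qed

text \<open>Replacing \<open>V\<close> by \<open>V + n\<close> on the right of \<open>b\<close> and
  by \<open>V + n'\<close> on its left changes the bracket by \<open>b n + n' b\<close>. So a
  bracket that lies in its indeterminacy becomes a boundary. The two corrections are independent,
  which is why \<open>massey_vanishes\<close> has both \<open>V\<close> and
  \<open>V'\<close>.\<close>

lemma massey_vanishesI:
  assumes b: "\<And>i l. b i l \<in> Z 1" and V: "\<And>i l. V i l \<in> carrier (E 1)" "\<And>i l. dd 1 (V i l) = mat_mul b b i l"
    and n: "\<And>i l. n i l \<in> Z 1" "\<And>i l. n' i l \<in> Z 1"
    and Z: "\<And>i l. mat_mul b V i l \<oplus>\<^bsub>E 2\<^esub> mat_mul V b i l \<in> Z 2"
    and eq: "\<And>i l. ecl 2 (mat_mul b V i l \<oplus>\<^bsub>E 2\<^esub> mat_mul V b i l) =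
        ecl 2 (mat_mul b n i l) \<oplus>\<^bsub>H 2\<^esub> ecl 2 (mat_mul n' b i l)"
  shows "massey_vanishes b"
proof -
  have mE: "module k (E m)" for m by (rule module_endo)
  have bE: "\<And>i l. b i l \<in> carrier (E 1)" and nE: "\<And>i l. n i l \<in> carrier (E 1)" "\<And>i l. n' i l \<in> carrier (E 1)"
    using b n cocycle_endo by auto
  let ?V = "\<lambda>i l. V i l \<oplus>\<^bsub>E 1\<^esub> n i l" and ?V' = "\<lambda>i l. V i l \<oplus>\<^bsub>E 1\<^esub> n' i l"
  have dn: "dd 1 (n i l) = \<zero>\<^bsub>E 2\<^esub>" "dd 1 (n' i l) = \<zero>\<^bsub>E 2\<^esub>" for i l
    using n[of i l] by (simp_all add: cocycle_iff)
  have mc: "mat_mul b b i l \<in> carrier (E 2)" "mat_mul b V i l \<in> carrier (E 2)" "mat_mul V b i l \<in> carrier (E 2)"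
    "mat_mul b n i l \<in> carrier (E 2)" "mat_mul n' b i l \<in> carrier (E 2)" for i l
    using bE V(1) nE by (auto intro: mat_mul_closed)
  have "\<exists>w\<in>carrier (E 1). dd 1 w = mat_mul b ?V i l \<oplus>\<^bsub>E 2\<^esub> mat_mul ?V' b i l" for i l
  proof -
    let ?m = "mat_mul b V i l \<oplus>\<^bsub>E 2\<^esub> mat_mul V b i l" and ?x = "mat_mul b n i l" and ?y = "mat_mul n' b i l"
    have z: "?x \<in> Z 2" "?y \<in> Z 2" using b n by (auto intro: mat_mul_cocycle)
    have "ecl 2 ?m = ecl 2 (?x \<oplus>\<^bsub>E 2\<^esub> ?y)" using eq z by (simp add: ecl_add)
    then obtain w where w: "w \<in> carrier (E 1)" "dd 1 w = ?m \<oplus>\<^bsub>E 2\<^esub> (?x \<oplus>\<^bsub>E 2\<^esub> ?y)"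
      using ecl_eq[OF Z[of i l] cocycle_add[OF z]] by auto
    have "?m \<oplus>\<^bsub>E 2\<^esub> (?x \<oplus>\<^bsub>E 2\<^esub> ?y) = mat_mul b ?V i l \<oplus>\<^bsub>E 2\<^esub> mat_mul ?V' b i l"
      unfolding mat_mul_add(1)[where b = b and c = V and c' = n, OF bE V(1) nE(1)]
        mat_mul_add(2)[where b = b and c = V and c' = n', OF bE V(1) nE(2)]
      using mc[of i l] by (simp add: vs_ac mE)
    then show ?thesis using w by auto
  qed
  then obtain W where W: "\<And>i l. W i l \<in> carrier (E 1)" "\<And>i l. dd 1 (W i l) = mat_mul b ?V i l \<oplus>\<^bsub>E 2\<^esub> mat_mul
      ?V' b i l"
    by metis
  have "dd 1 (?V i l) = mat_mul b b i l" "dd 1 (?V' i l) = mat_mul b b i l" for i l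
    using V nE mc[of i l] by (simp_all add: diff_add[where m = 2] dn vs_r_zero mE)
  moreover have "?V i l \<in> carrier (E 1)" "?V' i l \<in> carrier (E 1)" for i l using V nE
    by (simp_all add: add_closed mE)
  ultimately show ?thesis using W unfolding massey_vanishes_def
    by (intro exI[of _ ?V] exI[of _ ?V'] exI[of _ W]) blast
qed

text \<open>The differential of \<open>b V + V b\<close> is \<open>b (b b) + (b b) b\<close>, which
  vanishes by associativity.\<close>

lemma massey_cocycle:
  assumes b: "\<And>i l. b i l \<in> Z 1" and V: "\<And>i l. V i l \<in> carrier (E 1)" "\<And>i l. dd 1 (V i l) = mat_mul b b i l"
  shows "mat_mul b V i l \<oplus>\<^bsub>E 2\<^esub> mat_mul V b i l \<in> Z 2"
proof -
  have mE: "module k (E m)" for m by (rule module_endo)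
  have bE: "\<And>i l. b i l \<in> carrier (E 1)" using b cocycle_endo by auto
  have bz: "dd 1 (b i l) = \<zero>\<^bsub>E 2\<^esub>" for i l using b[of i l] by (simp add: cocycle_iff)
  have m2: "mul 1 1 x y \<in> carrier (E 2)" if "x \<in> carrier (E 1)" "y \<in> carrier (E 1)" for x y
    using that by (rule mul_closed) simp
  have m3: "mul 2 1 x y \<in> carrier (E 3)" "mul 1 2 y x \<in> carrier (E 3)" if "x \<in> carrier (E 2)"
    "y \<in> carrier (E 1)" for x y
    using that by (auto intro: mul_closed)
  have l1: "dd 2 (mul 1 1 (b i j) (V j' l)) = mul 1 2 (b i j) (mat_mul b b j' l)" for i j j' l
  proof -
    have "dd 2 (mul 1 1 (b i j) (V j' l)) = mul 2 1 (dd 1 (b i j)) (V j' l) \<oplus>\<^bsub>E 3\<^esub> mul 1 2 (b i j)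
        (dd 1 (V j' l))"
      by (rule leibniz[OF bE V(1)]) simp_all
    then show ?thesis unfolding bz V(2)
      using V(1) bE mat_mul_closed[OF bE bE] m3 by (simp add: mul_zero_left[where l = 3] vs_l_zero mE)
  qed
  have l2: "dd 2 (mul 1 1 (V i j) (b j' l)) = mul 2 1 (mat_mul b b i j) (b j' l)" for i j j' l
  proof -
    have "dd 2 (mul 1 1 (V i j) (b j' l)) = mul 2 1 (dd 1 (V i j)) (b j' l) \<oplus>\<^bsub>E 3\<^esub> mul 1 2 (V i j)
        (dd 1 (b j' l))"
      by (rule leibniz[OF V(1) bE]) simp_all
    then show ?thesis unfolding bz V(2)
      using V(1) bE mat_mul_closed[OF bE bE] m3 by (simp add: mul_zero_right[where l = 3] vs_r_zero mE)
  qed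
  have as: "mul 2 1 (mul 1 1 x y) z = mul 1 2 x (mul 1 1 y z)" if "x \<in> carrier (E 1)" "y \<in> carrier (E 1)"
    "z \<in> carrier (E 1)" for x y z
    by (rule mul_assoc[OF that]) simp_all
  have "dd 2 (mat_mul b V i l \<oplus>\<^bsub>E 2\<^esub> mat_mul V b i l) = \<zero>\<^bsub>E 3\<^esub>"
    unfolding mat_mul_def[of b V] mat_mul_def[of V b]
    using bE V(1)
    by (simp add: diff_add[where m = 3] m2 add_closed mE l1 l2,
        simp add: mat_mul_def mul_add_left[where l = 3] mul_add_right[where l = 3] m2 as m3 vs_ac mE)
  moreover have "mat_mul b V i l \<oplus>\<^bsub>E 2\<^esub> mat_mul V b i l \<in> carrier (E 2)"
    using bE V(1) by (intro add_closed mE mat_mul_closed)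
  ultimately show ?thesis by (simp add: cocycle_iff)
qed

text \<open>The value of the canonical cocycle on \<open>(B, B, B)\<close>, summed over the inner
  matrix indices, is the class of the bracket. If the cocycle is the coboundary of \<open>g\<close>,
  the same sum lies in the indeterminacy.\<close>

lemma massey_of_canonical_class_zero:
  assumes B: "\<And>i l. B i l \<in> carrier (H 1)"
    and BB: "\<And>i l. tact T 1 1 (B i False) (B False l) \<oplus>\<^bsub>H 2\<^esub> tact T 1 1 (B i True) (B True l) = \<zero>\<^bsub>H 2\<^esub>"
    and zero: "canonical_class k G P = \<zero>\<^bsub>HH k L 3 (-1)\<^esub>"
  shows "\<exists>b. (\<forall>i l. b i l \<in> Z 1 \<and> ecl 1 (b i l) = B i l) \<and> massey_vanishes b"
proof -
  have mE: "module k (E m)" for m by (rule module_endo)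
  obtain f1 f2 g where ch: "canonical_choice k G P f1 f2" and g: "g \<in> hoch_cochains k L 2 (-1)"
    and cg: "\<And>r s t a b c. a \<in> carrier (H r) \<Longrightarrow> b \<in> carrier (H s) \<Longrightarrow> c \<in> carrier (H t) \<Longrightarrow>
      canonical_cocycle k G P f1 f2 [(r, a), (s, b), (t, c)] = hoch_diff L 2 (-1) g [(r, a), (s, b), (t, c)]"
    using canonical_class_zero[OF zero] by blast
  note f1r = linear_maps_rules[OF f1_linear[OF ch]] and f2c = f2_closed[OF ch _ _ refl]
  define b where "b i l = f1 1 (B i l)" for i l
  have b: "b i l \<in> Z 1" "ecl 1 (b i l) = B i l" "b i l \<in> carrier (E 1)" for i l
    using f1_cocycle[OF ch B] f1_class[OF ch B] f1r(1)[OF B] by (simp_all add: b_def)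
  have f11: "f2 1 1 x y \<in> carrier (E 1)" if "x \<in> carrier (H 1)" "y \<in> carrier (H 1)" for x y
    using f2_closed[OF ch that] by simp
  define V where "V i l = f2 1 1 (B i False) (B False l) \<oplus>\<^bsub>E 1\<^esub> f2 1 1 (B i True) (B True l)" for i l
  have V: "V i l \<in> carrier (E 1)" for i l unfolding V_def using B by (simp add: f11 add_closed mE)
  have t2: "tact T 1 1 x y \<in> carrier (H 2)" if "x \<in> carrier (H 1)" "y \<in> carrier (H 1)" for x y
    using tact_closed[OF T_kG that] by simp
  have m2: "mul 1 1 x y \<in> carrier (E 2)" if "x \<in> carrier (E 1)" "y \<in> carrier (E 1)" for x y
    using that by (rule mul_closed) simp
  \<comment> \<open>In characteristic two the vanishing of an entry of the square means that its two
    summands are equal. Hence they may be cancelled in pairs inside \<open>f1\<close>,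
    \<open>f2\<close> and \<open>g\<close>.\<close>
  have BBe: "tact T 1 1 (B i True) (B True l) = tact T 1 1 (B i False) (B False l)" for i l
    using BB[of i l] vs_eq[OF H_module t2 t2] B by metis
  have dV: "dd 1 (V i l) = mat_mul b b i l" for i l
  proof -
    have d: "dd 1 (f2 1 1 (B i j) (B j l)) = f1 2 (tact T 1 1 (B i j) (B j l)) \<oplus>\<^bsub>E 2\<^esub> mul 1 1 (b i j) (b j l)"
      for j
      unfolding b_def by (rule f2_diff[OF ch B B]) simp_all
    show ?thesis
      unfolding V_def using B b(3)
      by (simp add: diff_add[where m = 2] f11 d BBe mat_mul_def t2 f1r m2 vs_ac mE)
  qed
  \<comment> \<open>The matrix \<open>g(B, B)\<close>; its entries have degree 1, since
    \<open>g\<close> lowers the total degree by one. Its lift by \<open>f1\<close> will be used for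
    both corrections \<open>n\<close> and \<open>n'\<close>.\<close>
  define G where "G i l = g [(1, B i False), (1, B False l)] \<oplus>\<^bsub>H 1\<^esub> g [(1, B i True), (1, B True l)]" for i l
  have gc: "g [(1, x), (1, y)] \<in> carrier (H 1)" if "x \<in> carrier (H 1)" "y \<in> carrier (H 1)" for x y
    using that by (intro hoch_closed[OF g]) (simp_all add: hoch_dom_def total_degree_def L_simps)
  have g2c: "g [(2, x), (1, y)] \<in> carrier (H 2)" "g [(1, y), (2, x)] \<in> carrier (H 2)" if "x \<in> carrier (H 2)"
    "y \<in> carrier (H 1)" for x y
    using that by (auto intro!: hoch_closed[OF g] simp: hoch_dom_def total_degree_def L_simps)
  have GH: "G i l \<in> carrier (H 1)" for i l unfolding G_def using B by (simp add: gc add_closed)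
  define n where "n i l = f1 1 (G i l)" for i l
  have n: "n i l \<in> Z 1" "ecl 1 (n i l) = G i l" for i l
    using f1_cocycle[OF ch GH] f1_class[OF ch GH] by (simp_all add: n_def)
  have M: "Mc f1 f2 1 1 1 (B i j) (B j q) (B q l) = mul 1 1 (f2 1 1 (B i j) (B j q)) (b q l) \<oplus>\<^bsub>E 2\<^esub>
      (f2 1 2 (B i j) (tact T 1 1 (B j q) (B q l)) \<oplus>\<^bsub>E 2\<^esub> (f2 2 1 (tact T 1 1 (B i j) (B j q)) (B q l) \<oplus>\<^bsub>E 2\<^esub>
      mul 1 1 (b i j) (f2 1 1 (B j q) (B q l))))" for i j q l
    using Mc_terms[OF ch B B B, of 2 i j j q q l] unfolding Mc_def[OF ch] b_def
      by (simp add: vs_assoc add_closed mE)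
  have Mz: "Mc f1 f2 1 1 1 (B i j) (B j q) (B q l) \<in> Z 2" for i j q l
    by (rule Mc_cocycle[OF ch B B B]) simp
  have f12: "f2 1 2 x y \<in> carrier (E 2)" "f2 2 1 y x \<in> carrier (E 2)" if "x \<in> carrier (H 1)" "y \<in> carrier (H 2)"
    for x y
    using f2_closed[OF ch that] f2_closed[OF ch that(2,1)] by simp_all
  let ?Mc = "\<lambda>i j q l. Mc f1 f2 1 1 1 (B i j) (B j q) (B q l)"
  \<comment> \<open>Summed over the inner indices, the terms f2(B, BB) and f2(BB, B) cancel in pairs
    by \<open>BBe\<close>, and only \<open>b V\<close> and \<open>V b\<close> remain.\<close>
  have S: "?Mc i False False l \<oplus>\<^bsub>E 2\<^esub> (?Mc i False True l \<oplus>\<^bsub>E 2\<^esub> (?Mc i True False l \<oplus>\<^bsub>E 2\<^esub> ?Mc i True True l))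
      =
      mat_mul b V i l \<oplus>\<^bsub>E 2\<^esub> mat_mul V b i l" for i l
    unfolding M mat_mul_def V_def BBe using B b(3)
    by (simp add: mul_add_left[where l = 2] mul_add_right[where l = 2] f11 f12 t2 m2 vs_ac mE)
  have eMc: "ecl 2 (?Mc i j q l) = tact T 1 1 (B i j) (g [(1, B j q), (1, B q l)]) \<oplus>\<^bsub>H 2\<^esub>
      (g [(2, tact T 1 1 (B i j) (B j q)), (1, B q l)] \<oplus>\<^bsub>H 2\<^esub> (g [(1, B i j), (2, tact T 1 1 (B j q) (B q l))]
        \<oplus>\<^bsub>H 2\<^esub>
      tact T 1 1 (g [(1, B i j), (1, B j q)]) (B q l)))" for i j q l
    using cg[OF B B B, of i j j q q l] cc_app[OF ch B B B, of i j j q q l]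
      hoch_diff_2[OF g B B B, of 2 i j j q q l] by simp
  \<comment> \<open>The same cancellation in the coboundary of \<open>g\<close> removes the terms
    with a product inside \<open>g\<close> and leaves B G + G B.\<close>
  have "ecl 2 (mat_mul b V i l \<oplus>\<^bsub>E 2\<^esub> mat_mul V b i l) = ecl 2 (mat_mul b n i l) \<oplus>\<^bsub>H 2\<^esub> ecl 2 (mat_mul n b i l)"
    for i l
    unfolding S[symmetric] ecl_mat_mul[where b = b and c = n, OF b(1) n(1)] ecl_mat_mul[where b = n
      and c = b, OF n(1) b(1)]
    unfolding b(2) n(2) G_def using Mz B
    by (simp add: ecl_add cocycle_add eMc BBe tact_add_left[OF T_kG, where l = 2] tact_add_right[OF T_kG,
      where l = 2] gc g2c t2 vs_ac)
  then have "massey_vanishes b"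
    using massey_vanishesI[where b = b and V = V and n = n
      and n' = n, OF b(1) V dV n(1) n(1) massey_cocycle[where b = b, OF b(1) V dV]] by simp
  then show ?thesis using b by blast
qed

lemma tcl_sum_cocycle:
  assumes M: "kG_module k G M" and "\<phi> \<in> tate_cocycles k G P M n" "\<psi> \<in> tate_cocycles k G P M n"
  shows "(\<lambda>v\<in>carrier (Ob n). \<phi> v \<oplus>\<^bsub>M\<^esub> \<psi> v) \<in> tate_cocycles k G P M n"
  using add_closed[OF TZ_module[OF M], of \<phi> n \<psi>] assms by (simp add: hom_module_def)

text \<open>The juggling formula: for \<open>\<phi>\<close> annihilated by the matrix, the bracket of \<open>\<phi>\<close> with \<open>b, b\<close>, times \<open>b\<close>,
  equals \<open>\<phi>\<close> times the bracket of \<open>b, b, b\<close>.\<close>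

lemma massey_juggle:
  fixes M :: "('k, 'm, 'g) kG_mod"
  assumes M: "kG_module k G M" and \<phi>: "\<And>i. \<phi> i \<in> tate_cocycles k G P M 0"
    and b: "\<And>i l. b i l \<in> Z 1" and V: "\<And>i l. V i l \<in> carrier (E 1)" "\<And>i l. dd 1 (V i l) = mat_mul b b i l"
    and zero: "\<And>l. tact M 0 1 (tcl M 0 (\<phi> False)) (ecl 1 (b False l)) \<oplus>\<^bsub>HM M 1\<^esub>
      tact M 0 1 (tcl M 0 (\<phi> True)) (ecl 1 (b True l)) = \<zero>\<^bsub>HM M 1\<^esub>"
  shows "\<exists>z. (\<forall>l. z l \<in> carrier (HM M 1)) \<and> (\<forall>m.
      tact M 1 1 (z False) (ecl 1 (b False m)) \<oplus>\<^bsub>HM M 2\<^esub> tact M 1 1 (z True) (ecl 1 (b True m)) =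
      tact M 0 2 (tcl M 0 (\<phi> False)) (ecl 2 (mat_mul b V False m \<oplus>\<^bsub>E 2\<^esub> mat_mul V b False m)) \<oplus>\<^bsub>HM M 2\<^esub>
      tact M 0 2 (tcl M 0 (\<phi> True)) (ecl 2 (mat_mul b V True m \<oplus>\<^bsub>E 2\<^esub> mat_mul V b True m)))"
proof -
  have mM: "module k M" by (rule kG_module_module[OF M])
  have mE: "module k (E m)" for m by (rule module_endo)
  have bE: "\<And>i l. b i l \<in> carrier (E 1)" using b cocycle_endo by auto
  note \<phi>h = tcocycle_hom[OF \<phi>]
  note \<phi>r = kG_homs_rules[OF \<phi>h]
  have \<phi>bd: "\<phi> i (bd P 1 v) = \<zero>\<^bsub>M\<^esub>" if "v \<in> carrier (Ob 1)" for i v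
    using tcocycle_bd[OF \<phi> _ that] by simp
  have b0: "b i l 0 \<in> kG_homs k G (Ob 1) (Ob 0)" and V0: "V i l 0 \<in> kG_homs k G (Ob 1) (Ob 0)" for i l
    by (rule endo_hom[OF bE], simp, rule endo_hom[OF V(1)], simp)
  have b1: "b i l 1 v \<in> carrier (Ob 1)" "V i l 1 v \<in> carrier (Ob 1)" if "v \<in> carrier (Ob 2)" for i l v
    using endo_closed[OF bE, of v 1] endo_closed[OF V(1), of v 1] that by simp_all
  note b0r = kG_homs_rules[OF b0] and V0r = kG_homs_rules[OF V0]
  have bb: "b i l 0 (bd P 2 v) = bd P 1 (b i l 1 v)" if "v \<in> carrier (Ob 2)" for i l v
    using cocycle_bd[OF b that, of 1 0] by simp
  have VV: "bd P 1 (V i l 1 v) \<oplus>\<^bsub>Ob 0\<^esub> V i l 0 (bd P 2 v) = b i False 0 (b False l 1 v) \<oplus>\<^bsub>Ob 0\<^esub> b i True 0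
      (b True l 1 v)"
    if v: "v \<in> carrier (Ob 2)" for i l v
  proof -
    have "dd 1 (V i l) 0 v = bd P 1 (V i l 1 v) \<oplus>\<^bsub>Ob 0\<^esub> V i l 0 (bd P 2 v)" using diff_app[OF V(1), of v 0] v
      by simp
    moreover have "mat_mul b b i l 0 v = b i False 0 (b False l 1 v) \<oplus>\<^bsub>Ob 0\<^esub> b i True 0 (b True l 1 v)"
      unfolding mat_mul_def using v by (simp add: endo_add_app mul_app)
    ultimately show ?thesis using V(2) by simp
  qed
  have bd2: "bd P 2 v \<in> carrier (Ob 1)" if "v \<in> carrier (Ob 2)" for v using that by (auto intro: bd_closed)
  have bd1: "bd P 1 v \<in> carrier (Ob 0)" if "v \<in> carrier (Ob 1)" for v using that by (auto intro: bd_closed)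
  have pb: "compose (carrier (Ob 1)) (\<phi> i) (b i l 0) \<in> tate_cocycles k G P M 1" for i l
    by (rule pull_closed[OF M \<phi> b]) simp
  have "\<exists>w\<in>kG_homs k G (Ob 0) M. \<forall>v\<in>carrier (Ob 1). \<phi> False (b False l 0 v) \<oplus>\<^bsub>M\<^esub> \<phi> True (b True l 0 v) =
      w (bd P 1 v)" for l
  proof -
    have t: "tact M 0 1 (tcl M 0 (\<phi> i)) (ecl 1 (b i l)) = tcl M 1 (compose (carrier (Ob 1)) (\<phi> i) (b i l 0))"
      for i
      using tact_eq[OF M \<phi> b, of i i l] by simp
    have "tcl M 1 (\<lambda>v\<in>carrier (Ob 1). compose (carrier (Ob 1)) (\<phi> False) (b False l 0) v \<oplus>\<^bsub>M\<^esub> compose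
        (carrier (Ob 1)) (\<phi> True) (b True l 0) v) = \<zero>\<^bsub>HM M 1\<^esub>"
      using zero[of l] unfolding t tcl_add[OF M pb pb] .
    from tcl_zeroD[OF M tcl_sum_cocycle[OF M pb pb] this] show ?thesis by (simp add: compose_def)
  qed
  \<comment> \<open>\<open>w\<close> is a primitive of the row \<open>\<phi> b\<close>, whose class
    vanishes by hypothesis.\<close>
  then obtain w where w: "\<And>l. w l \<in> kG_homs k G (Ob 0) M"
    "\<And>l v. v \<in> carrier (Ob 1) \<Longrightarrow> \<phi> False (b False l 0 v) \<oplus>\<^bsub>M\<^esub> \<phi> True (b True l 0 v) = w l (bd P 1 v)" by metis
  note wr = kG_homs_rules[OF w(1)]
  let ?c = "\<lambda>f g. compose (carrier (Ob 1)) f g"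
  \<comment> \<open>The bracket of \<open>\<phi>\<close>, \<open>b\<close>, \<open>b\<close> is
    represented by \<phi> V + w b. This is a cocycle, since each of the two parts has coboundary
    \<phi> b b.\<close>
  define \<psi>1 where "\<psi>1 l = (\<lambda>v\<in>carrier (Ob 1). ?c (\<phi> False) (V False l 0) v \<oplus>\<^bsub>M\<^esub> ?c (\<phi> True) (V True l 0) v)"
    for l
  define \<psi>2 where "\<psi>2 l = (\<lambda>v\<in>carrier (Ob 1). ?c (w False) (b False l 0) v \<oplus>\<^bsub>M\<^esub> ?c (w True) (b True l 0) v)"
    for l
  define \<psi> where "\<psi> l = (\<lambda>v\<in>carrier (Ob 1). \<psi>1 l v \<oplus>\<^bsub>M\<^esub> \<psi>2 l v)" for l
  have c1: "?c (\<phi> i) (V i l 0) \<in> kG_homs k G (Ob 1) M" "?c (w i) (b i l 0) \<in> kG_homs k G (Ob 1) M" for i l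
    by (rule kG_homs_compose[OF V0 \<phi>h Ob_kG], rule kG_homs_compose[OF b0 w(1) Ob_kG])
  have \<psi>h: "\<psi> l \<in> kG_homs k G (Ob 1) M" for l
    unfolding \<psi>_def \<psi>1_def \<psi>2_def using c1 M by (intro kG_homs_add_closed Ob_kG)
  have \<psi>app: "\<psi> l v = (\<phi> False (V False l 0 v) \<oplus>\<^bsub>M\<^esub> \<phi> True (V True l 0 v)) \<oplus>\<^bsub>M\<^esub>
      (w False (b False l 0 v) \<oplus>\<^bsub>M\<^esub> w True (b True l 0 v))"
    if "v \<in> carrier (Ob 1)" for l v
    using that by (simp add: \<psi>_def \<psi>1_def \<psi>2_def compose_def)
  have \<phi>V: "\<phi> i (V i l 0 (bd P 2 v)) = \<phi> i (b i False 0 (b False l 1 v)) \<oplus>\<^bsub>M\<^esub> \<phi> i (b i True 0 (b True l 1 v))"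
    if v: "v \<in> carrier (Ob 2)" for i l v
  proof -
    have "\<phi> i (bd P 1 (V i l 1 v) \<oplus>\<^bsub>Ob 0\<^esub> V i l 0 (bd P 2 v)) =
        \<phi> i (b i False 0 (b False l 1 v) \<oplus>\<^bsub>Ob 0\<^esub> b i True 0 (b True l 1 v))"
      unfolding VV[OF v] ..
    then show ?thesis using v b1 bd1 bd2 b0r V0r \<phi>r by (simp add: \<phi>bd vs_l_zero mM)
  qed
  have wb: "w i (b i l 0 (bd P 2 v)) = \<phi> False (b False i 0 (b i l 1 v)) \<oplus>\<^bsub>M\<^esub> \<phi> True (b True i 0 (b i l 1 v))"
    if v: "v \<in> carrier (Ob 2)" for i l v
    unfolding bb[OF v] using w(2)[OF b1(1)[OF v]] by simp
  have \<psi>Z: "\<psi> l \<in> tate_cocycles k G P M 1" for l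
    unfolding tcocycle_iff
  proof (intro conjI ballI)
    show "\<psi> l \<in> kG_homs k G (Ob 1) M" by (rule \<psi>h)
    fix v assume "v \<in> carrier (Ob (1 + 1))"
    then have v: "v \<in> carrier (Ob 2)" by simp
    have "\<psi> l (bd P 2 v) = \<zero>\<^bsub>M\<^esub>"
      unfolding \<psi>app[OF bd2[OF v]] \<phi>V[OF v] wb[OF v] using b1[OF v] b0r(1) \<phi>r(1) by (simp add: vs_ac mM)
    then show "\<psi> l (bd P (1 + 1) v) = \<zero>\<^bsub>M\<^esub>" by simp
  qed
  have main: "tact M 1 1 (tcl M 1 (\<psi> False)) (ecl 1 (b False m)) \<oplus>\<^bsub>HM M 2\<^esub> tact M 1 1 (tcl M 1 (\<psi> True))
      (ecl 1 (b True m)) =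
      tact M 0 2 (tcl M 0 (\<phi> False)) (ecl 2 (mat_mul b V False m \<oplus>\<^bsub>E 2\<^esub> mat_mul V b False m)) \<oplus>\<^bsub>HM M 2\<^esub>
      tact M 0 2 (tcl M 0 (\<phi> True)) (ecl 2 (mat_mul b V True m \<oplus>\<^bsub>E 2\<^esub> mat_mul V b True m))" for m
  proof -
    let ?m = "\<lambda>i. mat_mul b V i m \<oplus>\<^bsub>E 2\<^esub> mat_mul V b i m"
    have mz: "?m i \<in> Z 2" for i by (rule massey_cocycle[OF b V])
    have t1: "tact M 1 1 (tcl M 1 (\<psi> i)) (ecl 1 (b i m)) = tcl M 2 (compose (carrier (Ob 2)) (\<psi> i) (b i m 1))"
      for i
      using tact_eq[OF M \<psi>Z b, of i i m] by simp
    have t2: "tact M 0 2 (tcl M 0 (\<phi> i)) (ecl 2 (?m i)) = tcl M 2 (compose (carrier (Ob 2)) (\<phi> i) (?m i 0))"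
      for i
      using tact_eq[OF M \<phi> mz, of i i] by simp
    have p1: "compose (carrier (Ob 2)) (\<psi> i) (b i m 1) \<in> tate_cocycles k G P M 2" for i
      by (rule pull_closed[OF M \<psi>Z b]) simp
    have p2: "compose (carrier (Ob 2)) (\<phi> i) (?m i 0) \<in> tate_cocycles k G P M 2" for i
      by (rule pull_closed[OF M \<phi> mz]) simp
    \<comment> \<open>The difference of both sides has the primitive w V: the terms \<phi> V b
      cancel, \<phi> b V equals w bd V, and w b b equals w bd V + w V bd.\<close>
    let ?x = "\<lambda>v\<in>carrier (Ob 1). ?c (w False) (V False m 0) v \<oplus>\<^bsub>M\<^esub> ?c (w True) (V True m 0) v"
    have xh: "?x \<in> kG_homs k G (Ob (2 - 1)) M"
      using kG_homs_add_closed[OF kG_homs_compose[OF V0 w(1) Ob_kG] kG_homs_compose[OF V0 w(1) Ob_kG] Ob_kG M]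
        by simp
    have "(\<psi> False (b False m 1 v) \<oplus>\<^bsub>M\<^esub> \<psi> True (b True m 1 v)) \<oplus>\<^bsub>M\<^esub> (\<phi> False (?m False 0 v) \<oplus>\<^bsub>M\<^esub> \<phi>
        True (?m True 0 v)) = ?x (bd P 2 v)"
      if v: "v \<in> carrier (Ob 2)" for v
    proof -
      have ma: "?m i 0 v = (b i False 0 (V False m 1 v) \<oplus>\<^bsub>Ob 0\<^esub> b i True 0 (V True m 1 v)) \<oplus>\<^bsub>Ob 0\<^esub>
          (V i False 0 (b False m 1 v) \<oplus>\<^bsub>Ob 0\<^esub> V i True 0 (b True m 1 v))" for i
        using v by (simp add: mat_mul_def endo_add_app mul_app)
      have \<phi>m: "\<phi> i (?m i 0 v) = (\<phi> i (b i False 0 (V False m 1 v)) \<oplus>\<^bsub>M\<^esub> \<phi> i (b i True 0 (V True m 1 v))) \<oplus>\<^bsub>M\<^esub>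
          (\<phi> i (V i False 0 (b False m 1 v)) \<oplus>\<^bsub>M\<^esub> \<phi> i (V i True 0 (b True m 1 v)))" for i
        unfolding ma using b1[OF v] b0r V0r \<phi>r by (simp add: add_closed)
      have wV: "w i (b i False 0 (b False m 1 v)) \<oplus>\<^bsub>M\<^esub> w i (b i True 0 (b True m 1 v)) =
          (\<phi> False (b False i 0 (V i m 1 v)) \<oplus>\<^bsub>M\<^esub> \<phi> True (b True i 0 (V i m 1 v))) \<oplus>\<^bsub>M\<^esub> w i
            (V i m 0 (bd P 2 v))" for i
      proof -
        have "w i (b i False 0 (b False m 1 v)) \<oplus>\<^bsub>M\<^esub> w i (b i True 0 (b True m 1 v)) =
            w i (bd P 1 (V i m 1 v) \<oplus>\<^bsub>Ob 0\<^esub> V i m 0 (bd P 2 v))"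
          unfolding VV[OF v] using b1[OF v] b0r wr by simp
        also have "\<dots> = w i (bd P 1 (V i m 1 v)) \<oplus>\<^bsub>M\<^esub> w i (V i m 0 (bd P 2 v))"
          using b1[OF v] bd1 bd2[OF v] V0r wr by simp
        finally show ?thesis using w(2)[OF b1(2)[OF v]] by simp
      qed
      have mem: "\<phi> i (V j l 0 y) \<in> carrier M" "\<phi> i (b j l 0 y) \<in> carrier M" "w i (b j l 0 y) \<in> carrier M"
        "w i (V j l 0 y) \<in> carrier M"
        if "y \<in> carrier (Ob 1)" for i j l y using that b0r V0r \<phi>r wr by simp_all
      note mm = mem[OF b1(1)[OF v]] mem[OF b1(2)[OF v]] mem[OF bd2[OF v]]
      have "(\<psi> False (b False m 1 v) \<oplus>\<^bsub>M\<^esub> \<psi> True (b True m 1 v)) \<oplus>\<^bsub>M\<^esub> (\<phi> False (?m False 0 v) \<oplus>\<^bsub>M\<^esub> \<phi>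
          True (?m True 0 v)) =
          ((w False (b False False 0 (b False m 1 v)) \<oplus>\<^bsub>M\<^esub> w False (b False True 0 (b True m 1 v))) \<oplus>\<^bsub>M\<^esub>
            (w True (b True False 0 (b False m 1 v)) \<oplus>\<^bsub>M\<^esub> w True (b True True 0 (b True m 1 v)))) \<oplus>\<^bsub>M\<^esub>
          ((\<phi> False (b False False 0 (V False m 1 v)) \<oplus>\<^bsub>M\<^esub> \<phi> False (b False True 0 (V True m 1 v))) \<oplus>\<^bsub>M\<^esub>
           (\<phi> True (b True False 0 (V False m 1 v)) \<oplus>\<^bsub>M\<^esub> \<phi> True (b True True 0 (V True m 1 v))))"
        unfolding \<psi>app[OF b1(1)[OF v]] \<phi>m using mm by (simp add: vs_ac mM)
      also have "\<dots> = w False (V False m 0 (bd P 2 v)) \<oplus>\<^bsub>M\<^esub> w True (V True m 0 (bd P 2 v))"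
        unfolding wV using mm by (simp add: vs_ac mM)
      also have "\<dots> = ?x (bd P 2 v)" using bd2[OF v] by (simp add: compose_def)
      finally show ?thesis .
    qed
    then show ?thesis
      unfolding t1 t2 tcl_add[OF M p1 p1] tcl_add[OF M p2 p2]
        tcl_eq[OF M tcl_sum_cocycle[OF M p1 p1] tcl_sum_cocycle[OF M p2 p2]]
      by (intro bexI[OF _ xh]) (simp add: compose_def)
  qed
  show ?thesis
    by (rule exI[of _ "\<lambda>l. tcl M 1 (\<psi> l)"]) (use main tcl_closed[OF M \<psi>Z] in blast)
qed

section \<open>Cokernels that are summands of a realisable module\<close>

context
  fixes B :: "bool \<Rightarrow> bool \<Rightarrow> ('p \<Rightarrow> 'k) set"
  assumes B: "\<And>i l. B i l \<in> carrier (H 1)"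
begin

abbreviation "BC \<equiv> C (B False False) (B False True) (B True False) (B True True)"
definition bcl :: "int \<Rightarrow> ('p \<Rightarrow> 'k) set \<times> ('p \<Rightarrow> 'k) set \<Rightarrow> (('p \<Rightarrow> 'k) set \<times> ('p \<Rightarrow> 'k) set) set" where
  "bcl j w = ccl (B False False) (B False True) (B True False) (B True True) j w"
abbreviation "bmap \<equiv> matrix_map (B False False) (B False True) (B True False) (B True True)"

lemmas B4 = B[of False False] B[of False True] B[of True False] B[of True True]
lemmas BC_simps = C_gact[OF B4, folded bcl_def] C_add[OF B4, folded bcl_def]
  C_closed[OF B4, folded bcl_def]
lemmas BC_eq = C_eq[OF B4, folded bcl_def]
lemmas BC_carrier = C_carrier[OF B4, folded bcl_def]

text \<open>Transported to the sum of the cokernel and \<open>N\<close>, the juggling formula is an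
  equation between pairs. Its cokernel component says that the bracket equals \<open>\<nu> B\<close>
  modulo the image of \<open>B\<close>, and this is membership in the indeterminacy
  \<open>B n + \<nu> B\<close>.\<close>

lemma massey_of_summand:
  fixes R :: "('k, ('p \<Rightarrow> 'k) set, 'r) graded_mod"
  assumes BB: "\<And>i l. tact T 1 1 (B i False) (B False l) \<oplus>\<^bsub>H 2\<^esub> tact T 1 1 (B i True) (B True l) = \<zero>\<^bsub>H 2\<^esub>"
    and summand: "direct_summand k L BC R" and real: "realisable TYPE('m) k G P R"
  shows "\<exists>b. (\<forall>i l. b i l \<in> Z 1 \<and> ecl 1 (b i l) = B i l) \<and> massey_vanishes b"
proof -
  obtain M :: "('k, 'm, 'g) kG_mod" where M: "kG_module k G M" and iso2:
    "graded_iso k L R (tate_module k G P M)"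
    using real unfolding realisable_def by blast
  obtain N :: "('k, ('p \<Rightarrow> 'k) set, 'r) graded_mod" where N: "graded_module k L N" and iso1:
    "graded_iso k L (graded_sum BC N) R"
    using summand unfolding direct_summand_def by blast
  obtain f where f: "\<And>i. f i \<in> linear_maps k (piece R i) (HM M i)" "\<And>i. bij_betw (f i) (carrier (piece R i))
      (carrier (HM M i))"
    "\<And>i j u a. u \<in> carrier (piece R i) \<Longrightarrow> a \<in> carrier (H j) \<Longrightarrow> f (i + j) (gact R i j u a) = tact M i j (f i u) a"
    using iso2 unfolding graded_iso_def tate_module_def L_simps graded_mod.select_convs by blast
  let ?S = "graded_sum BC N"
  obtain g where g: "\<And>i. g i \<in> linear_maps k (piece ?S i) (piece R i)"
    "\<And>i. bij_betw (g i) (carrier (piece ?S i)) (carrier (piece R i))"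
    "\<And>i j u a. u \<in> carrier (piece ?S i) \<Longrightarrow> a \<in> carrier (H j) \<Longrightarrow> g (i + j) (gact ?S i j u a) =
        gact R i j (g i u) a"
    using iso1 unfolding graded_iso_def L_simps by blast
  have Sc: "carrier (piece ?S i) = carrier (piece BC i) \<times> carrier (piece N i)"
    and Sa: "(c, n) \<oplus>\<^bsub>piece ?S i\<^esub> (c', n') = (c \<oplus>\<^bsub>piece BC i\<^esub> c', n \<oplus>\<^bsub>piece N i\<^esub> n')"
    and Sg: "gact ?S i j (c, n) a = (gact BC i j c a, gact N i j n a)" for i j c n c' n' a
    by (simp_all add: graded_sum_def sum_module_def)
  note mN = N[unfolded graded_module_def L_simps]
  have Nm: "module k (piece N i)" for i using mN by blast
  have Nl: "(\<lambda>u\<in>carrier (piece N i). gact N i j u a) \<in> linear_maps k (piece N i) (piece N (i + j))"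
    if "a \<in> carrier (H j)" for i j a
    using mN that by blast
  have Nz: "gact N i j \<zero>\<^bsub>piece N i\<^esub> a = \<zero>\<^bsub>piece N (i + j)\<^esub>" if "a \<in> carrier (H j)" for i j a
    using lin_zero[OF Nl[OF that] Nm Nm] by (simp add: zero_closed[OF Nm])
  have Nc: "gact N i j n a \<in> carrier (piece N (i + j))" if "n \<in> carrier (piece N i)" "a \<in> carrier (H j)"
    for i j n a
    using linear_maps_closed[OF Nl[OF that(2)] that(1)] that by simp
  \<comment> \<open>The composite of the two isomorphisms, from pairs of a cokernel element and an
    element of \<open>N\<close> to Tate cohomology of \<open>M\<close>.\<close>
  define h where "h i c n = f i (g i (c, n))" for i c n
  note fr = linear_maps_rules[OF f(1)] and gr = linear_maps_rules[OF g(1)]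
  have hc: "h i c n \<in> carrier (HM M i)" if "c \<in> carrier (piece BC i)" "n \<in> carrier (piece N i)" for i c n
    unfolding h_def using that by (intro fr(1) gr(1)) (simp add: Sc)
  have ha: "h i (c \<oplus>\<^bsub>piece BC i\<^esub> c') (n \<oplus>\<^bsub>piece N i\<^esub> n') = h i c n \<oplus>\<^bsub>HM M i\<^esub> h i c' n'"
    if "c \<in> carrier (piece BC i)" "n \<in> carrier (piece N i)" "c' \<in> carrier (piece BC i)"
      "n' \<in> carrier (piece N i)" for i c n c' n'
    using that gr(1)[of "(c, n)" i] gr(1)[of "(c', n')" i] gr(2)[of "(c, n)" i "(c', n')"] fr(2)[of
      "g i (c, n)" i "g i (c', n')"]
    unfolding h_def by (simp add: Sc Sa)
  have hg: "h (i + j) (gact BC i j c a) (gact N i j n a) = tact M i j (h i c n) a"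
    if "c \<in> carrier (piece BC i)" "n \<in> carrier (piece N i)" "a \<in> carrier (H j)" for i j c n a
    using that gr(1)[of "(c, n)" i] g(3)[of "(c, n)" i a j] f(3)[of "g i (c, n)" i a j] unfolding h_def
      by (simp add: Sc Sg)
  \<comment> \<open>Only the cokernel component is retained; this is the projection onto the
    summand.\<close>
  have hi: "c = c'" if "h i c n = h i c' n'" "c \<in> carrier (piece BC i)" "n \<in> carrier (piece N i)"
    "c' \<in> carrier (piece BC i)" "n' \<in> carrier (piece N i)"
    for i c n c' n'
  proof -
    have "g i (c, n) = g i (c', n')"
      using that gr(1)[of "(c, n)" i] gr(1)[of "(c', n')" i] bij_betw_imp_inj_on[OF f(2)[of i]] unfolding h_def
        by (simp add: Sc inj_on_def)
    then have "(c, n) = (c', n')"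
      using that bij_betw_imp_inj_on[OF g(2)[of i]] by (simp add: Sc inj_on_def)
    then show ?thesis by simp
  qed
  have hs: "\<exists>c\<in>carrier (piece BC i). \<exists>n\<in>carrier (piece N i). h i c n = z" if z: "z \<in> carrier (HM M i)" for i z
  proof -
    have "z \<in> f i ` carrier (piece R i)" using z bij_betw_imp_surj_on[OF f(2)[of i]] by simp
    then obtain y where y: "y \<in> carrier (piece R i)" "f i y = z" by blast
    have "y \<in> g i ` carrier (piece ?S i)" using y(1) bij_betw_imp_surj_on[OF g(2)[of i]] by simp
    then obtain x where x: "x \<in> carrier (piece ?S i)" "g i x = y" by blast
    show ?thesis using x y unfolding h_def by (cases x) (auto simp: Sc)
  qed
  note z0 = zero_closed[OF H_module] and zN = zero_closed[OF Nm]
  let ?one = "tcl T 0 (aug P)"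
  \<comment> \<open>The images of the two standard generators of the cokernel, with component zero
    in \<open>N\<close>.\<close>
  define u where "u i = (if i then h 0 (bcl 0 (\<zero>\<^bsub>H 0\<^esub>, ?one)) \<zero>\<^bsub>piece N 0\<^esub> else h 0 (bcl 0 (?one,
      \<zero>\<^bsub>H 0\<^esub>)) \<zero>\<^bsub>piece N 0\<^esub>)" for i
  have uc: "u i \<in> carrier (HM M 0)" for i
    unfolding u_def using one_closed z0 zN by (auto intro!: hc BC_simps(3))
  \<comment> \<open>The row \<open>u\<close> times a column is the image of the class of this
    column. Both the vanishing of \<open>u B\<close> and the reading of the juggled side rest on
    this.\<close>
  have EA: "tact M 0 j (u False) x \<oplus>\<^bsub>HM M j\<^esub> tact M 0 j (u True) y = h j (bcl j (x, y)) \<zero>\<^bsub>piece N j\<^esub>"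
    if x: "x \<in> carrier (H j)" and y: "y \<in> carrier (H j)" for j x y
  proof -
    have 1: "tact M 0 j (u False) x = h j (bcl j (x, \<zero>\<^bsub>H j\<^esub>)) \<zero>\<^bsub>piece N j\<^esub>"
      unfolding u_def using hg[of "bcl 0 (?one, \<zero>\<^bsub>H 0\<^esub>)" 0 "\<zero>\<^bsub>piece N 0\<^esub>" x j] x one_closed z0 zN
      by (simp add: BC_simps one_tact tact_zero_left[where l = j] Nz)
    have 2: "tact M 0 j (u True) y = h j (bcl j (\<zero>\<^bsub>H j\<^esub>, y)) \<zero>\<^bsub>piece N j\<^esub>"
      unfolding u_def using hg[of "bcl 0 (\<zero>\<^bsub>H 0\<^esub>, ?one)" 0 "\<zero>\<^bsub>piece N 0\<^esub>" y j] y one_closed z0 zN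
      by (simp add: BC_simps one_tact tact_zero_left[where l = j] Nz)
    have "h j (bcl j (x, \<zero>\<^bsub>H j\<^esub>) \<oplus>\<^bsub>piece BC j\<^esub> bcl j (\<zero>\<^bsub>H j\<^esub>, y)) (\<zero>\<^bsub>piece N j\<^esub> \<oplus>\<^bsub>piece N j\<^esub> \<zero>\<^bsub>piece N j\<^esub>) =
        h j (bcl j (x, \<zero>\<^bsub>H j\<^esub>)) \<zero>\<^bsub>piece N j\<^esub> \<oplus>\<^bsub>HM M j\<^esub> h j (bcl j (\<zero>\<^bsub>H j\<^esub>, y)) \<zero>\<^bsub>piece N j\<^esub>"
      using x y z0 zN by (intro ha BC_simps(3))
    then show ?thesis unfolding 1 2 using x y z0 zN by (simp add: BC_simps vs_l_zero vs_r_zero Nm)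
  qed
  have "\<exists>\<phi>. \<phi> \<in> tate_cocycles k G P M 0 \<and> tcl M 0 \<phi> = u i" for i using uc[of i] unfolding HM_carrier[OF M]
    by auto
  then obtain \<phi> where \<phi>: "\<And>i. \<phi> i \<in> tate_cocycles k G P M 0" "\<And>i. tcl M 0 (\<phi> i) = u i" by metis
  have "\<exists>b. b \<in> Z 1 \<and> ecl 1 b = B i l" for i l using ecl_surj[OF B] by blast
  then obtain b where b: "\<And>i l. b i l \<in> Z 1" "\<And>i l. ecl 1 (b i l) = B i l" by metis
  have "ecl 2 (mat_mul b b i l) = \<zero>\<^bsub>H 2\<^esub>" for i l
    unfolding ecl_mat_mul[where b = b and c = b, OF b(1) b(1)] b(2) by (rule BB)
  then have "\<exists>v\<in>carrier (E 1). dd 1 v = mat_mul b b i l" for i l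
    using ecl_eq_zero[OF mat_mul_cocycle[where b = b and c = b, OF b(1) b(1)], of i l] by simp
  then obtain V where V: "\<And>i l. V i l \<in> carrier (E 1)" "\<And>i l. dd 1 (V i l) = mat_mul b b i l" by metis
  have "tact M 0 1 (u False) (B False l) \<oplus>\<^bsub>HM M 1\<^esub> tact M 0 1 (u True) (B True l) = \<zero>\<^bsub>HM M 1\<^esub>" for l
  proof -
    have t: "tact T 1 0 (B i j) ?one = B i j" "tact T 1 0 (B i j) \<zero>\<^bsub>H 0\<^esub> = \<zero>\<^bsub>H 1\<^esub>" for i j
      using tact_one[OF T_kG B] tact_zero_right[OF B, of 1 0] by simp_all
    \<comment> \<open>Column \<open>l\<close> of the matrix is its value on the unit vector with
      index \<open>l\<close>, hence zero in the cokernel.\<close>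
    have "(B False l, B True l) = bmap 1 (if l then (\<zero>\<^bsub>H 0\<^esub>, ?one) else (?one, \<zero>\<^bsub>H 0\<^esub>))"
      unfolding matrix_map_def[OF B B B B] using B by (simp add: t vs_l_zero vs_r_zero)
    moreover have "(if l then (\<zero>\<^bsub>H 0\<^esub>, ?one) else (?one, \<zero>\<^bsub>H 0\<^esub>)) \<in> carrier (H (1 - 1)) \<times> carrier (H (1 - 1))"
      using one_closed z0 by simp
    ultimately have "(B False l, B True l) \<in> bmap 1 ` (carrier (H (1 - 1)) \<times> carrier (H (1 - 1)))"
      by (rule image_eqI)
    then have "bcl 1 (B False l, B True l) = bcl 1 (\<zero>\<^bsub>H 1\<^esub>, \<zero>\<^bsub>H 1\<^esub>)"
      using BC_eq[OF B B z0 z0, of False l True l] B by (simp add: vs_r_zero)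
    then have eq: "tact M 0 1 (u False) (B False l) \<oplus>\<^bsub>HM M 1\<^esub> tact M 0 1 (u True) (B True l) =
        tact M 0 1 (u False) \<zero>\<^bsub>H 1\<^esub> \<oplus>\<^bsub>HM M 1\<^esub> tact M 0 1 (u True) \<zero>\<^bsub>H 1\<^esub>"
      using EA[OF B B] EA[OF z0 z0] by metis
    have "tact M 0 1 (u i) \<zero>\<^bsub>H 1\<^esub> = \<zero>\<^bsub>HM M 1\<^esub>" for i
      using tact_add_right[OF M uc[of i] z0[of 1] z0[of 1], of 1] tact_closed[OF M uc[of i] z0[of 1], of 1]
        by (simp add: vs_self z0 HM_module[OF M])
    then show ?thesis unfolding eq by (simp add: vs_self zero_closed HM_module[OF M])
  qed
  then obtain z where z: "\<And>l. z l \<in> carrier (HM M 1)"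
    "\<And>m. tact M 1 1 (z False) (B False m) \<oplus>\<^bsub>HM M 2\<^esub> tact M 1 1 (z True) (B True m) =
      tact M 0 2 (u False) (ecl 2 (mat_mul b V False m \<oplus>\<^bsub>E 2\<^esub> mat_mul V b False m)) \<oplus>\<^bsub>HM M 2\<^esub>
      tact M 0 2 (u True) (ecl 2 (mat_mul b V True m \<oplus>\<^bsub>E 2\<^esub> mat_mul V b True m))"
    using massey_juggle[where b = b and V = V and \<phi> = \<phi>, OF M \<phi>(1) b(1) V] unfolding b(2) \<phi>(2) by blast
  have "\<exists>x y n. x \<in> carrier (H 1) \<and> y \<in> carrier (H 1) \<and> n \<in> carrier (piece N 1) \<and> h 1 (bcl 1 (x, y)) n = z l"
    for l
    using hs[OF z(1)[of l]] unfolding BC_carrier by blast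
  then obtain xx yy nn where xy: "\<And>l. xx l \<in> carrier (H 1)" "\<And>l. yy l \<in> carrier (H 1)"
    "\<And>l. nn l \<in> carrier (piece N 1)"
    "\<And>l. h 1 (bcl 1 (xx l, yy l)) (nn l) = z l" by metis
  \<comment> \<open>Column \<open>l\<close> of \<open>\<nu>\<close> represents the cokernel
    component of \<open>z l\<close>.\<close>
  define \<nu> where "\<nu> i l = (if i then yy l else xx l)" for i l
  have \<nu>: "\<nu> i l \<in> carrier (H 1)" for i l using xy by (simp add: \<nu>_def)
  have t2: "tact T 1 1 x y \<in> carrier (H 2)" if "x \<in> carrier (H 1)" "y \<in> carrier (H 1)" for x y
    using tact_closed[OF T_kG that] by simp
  define mm where "mm i m = ecl 2 (mat_mul b V i m \<oplus>\<^bsub>E 2\<^esub> mat_mul V b i m)" for i m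
  have mmc: "mm i m \<in> carrier (H 2)" for i m unfolding mm_def by (rule ecl_closed[OF massey_cocycle[OF b(1) V]])
  let ?s = "\<lambda>i m. tact T 1 1 (\<nu> i False) (B False m) \<oplus>\<^bsub>H 2\<^esub> tact T 1 1 (\<nu> i True) (B True m)"
  have sc: "?s i m \<in> carrier (H 2)" for i m using \<nu> B by (simp add: t2 add_closed)
  \<comment> \<open>For each \<open>m\<close>, column \<open>m\<close> of the bracket differs from
    that of \<open>\<nu> B\<close> by an element in the image of the matrix; a preimage becomes
    column \<open>m\<close> of the matrix \<open>n\<close> assembled afterwards.\<close>
  have ex: "\<exists>n. \<forall>i. n i \<in> carrier (H 1) \<and> mm i m =
      (tact T 1 1 (B i False) (n False) \<oplus>\<^bsub>H 2\<^esub> tact T 1 1 (B i True) (n True)) \<oplus>\<^bsub>H 2\<^esub> ?s i m" for m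
  proof -
    have c1: "bcl 1 (\<nu> False l, \<nu> True l) \<in> carrier (piece BC 1)" for l using \<nu> by (intro BC_simps(3))
    have ng: "gact N 1 1 (nn l) (B l m) \<in> carrier (piece N 2)" for l using Nc[OF xy(3)[of l] B[of l m]] by simp
    have gc: "gact BC 1 1 (bcl 1 (\<nu> False l, \<nu> True l)) (B l m) = bcl 2 (tact T 1 1 (\<nu> False l) (B l m),
        tact T 1 1 (\<nu> True l) (B l m))" for l
      using BC_simps(1)[OF \<nu>[of False l] \<nu>[of True l] B[of l m]] by simp
    have tz: "tact M 1 1 (z l) (B l m) =
        h 2 (bcl 2 (tact T 1 1 (\<nu> False l) (B l m), tact T 1 1 (\<nu> True l) (B l m))) (gact N 1 1 (nn l) (B l m))"
        for l
      using hg[OF c1[of l] xy(3)[of l] B[of l m]] xy(4)[of l] unfolding gc by (simp add: \<nu>_def)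
    have "h 2 (bcl 2 (?s False m, ?s True m)) (gact N 1 1 (nn False) (B False m) \<oplus>\<^bsub>piece N 2\<^esub> gact N 1 1
        (nn True) (B True m)) =
        tact M 1 1 (z False) (B False m) \<oplus>\<^bsub>HM M 2\<^esub> tact M 1 1 (z True) (B True m)"
      unfolding tz using \<nu> B t2 ng
        ha[of "bcl 2 (tact T 1 1 (\<nu> False False) (B False m), tact T 1 1 (\<nu> True False) (B False m))" 2
          "gact N 1 1 (nn False) (B False m)"
          "bcl 2 (tact T 1 1 (\<nu> False True) (B True m), tact T 1 1 (\<nu> True True) (B True m))"
            "gact N 1 1 (nn True) (B True m)"]
      by (simp add: BC_simps)
    also have "\<dots> = h 2 (bcl 2 (mm False m, mm True m)) \<zero>\<^bsub>piece N 2\<^esub>"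
      unfolding z(2) mm_def[symmetric] by (rule EA[OF mmc mmc])
    finally have "bcl 2 (?s False m, ?s True m) = bcl 2 (mm False m, mm True m)"
      by (rule hi) (use sc mmc ng zN in \<open>simp_all add: BC_simps add_closed[OF Nm]\<close>)
    then have "(?s False m \<oplus>\<^bsub>H 2\<^esub> mm False m, ?s True m \<oplus>\<^bsub>H 2\<^esub> mm True m) \<in> bmap 2 `
        (carrier (H (2 - 1)) \<times> carrier (H (2 - 1)))"
      using BC_eq[OF sc sc mmc mmc, of False m True m False m True m] by simp
    then obtain x y where xy': "x \<in> carrier (H 1)" "y \<in> carrier (H 1)"
      "(?s False m \<oplus>\<^bsub>H 2\<^esub> mm False m, ?s True m \<oplus>\<^bsub>H 2\<^esub> mm True m) = bmap 2 (x, y)" by auto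
    have r: "mm i m = (?s i m \<oplus>\<^bsub>H 2\<^esub> mm i m) \<oplus>\<^bsub>H 2\<^esub> ?s i m" for i
      using sc[of i m] mmc[of i m] vs_comm[OF H_module sc mmc, of i m i m]
        by (simp add: vs_assoc vs_self vs_r_zero)
    have e: "?s False m \<oplus>\<^bsub>H 2\<^esub> mm False m = tact T 1 1 (B False False) x \<oplus>\<^bsub>H 2\<^esub> tact T 1 1 (B False True) y"
      "?s True m \<oplus>\<^bsub>H 2\<^esub> mm True m = tact T 1 1 (B True False) x \<oplus>\<^bsub>H 2\<^esub> tact T 1 1 (B True True) y"
      using xy'(3) unfolding matrix_map_def[OF B B B B] by simp_all
    show ?thesis
    proof (intro exI[of _ "\<lambda>i. if i then y else x"] allI conjI)
      fix i
      show "(if i then y else x) \<in> carrier (H 1)" using xy' by simp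
      show "mm i m = (tact T 1 1 (B i False) (if False then y else x) \<oplus>\<^bsub>H 2\<^esub> tact T 1 1 (B i True)
          (if True then y else x)) \<oplus>\<^bsub>H 2\<^esub> ?s i m"
      proof (cases i)
        case True
        then show ?thesis using r[of True] unfolding e(2) by simp
      next
        case False
        then show ?thesis using r[of False] unfolding e(1) by simp
      qed
    qed
  qed
  obtain n where n: "\<And>i m. n i m \<in> carrier (H 1)"
    "\<And>i m. mm i m = (tact T 1 1 (B i False) (n False m) \<oplus>\<^bsub>H 2\<^esub> tact T 1 1 (B i True) (n True m)) \<oplus>\<^bsub>H 2\<^esub> ?s i m"
  proof -
    have "\<exists>n. \<forall>m i. n m i \<in> carrier (H 1) \<and> mm i m =
        (tact T 1 1 (B i False) (n m False) \<oplus>\<^bsub>H 2\<^esub> tact T 1 1 (B i True) (n m True)) \<oplus>\<^bsub>H 2\<^esub> ?s i m"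
      by (rule choice) (use ex in blast)
    then obtain n where "\<forall>m i. n m i \<in> carrier (H 1) \<and> mm i m =
        (tact T 1 1 (B i False) (n m False) \<oplus>\<^bsub>H 2\<^esub> tact T 1 1 (B i True) (n m True)) \<oplus>\<^bsub>H 2\<^esub> ?s i m" by blast
    then show thesis using that[of "\<lambda>i m. n m i"] by blast
  qed
  have "\<exists>c. c \<in> Z 1 \<and> ecl 1 c = n i l" "\<exists>c. c \<in> Z 1 \<and> ecl 1 c = \<nu> i l" for i l
    using ecl_surj[OF n(1)] ecl_surj[OF \<nu>] by blast+
  then obtain c c' where c: "\<And>i l. c i l \<in> Z 1" "\<And>i l. ecl 1 (c i l) = n i l" and c': "\<And>i l. c' i l \<in> Z 1"
    "\<And>i l. ecl 1 (c' i l) = \<nu> i l"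
    by metis
  have "massey_vanishes b"
  proof (rule massey_vanishesI[where b = b and V = V and n = c
    and n' = c', OF b(1) V c(1) c'(1) massey_cocycle[OF b(1) V]])
    show "ecl 2 (mat_mul b V i l \<oplus>\<^bsub>E 2\<^esub> mat_mul V b i l) =
        ecl 2 (mat_mul b c i l) \<oplus>\<^bsub>H 2\<^esub> ecl 2 (mat_mul c' b i l)" for i l
      unfolding ecl_mat_mul[where b = b and c = c, OF b(1) c(1)] ecl_mat_mul[where b = c'
        and c = b, OF c'(1) b(1)]
        mm_def[symmetric] b(2) c(2) c'(2) by (rule n(2))
  qed
  then show ?thesis using b by blast
qed

end

end

section \<open>Twisted complexes\<close>

text \<open>The twisted complex will be evaluated on two basis vectors and their sum only, so
  additivity captures all the linearity in question.\<close>

definition additive_map :: "('k, 'v, 'd) module_scheme \<Rightarrow> ('k, 'w, 'e) module_scheme \<Rightarrow> ('v \<Rightarrow> 'w) \<Rightarrow> bool" where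
  "additive_map V W f \<longleftrightarrow> (\<forall>v\<in>carrier V. f v \<in> carrier W) \<and>
     (\<forall>u\<in>carrier V. \<forall>v\<in>carrier V. f (u \<oplus>\<^bsub>V\<^esub> v) = f u \<oplus>\<^bsub>W\<^esub> f v)"

lemma additive_mapD:
  assumes "additive_map V W f"
  shows "v \<in> carrier V \<Longrightarrow> f v \<in> carrier W" "u \<in> carrier V \<Longrightarrow> v \<in> carrier V \<Longrightarrow> f (u \<oplus>\<^bsub>V\<^esub> v) = f u \<oplus>\<^bsub>W\<^esub> f v"
  using assms unfolding additive_map_def by auto

text \<open>The differential \<open>d + b + V + W\<close> on four copies of a resolution \<open>X2 \<rightarrow> X1 \<rightarrow> X0 \<rightarrow> F\<close>, strictly
  triangular in the copies: \<open>b\<close> raises the index of the copy by one, \<open>V\<close> (from copy 0) and \<open>V'\<close>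
  (from copy 1) by two, \<open>W\<close> by three. Its square vanishes.\<close>

locale twisted = char2 k
  for k :: "('k, 'c) ring_scheme" +
  fixes X0 :: "('k, 'x) module" and X1 :: "('k, 'y) module" and X2 :: "('k, 'z) module" and F ::
    "('k, 'f) module"
    and d1 b1 V1 V1' W1 :: "'y \<Rightarrow> 'x" and d2 b2 V2 V2' W2 :: "'z \<Rightarrow> 'y"
    and e :: "'x \<Rightarrow> 'f" and s :: "'f \<Rightarrow> 'x"
  assumes mods: "module k X0" "module k X1" "module k X2" "module k F"
    and add1: "additive_map X1 X0 d1" "additive_map X1 X0 b1" "additive_map X1 X0 V1" "additive_map X1 X0 V1'"
      "additive_map X1 X0 W1"
    and add2: "additive_map X2 X1 d2" "additive_map X2 X1 b2" "additive_map X2 X1 V2" "additive_map X2 X1 V2'"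
      "additive_map X2 X1 W2"
    and adde: "additive_map X0 F e" and adds: "additive_map F X0 s"
    and sq: "\<And>r. r \<in> carrier X2 \<Longrightarrow> d1 (b2 r) = b1 (d2 r)"
      "\<And>r. r \<in> carrier X2 \<Longrightarrow> d1 (V2 r) \<oplus>\<^bsub>X0\<^esub> V1 (d2 r) = b1 (b2 r)"
      "\<And>r. r \<in> carrier X2 \<Longrightarrow> d1 (V2' r) \<oplus>\<^bsub>X0\<^esub> V1' (d2 r) = b1 (b2 r)"
      "\<And>r. r \<in> carrier X2 \<Longrightarrow> d1 (W2 r) \<oplus>\<^bsub>X0\<^esub> W1 (d2 r) = b1 (V2 r) \<oplus>\<^bsub>X0\<^esub> V1' (b2 r)"
    and exact1: "\<And>z. z \<in> carrier X1 \<Longrightarrow> d1 z = \<zero>\<^bsub>X0\<^esub> \<Longrightarrow> \<exists>r\<in>carrier X2. z = d2 r"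
    and exact0: "\<And>x. x \<in> carrier X0 \<Longrightarrow> e x = \<zero>\<^bsub>F\<^esub> \<Longrightarrow> \<exists>z\<in>carrier X1. x = d1 z"
    and ed: "\<And>z. z \<in> carrier X1 \<Longrightarrow> e (d1 z) = \<zero>\<^bsub>F\<^esub>"
    and es: "\<And>x. x \<in> carrier F \<Longrightarrow> e (s x) = x"
begin

lemmas cl = add1[THEN additive_mapD(1)] add2[THEN additive_mapD(1)] adde[THEN additive_mapD(1)]
  adds[THEN additive_mapD(1)]
lemmas ad = add1[THEN additive_mapD(2)] add2[THEN additive_mapD(2)] adde[THEN additive_mapD(2)]
  adds[THEN additive_mapD(2)]
lemmas ac0 = vs_ac[OF mods(1)]
lemmas ac1 = vs_ac[OF mods(2)]
lemmas acF = vs_ac[OF mods(4)]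

lemma additive_zero: "additive_map V W f \<Longrightarrow> module k V \<Longrightarrow> module k W \<Longrightarrow> f \<zero>\<^bsub>V\<^esub> = \<zero>\<^bsub>W\<^esub>"
  using additive_mapD(2)[of V W f "\<zero>\<^bsub>V\<^esub>" "\<zero>\<^bsub>V\<^esub>"] additive_mapD(1)[of V W f "\<zero>\<^bsub>V\<^esub>"]
  by (simp add: vs_self zero_closed)

text \<open>The boundaries of the twisted differential, with one component for each copy. The
  representation lives on four copies of \<open>X0\<close> modulo these boundaries; it is handled
  through the relation instead of a quotient module.\<close>

definition Bd where
  "Bd x0 x1 x2 x3 \<longleftrightarrow> (\<exists>z0\<in>carrier X1. \<exists>z1\<in>carrier X1. \<exists>z2\<in>carrier X1. \<exists>z3\<in>carrier X1.
     x0 = d1 z0 \<and> x1 = d1 z1 \<oplus>\<^bsub>X0\<^esub> b1 z0 \<and> x2 = d1 z2 \<oplus>\<^bsub>X0\<^esub> (b1 z1 \<oplus>\<^bsub>X0\<^esub> V1 z0) \<and>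
     x3 = d1 z3 \<oplus>\<^bsub>X0\<^esub> (b1 z2 \<oplus>\<^bsub>X0\<^esub> (V1' z1 \<oplus>\<^bsub>X0\<^esub> W1 z0)))"

lemma Bd_add:
  assumes "Bd x0 x1 x2 x3" "Bd y0 y1 y2 y3"
  shows "Bd (x0 \<oplus>\<^bsub>X0\<^esub> y0) (x1 \<oplus>\<^bsub>X0\<^esub> y1) (x2 \<oplus>\<^bsub>X0\<^esub> y2) (x3 \<oplus>\<^bsub>X0\<^esub> y3)"
proof -
  obtain z0 z1 z2 z3 where z: "z0 \<in> carrier X1" "z1 \<in> carrier X1" "z2 \<in> carrier X1" "z3 \<in> carrier X1"
    "x0 = d1 z0" "x1 = d1 z1 \<oplus>\<^bsub>X0\<^esub> b1 z0" "x2 = d1 z2 \<oplus>\<^bsub>X0\<^esub> (b1 z1 \<oplus>\<^bsub>X0\<^esub> V1 z0)"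
    "x3 = d1 z3 \<oplus>\<^bsub>X0\<^esub> (b1 z2 \<oplus>\<^bsub>X0\<^esub> (V1' z1 \<oplus>\<^bsub>X0\<^esub> W1 z0))"
    using assms(1) unfolding Bd_def by blast
  obtain w0 w1 w2 w3 where w: "w0 \<in> carrier X1" "w1 \<in> carrier X1" "w2 \<in> carrier X1" "w3 \<in> carrier X1"
    "y0 = d1 w0" "y1 = d1 w1 \<oplus>\<^bsub>X0\<^esub> b1 w0" "y2 = d1 w2 \<oplus>\<^bsub>X0\<^esub> (b1 w1 \<oplus>\<^bsub>X0\<^esub> V1 w0)"
    "y3 = d1 w3 \<oplus>\<^bsub>X0\<^esub> (b1 w2 \<oplus>\<^bsub>X0\<^esub> (V1' w1 \<oplus>\<^bsub>X0\<^esub> W1 w0))"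
    using assms(2) unfolding Bd_def by blast
  show ?thesis unfolding Bd_def
    by (rule bexI[of _ "z0 \<oplus>\<^bsub>X1\<^esub> w0"], rule bexI[of _ "z1 \<oplus>\<^bsub>X1\<^esub> w1"], rule bexI[of _ "z2 \<oplus>\<^bsub>X1\<^esub> w2"], rule
      bexI[of _ "z3 \<oplus>\<^bsub>X1\<^esub> w3"])
      (use z(1-4) w(1-4) in \<open>simp_all add: z(5-8) w(5-8) ad cl ac0 ac1\<close>)
qed

text \<open>The copy with the highest index is detected by \<open>e\<close>, since the square of the twisted
  differential vanishes and the resolution is exact.\<close>

lemma Bd_top:
  assumes "Bd \<zero>\<^bsub>X0\<^esub> \<zero>\<^bsub>X0\<^esub> \<zero>\<^bsub>X0\<^esub> (s x)" and x: "x \<in> carrier F"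
  shows "x = \<zero>\<^bsub>F\<^esub>"
proof -
  note q0 = vs_eq[OF mods(1)] and q1 = vs_eq[OF mods(2)]
  obtain z0 z1 z2 z3 where z: "z0 \<in> carrier X1" "z1 \<in> carrier X1" "z2 \<in> carrier X1" "z3 \<in> carrier X1"
    and e0: "\<zero>\<^bsub>X0\<^esub> = d1 z0" and e1: "\<zero>\<^bsub>X0\<^esub> = d1 z1 \<oplus>\<^bsub>X0\<^esub> b1 z0" and e2: "\<zero>\<^bsub>X0\<^esub> =
        d1 z2 \<oplus>\<^bsub>X0\<^esub> (b1 z1 \<oplus>\<^bsub>X0\<^esub> V1 z0)"
    and e3: "s x = d1 z3 \<oplus>\<^bsub>X0\<^esub> (b1 z2 \<oplus>\<^bsub>X0\<^esub> (V1' z1 \<oplus>\<^bsub>X0\<^esub> W1 z0))"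
    using assms(1) unfolding Bd_def by blast
  \<comment> \<open>The chain with components \<open>z0\<close> to \<open>z3\<close> has zero
    boundary in the copies 0, 1, 2. By exactness its components are changed copy after copy by the
    twisted boundary of a chain \<open>r0\<close>, \<open>r1\<close>, \<open>r2\<close>, until only
    the last one is left.\<close>
  obtain r0 where r0: "r0 \<in> carrier X2" "z0 = d2 r0" using exact1[OF z(1)] e0 by auto
  have "d1 z1 = b1 z0" using e1 q0[of "d1 z1" "b1 z0"] z cl by simp
  then have "d1 (z1 \<oplus>\<^bsub>X1\<^esub> b2 r0) = \<zero>\<^bsub>X0\<^esub>" using z r0 by (simp add: ad cl sq(1) ac0)
  then obtain r1 where r1: "r1 \<in> carrier X2" "z1 \<oplus>\<^bsub>X1\<^esub> b2 r0 = d2 r1" using exact1[of "z1 \<oplus>\<^bsub>X1\<^esub> b2 r0"] z r0 cl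
    by (auto simp: ac1)
  have z1: "z1 = d2 r1 \<oplus>\<^bsub>X1\<^esub> b2 r0" using r1(2)[symmetric] z r0 cl by (simp add: ac1)
  have s2: "V1 (d2 r) = b1 (b2 r) \<oplus>\<^bsub>X0\<^esub> d1 (V2 r)" "V1' (d2 r) = b1 (b2 r) \<oplus>\<^bsub>X0\<^esub> d1 (V2' r)"
    "W1 (d2 r) = b1 (V2 r) \<oplus>\<^bsub>X0\<^esub> (V1' (b2 r) \<oplus>\<^bsub>X0\<^esub> d1 (W2 r))" if "r \<in> carrier X2" for r
  proof -
    have "V1 (d2 r) = (d1 (V2 r) \<oplus>\<^bsub>X0\<^esub> V1 (d2 r)) \<oplus>\<^bsub>X0\<^esub> d1 (V2 r)" using that cl by (simp add: ac0)
    then show "V1 (d2 r) = b1 (b2 r) \<oplus>\<^bsub>X0\<^esub> d1 (V2 r)" unfolding sq(2)[OF that] .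
    have "V1' (d2 r) = (d1 (V2' r) \<oplus>\<^bsub>X0\<^esub> V1' (d2 r)) \<oplus>\<^bsub>X0\<^esub> d1 (V2' r)" using that cl by (simp add: ac0)
    then show "V1' (d2 r) = b1 (b2 r) \<oplus>\<^bsub>X0\<^esub> d1 (V2' r)" unfolding sq(3)[OF that] .
    have "W1 (d2 r) = (d1 (W2 r) \<oplus>\<^bsub>X0\<^esub> W1 (d2 r)) \<oplus>\<^bsub>X0\<^esub> d1 (W2 r)" using that cl by (simp add: ac0)
    then show "W1 (d2 r) = b1 (V2 r) \<oplus>\<^bsub>X0\<^esub> (V1' (b2 r) \<oplus>\<^bsub>X0\<^esub> d1 (W2 r))" unfolding sq(4)[OF that] using that cl
      by (simp add: vs_assoc mods)
  qed
  have "d1 z2 = b1 z1 \<oplus>\<^bsub>X0\<^esub> V1 z0" using e2 q0[of "d1 z2" "b1 z1 \<oplus>\<^bsub>X0\<^esub> V1 z0"] z cl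
    by (simp add: add_closed mods)
  then have dz2: "d1 z2 = d1 (b2 r1) \<oplus>\<^bsub>X0\<^esub> d1 (V2 r0)" using r0 r1(1) cl by (simp add: z1 r0(2) ad s2 sq(1) ac0)
  let ?y = "z2 \<oplus>\<^bsub>X1\<^esub> (b2 r1 \<oplus>\<^bsub>X1\<^esub> V2 r0)"
  have "d1 ?y = \<zero>\<^bsub>X0\<^esub>" using z r0(1) r1(1) cl by (simp add: ad dz2 ac0 ac1(1))
  then obtain r2 where r2: "r2 \<in> carrier X2" "?y = d2 r2" using exact1[of ?y] z r0(1) r1(1) cl
    by (auto simp: ac1(1))
  have z2: "z2 = d2 r2 \<oplus>\<^bsub>X1\<^esub> (b2 r1 \<oplus>\<^bsub>X1\<^esub> V2 r0)" using r2(2)[symmetric] z r0(1) r1(1) cl by (simp add: ac1)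
  \<comment> \<open>As the twisted differential squares to zero, subtracting the boundary of
    \<open>r0\<close>, \<open>r1\<close>, \<open>r2\<close> does not change the result; the
    remaining component enters through \<open>d1\<close> alone, which \<open>e\<close>
    kills.\<close>
  have "s x = d1 (z3 \<oplus>\<^bsub>X1\<^esub> (b2 r2 \<oplus>\<^bsub>X1\<^esub> (V2' r1 \<oplus>\<^bsub>X1\<^esub> W2 r0)))"
    unfolding e3 using z(4) r0(1) r1(1) r2(1) cl by (simp add: z1 z2 r0(2) ad s2 sq(1)[symmetric] ac0 ac1(1))
  then have "e (s x) = \<zero>\<^bsub>F\<^esub>" using z(4) r0(1) r1(1) r2(1) cl by (simp add: ed ac1(1))
  then show ?thesis using es[OF x] by simp
qed

text \<open>The map \<open>g\<close> acts diagonally on the four copies; stability means that it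
  descends to the quotient by boundaries.\<close>

definition stable :: "('x \<Rightarrow> 'x) \<Rightarrow> bool" where
  "stable g \<longleftrightarrow> additive_map X0 X0 g \<and> (\<forall>x0 x1 x2 x3. Bd x0 x1 x2 x3 \<longrightarrow> Bd (g x0) (g x1) (g x2) (g x3))"

lemma stable_compose: "stable g \<Longrightarrow> stable h \<Longrightarrow> stable (\<lambda>x. h (g x))"
  unfolding stable_def additive_map_def by auto

lemma stableI:
  assumes g0: "additive_map X0 X0 g0" and g1: "additive_map X1 X1 g1"
    and c: "\<And>z. z \<in> carrier X1 \<Longrightarrow> d1 (g1 z) = g0 (d1 z)" "\<And>z. z \<in> carrier X1 \<Longrightarrow> b1 (g1 z) = g0 (b1 z)"
      "\<And>z. z \<in> carrier X1 \<Longrightarrow> V1 (g1 z) = g0 (V1 z)" "\<And>z. z \<in> carrier X1 \<Longrightarrow> V1' (g1 z) = g0 (V1' z)"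
      "\<And>z. z \<in> carrier X1 \<Longrightarrow> W1 (g1 z) = g0 (W1 z)"
  shows "stable g0"
proof -
  note g = additive_mapD[OF g0] additive_mapD[OF g1]
  have "Bd (g0 x0) (g0 x1) (g0 x2) (g0 x3)" if B: "Bd x0 x1 x2 x3" for x0 x1 x2 x3
  proof -
    obtain z0 z1 z2 z3 where z: "z0 \<in> carrier X1" "z1 \<in> carrier X1" "z2 \<in> carrier X1" "z3 \<in> carrier X1"
      "x0 = d1 z0" "x1 = d1 z1 \<oplus>\<^bsub>X0\<^esub> b1 z0" "x2 = d1 z2 \<oplus>\<^bsub>X0\<^esub> (b1 z1 \<oplus>\<^bsub>X0\<^esub> V1 z0)"
      "x3 = d1 z3 \<oplus>\<^bsub>X0\<^esub> (b1 z2 \<oplus>\<^bsub>X0\<^esub> (V1' z1 \<oplus>\<^bsub>X0\<^esub> W1 z0))"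
      using B unfolding Bd_def by blast
    show ?thesis unfolding Bd_def
      by (rule bexI[of _ "g1 z0"], rule bexI[of _ "g1 z1"], rule bexI[of _ "g1 z2"], rule bexI[of _ "g1 z3"])
        (use z(1-4) in \<open>simp_all add: z(5-8) g cl c ac0(1)\<close>)
  qed
  then show ?thesis using g0 unfolding stable_def by blast
qed

text \<open>\<open>R0\<close>, \<open>R1\<close>, \<open>R2\<close>, \<open>R3\<close> describe how \<open>g\<close> moves the generators of the copies 0, 1, 2, 3 modulo
  boundaries: they are the columns of an upper triangular representation.\<close>

definition "R0 g x y u t \<longleftrightarrow> Bd (g (s x) \<oplus>\<^bsub>X0\<^esub> s x) (s y) (s u) (s t)"
definition "R1 g x y u \<longleftrightarrow> Bd \<zero>\<^bsub>X0\<^esub> (g (s x) \<oplus>\<^bsub>X0\<^esub> s x) (s y) (s u)"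
definition "R2 g x y \<longleftrightarrow> Bd \<zero>\<^bsub>X0\<^esub> \<zero>\<^bsub>X0\<^esub> (g (s x) \<oplus>\<^bsub>X0\<^esub> s x) (s y)"
definition "R3 g x \<longleftrightarrow> Bd \<zero>\<^bsub>X0\<^esub> \<zero>\<^bsub>X0\<^esub> \<zero>\<^bsub>X0\<^esub> (g (s x) \<oplus>\<^bsub>X0\<^esub> s x)"

text \<open>Multiplication of unitriangular matrices, one column at a time: apply \<open>h\<close>
  to the relation for \<open>g\<close> and add the relations for \<open>h\<close> at
  \<open>x\<close>, \<open>y\<close>, \<open>u\<close> and \<open>t\<close>. The terms that contain
  \<open>h\<close> applied to \<open>s y\<close>, \<open>s u\<close> and \<open>s t\<close>
  cancel.\<close>

lemma R0_compose:
  assumes g: "stable g" and h: "stable h" and F: "x \<in> carrier F" "y \<in> carrier F" "u \<in> carrier F" "t \<in> carrier F"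
    "y' \<in> carrier F" "u' \<in> carrier F" "t' \<in> carrier F" "y'' \<in> carrier F" "u'' \<in> carrier F" "y3 \<in> carrier F"
    and R: "R0 g x y u t" "R0 h x y' u' t'" "R1 h y y'' u''" "R2 h u y3" "R3 h t"
  shows "R0 (\<lambda>z. h (g z)) x (y \<oplus>\<^bsub>F\<^esub> y') (u \<oplus>\<^bsub>F\<^esub> (u' \<oplus>\<^bsub>F\<^esub> y'')) (t \<oplus>\<^bsub>F\<^esub> (t' \<oplus>\<^bsub>F\<^esub> (u'' \<oplus>\<^bsub>F\<^esub> y3)))"
proof -
  have hh: "additive_map X0 X0 h" and gg: "additive_map X0 X0 g" using g h unfolding stable_def by auto
  note hr = additive_mapD[OF hh] and gr = additive_mapD[OF gg]
  have 1: "Bd (h (g (s x) \<oplus>\<^bsub>X0\<^esub> s x)) (h (s y)) (h (s u)) (h (s t))" using R(1) h unfolding R0_def stable_def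
    by blast
  have "h \<zero>\<^bsub>X0\<^esub> = \<zero>\<^bsub>X0\<^esub>" by (rule additive_zero[OF hh mods(1) mods(1)])
  note S = Bd_add[OF Bd_add[OF Bd_add[OF Bd_add[OF 1 R(2)[unfolded R0_def]] R(3)[unfolded R1_def]]
    R(4)[unfolded R2_def]] R(5)[unfolded R3_def]]
  show ?thesis unfolding R0_def using S F cl hr gr by (simp add: ad ac0 acF(1))
qed

lemma R1_compose:
  assumes g: "stable g" and h: "stable h" and F: "x \<in> carrier F" "y \<in> carrier F" "u \<in> carrier F"
    "y' \<in> carrier F" "u' \<in> carrier F" "y'' \<in> carrier F"
    and R: "R1 g x y u" "R1 h x y' u'" "R2 h y y''" "R3 h u"
  shows "R1 (\<lambda>z. h (g z)) x (y \<oplus>\<^bsub>F\<^esub> y') (u \<oplus>\<^bsub>F\<^esub> (u' \<oplus>\<^bsub>F\<^esub> y''))"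
proof -
  have hh: "additive_map X0 X0 h" and gg: "additive_map X0 X0 g" using g h unfolding stable_def by auto
  note hr = additive_mapD[OF hh] and gr = additive_mapD[OF gg]
  have 1: "Bd (h \<zero>\<^bsub>X0\<^esub>) (h (g (s x) \<oplus>\<^bsub>X0\<^esub> s x)) (h (s y)) (h (s u))" using R(1) h unfolding R1_def stable_def
    by blast
  have h0: "h \<zero>\<^bsub>X0\<^esub> = \<zero>\<^bsub>X0\<^esub>" by (rule additive_zero[OF hh mods(1) mods(1)])
  note S = Bd_add[OF Bd_add[OF Bd_add[OF 1 R(2)[unfolded R1_def]] R(3)[unfolded R2_def]] R(4)[unfolded R3_def]]
  show ?thesis unfolding R1_def using S F cl hr gr by (simp add: ad ac0 acF(1) h0)
qed

lemma R2_compose: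
  assumes g: "stable g" and h: "stable h" and F: "x \<in> carrier F" "y \<in> carrier F" "y' \<in> carrier F"
    and R: "R2 g x y" "R2 h x y'" "R3 h y"
  shows "R2 (\<lambda>z. h (g z)) x (y \<oplus>\<^bsub>F\<^esub> y')"
proof -
  have hh: "additive_map X0 X0 h" and gg: "additive_map X0 X0 g" using g h unfolding stable_def by auto
  note hr = additive_mapD[OF hh] and gr = additive_mapD[OF gg]
  have 1: "Bd (h \<zero>\<^bsub>X0\<^esub>) (h \<zero>\<^bsub>X0\<^esub>) (h (g (s x) \<oplus>\<^bsub>X0\<^esub> s x)) (h (s y))" using R(1) h unfolding R2_def stable_def
    by blast
  have h0: "h \<zero>\<^bsub>X0\<^esub> = \<zero>\<^bsub>X0\<^esub>" by (rule additive_zero[OF hh mods(1) mods(1)])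
  note S = Bd_add[OF Bd_add[OF 1 R(2)[unfolded R2_def]] R(3)[unfolded R3_def]]
  show ?thesis unfolding R2_def using S F cl hr gr by (simp add: ad ac0 acF(1) h0)
qed

lemma R3_compose:
  assumes g: "stable g" and h: "stable h" and F: "x \<in> carrier F" and R: "R3 g x" "R3 h x"
  shows "R3 (\<lambda>z. h (g z)) x"
proof -
  have hh: "additive_map X0 X0 h" and gg: "additive_map X0 X0 g" using g h unfolding stable_def by auto
  note hr = additive_mapD[OF hh] and gr = additive_mapD[OF gg]
  have 1: "Bd (h \<zero>\<^bsub>X0\<^esub>) (h \<zero>\<^bsub>X0\<^esub>) (h \<zero>\<^bsub>X0\<^esub>) (h (g (s x) \<oplus>\<^bsub>X0\<^esub> s x))" using R(1) h unfolding R3_def stable_def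
    by blast
  have h0: "h \<zero>\<^bsub>X0\<^esub> = \<zero>\<^bsub>X0\<^esub>" by (rule additive_zero[OF hh mods(1) mods(1)])
  note S = Bd_add[OF 1 R(2)[unfolded R3_def]]
  show ?thesis unfolding R3_def using S F cl hr gr by (simp add: ad ac0 h0)
qed

text \<open>The sum of the two relations is concentrated in copy 3, where \<open>Bd_top\<close>
  detects it. The two maps are compared only on the generator \<open>s x\<close>.\<close>

lemma R0_unique:
  assumes "R0 g x y u t" "R0 g' x y u t'" "g (s x) = g' (s x)" and g: "stable g"
    and F: "x \<in> carrier F" "y \<in> carrier F" "u \<in> carrier F" "t \<in> carrier F" "t' \<in> carrier F"
  shows "t = t'"
proof -
  have gg: "additive_map X0 X0 g" using g unfolding stable_def by auto
  have "Bd \<zero>\<^bsub>X0\<^esub> \<zero>\<^bsub>X0\<^esub> \<zero>\<^bsub>X0\<^esub> (s (t \<oplus>\<^bsub>F\<^esub> t'))"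
    using Bd_add[OF assms(1)[unfolded R0_def] assms(2)[unfolded R0_def]] F cl additive_mapD[OF gg]
    unfolding assms(3)[symmetric] by (simp add: ad ac0)
  then have "t \<oplus>\<^bsub>F\<^esub> t' = \<zero>\<^bsub>F\<^esub>" using F by (intro Bd_top) (simp_all add: acF(1))
  then show ?thesis using vs_eq[OF mods(4)] F by blast
qed

text \<open>The sum of the three relations is again concentrated in copy 3. Additivity of the block
  from copy 1 to copy 3 is what allows it to be evaluated on \<open>a x + c x\<close> in the product
  of \<open>I\<close> and \<open>J\<close>.\<close>

lemma R1_additive:
  assumes "R1 g x y u" "R1 g x' y' u'" "R1 g (x \<oplus>\<^bsub>F\<^esub> x') (y \<oplus>\<^bsub>F\<^esub> y') u''" and g: "stable g"
    and F: "x \<in> carrier F" "y \<in> carrier F" "u \<in> carrier F" "x' \<in> carrier F" "y' \<in> carrier F" "u' \<in> carrier F"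
      "u'' \<in> carrier F"
  shows "u'' = u \<oplus>\<^bsub>F\<^esub> u'"
proof -
  have gg: "additive_map X0 X0 g" using g unfolding stable_def by auto
  have "Bd \<zero>\<^bsub>X0\<^esub> \<zero>\<^bsub>X0\<^esub> \<zero>\<^bsub>X0\<^esub> (s (u'' \<oplus>\<^bsub>F\<^esub> (u \<oplus>\<^bsub>F\<^esub> u')))"
    using Bd_add[OF Bd_add[OF assms(1)[unfolded R1_def] assms(2)[unfolded R1_def]] assms(3)[unfolded R1_def]] F
      cl additive_mapD[OF gg]
    by (simp add: ad ac0 acF(1))
  then have "u'' \<oplus>\<^bsub>F\<^esub> (u \<oplus>\<^bsub>F\<^esub> u') = \<zero>\<^bsub>F\<^esub>" using F by (intro Bd_top) (simp_all add: acF(1))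
  then show ?thesis using vs_eq[OF mods(4)] F by (simp add: acF(1))
qed

text \<open>\<open>g\<close> acts trivially on \<open>F\<close>, and \<open>a\<close> is the value
  at \<open>g\<close> of the matrix of homomorphisms defined by the class of \<open>b1\<close>: for
  \<open>q\<close> with boundary \<open>g x - x\<close>, the component \<open>b1 q\<close> is read
  off by \<open>e\<close>. This \<open>a\<close> becomes the superdiagonal block.\<close>

definition twist :: "('x \<Rightarrow> 'x) \<Rightarrow> ('f \<Rightarrow> 'f) \<Rightarrow> bool" where
  "twist g a \<longleftrightarrow> stable g \<and> additive_map F F a \<and> (\<forall>x\<in>carrier X0. e (g x) = e x) \<and>
     (\<forall>x\<in>carrier X0. \<forall>q\<in>carrier X1. d1 q = g x \<oplus>\<^bsub>X0\<^esub> x \<longrightarrow> e (b1 q) = a (e x))"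

text \<open>The chain bounding the required tuple is found copy after copy. It begins with a
  \<open>z\<close> whose boundary is \<open>g (s x) + s x\<close>; each later component is chosen so
  as to move the current entry into the image of \<open>s\<close>. The columns starting in copies 1,
  2, 3 reuse \<open>z\<close> and \<open>z1\<close>, shifted.\<close>

lemma twist_R:
  assumes tw: "twist g a" and x: "x \<in> carrier F"
  shows "\<exists>u\<in>carrier F. \<exists>t\<in>carrier F. R0 g x (a x) u t" "\<exists>u\<in>carrier F. R1 g x (a x) u" "R2 g x (a x)" "R3 g x"
proof -
  have gg: "additive_map X0 X0 g" and aa: "additive_map F F a" and eg: "\<And>x. x \<in> carrier X0 \<Longrightarrow> e (g x) = e x"
    and tw': "\<And>x q. x \<in> carrier X0 \<Longrightarrow> q \<in> carrier X1 \<Longrightarrow> d1 q = g x \<oplus>\<^bsub>X0\<^esub> x \<Longrightarrow> e (b1 q) = a (e x)"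
    using tw unfolding twist_def stable_def by auto
  note gr = additive_mapD[OF gg] and ar = additive_mapD[OF aa]
  have sx: "s x \<in> carrier X0" "g (s x) \<oplus>\<^bsub>X0\<^esub> s x \<in> carrier X0" using x cl gr by (simp_all add: ac0(1))
  have sx0: "e (g (s x) \<oplus>\<^bsub>X0\<^esub> s x) = \<zero>\<^bsub>F\<^esub>" using sx(1) gr cl by (simp add: ad eg acF)
  obtain z where z: "z \<in> carrier X1" "g (s x) \<oplus>\<^bsub>X0\<^esub> s x = d1 z" using exact0[OF sx(2) sx0] by blast
  have ebz: "e (b1 z) = a x" using tw'[OF sx(1) z(1) z(2)[symmetric]] es[OF x] by simp
  \<comment> \<open>Modulo the image of \<open>d1\<close>, every \<open>y\<close> has the normal
    form \<open>s (e y)\<close>.\<close>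
  have lift: "\<exists>w\<in>carrier X1. \<exists>t\<in>carrier F. s t = d1 w \<oplus>\<^bsub>X0\<^esub> y \<and> t = e y" if y: "y \<in> carrier X0" for y
  proof -
    have "e (s (e y) \<oplus>\<^bsub>X0\<^esub> y) = \<zero>\<^bsub>F\<^esub>" using y cl by (simp add: ad es acF)
    moreover have "s (e y) \<oplus>\<^bsub>X0\<^esub> y \<in> carrier X0" using y cl by (simp add: ac0(1))
    ultimately obtain w where w: "w \<in> carrier X1" "s (e y) \<oplus>\<^bsub>X0\<^esub> y = d1 w" using exact0 by blast
    have "s (e y) = d1 w \<oplus>\<^bsub>X0\<^esub> y" unfolding w(2)[symmetric] using y cl by (simp add: ac0)
    then show ?thesis using w(1) y cl by blast
  qed
  have z0: "\<zero>\<^bsub>X1\<^esub> \<in> carrier X1" by (simp add: ac1)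
  have ze: "d1 \<zero>\<^bsub>X1\<^esub> = \<zero>\<^bsub>X0\<^esub>" "b1 \<zero>\<^bsub>X1\<^esub> = \<zero>\<^bsub>X0\<^esub>" "V1 \<zero>\<^bsub>X1\<^esub> = \<zero>\<^bsub>X0\<^esub>" "V1' \<zero>\<^bsub>X1\<^esub> = \<zero>\<^bsub>X0\<^esub>" "W1 \<zero>\<^bsub>X1\<^esub> = \<zero>\<^bsub>X0\<^esub>"
    using add1[THEN additive_zero, OF mods(2,1)] by simp_all
  obtain z1 where z1: "z1 \<in> carrier X1" "s (a x) = d1 z1 \<oplus>\<^bsub>X0\<^esub> b1 z"
  proof -
    have "b1 z \<in> carrier X0" using z cl by simp
    from lift[OF this] ebz show thesis using that by metis
  qed
  show "R3 g x" unfolding R3_def Bd_def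
    by (rule bexI[OF _ z0], rule bexI[OF _ z0], rule bexI[OF _ z0], rule bexI[OF _ z(1)]) (use z cl in \<open>simp_all
      add: ze ac0\<close>)
  show "R2 g x (a x)" unfolding R2_def Bd_def
    by (rule bexI[OF _ z0], rule bexI[OF _ z0], rule bexI[OF _ z(1)], rule bexI[OF _ z1(1)])
      (use z z1 cl in \<open>simp_all add: ze ac0\<close>)
  \<comment> \<open>The column that starts in copy 1 sees \<open>V1'\<close> as its second-order
    term; the one that starts in copy 0 sees \<open>V1\<close>, hence the separate chains
    \<open>z2\<close> and \<open>z3\<close>.\<close>
  have "b1 z1 \<oplus>\<^bsub>X0\<^esub> V1' z \<in> carrier X0" using z z1 cl by (simp add: ac0(1))
  from lift[OF this] obtain z2 u where z2: "z2 \<in> carrier X1" "u \<in> carrier F" "s u =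
      d1 z2 \<oplus>\<^bsub>X0\<^esub> (b1 z1 \<oplus>\<^bsub>X0\<^esub> V1' z)" by blast
  have "R1 g x (a x) u" unfolding R1_def Bd_def
    by (rule bexI[OF _ z0], rule bexI[OF _ z(1)], rule bexI[OF _ z1(1)], rule bexI[OF _ z2(1)])
      (use z z1 z2 cl in \<open>simp_all add: ze ac0\<close>)
  then show "\<exists>u\<in>carrier F. R1 g x (a x) u" using z2 by blast
  have "b1 z1 \<oplus>\<^bsub>X0\<^esub> V1 z \<in> carrier X0" using z z1 cl by (simp add: ac0(1))
  from lift[OF this] obtain z3 u where z3: "z3 \<in> carrier X1" "u \<in> carrier F" "s u =
      d1 z3 \<oplus>\<^bsub>X0\<^esub> (b1 z1 \<oplus>\<^bsub>X0\<^esub> V1 z)" by blast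
  have "b1 z3 \<oplus>\<^bsub>X0\<^esub> (V1' z1 \<oplus>\<^bsub>X0\<^esub> W1 z) \<in> carrier X0" using z z1 z3 cl by (simp add: ac0(1))
  from lift[OF this] obtain z4 t where z4: "z4 \<in> carrier X1" "t \<in> carrier F" "s t =
      d1 z4 \<oplus>\<^bsub>X0\<^esub> (b1 z3 \<oplus>\<^bsub>X0\<^esub> (V1' z1 \<oplus>\<^bsub>X0\<^esub> W1 z))" by blast
  have "R0 g x (a x) u t" unfolding R0_def Bd_def
    by (rule bexI[OF _ z(1)], rule bexI[OF _ z1(1)], rule bexI[OF _ z3(1)], rule bexI[OF _ z4(1)])
      (use z(2) z1 z3 z4 in simp_all)
  then show "\<exists>u\<in>carrier F. \<exists>t\<in>carrier F. R0 g x (a x) u t" using z3 z4 by blast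
qed

text \<open>The relations \<open>I I = J J = (I J) (I J)\<close> of the quaternion group, evaluated in the top right
  corner of the representation.\<close>

lemma quaternion_relations:
  assumes I: "twist I a" and J: "twist J c"
    and rel: "\<And>x. x \<in> carrier X0 \<Longrightarrow> I (I x) = J (J x)" "\<And>x. x \<in> carrier X0 \<Longrightarrow> J (I (J (I x))) = J (J x)"
    and ac: "\<And>x. x \<in> carrier F \<Longrightarrow> a (a x) = x" "\<And>x. x \<in> carrier F \<Longrightarrow> c (c x) = x"
      "\<And>x. x \<in> carrier F \<Longrightarrow> a (c x) \<oplus>\<^bsub>F\<^esub> c (a x) = x"
  shows "\<exists>u v u' v'. additive_map F F u' \<and> additive_map F F v' \<and>
      (\<forall>x\<in>carrier F. u x \<in> carrier F \<and> v x \<in> carrier F \<and>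
      u' (a x) \<oplus>\<^bsub>F\<^esub> a (u x) = v' (c x) \<oplus>\<^bsub>F\<^esub> c (v x) \<and>
      v' (c x) \<oplus>\<^bsub>F\<^esub> c (v x) = u' (a x \<oplus>\<^bsub>F\<^esub> c x) \<oplus>\<^bsub>F\<^esub> (v' (a x \<oplus>\<^bsub>F\<^esub> c x) \<oplus>\<^bsub>F\<^esub> (c (a (a x \<oplus>\<^bsub>F\<^esub> c x)) \<oplus>\<^bsub>F\<^esub>
        (a (u x \<oplus>\<^bsub>F\<^esub> (v x \<oplus>\<^bsub>F\<^esub> c (a x))) \<oplus>\<^bsub>F\<^esub> c (u x \<oplus>\<^bsub>F\<^esub> (v x \<oplus>\<^bsub>F\<^esub> c (a x)))))))"
proof -
  have sI: "stable I" and sJ: "stable J" and aa: "additive_map F F a" and cc: "additive_map F F c"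
    using I J unfolding twist_def by auto
  note ar = additive_mapD[OF aa] and cr = additive_mapD[OF cc]
  note FI = twist_R[OF I] and FJ = twist_R[OF J]
  have "\<exists>u. \<exists>t. \<forall>x. x \<in> carrier F \<longrightarrow> u x \<in> carrier F \<and> t x \<in> carrier F \<and> R0 I x (a x) (u x) (t x)"
    using FI(1) by metis
  then obtain u t where u: "\<And>x. x \<in> carrier F \<Longrightarrow> u x \<in> carrier F" "\<And>x. x \<in> carrier F \<Longrightarrow> t x \<in> carrier F"
    "\<And>x. x \<in> carrier F \<Longrightarrow> R0 I x (a x) (u x) (t x)" by blast
  have "\<exists>v. \<exists>q. \<forall>x. x \<in> carrier F \<longrightarrow> v x \<in> carrier F \<and> q x \<in> carrier F \<and> R0 J x (c x) (v x) (q x)"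
    using FJ(1) by metis
  then obtain v q where v: "\<And>x. x \<in> carrier F \<Longrightarrow> v x \<in> carrier F" "\<And>x. x \<in> carrier F \<Longrightarrow> q x \<in> carrier F"
    "\<And>x. x \<in> carrier F \<Longrightarrow> R0 J x (c x) (v x) (q x)" by blast
  have "\<exists>u'. \<forall>x. x \<in> carrier F \<longrightarrow> u' x \<in> carrier F \<and> R1 I x (a x) (u' x)" using FI(2) by metis
  then obtain u' where u': "\<And>x. x \<in> carrier F \<Longrightarrow> u' x \<in> carrier F" "\<And>x. x \<in> carrier F \<Longrightarrow> R1 I x (a x) (u' x)"
    by blast
  have "\<exists>v'. \<forall>x. x \<in> carrier F \<longrightarrow> v' x \<in> carrier F \<and> R1 J x (c x) (v' x)" using FJ(2) by metis
  then obtain v' where v': "\<And>x. x \<in> carrier F \<Longrightarrow> v' x \<in> carrier F" "\<And>x. x \<in> carrier F \<Longrightarrow> R1 J x (c x) (v' x)"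
    by blast
  have u'add: "additive_map F F u'" unfolding additive_map_def
  proof (intro conjI ballI)
    fix x y assume x: "x \<in> carrier F" and y: "y \<in> carrier F"
    have xy: "x \<oplus>\<^bsub>F\<^esub> y \<in> carrier F" using x y by (simp add: acF(1))
    show "u' (x \<oplus>\<^bsub>F\<^esub> y) = u' x \<oplus>\<^bsub>F\<^esub> u' y"
      using R1_additive[OF u'(2)[OF x] u'(2)[OF y] u'(2)[OF xy, unfolded ar(2)[OF x y]] sI] x y xy ar(1) u'(1)
        by simp
  qed (rule u'(1))
  have v'add: "additive_map F F v'" unfolding additive_map_def
  proof (intro conjI ballI)
    fix x y assume x: "x \<in> carrier F" and y: "y \<in> carrier F"
    have xy: "x \<oplus>\<^bsub>F\<^esub> y \<in> carrier F" using x y by (simp add: acF(1))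
    show "v' (x \<oplus>\<^bsub>F\<^esub> y) = v' x \<oplus>\<^bsub>F\<^esub> v' y"
      using R1_additive[OF v'(2)[OF x] v'(2)[OF y] v'(2)[OF xy, unfolded cr(2)[OF x y]] sJ] x y xy cr(1) v'(1)
        by simp
  qed (rule v'(1))
  have main: "u' (a x) \<oplus>\<^bsub>F\<^esub> a (u x) = v' (c x) \<oplus>\<^bsub>F\<^esub> c (v x) \<and>
      v' (c x) \<oplus>\<^bsub>F\<^esub> c (v x) = u' (a x \<oplus>\<^bsub>F\<^esub> c x) \<oplus>\<^bsub>F\<^esub> (v' (a x \<oplus>\<^bsub>F\<^esub> c x) \<oplus>\<^bsub>F\<^esub> (c (a (a x \<oplus>\<^bsub>F\<^esub> c x)) \<oplus>\<^bsub>F\<^esub>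
        (a (u x \<oplus>\<^bsub>F\<^esub> (v x \<oplus>\<^bsub>F\<^esub> c (a x))) \<oplus>\<^bsub>F\<^esub> c (u x \<oplus>\<^bsub>F\<^esub> (v x \<oplus>\<^bsub>F\<^esub> c (a x))))))" if x: "x \<in> carrier F" for x
  proof -
    have mem: "a x \<in> carrier F" "c x \<in> carrier F" "u x \<in> carrier F" "v x \<in> carrier F" "t x \<in> carrier F"
      "q x \<in> carrier F"
      using x ar cr u v by auto
    \<comment> \<open>In a square the corner entry \<open>t\<close> of the factor occurs twice and
      disappears; the middle blocks remain. The entry in copy 1 vanishes for the same
      reason.\<close>
    have II: "R0 (\<lambda>z. I (I z)) x \<zero>\<^bsub>F\<^esub> x (u' (a x) \<oplus>\<^bsub>F\<^esub> a (u x))"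
      using R0_compose[OF sI sI x mem(1,3,5) mem(1,3,5) ar(1)[OF mem(1)] u'(1)[OF mem(1)] ar(1)[OF mem(3)]
          u(3)[OF x] u(3)[OF x] u'(2)[OF mem(1)] FI(3)[OF mem(3)] FI(4)[OF mem(5)]]
        x mem u'(1) ar(1) by (simp add: ac(1) acF)
    have JJ: "R0 (\<lambda>z. J (J z)) x \<zero>\<^bsub>F\<^esub> x (v' (c x) \<oplus>\<^bsub>F\<^esub> c (v x))"
      using R0_compose[OF sJ sJ x mem(2,4,6) mem(2,4,6) cr(1)[OF mem(2)] v'(1)[OF mem(2)] cr(1)[OF mem(4)]
          v(3)[OF x] v(3)[OF x] v'(2)[OF mem(2)] FJ(3)[OF mem(4)] FJ(4)[OF mem(6)]]
        x mem v'(1) cr(1) by (simp add: ac(2) acF)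
    let ?K = "\<lambda>z. J (I z)"
    have sK: "stable ?K" by (rule stable_compose[OF sI sJ])
    define l where "l = a x \<oplus>\<^bsub>F\<^esub> c x"
    define m where "m = u x \<oplus>\<^bsub>F\<^esub> (v x \<oplus>\<^bsub>F\<^esub> c (a x))"
    \<comment> \<open>The corner entry of the product of \<open>I\<close> and \<open>J\<close>. In
      its square it occurs twice and cancels.\<close>
    define n where "n = t x \<oplus>\<^bsub>F\<^esub> (q x \<oplus>\<^bsub>F\<^esub> (v' (a x) \<oplus>\<^bsub>F\<^esub> c (u x)))"
    have lmn: "l \<in> carrier F" "m \<in> carrier F" "n \<in> carrier F" unfolding l_def m_def n_def
      using mem ar(1) cr(1) u'(1) v'(1) by (simp_all add: acF(1))
    have K0: "R0 ?K x l m n"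
      unfolding l_def m_def n_def
      by (rule R0_compose[OF sI sJ x mem(1,3,5) mem(2,4,6) cr(1)[OF mem(1)] v'(1)[OF mem(1)] cr(1)[OF mem(3)]
          u(3)[OF x] v(3)[OF x] v'(2)[OF mem(1)] FJ(3)[OF mem(3)] FJ(4)[OF mem(5)]])
    have K1: "R1 ?K y (a y \<oplus>\<^bsub>F\<^esub> c y) (u' y \<oplus>\<^bsub>F\<^esub> (v' y \<oplus>\<^bsub>F\<^esub> c (a y)))" if y: "y \<in> carrier F" for y
      by (rule R1_compose[OF sI sJ y ar(1)[OF y] u'(1)[OF y] cr(1)[OF y] v'(1)[OF y] cr(1)[OF ar(1)[OF y]]
          u'(2)[OF y] v'(2)[OF y] FJ(3)[OF ar(1)[OF y]] FJ(4)[OF u'(1)[OF y]]])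
    have K2: "R2 ?K y (a y \<oplus>\<^bsub>F\<^esub> c y)" if y: "y \<in> carrier F" for y
      by (rule R2_compose[OF sI sJ y ar(1)[OF y] cr(1)[OF y] FI(3)[OF y] FJ(3)[OF y] FJ(4)[OF ar(1)[OF y]]])
    have K3: "R3 ?K y" if y: "y \<in> carrier F" for y by (rule R3_compose[OF sI sJ y FI(4)[OF y] FJ(4)[OF y]])
    have cl': "a l \<oplus>\<^bsub>F\<^esub> c l \<in> carrier F" "a m \<oplus>\<^bsub>F\<^esub> c m \<in> carrier F" "u' l \<oplus>\<^bsub>F\<^esub> (v' l \<oplus>\<^bsub>F\<^esub> c (a l)) \<in> carrier F"
      using lmn ar(1) cr(1) u'(1) v'(1) by (simp_all add: acF(1))
    have "a l \<oplus>\<^bsub>F\<^esub> c l = (a (a x) \<oplus>\<^bsub>F\<^esub> c (c x)) \<oplus>\<^bsub>F\<^esub> (a (c x) \<oplus>\<^bsub>F\<^esub> c (a x))"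
      unfolding l_def using mem ar cr by (simp add: acF)
    \<comment> \<open>Expanding the square of \<open>a + c\<close> gives a a + c c + (a c + c a) = 1
      + 1 + 1 = 1, so all three squares have the same entry \<open>x\<close> in copy 2 and their
      corners can be compared.\<close>
    then have al: "a l \<oplus>\<^bsub>F\<^esub> c l = x" unfolding ac(1)[OF x] ac(2)[OF x] ac(3)[OF x] using x by (simp add: acF)
    have KK: "R0 (\<lambda>z. ?K (?K z)) x \<zero>\<^bsub>F\<^esub> x ((u' l \<oplus>\<^bsub>F\<^esub> (v' l \<oplus>\<^bsub>F\<^esub> c (a l))) \<oplus>\<^bsub>F\<^esub> (a m \<oplus>\<^bsub>F\<^esub> c m))"
      using R0_compose[OF sK sK x lmn lmn cl'(1,3,2) K0 K0 K1[OF lmn(1)] K2[OF lmn(2)] K3[OF lmn(3)]]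
        x lmn cl'(2,3) unfolding al by (simp add: vs_self[OF mods(4)] vs_self2[OF mods(4)] acF(1))
    have s2: "stable (\<lambda>z. J (J z))" by (rule stable_compose[OF sJ sJ])
    have z: "\<zero>\<^bsub>F\<^esub> \<in> carrier F" by (simp add: acF)
    have sx: "s x \<in> carrier X0" using x cl by simp
    have mA: "u' (a x) \<oplus>\<^bsub>F\<^esub> a (u x) \<in> carrier F" and mB: "v' (c x) \<oplus>\<^bsub>F\<^esub> c (v x) \<in> carrier F"
      and mC: "(u' l \<oplus>\<^bsub>F\<^esub> (v' l \<oplus>\<^bsub>F\<^esub> c (a l))) \<oplus>\<^bsub>F\<^esub> (a m \<oplus>\<^bsub>F\<^esub> c m) \<in> carrier F"
      using mem lmn ar(1) cr(1) u'(1) v'(1) by (simp_all add: acF(1))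
    have A: "v' (c x) \<oplus>\<^bsub>F\<^esub> c (v x) = u' (a x) \<oplus>\<^bsub>F\<^esub> a (u x)"
      by (rule R0_unique[OF JJ II rel(1)[OF sx, symmetric] s2 x z x mB mA])
    have B: "v' (c x) \<oplus>\<^bsub>F\<^esub> c (v x) = (u' l \<oplus>\<^bsub>F\<^esub> (v' l \<oplus>\<^bsub>F\<^esub> c (a l))) \<oplus>\<^bsub>F\<^esub> (a m \<oplus>\<^bsub>F\<^esub> c m)"
      by (rule R0_unique[OF JJ KK rel(2)[OF sx, symmetric] s2 x z x mB mC])
    show ?thesis using A B lmn ar(1) cr(1) u'(1) v'(1) unfolding l_def[symmetric] m_def[symmetric]
      by (simp add: vs_assoc[OF mods(4)] acF(1))
  qed
  show ?thesis
    by (rule exI[of _ u], rule exI[of _ v], rule exI[of _ u'], rule exI[of _ v']) (use main u'add v'add u(1)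
      v(1) in blast)
qed

end

text \<open>Columns of length two, indexed by \<open>bool\<close> like the matrices. Applied to the
  objects of the resolution it gives two copies of the resolution, applied to the trivial module it
  gives the plane on which \<open>a\<close> and \<open>c\<close> act.\<close>

definition vec :: "('k, 'v, 'd) module_scheme \<Rightarrow> ('k, bool \<Rightarrow> 'v) module" where
  "vec V = \<lparr>carrier = {v. \<forall>i. v i \<in> carrier V}, monoid.mult = undefined, monoid.one = undefined,
     ring.zero = (\<lambda>i. \<zero>\<^bsub>V\<^esub>), ring.add = (\<lambda>u v i. u i \<oplus>\<^bsub>V\<^esub> v i), module.smult = (\<lambda>c v i. c \<odot>\<^bsub>V\<^esub> v i)\<rparr>"

lemma vec_simps: "v \<in> carrier (vec V) \<longleftrightarrow> (\<forall>i. v i \<in> carrier V)" "\<zero>\<^bsub>vec V\<^esub> = (\<lambda>i. \<zero>\<^bsub>V\<^esub>)"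
  "u \<oplus>\<^bsub>vec V\<^esub> v = (\<lambda>i. u i \<oplus>\<^bsub>V\<^esub> v i)" "c \<odot>\<^bsub>vec V\<^esub> v = (\<lambda>i. c \<odot>\<^bsub>V\<^esub> v i)"
  by (simp_all add: vec_def)

lemma (in char2) module_vec: "module k V \<Longrightarrow> module k (vec V)"
  by (rule vs_moduleI) (auto simp: vec_simps fun_eq_iff vs_ac vs_smult)

section \<open>Two copies of the resolution as a twisted complex\<close>

context tate
begin

definition mat_op :: "(bool \<Rightarrow> bool \<Rightarrow> int \<Rightarrow> 'p \<Rightarrow> 'p) \<Rightarrow> int \<Rightarrow> (bool \<Rightarrow> 'p) \<Rightarrow> bool \<Rightarrow> 'p" where
  "mat_op c j v = (\<lambda>i. c i False j (v False) \<oplus>\<^bsub>Ob j\<^esub> c i True j (v True))"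

lemma mat_op_additive:
  assumes "\<And>i l. c i l \<in> carrier (E 1)" "m = j + 1"
  shows "additive_map (vec (Ob m)) (vec (Ob j)) (mat_op c j)"
  unfolding additive_map_def mat_op_def assms(2)
  using endo_closed[OF assms(1)] endo_add[OF assms(1)] by (auto simp: vec_simps fun_eq_iff vs_ac)

lemma mat_op_mul:
  assumes b: "\<And>i l. b i l \<in> carrier (E 1)" and c: "\<And>i l. c i l \<in> carrier (E 1)" and v:
    "v \<in> carrier (vec (Ob 2))"
  shows "mat_op b 0 (mat_op c 1 v) i = mat_mul b c i False 0 (v False) \<oplus>\<^bsub>Ob 0\<^esub> mat_mul b c i True 0 (v True)"
proof -
  have c1: "c i l 1 (v l) \<in> carrier (Ob 1)" for i l using endo_closed[OF c, of "v l" 1 i l] v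
    by (simp add: vec_simps)
  have b0: "b i l 0 x \<in> carrier (Ob 0)" "y \<in> carrier (Ob 1) \<Longrightarrow> b i l 0 (x \<oplus>\<^bsub>Ob 1\<^esub> y) =
      b i l 0 x \<oplus>\<^bsub>Ob 0\<^esub> b i l 0 y"
    if "x \<in> carrier (Ob 1)" for i l x y
    using endo_closed[OF b, of x 0] endo_add[OF b, of x 0 y 1] that by simp_all
  have m: "mat_mul b c i l 0 (v l) = b i False 0 (c False l 1 (v l)) \<oplus>\<^bsub>Ob 0\<^esub> b i True 0 (c True l 1 (v l))"
    for l
    using v by (simp add: mat_mul_def endo_add_app mul_app vec_simps)
  show ?thesis unfolding m using c1 b0 by (simp add: mat_op_def vs_ac)
qed

text \<open>The hypotheses \<open>bI\<close> and \<open>bJ\<close> fix \<open>b\<close> only through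
  the homomorphisms that its entries define, evaluated at the two generators. They are therefore
  available for every matrix of cocycles representing the given classes.\<close>

lemma not_massey_vanishes:
  assumes b: "\<And>i l. b i l \<in> Z 1" and IJ: "I \<in> carrier G" "J \<in> carrier G" and rel: "I \<otimes>\<^bsub>G\<^esub> I = J \<otimes>\<^bsub>G\<^esub> J"
    "(I \<otimes>\<^bsub>G\<^esub> J) \<otimes>\<^bsub>G\<^esub> (I \<otimes>\<^bsub>G\<^esub> J) = J \<otimes>\<^bsub>G\<^esub> J"
    and bI: "\<And>i l p q. p \<in> carrier (Ob 0) \<Longrightarrow> q \<in> carrier (Ob 1) \<Longrightarrow> bd P 1 q = act (Ob 0) p I \<oplus>\<^bsub>Ob 0\<^esub> p \<Longrightarrow>
      aug P (b i l 0 q) = (if i = l then \<zero>\<^bsub>k\<^esub> else aug P p)"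
    and bJ: "\<And>i l p q. p \<in> carrier (Ob 0) \<Longrightarrow> q \<in> carrier (Ob 1) \<Longrightarrow> bd P 1 q = act (Ob 0) p J \<oplus>\<^bsub>Ob 0\<^esub> p \<Longrightarrow>
      aug P (b i l 0 q) = (if i \<and> \<not> l then \<zero>\<^bsub>k\<^esub> else aug P p)"
  shows "\<not> massey_vanishes b"
proof
  assume "massey_vanishes b"
  then obtain V V' W where V: "\<And>i l. V i l \<in> carrier (E 1)" "\<And>i l. V' i l \<in> carrier (E 1)"
    "\<And>i l. W i l \<in> carrier (E 1)"
    and dV: "\<And>i l. dd 1 (V i l) = mat_mul b b i l" "\<And>i l. dd 1 (V' i l) = mat_mul b b i l"
      "\<And>i l. dd 1 (W i l) = mat_mul b V i l \<oplus>\<^bsub>E 2\<^esub> mat_mul V' b i l"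
    unfolding massey_vanishes_def by blast
  have bE: "\<And>i l. b i l \<in> carrier (E 1)" using b cocycle_endo by auto
  have mO: "module k (vec (Ob n))" for n by (rule module_vec) simp
  have mT: "module k (vec T)" by (rule module_vec) simp
  let ?d = "\<lambda>n v i. bd P n (v i)" and ?e = "\<lambda>v i. aug P (v i)"
  \<comment> \<open>An element of augmentation 1; its multiples define the section \<open>?s\<close>
    of the augmentation.\<close>
  obtain p0 where p0: "p0 \<in> carrier (Ob 0)" "aug P p0 = \<one>\<^bsub>k\<^esub>" using aug_surj[OF K.one_closed] by blast
  let ?s = "\<lambda>\<kappa> i. \<kappa> i \<odot>\<^bsub>Ob 0\<^esub> p0"
  have bdc: "x \<in> carrier (Ob 1) \<Longrightarrow> bd P 1 x \<in> carrier (Ob 0)" "x \<in> carrier (Ob 2) \<Longrightarrow> bd P 2 x \<in> carrier (Ob 1)"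
    for x
    by (auto intro: bd_closed)
  have bdd: "x \<in> carrier (Ob 2) \<Longrightarrow> bd P 1 (bd P 2 x) = \<zero>\<^bsub>Ob 0\<^esub>" for x by (auto intro: bd_bd)
  have bd1a: "bd P 1 (x \<oplus>\<^bsub>Ob 1\<^esub> y) = bd P 1 x \<oplus>\<^bsub>Ob 0\<^esub> bd P 1 y" if "x \<in> carrier (Ob 1)" "y \<in> carrier (Ob 1)"
    for x y
    using bd_add[OF that] by simp
  have bd2a: "bd P 2 (x \<oplus>\<^bsub>Ob 2\<^esub> y) = bd P 2 x \<oplus>\<^bsub>Ob 1\<^esub> bd P 2 y" if "x \<in> carrier (Ob 2)" "y \<in> carrier (Ob 2)"
    for x y
    using bd_add[OF that] by simp
  have op0: "additive_map (vec (Ob 1)) (vec (Ob 0)) (mat_op c 0)" and op1: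
    "additive_map (vec (Ob 2)) (vec (Ob 1)) (mat_op c 1)"
    if "\<And>i l. c i l \<in> carrier (E 1)" for c
    using mat_op_additive[of c, OF that, of 1 0] mat_op_additive[of c, OF that, of 2 1] by simp_all
  \<comment> \<open>The commutator of a matrix of operators with the boundary has the differentials
    of the entries as its entries, so the relations of a twisted complex can be read off in the
    endomorphism algebra.\<close>
  have opd: "?d 1 (mat_op c 1 r) i \<oplus>\<^bsub>Ob 0\<^esub> mat_op c 0 (?d 2 r) i =
      dd 1 (c i False) 0 (r False) \<oplus>\<^bsub>Ob 0\<^esub> dd 1 (c i True) 0 (r True)"
    if c: "\<And>i l. c i l \<in> carrier (E 1)" and r: "r \<in> carrier (vec (Ob 2))" for c r i
  proof -
    have rr: "r l \<in> carrier (Ob 2)" for l using r by (simp add: vec_simps)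
    have c1: "c i l 1 (r l) \<in> carrier (Ob 1)" for i l using endo_closed[OF c, of "r l" 1 i l] rr by simp
    have c0: "c i l 0 (bd P 2 (r l)) \<in> carrier (Ob 0)" for i l using endo_closed[OF c, of "bd P 2 (r l)" 0 i l]
      bdc(2)[OF rr] by simp
    have d: "dd 1 (c i l) 0 (r l) = bd P 1 (c i l 1 (r l)) \<oplus>\<^bsub>Ob 0\<^esub> c i l 0 (bd P 2 (r l))" for l
      using diff_app[OF c, of "r l" 0 i l] rr by simp
    show ?thesis unfolding d mat_op_def using c1 c0 bdc(1)[OF c1] by (simp add: bd1a vs_ac)
  qed
  have bz: "dd 1 (b i l) = \<zero>\<^bsub>E 2\<^esub>" for i l using b[of i l] by (simp add: cocycle_iff)
  have opc: "mat_op c 1 r \<in> carrier (vec (Ob 1))" "mat_op c 0 (?d 2 r) \<in> carrier (vec (Ob 0))"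
    "?d 1 (mat_op c 1 r) \<in> carrier (vec (Ob 0))"
    "?d 2 r \<in> carrier (vec (Ob 1))"
    if c: "\<And>i l. c i l \<in> carrier (E 1)" and r: "r \<in> carrier (vec (Ob 2))" for c r
  proof -
    show 1: "?d 2 r \<in> carrier (vec (Ob 1))" using r bdc by (simp add: vec_simps)
    show 2: "mat_op c 1 r \<in> carrier (vec (Ob 1))" using op1[of c, OF c] r by (rule additive_mapD(1))
    show "mat_op c 0 (?d 2 r) \<in> carrier (vec (Ob 0))" using op0[of c, OF c] 1 by (rule additive_mapD(1))
    show "?d 1 (mat_op c 1 r) \<in> carrier (vec (Ob 0))" using 2 bdc by (simp add: vec_simps)
  qed
  \<comment> \<open>The four square relations are, in this order: \<open>b\<close> is a cocycle,
    \<open>V\<close> bounds \<open>b b\<close>, \<open>V'\<close> bounds \<open>b b\<close>, and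
    \<open>W\<close> bounds \<open>b V + V' b\<close>.\<close>
  interpret tw: twisted k "vec (Ob 0)" "vec (Ob 1)" "vec (Ob 2)" "vec T" "?d 1" "mat_op b 0" "mat_op V 0"
    "mat_op V' 0" "mat_op W 0"
    "?d 2" "mat_op b 1" "mat_op V 1" "mat_op V' 1" "mat_op W 1" ?e ?s
  proof (intro twisted.intro twisted_axioms.intro)
    show "additive_map (vec (Ob 1)) (vec (Ob 0)) (?d 1)" "additive_map (vec (Ob 2)) (vec (Ob 1)) (?d 2)"
      unfolding additive_map_def using bdc bd1a bd2a by (auto simp: vec_simps)
    show "additive_map (vec (Ob 0)) (vec T) ?e" unfolding additive_map_def using aug_rules
      by (auto simp: vec_simps)
    show "additive_map (vec T) (vec (Ob 0)) ?s" unfolding additive_map_def using p0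
      by (auto simp: vec_simps smult_closed smult_ladd)
    show "?d 1 (mat_op b 1 r) = mat_op b 0 (?d 2 r)" if r: "r \<in> carrier (vec (Ob 2))" for r
    proof
      fix i
      have "?d 1 (mat_op b 1 r) i \<oplus>\<^bsub>Ob 0\<^esub> mat_op b 0 (?d 2 r) i = \<zero>\<^bsub>Ob 0\<^esub>"
        unfolding opd[of b, OF bE r] bz using r by (simp add: endo_zero_app vec_simps vs_self zero_closed)
      then show "?d 1 (mat_op b 1 r) i = mat_op b 0 (?d 2 r) i"
        using vs_eq[OF Ob_module] opc[of b, OF bE r] by (simp add: vec_simps)
    qed
    show "?d 1 (mat_op V 1 r) \<oplus>\<^bsub>vec (Ob 0)\<^esub> mat_op V 0 (?d 2 r) = mat_op b 0 (mat_op b 1 r)"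
      "?d 1 (mat_op V' 1 r) \<oplus>\<^bsub>vec (Ob 0)\<^esub> mat_op V' 0 (?d 2 r) = mat_op b 0 (mat_op b 1 r)"
      "?d 1 (mat_op W 1 r) \<oplus>\<^bsub>vec (Ob 0)\<^esub> mat_op W 0 (?d 2 r) = mat_op b 0 (mat_op V 1 r) \<oplus>\<^bsub>vec (Ob 0)\<^esub> mat_op V'
          0 (mat_op b 1 r)"
      if r: "r \<in> carrier (vec (Ob 2))" for r
    proof -
      show "?d 1 (mat_op V 1 r) \<oplus>\<^bsub>vec (Ob 0)\<^esub> mat_op V 0 (?d 2 r) = mat_op b 0 (mat_op b 1 r)"
        using opd[of V, OF V(1) r] mat_op_mul[of b b, OF bE bE r] by (simp add: vec_simps fun_eq_iff dV)
      show "?d 1 (mat_op V' 1 r) \<oplus>\<^bsub>vec (Ob 0)\<^esub> mat_op V' 0 (?d 2 r) = mat_op b 0 (mat_op b 1 r)"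
        using opd[of V', OF V(2) r] mat_op_mul[of b b, OF bE bE r] by (simp add: vec_simps fun_eq_iff dV)
      have m: "mat_mul b V i l 0 (r l) \<in> carrier (Ob 0)" "mat_mul V' b i l 0 (r l) \<in> carrier (Ob 0)" for i l
        using endo_closed[OF mat_mul_closed[of b V, OF bE V(1)], of "r l" 0]
          endo_closed[OF mat_mul_closed[of V' b, OF V(2) bE], of "r l" 0] r
        by (simp_all add: vec_simps)
      show "?d 1 (mat_op W 1 r) \<oplus>\<^bsub>vec (Ob 0)\<^esub> mat_op W 0 (?d 2 r) =
          mat_op b 0 (mat_op V 1 r) \<oplus>\<^bsub>vec (Ob 0)\<^esub> mat_op V' 0 (mat_op b 1 r)"
        using opd[of W, OF V(3) r] mat_op_mul[of b V, OF bE V(1) r] mat_op_mul[of V' b, OF V(2) bE r] r m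
        by (simp add: vec_simps fun_eq_iff dV endo_add_app vs_ac)
    qed
    show "\<exists>r\<in>carrier (vec (Ob 2)). z = ?d 2 r" if z: "z \<in> carrier (vec (Ob 1))" "?d 1 z = \<zero>\<^bsub>vec (Ob 0)\<^esub>" for z
    proof -
      have "\<forall>i. \<exists>w. w \<in> carrier (Ob 2) \<and> bd P 2 w = z i"
        using z bd_lift[of _ 1 2] by (fastforce simp: vec_simps fun_eq_iff)
      then obtain r where "\<forall>i. r i \<in> carrier (Ob 2) \<and> bd P 2 (r i) = z i" by metis
      then show ?thesis by (intro bexI[of _ r]) (auto simp: vec_simps)
    qed
    show "\<exists>w\<in>carrier (vec (Ob 1)). x = ?d 1 w" if x: "x \<in> carrier (vec (Ob 0))" "?e x = \<zero>\<^bsub>vec T\<^esub>" for x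
    proof -
      have "\<forall>i. \<exists>w. w \<in> carrier (Ob 1) \<and> bd P 1 w = x i"
        using x aug_lift by (fastforce simp: vec_simps fun_eq_iff)
      then obtain r where "\<forall>i. r i \<in> carrier (Ob 1) \<and> bd P 1 (r i) = x i" by metis
      then show ?thesis by (intro bexI[of _ r]) (auto simp: vec_simps)
    qed
    show "?e (?d 1 z) = \<zero>\<^bsub>vec T\<^esub>" if "z \<in> carrier (vec (Ob 1))" for z using that by (simp add: vec_simps aug_bd)
    show "?e (?s \<kappa>) = \<kappa>" if "\<kappa> \<in> carrier (vec T)" for \<kappa> using that p0 by (simp add: vec_simps aug_rules)
  qed (rule mO mT char2_axioms op0[of b, OF bE] op0[of V, OF V(1)] op0[of V', OF V(2)] op0[of W, OF V(3)]
    op1[of b, OF bE] op1[of V, OF V(1)] op1[of V', OF V(2)] op1[of W, OF V(3)])+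
  let ?g = "\<lambda>n g v i. act (Ob n) (v i) g"
  \<comment> \<open>All components of the twisted differential are equivariant, so each group
    element acts diagonally on the twisted complex.\<close>
  have st: "tw.stable (?g 0 g)" if g: "g \<in> carrier G" for g
  proof (rule tw.stableI[of _ "?g 1 g"])
    have a: "x \<in> carrier (Ob n) \<Longrightarrow> act (Ob n) x g \<in> carrier (Ob n)" "x \<in> carrier (Ob n) \<Longrightarrow> y \<in> carrier (Ob n) \<Longrightarrow>
      act (Ob n) (x \<oplus>\<^bsub>Ob n\<^esub> y) g = act (Ob n) x g \<oplus>\<^bsub>Ob n\<^esub> act (Ob n) y g" for n x y
      using act_closed[OF Ob_kG _ g] act_add[OF Ob_kG _ _ g] by auto
    show "additive_map (vec (Ob 0)) (vec (Ob 0)) (?g 0 g)" "additive_map (vec (Ob 1)) (vec (Ob 1)) (?g 1 g)"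
      unfolding additive_map_def using a by (auto simp: vec_simps)
    show "?d 1 (?g 1 g z) = ?g 0 g (?d 1 z)" if "z \<in> carrier (vec (Ob 1))" for z
      using that bd_act[OF _ g, of _ 1] by (simp add: vec_simps)
    have m: "mat_op c 0 (?g 1 g z) = ?g 0 g (mat_op c 0 z)" if c: "\<And>i l. c i l \<in> carrier (E 1)" and z:
      "z \<in> carrier (vec (Ob 1))" for c z
    proof -
      have "c i l 0 (act (Ob 1) (z l) g) = act (Ob 0) (c i l 0 (z l)) g" "c i l 0 (z l) \<in> carrier (Ob 0)"
        for i l
        using endo_act[OF c, of "z l" 0 g 1 i l] endo_closed[OF c, of "z l" 0 i l] z g
          by (simp_all add: vec_simps)
      then show ?thesis by (simp add: mat_op_def a fun_eq_iff)
    qed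
    show "mat_op b 0 (?g 1 g z) = ?g 0 g (mat_op b 0 z)" "mat_op V 0 (?g 1 g z) = ?g 0 g (mat_op V 0 z)"
      "mat_op V' 0 (?g 1 g z) = ?g 0 g (mat_op V' 0 z)" "mat_op W 0 (?g 1 g z) = ?g 0 g (mat_op W 0 z)"
      if "z \<in> carrier (vec (Ob 1))" for z
      using m[of b, OF bE that] m[of V, OF V(1) that] m[of V', OF V(2) that] m[of W, OF V(3) that] by auto
  qed
  \<comment> \<open>The matrices \<open>B(I)\<close> (swap of the coordinates) and
    \<open>B(J)\<close> (upper triangular), as maps of the plane.\<close>
  define a where "a \<kappa> = (\<lambda>i. \<kappa> (\<not> i))" for \<kappa> :: "bool \<Rightarrow> 'k"
  define c where "c \<kappa> = (\<lambda>i. if i then \<kappa> True else \<kappa> False \<oplus>\<^bsub>k\<^esub> \<kappa> True)" for \<kappa> :: "bool \<Rightarrow> 'k"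
  note kk = K.a_assoc K.a_comm K.a_lcomm K_self K_self2
  have b0: "b i l 0 x \<in> carrier (Ob 0)" if "x \<in> carrier (Ob 1)" for i l x
    using endo_closed[OF bE, of x 0 i l] that by simp
  have eb: "?e (mat_op b 0 q) i = aug P (b i False 0 (q False)) \<oplus>\<^bsub>k\<^esub> aug P (b i True 0 (q True))"
    if "q \<in> carrier (vec (Ob 1))" for q i
    using that b0 by (simp add: mat_op_def vec_simps aug_rules)
  have tI: "tw.twist (?g 0 I) a"
    unfolding tw.twist_def
  proof (intro conjI ballI impI)
    show "tw.stable (?g 0 I)" by (rule st[OF IJ(1)])
    show "additive_map (vec T) (vec T) a" unfolding additive_map_def a_def by (auto simp: vec_simps)
    show "?e (?g 0 I x) = ?e x" if "x \<in> carrier (vec (Ob 0))" for x using that IJ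
      by (simp add: vec_simps aug_rules)
    fix x q assume x: "x \<in> carrier (vec (Ob 0))" and q: "q \<in> carrier (vec (Ob 1))" and eq: "?d 1 q =
        ?g 0 I x \<oplus>\<^bsub>vec (Ob 0)\<^esub> x"
    have h: "aug P (b i l 0 (q l)) = (if i = l then \<zero>\<^bsub>k\<^esub> else aug P (x l))" for i l
      by (rule bI) (use x q fun_cong[OF eq, of l] in \<open>simp_all add: vec_simps\<close>)
    show "?e (mat_op b 0 q) = a (?e x)"
      unfolding fun_eq_iff eb[OF q] h a_def using x by (auto simp: vec_simps aug_rules)
  qed
  have tJ: "tw.twist (?g 0 J) c"
    unfolding tw.twist_def
  proof (intro conjI ballI impI)
    show "tw.stable (?g 0 J)" by (rule st[OF IJ(2)])
    show "additive_map (vec T) (vec T) c" unfolding additive_map_def c_def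
      by (auto simp: vec_simps kk fun_eq_iff)
    show "?e (?g 0 J x) = ?e x" if "x \<in> carrier (vec (Ob 0))" for x using that IJ
      by (simp add: vec_simps aug_rules)
    fix x q assume x: "x \<in> carrier (vec (Ob 0))" and q: "q \<in> carrier (vec (Ob 1))" and eq: "?d 1 q =
        ?g 0 J x \<oplus>\<^bsub>vec (Ob 0)\<^esub> x"
    have h: "aug P (b i l 0 (q l)) = (if i \<and> \<not> l then \<zero>\<^bsub>k\<^esub> else aug P (x l))" for i l
      by (rule bJ) (use x q fun_cong[OF eq, of l] in \<open>simp_all add: vec_simps\<close>)
    show "?e (mat_op b 0 q) = c (?e x)"
      unfolding fun_eq_iff eb[OF q] h c_def using x by (auto simp: vec_simps aug_rules)
  qed
  have aa: "a (a x) = x" for x by (simp add: a_def)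
  \<comment> \<open>Together with \<open>aa\<close> these are the Clifford relations a a = c c = 1
    and a c + c a = 1.\<close>
  have cc: "c (c x) = x" "a (c x) \<oplus>\<^bsub>vec T\<^esub> c (a x) = x" if "x \<in> carrier (vec T)" for x
    using that by (auto simp: c_def a_def vec_simps fun_eq_iff kk)
  have aG: "act (Ob 0) y (g \<otimes>\<^bsub>G\<^esub> h) = act (Ob 0) (act (Ob 0) y g) h" if "y \<in> carrier (Ob 0)" "g \<in> carrier G"
    "h \<in> carrier G" for y g h
    by (rule kG_module_mult[OF Ob_kG that])
  have ac: "act (Ob 0) y g \<in> carrier (Ob 0)" if "y \<in> carrier (Ob 0)" "g \<in> carrier G" for y g
    by (rule act_closed[OF Ob_kG that])
  have rel1: "act (Ob 0) (act (Ob 0) y I) I = act (Ob 0) (act (Ob 0) y J) J" if y: "y \<in> carrier (Ob 0)" for y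
    unfolding aG[OF y IJ(1,1), symmetric] aG[OF y IJ(2,2), symmetric] rel(1) ..
  have rel2: "act (Ob 0) (act (Ob 0) (act (Ob 0) (act (Ob 0) y I) J) I) J = act (Ob 0) (act (Ob 0) y J) J" if y:
    "y \<in> carrier (Ob 0)" for y
  proof -
    have "((I \<otimes>\<^bsub>G\<^esub> J) \<otimes>\<^bsub>G\<^esub> I) \<otimes>\<^bsub>G\<^esub> J = J \<otimes>\<^bsub>G\<^esub> J" using rel(2) IJ by (simp add: Gr.m_assoc)
    then have "act (Ob 0) y (((I \<otimes>\<^bsub>G\<^esub> J) \<otimes>\<^bsub>G\<^esub> I) \<otimes>\<^bsub>G\<^esub> J) = act (Ob 0) y (J \<otimes>\<^bsub>G\<^esub> J)" by simp
    then show ?thesis using IJ y by (simp add: aG ac)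
  qed
  have r1: "?g 0 I (?g 0 I x) = ?g 0 J (?g 0 J x)" and r2: "?g 0 J (?g 0 I (?g 0 J (?g 0 I x))) =
      ?g 0 J (?g 0 J x)"
    if "x \<in> carrier (vec (Ob 0))" for x
    using that rel1 rel2 by (simp_all add: vec_simps)
  obtain u v u' v' where uv: "additive_map (vec T) (vec T) u'" "additive_map (vec T) (vec T) v'"
    "\<And>x. x \<in> carrier (vec T) \<Longrightarrow> u x \<in> carrier (vec T) \<and> v x \<in> carrier (vec T) \<and>
      u' (a x) \<oplus>\<^bsub>vec T\<^esub> a (u x) = v' (c x) \<oplus>\<^bsub>vec T\<^esub> c (v x) \<and>
      v' (c x) \<oplus>\<^bsub>vec T\<^esub> c (v x) = u' (a x \<oplus>\<^bsub>vec T\<^esub> c x) \<oplus>\<^bsub>vec T\<^esub> (v' (a x \<oplus>\<^bsub>vec T\<^esub> c x) \<oplus>\<^bsub>vec T\<^esub>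
        (c (a (a x \<oplus>\<^bsub>vec T\<^esub> c x)) \<oplus>\<^bsub>vec T\<^esub>
        (a (u x \<oplus>\<^bsub>vec T\<^esub> (v x \<oplus>\<^bsub>vec T\<^esub> c (a x))) \<oplus>\<^bsub>vec T\<^esub> c (u x \<oplus>\<^bsub>vec T\<^esub> (v x \<oplus>\<^bsub>vec T\<^esub> c (a x))))))"
    using tw.quaternion_relations[OF tI tJ r1 r2 aa cc] by blast
  \<comment> \<open>The unit vectors. The set consisting of \<open>e1\<close>, \<open>e2\<close> and
    their sum is preserved by \<open>a\<close> and by \<open>c\<close>, so the two equations become
    finitely many equations in \<open>k\<close>.\<close>
  define e1 :: "bool \<Rightarrow> 'k" where "e1 = (\<lambda>i. if i then \<zero>\<^bsub>k\<^esub> else \<one>\<^bsub>k\<^esub>)"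
  define e2 :: "bool \<Rightarrow> 'k" where "e2 = (\<lambda>i. if i then \<one>\<^bsub>k\<^esub> else \<zero>\<^bsub>k\<^esub>)"
  have ee: "e1 \<in> carrier (vec T)" "e2 \<in> carrier (vec T)" by (simp_all add: vec_simps e1_def e2_def)
  have ev: "a e1 = e2" "a e2 = e1" "c e1 = e1" "c e2 = e1 \<oplus>\<^bsub>vec T\<^esub> e2" "e2 \<oplus>\<^bsub>vec T\<^esub> e1 = e1 \<oplus>\<^bsub>vec T\<^esub> e2"
    "e1 \<oplus>\<^bsub>vec T\<^esub> (e1 \<oplus>\<^bsub>vec T\<^esub> e2) = e2"
    "a (e1 \<oplus>\<^bsub>vec T\<^esub> e2) = e1 \<oplus>\<^bsub>vec T\<^esub> e2" "c (e1 \<oplus>\<^bsub>vec T\<^esub> e2) = e2"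
    by (auto simp: a_def c_def e1_def e2_def vec_simps fun_eq_iff K_self)
  have u12: "u' (e1 \<oplus>\<^bsub>vec T\<^esub> e2) = u' e1 \<oplus>\<^bsub>vec T\<^esub> u' e2" "v' (e1 \<oplus>\<^bsub>vec T\<^esub> e2) = v' e1 \<oplus>\<^bsub>vec T\<^esub> v' e2"
    using additive_mapD(2)[OF uv(1) ee] additive_mapD(2)[OF uv(2) ee] by auto
  have mem: "u e1 i \<in> carrier k" "u e2 i \<in> carrier k" "v e1 i \<in> carrier k" "v e2 i \<in> carrier k"
    "u' e1 i \<in> carrier k" "u' e2 i \<in> carrier k" "v' e1 i \<in> carrier k" "v' e2 i \<in> carrier k" for i
    using uv(3)[OF ee(1)] uv(3)[OF ee(2)] additive_mapD(1)[OF uv(1) ee(1)] additive_mapD(1)[OF uv(1) ee(2)]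
      additive_mapD(1)[OF uv(2) ee(1)] additive_mapD(1)[OF uv(2) ee(2)] by (simp_all add: vec_simps)
  have eqA1: "u' e2 \<oplus>\<^bsub>vec T\<^esub> a (u e1) = v' e1 \<oplus>\<^bsub>vec T\<^esub> c (v e1)"
    and eqA2: "u' e1 \<oplus>\<^bsub>vec T\<^esub> a (u e2) = (v' e1 \<oplus>\<^bsub>vec T\<^esub> v' e2) \<oplus>\<^bsub>vec T\<^esub> c (v e2)"
    using uv(3)[OF ee(1)] uv(3)[OF ee(2)] unfolding ev u12 by blast+
  have eqB1: "v' e1 \<oplus>\<^bsub>vec T\<^esub> c (v e1) =
      (u' e1 \<oplus>\<^bsub>vec T\<^esub> u' e2) \<oplus>\<^bsub>vec T\<^esub> ((v' e1 \<oplus>\<^bsub>vec T\<^esub> v' e2) \<oplus>\<^bsub>vec T\<^esub> (e2 \<oplus>\<^bsub>vec T\<^esub>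
      (a (u e1 \<oplus>\<^bsub>vec T\<^esub> (v e1 \<oplus>\<^bsub>vec T\<^esub> (e1 \<oplus>\<^bsub>vec T\<^esub> e2))) \<oplus>\<^bsub>vec T\<^esub> c
        (u e1 \<oplus>\<^bsub>vec T\<^esub> (v e1 \<oplus>\<^bsub>vec T\<^esub> (e1 \<oplus>\<^bsub>vec T\<^esub> e2))))))"
    using uv(3)[OF ee(1)] unfolding ev u12 by blast
  have eqB2: "(v' e1 \<oplus>\<^bsub>vec T\<^esub> v' e2) \<oplus>\<^bsub>vec T\<^esub> c (v e2) = u' e2 \<oplus>\<^bsub>vec T\<^esub> (v' e2 \<oplus>\<^bsub>vec T\<^esub> (e1 \<oplus>\<^bsub>vec T\<^esub>
      (a (u e2 \<oplus>\<^bsub>vec T\<^esub> (v e2 \<oplus>\<^bsub>vec T\<^esub> e1)) \<oplus>\<^bsub>vec T\<^esub> c (u e2 \<oplus>\<^bsub>vec T\<^esub> (v e2 \<oplus>\<^bsub>vec T\<^esub> e1)))))"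
    using uv(3)[OF ee(2)] unfolding ev u12 by blast
  let ?z = "\<lambda>x y. x \<oplus>\<^bsub>k\<^esub> (y :: 'k)"
  have zz: "x = y \<Longrightarrow> y \<in> carrier k \<Longrightarrow> ?z x y = \<zero>\<^bsub>k\<^esub>" for x y by (simp add: K_self)
  note vs = vec_simps a_def c_def e1_def e2_def
  \<comment> \<open>With \<open>E1\<close> and \<open>E2\<close> the sums of both sides of the two
    matrix equations, \<open>s1\<close>, \<open>s2\<close>, \<open>s3\<close> are the entries that
    make up tr(c E1), and \<open>s4\<close>, \<open>s5\<close> those that make up tr(a E2). In the
    total the coefficient of u' is a c + c a + 1 = 0, similarly for u, while v and v' occur with
    equal coefficients from both traces. The terms coming from \<open>c a\<close> leave 1.\<close>
  have s1: "?z (u' e2 False \<oplus>\<^bsub>k\<^esub> u e1 True) (v' e1 False \<oplus>\<^bsub>k\<^esub> (v e1 False \<oplus>\<^bsub>k\<^esub> v e1 True)) = \<zero>\<^bsub>k\<^esub>"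
    by (rule zz) (use fun_cong[OF eqA1, of False] mem in \<open>simp_all add: vs\<close>)
  have s2: "?z (u' e2 True \<oplus>\<^bsub>k\<^esub> u e1 False) (v' e1 True \<oplus>\<^bsub>k\<^esub> v e1 True) = \<zero>\<^bsub>k\<^esub>"
    by (rule zz) (use fun_cong[OF eqA1, of True] mem in \<open>simp_all add: vs\<close>)
  have s3: "?z (u' e1 True \<oplus>\<^bsub>k\<^esub> u e2 False) ((v' e1 True \<oplus>\<^bsub>k\<^esub> v' e2 True) \<oplus>\<^bsub>k\<^esub> v e2 True) = \<zero>\<^bsub>k\<^esub>"
    by (rule zz) (use fun_cong[OF eqA2, of True] mem in \<open>simp_all add: vs\<close>)
  have s4: "?z (v' e1 True \<oplus>\<^bsub>k\<^esub> v e1 True) ((u' e1 True \<oplus>\<^bsub>k\<^esub> u' e2 True) \<oplus>\<^bsub>k\<^esub> ((v' e1 True \<oplus>\<^bsub>k\<^esub> v' e2 True) \<oplus>\<^bsub>k\<^esub>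
      (\<one>\<^bsub>k\<^esub> \<oplus>\<^bsub>k\<^esub>
      ((u e1 False \<oplus>\<^bsub>k\<^esub> (v e1 False \<oplus>\<^bsub>k\<^esub> \<one>\<^bsub>k\<^esub>)) \<oplus>\<^bsub>k\<^esub> (u e1 True \<oplus>\<^bsub>k\<^esub> (v e1 True \<oplus>\<^bsub>k\<^esub> \<one>\<^bsub>k\<^esub>)))))) = \<zero>\<^bsub>k\<^esub>"
    by (rule zz) (use fun_cong[OF eqB1, of True] mem in \<open>simp_all add: vs\<close>)
  have s5: "?z ((v' e1 False \<oplus>\<^bsub>k\<^esub> v' e2 False) \<oplus>\<^bsub>k\<^esub> (v e2 False \<oplus>\<^bsub>k\<^esub> v e2 True))
      (u' e2 False \<oplus>\<^bsub>k\<^esub> (v' e2 False \<oplus>\<^bsub>k\<^esub> (\<one>\<^bsub>k\<^esub> \<oplus>\<^bsub>k\<^esub>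
      ((u e2 True \<oplus>\<^bsub>k\<^esub> v e2 True) \<oplus>\<^bsub>k\<^esub> ((u e2 False \<oplus>\<^bsub>k\<^esub> (v e2 False \<oplus>\<^bsub>k\<^esub> \<one>\<^bsub>k\<^esub>)) \<oplus>\<^bsub>k\<^esub> (u e2 True \<oplus>\<^bsub>k\<^esub> v e2
        True)))))) = \<zero>\<^bsub>k\<^esub>"
    by (rule zz) (use fun_cong[OF eqB2, of False] mem in \<open>simp_all add: vs\<close>)
  have "\<one>\<^bsub>k\<^esub> = (?z (u' e2 False \<oplus>\<^bsub>k\<^esub> u e1 True) (v' e1 False \<oplus>\<^bsub>k\<^esub> (v e1 False \<oplus>\<^bsub>k\<^esub> v e1 True))) \<oplus>\<^bsub>k\<^esub>
      ((?z (u' e2 True \<oplus>\<^bsub>k\<^esub> u e1 False) (v' e1 True \<oplus>\<^bsub>k\<^esub> v e1 True)) \<oplus>\<^bsub>k\<^esub>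
    ((?z (u' e1 True \<oplus>\<^bsub>k\<^esub> u e2 False) ((v' e1 True \<oplus>\<^bsub>k\<^esub> v' e2 True) \<oplus>\<^bsub>k\<^esub> v e2 True)) \<oplus>\<^bsub>k\<^esub>
    ((?z (v' e1 True \<oplus>\<^bsub>k\<^esub> v e1 True) ((u' e1 True \<oplus>\<^bsub>k\<^esub> u' e2 True) \<oplus>\<^bsub>k\<^esub> ((v' e1 True \<oplus>\<^bsub>k\<^esub> v' e2 True) \<oplus>\<^bsub>k\<^esub>
    (\<one>\<^bsub>k\<^esub> \<oplus>\<^bsub>k\<^esub>
      ((u e1 False \<oplus>\<^bsub>k\<^esub> (v e1 False \<oplus>\<^bsub>k\<^esub> \<one>\<^bsub>k\<^esub>)) \<oplus>\<^bsub>k\<^esub> (u e1 True \<oplus>\<^bsub>k\<^esub> (v e1 True \<oplus>\<^bsub>k\<^esub> \<one>\<^bsub>k\<^esub>))))))) \<oplus>\<^bsub>k\<^esub> ((?z ((v'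
        e1 False \<oplus>\<^bsub>k\<^esub> v' e2 False) \<oplus>\<^bsub>k\<^esub> (v e2 False \<oplus>\<^bsub>k\<^esub> v e2 True)) (u' e2 False \<oplus>\<^bsub>k\<^esub> (v' e2 False \<oplus>\<^bsub>k\<^esub>
        (\<one>\<^bsub>k\<^esub> \<oplus>\<^bsub>k\<^esub>
      ((u e2 True \<oplus>\<^bsub>k\<^esub> v e2 True) \<oplus>\<^bsub>k\<^esub> ((u e2 False \<oplus>\<^bsub>k\<^esub> (v e2 False \<oplus>\<^bsub>k\<^esub> \<one>\<^bsub>k\<^esub>)) \<oplus>\<^bsub>k\<^esub> (u e2 True \<oplus>\<^bsub>k\<^esub> v e2
        True)))))))))))"
    using mem by (simp add: kk)
  then have "\<one>\<^bsub>k\<^esub> = \<zero>\<^bsub>k\<^esub>" unfolding s1 s2 s3 s4 s5 by simp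
  then show False using K.one_not_zero by simp
qed

end

section \<open>Classes of homomorphisms and their relations\<close>

definition with_act :: "('k, 'v, 'd) module_scheme \<Rightarrow> ('v \<Rightarrow> 'g \<Rightarrow> 'v) \<Rightarrow> ('k, 'v, 'g) kG_mod" where
  "with_act V \<alpha> = \<lparr>carrier = carrier V, monoid.mult = undefined, monoid.one = undefined, ring.zero = \<zero>\<^bsub>V\<^esub>,
     ring.add = ring.add V, module.smult = module.smult V, act = \<alpha>\<rparr>"

lemma with_act_simps: "carrier (with_act V \<alpha>) = carrier V" "\<zero>\<^bsub>with_act V \<alpha>\<^esub> = \<zero>\<^bsub>V\<^esub>" "u \<oplus>\<^bsub>with_act V \<alpha>\<^esub> v =
    u \<oplus>\<^bsub>V\<^esub> v"
  "c \<odot>\<^bsub>with_act V \<alpha>\<^esub> v = c \<odot>\<^bsub>V\<^esub> v" "act (with_act V \<alpha>) v g = \<alpha> v g"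
  by (simp_all add: with_act_def)

lemma (in char2) module_with_act: "module k V \<Longrightarrow> module k (with_act V \<alpha>)"
  by (rule vs_moduleI) (auto simp: with_act_simps vs_ac vs_smult)

section \<open>Values of degree one classes on group elements\<close>

context tate
begin

text \<open>Cohomologous cocycles differ by an equivariant map \<open>\<psi>\<close> composed with
  the boundary, and \<open>\<psi>\<close> into the trivial module kills every
  \<open>p g - p\<close>.\<close>

lemma class_value:
  assumes f: "f \<in> Z 1" "f' \<in> Z 1" "ecl 1 f = ecl 1 f'" and g: "g \<in> carrier G"
    and p: "p \<in> carrier (Ob 0)" and q: "q \<in> carrier (Ob 1)" "bd P 1 q = act (Ob 0) p g \<oplus>\<^bsub>Ob 0\<^esub> p"
  shows "aug P (f 0 q) = aug P (f' 0 q)"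
proof -
  obtain \<psi> where \<psi>: "\<psi> \<in> kG_homs k G (Ob (1 - 1)) T"
    "\<And>v. v \<in> carrier (Ob 1) \<Longrightarrow> compose (carrier (Ob 1)) (aug P) (f 0) v \<oplus>\<^bsub>T\<^esub> compose (carrier (Ob 1)) (aug P)
        (f' 0) v = \<psi> (bd P 1 v)"
    using f(3) unfolding ecl_def' tcl_eq[OF T_kG aug_pull[OF f(1)] aug_pull[OF f(2)]] by blast
  have \<psi>': "\<psi> \<in> kG_homs k G (Ob 0) T" using \<psi>(1) by simp
  note r = kG_homs_rules[OF \<psi>']
  have "aug P (f 0 q) \<oplus>\<^bsub>k\<^esub> aug P (f' 0 q) = \<psi> (act (Ob 0) p g \<oplus>\<^bsub>Ob 0\<^esub> p)" using \<psi>(2)[OF q(1)] q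
    by (simp add: compose_def)
  also have "\<dots> = \<zero>\<^bsub>k\<^esub>" using p g r act_closed[OF Ob_kG p g] by (simp add: K_self)
  finally have "aug P (f 0 q) \<oplus>\<^bsub>T\<^esub> aug P (f' 0 q) = \<zero>\<^bsub>T\<^esub>" by simp
  moreover have "f 0 q \<in> carrier (Ob 0)" "f' 0 q \<in> carrier (Ob 0)"
    using endo_closed[OF cocycle_endo[OF f(1)], of q 0] endo_closed[OF cocycle_endo[OF f(2)], of q 0] q
      by simp_all
  ultimately show ?thesis using vs_eq[OF T_module, of "aug P (f 0 q)" "aug P (f' 0 q)"] aug_rules by simp
qed

text \<open>One inclusion is \<open>class_value\<close>. For the other, two cocycles with the same
  values differ by a map that vanishes on every \<open>q\<close> with boundary
  \<open>p g - p\<close>; it has to be factored through the boundary by an equivariant map on degree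
  zero.\<close>

lemma hom_class_eq:
  assumes \<phi>: "\<phi> \<in> tate_cocycles k G P T 1"
    and val: "\<And>g p q. g \<in> carrier G \<Longrightarrow> p \<in> carrier (Ob 0) \<Longrightarrow> q \<in> carrier (Ob 1) \<Longrightarrow>
      bd P 1 q = act (Ob 0) p g \<oplus>\<^bsub>Ob 0\<^esub> p \<Longrightarrow> \<phi> q = \<chi> g \<otimes>\<^bsub>k\<^esub> aug P p"
  shows "hom_class k G P \<chi> = tcl T 1 \<phi>"
proof (intro equalityI subsetI)
  have minus: "u \<ominus>\<^bsub>Ob 0\<^esub> v = u \<oplus>\<^bsub>Ob 0\<^esub> v" if "v \<in> carrier (Ob 0)" for u v by (rule vs_minus[OF Ob_module that])
  {
    fix \<phi>' assume m: "\<phi>' \<in> tcl T 1 \<phi>"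
    have \<phi>': "\<phi>' \<in> tate_cocycles k G P T 1" "tcl T 1 \<phi>' = tcl T 1 \<phi>" using tcl_mem[OF T_kG \<phi> m] by auto
    obtain f where f: "f \<in> Z 1" "ecl 1 f = tcl T 1 \<phi>" "\<And>v. v \<in> carrier (Ob 1) \<Longrightarrow> aug P (f 0 v) = \<phi> v"
      using cocycle_lift[OF \<phi>] by blast
    obtain f' where f': "f' \<in> Z 1" "ecl 1 f' = tcl T 1 \<phi>'" "\<And>v. v \<in> carrier (Ob 1) \<Longrightarrow> aug P (f' 0 v) = \<phi>' v"
      using cocycle_lift[OF \<phi>'(1)] by blast
    have "\<phi>' q = \<chi> g \<otimes>\<^bsub>k\<^esub> aug P p"
      if "g \<in> carrier G" "p \<in> carrier (Ob 0)" "q \<in> carrier (Ob 1)" "bd P 1 q = act (Ob 0) p g \<ominus>\<^bsub>Ob 0\<^esub> p"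
        for g p q
      using class_value[OF f(1) f'(1) _ that(1-3)] val[OF that(1-3)] that minus f f' \<phi>'(2) by simp
    then show "\<phi>' \<in> hom_class k G P \<chi>" using \<phi>'(1) unfolding hom_class_def by blast
  next
    fix \<phi>' assume m: "\<phi>' \<in> hom_class k G P \<chi>"
    then have \<phi>': "\<phi>' \<in> tate_cocycles k G P T 1"
      and val': "\<And>g p q. g \<in> carrier G \<Longrightarrow> p \<in> carrier (Ob 0) \<Longrightarrow> q \<in> carrier (Ob 1) \<Longrightarrow>
        bd P 1 q = act (Ob 0) p g \<oplus>\<^bsub>Ob 0\<^esub> p \<Longrightarrow> \<phi>' q = \<chi> g \<otimes>\<^bsub>k\<^esub> aug P p"
      unfolding hom_class_def using minus by auto
    define D where "D q = \<phi>' q \<oplus>\<^bsub>k\<^esub> \<phi> q" for q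
    note r = kG_homs_rules[OF tcocycle_hom[OF \<phi>]] kG_homs_rules[OF tcocycle_hom[OF \<phi>']]
    note kk = K.a_assoc K.a_comm K.a_lcomm K_self K_self2
    have Dr: "D q \<in> carrier k" "q' \<in> carrier (Ob 1) \<Longrightarrow> D (q \<oplus>\<^bsub>Ob 1\<^esub> q') = D q \<oplus>\<^bsub>k\<^esub> D q'"
      "c \<in> carrier k \<Longrightarrow> D (c \<odot>\<^bsub>Ob 1\<^esub> q) = c \<otimes>\<^bsub>k\<^esub> D q" if "q \<in> carrier (Ob 1)" for q q' c
      using that r by (simp_all add: D_def kk K.r_distr)
    have D0: "D q = \<zero>\<^bsub>k\<^esub>" if "q \<in> carrier (Ob 1)" "p \<in> carrier (Ob 0)" "g \<in> carrier G" "bd P 1 q =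
        act (Ob 0) p g \<oplus>\<^bsub>Ob 0\<^esub> p" for p q g
      using val[OF that(3,2,1,4)] val'[OF that(3,2,1,4)] that aug_rules r by (simp add: D_def) (metis K_self)
    \<comment> \<open>The choice of \<open>p = 0\<close> and \<open>g\<close> neutral in
      \<open>D0\<close> shows that the difference \<open>D\<close> vanishes on cycles, so
      \<open>D q\<close> depends only on the boundary of \<open>q\<close>.\<close>
    have Db: "D q = D q'" if q: "q \<in> carrier (Ob 1)" "q' \<in> carrier (Ob 1)" "bd P 1 q = bd P 1 q'" for q q'
    proof -
      have qq: "q \<oplus>\<^bsub>Ob 1\<^esub> q' \<in> carrier (Ob 1)" using q by (simp add: add_closed)
      have z: "bd P 1 (q \<oplus>\<^bsub>Ob 1\<^esub> q') = act (Ob 0) \<zero>\<^bsub>Ob 0\<^esub> \<one>\<^bsub>G\<^esub> \<oplus>\<^bsub>Ob 0\<^esub> \<zero>\<^bsub>Ob 0\<^esub>"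
        using q bd_closed[of q' 1 0] bd_add[of q 1 q']
          by (simp add: vs_self vs_r_zero zero_closed act_zero[OF Ob_kG Gr.one_closed])
      have "D q \<oplus>\<^bsub>k\<^esub> D q' = \<zero>\<^bsub>k\<^esub>"
        using D0[OF qq zero_closed[OF Ob_module] Gr.one_closed z] Dr(2)[OF q(1,2)] by simp
      then show ?thesis using vs_eq[OF T_module, of "D q" "D q'"] Dr(1) q by simp
    qed
    obtain p0 where p0: "p0 \<in> carrier (Ob 0)" "aug P p0 = \<one>\<^bsub>k\<^esub>" using aug_surj[OF K.one_closed] by blast
    \<comment> \<open>Removing from \<open>v\<close> the multiple of \<open>p0\<close> with the same
      augmentation leaves a boundary, and \<open>sp v\<close> is a preimage of it. By
      \<open>Db\<close> the value \<open>D (sp v)\<close> does not depend on the preimage.\<close>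
    define sp where "sp v = (SOME q. q \<in> carrier (Ob 1) \<and> bd P 1 q = v \<oplus>\<^bsub>Ob 0\<^esub> aug P v \<odot>\<^bsub>Ob 0\<^esub> p0)" for v
    have sp: "sp v \<in> carrier (Ob 1)" "bd P 1 (sp v) = v \<oplus>\<^bsub>Ob 0\<^esub> aug P v \<odot>\<^bsub>Ob 0\<^esub> p0" if v: "v \<in> carrier (Ob 0)"
      for v
    proof -
      have "v \<oplus>\<^bsub>Ob 0\<^esub> aug P v \<odot>\<^bsub>Ob 0\<^esub> p0 \<in> carrier (Ob 0)" "aug P (v \<oplus>\<^bsub>Ob 0\<^esub> aug P v \<odot>\<^bsub>Ob 0\<^esub> p0) = \<zero>\<^bsub>k\<^esub>"
        using v p0 aug_rules by (simp_all add: vs_closed K_self)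
      then have "\<exists>q. q \<in> carrier (Ob 1) \<and> bd P 1 q = v \<oplus>\<^bsub>Ob 0\<^esub> aug P v \<odot>\<^bsub>Ob 0\<^esub> p0" using aug_lift by blast
      from someI_ex[OF this] show "sp v \<in> carrier (Ob 1)" "bd P 1 (sp v) = v \<oplus>\<^bsub>Ob 0\<^esub> aug P v \<odot>\<^bsub>Ob 0\<^esub> p0"
        unfolding sp_def by auto
    qed
    have ba: "bd P 1 (x \<oplus>\<^bsub>Ob 1\<^esub> y) = bd P 1 x \<oplus>\<^bsub>Ob 0\<^esub> bd P 1 y" "c \<in> carrier k \<Longrightarrow> bd P 1 (c \<odot>\<^bsub>Ob 1\<^esub> x) =
        c \<odot>\<^bsub>Ob 0\<^esub> bd P 1 x"
      if "x \<in> carrier (Ob 1)" "y \<in> carrier (Ob 1)" for x y c using bd_add[OF that] bd_smult[OF _ that(1), of c]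
        by simp_all
    have \<psi>: "(\<lambda>v\<in>carrier (Ob 0). D (sp v)) \<in> kG_homs k G (Ob 0) T"
    proof (rule kG_homsI)
      fix v assume v: "v \<in> carrier (Ob 0)"
      show "(\<lambda>v\<in>carrier (Ob 0). D (sp v)) v \<in> carrier T" using v sp Dr by simp
      { fix u assume u: "u \<in> carrier (Ob 0)"
        have uv: "u \<oplus>\<^bsub>Ob 0\<^esub> v \<in> carrier (Ob 0)" using u v by (simp add: add_closed)
        have "D (sp (u \<oplus>\<^bsub>Ob 0\<^esub> v)) = D (sp u \<oplus>\<^bsub>Ob 1\<^esub> sp v)"
          by (rule Db) (use u v uv sp p0 aug_rules in \<open>simp_all add: vs_ac ba smult_ladd smult_closed\<close>)
        then show "(\<lambda>v\<in>carrier (Ob 0). D (sp v)) (u \<oplus>\<^bsub>Ob 0\<^esub> v) =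
            (\<lambda>v\<in>carrier (Ob 0). D (sp v)) u \<oplus>\<^bsub>T\<^esub> (\<lambda>v\<in>carrier (Ob 0). D (sp v)) v"
          using u v uv sp Dr by simp }
      { fix c assume c: "c \<in> carrier k"
        have cv: "c \<odot>\<^bsub>Ob 0\<^esub> v \<in> carrier (Ob 0)" using c v by (simp add: smult_closed)
        have "D (sp (c \<odot>\<^bsub>Ob 0\<^esub> v)) = D (c \<odot>\<^bsub>Ob 1\<^esub> sp v)"
          by (rule Db) (use c v cv sp[OF v] sp[OF cv] p0 aug_rules in \<open>simp_all add: vs_closed ba[of _ "sp v"]
            smult_radd smult_mult\<close>)
        then show "(\<lambda>v\<in>carrier (Ob 0). D (sp v)) (c \<odot>\<^bsub>Ob 0\<^esub> v) = c \<odot>\<^bsub>T\<^esub> (\<lambda>v\<in>carrier (Ob 0). D (sp v)) v"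
          using c v cv sp Dr by simp }
      { fix g assume g: "g \<in> carrier G"
        have gv: "act (Ob 0) v g \<in> carrier (Ob 0)" by (rule act_closed[OF Ob_kG v g])
        \<comment> \<open>\<open>v\<close> and its translate have the same augmentation, so the
          multiples of \<open>p0\<close> cancel and the boundary is exactly \<open>v g - v\<close>;
          \<open>D0\<close> applies.\<close>
        have "D (sp (act (Ob 0) v g) \<oplus>\<^bsub>Ob 1\<^esub> sp v) = \<zero>\<^bsub>k\<^esub>"
          by (rule D0[OF _ v g]) (use v gv g sp p0 aug_rules in \<open>simp_all add: vs_ac ba smult_closed\<close>)
        then have "D (sp (act (Ob 0) v g)) \<oplus>\<^bsub>T\<^esub> D (sp v) = \<zero>\<^bsub>T\<^esub>" using v gv sp Dr by simp
        then have "D (sp (act (Ob 0) v g)) = D (sp v)" using vs_eq[OF T_module, of "D (sp (act (Ob 0) v g))"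
          "D (sp v)"] v gv sp Dr by simp
        then show "(\<lambda>v\<in>carrier (Ob 0). D (sp v)) (act (Ob 0) v g) = act T ((\<lambda>v\<in>carrier (Ob 0). D (sp v)) v) g"
          using v gv by simp }
    qed simp
    have "\<phi>' v \<oplus>\<^bsub>T\<^esub> \<phi> v = (\<lambda>v\<in>carrier (Ob 0). D (sp v)) (bd P 1 v)" if v: "v \<in> carrier (Ob 1)" for v
    proof -
      have b: "bd P 1 v \<in> carrier (Ob 0)" using v by (auto intro: bd_closed)
      have "D (sp (bd P 1 v)) = D v" by (rule Db) (use v b sp[OF b] p0 in \<open>simp_all add: aug_bd smult_0
        vs_r_zero\<close>)
      then show ?thesis using b by (simp add: D_def)
    qed
    then have "tcl T 1 \<phi>' = tcl T 1 \<phi>" unfolding tcl_eq[OF T_kG \<phi>' \<phi>] using \<psi>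
      by (intro bexI[of _ "\<lambda>v\<in>carrier (Ob 0). D (sp v)"]) simp_all
    then show "\<phi>' \<in> tcl T 1 \<phi>" using tcl_self[OF T_kG \<phi>'] by simp
  }
qed

text \<open>A function \<open>f\<close> on \<open>G\<close> whose coboundary is the sum of the cup products of the \<open>\<chi> s\<close>
  and \<open>\<chi> t\<close> with \<open>c s t\<close> defines a four-dimensional unipotent \<open>kG\<close>-module.\<close>

definition pick :: "bool \<Rightarrow> 'k \<Rightarrow> 'k" where
  "pick b x = (if b then x else \<zero>\<^bsub>k\<^esub>)"

definition quad :: "(bool \<Rightarrow> 'g \<Rightarrow> 'k) \<Rightarrow> (bool \<Rightarrow> bool \<Rightarrow> bool) \<Rightarrow> 'g \<Rightarrow> (bool \<Rightarrow> 'k) \<Rightarrow> 'k" where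
  "quad \<chi> c g l = \<chi> False g \<otimes>\<^bsub>k\<^esub> (pick (c False False) (l False) \<oplus>\<^bsub>k\<^esub> pick (c False True) (l True)) \<oplus>\<^bsub>k\<^esub>
     \<chi> True g \<otimes>\<^bsub>k\<^esub> (pick (c True False) (l False) \<oplus>\<^bsub>k\<^esub> pick (c True True) (l True))"

lemma pick_rules: "x \<in> carrier k \<Longrightarrow> pick b x \<in> carrier k" "x \<in> carrier k \<Longrightarrow> y \<in> carrier k \<Longrightarrow> pick b (x \<oplus>\<^bsub>k\<^esub> y) =
    pick b x \<oplus>\<^bsub>k\<^esub> pick b y"
  "x \<in> carrier k \<Longrightarrow> y \<in> carrier k \<Longrightarrow> pick b (x \<otimes>\<^bsub>k\<^esub> y) = x \<otimes>\<^bsub>k\<^esub> pick b y"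
  by (auto simp: pick_def)

context
  fixes \<chi> :: "bool \<Rightarrow> 'g \<Rightarrow> 'k" and c f
  assumes \<chi>: "\<And>i. \<chi> i \<in> hom G (add_monoid k)" and f: "\<And>g. g \<in> carrier G \<Longrightarrow> f g \<in> carrier k"
    and df: "\<And>g h. g \<in> carrier G \<Longrightarrow> h \<in> carrier G \<Longrightarrow> f (g \<otimes>\<^bsub>G\<^esub> h) = f g \<oplus>\<^bsub>k\<^esub> (f h \<oplus>\<^bsub>k\<^esub> quad \<chi> c h (\<lambda>i. \<chi> i g))"
begin

lemma \<chi>_rules: "g \<in> carrier G \<Longrightarrow> \<chi> i g \<in> carrier k" "g \<in> carrier G \<Longrightarrow> h \<in> carrier G \<Longrightarrow> \<chi> i (g \<otimes>\<^bsub>G\<^esub> h) =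
    \<chi> i g \<oplus>\<^bsub>k\<^esub> \<chi> i h"
  using \<chi>[of i] by (auto simp: hom_def)

lemma \<chi>_one: "\<chi> i \<one>\<^bsub>G\<^esub> = \<zero>\<^bsub>k\<^esub>"
  using \<chi>_rules(2)[of "\<one>\<^bsub>G\<^esub>" "\<one>\<^bsub>G\<^esub>" i] \<chi>_rules(1)[of "\<one>\<^bsub>G\<^esub>" i] by (simp add: K_self)

text \<open>Lift the augmentation along the projection of the four-dimensional module onto its
  trivial quotient, using that degree zero of the resolution is projective. The other coordinates
  \<open>\<mu>\<close> and \<open>F\<close> of the lift fail to be equivariant in a controlled way,
  governed by \<open>\<chi>\<close> and \<open>f\<close>.\<close>

lemma quad_lift:
  "\<exists>\<mu> F. \<forall>p\<in>carrier (Ob 0). (\<forall>i. \<mu> i p \<in> carrier k) \<and> F p \<in> carrier k \<and>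
     (\<forall>q\<in>carrier (Ob 0). (\<forall>i. \<mu> i (p \<oplus>\<^bsub>Ob 0\<^esub> q) = \<mu> i p \<oplus>\<^bsub>k\<^esub> \<mu> i q) \<and> F (p \<oplus>\<^bsub>Ob 0\<^esub> q) = F p \<oplus>\<^bsub>k\<^esub> F q) \<and>
     (\<forall>x\<in>carrier k. (\<forall>i. \<mu> i (x \<odot>\<^bsub>Ob 0\<^esub> p) = x \<otimes>\<^bsub>k\<^esub> \<mu> i p) \<and> F (x \<odot>\<^bsub>Ob 0\<^esub> p) = x \<otimes>\<^bsub>k\<^esub> F p) \<and>
     (\<forall>g\<in>carrier G. (\<forall>i. \<mu> i (act (Ob 0) p g) = \<mu> i p \<oplus>\<^bsub>k\<^esub> \<chi> i g \<otimes>\<^bsub>k\<^esub> aug P p) \<and>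
       F (act (Ob 0) p g) = F p \<oplus>\<^bsub>k\<^esub> (quad \<chi> c g (\<lambda>i. \<mu> i p) \<oplus>\<^bsub>k\<^esub> f g \<otimes>\<^bsub>k\<^esub> aug P p))"
proof -
  note kk = K.a_assoc K.a_comm K.a_lcomm K_self K_self2
  let ?V = "sum_module T (sum_module (vec T) T)"
  have mV: "module k ?V" by (intro module_sum module_vec T_module)
  \<comment> \<open>Unipotent action on triples: a scalar, two coordinates that move by the
    homomorphisms, and a last coordinate that moves by \<open>quad\<close> and
    \<open>f\<close>.\<close>
  define \<alpha> where "\<alpha> = (\<lambda>(e, l, F) g. (e, \<lambda>i. l i \<oplus>\<^bsub>k\<^esub> \<chi> i g \<otimes>\<^bsub>k\<^esub> e, F \<oplus>\<^bsub>k\<^esub> (quad \<chi> c g l \<oplus>\<^bsub>k\<^esub> f g \<otimes>\<^bsub>k\<^esub> e)))"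
  let ?M = "with_act ?V \<alpha>"
  have Vs: "carrier ?V = {(e, l, F). e \<in> carrier k \<and> (\<forall>i. l i \<in> carrier k) \<and> F \<in> carrier k}"
    "(e, l, F) \<oplus>\<^bsub>?V\<^esub> (e', l', F') = (e \<oplus>\<^bsub>k\<^esub> e', \<lambda>i. l i \<oplus>\<^bsub>k\<^esub> l' i, F \<oplus>\<^bsub>k\<^esub> F')"
    "x \<odot>\<^bsub>?V\<^esub> (e, l, F) = (x \<otimes>\<^bsub>k\<^esub> e, \<lambda>i. x \<otimes>\<^bsub>k\<^esub> l i, x \<otimes>\<^bsub>k\<^esub> F)" for e l F e' l' F' x
    by (auto simp: sum_module_def vec_simps)
  have qc: "quad \<chi> c g l \<in> carrier k" if "g \<in> carrier G" "\<And>i. l i \<in> carrier k" for g l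
    using that by (simp add: quad_def \<chi>_rules pick_rules)
  have qa: "quad \<chi> c g (\<lambda>i. l i \<oplus>\<^bsub>k\<^esub> l' i) = quad \<chi> c g l \<oplus>\<^bsub>k\<^esub> quad \<chi> c g l'" if "g \<in> carrier G"
    "\<And>i. l i \<in> carrier k" "\<And>i. l' i \<in> carrier k" for g l l'
    using that by (simp add: quad_def \<chi>_rules pick_rules K.r_distr kk)
  have qs: "quad \<chi> c g (\<lambda>i. x \<otimes>\<^bsub>k\<^esub> l i) = x \<otimes>\<^bsub>k\<^esub> quad \<chi> c g l" if "g \<in> carrier G" "\<And>i. l i \<in> carrier k"
    "x \<in> carrier k" for g l x
    using that by (simp add: quad_def \<chi>_rules pick_rules K.r_distr K.m_lcomm)
  have qs': "quad \<chi> c g (\<lambda>i. l i \<otimes>\<^bsub>k\<^esub> x) = quad \<chi> c g l \<otimes>\<^bsub>k\<^esub> x" if "g \<in> carrier G" "\<And>i. l i \<in> carrier k"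
    "x \<in> carrier k" for g l x
    using qs[OF that] that qc[OF that(1,2)] by (simp add: K.m_comm)
  have qg: "quad \<chi> c (g \<otimes>\<^bsub>G\<^esub> h) l = quad \<chi> c g l \<oplus>\<^bsub>k\<^esub> quad \<chi> c h l" if "g \<in> carrier G" "h \<in> carrier G"
    "\<And>i. l i \<in> carrier k" for g h l
    using that by (simp add: quad_def \<chi>_rules pick_rules K.l_distr kk)
  have q1: "quad \<chi> c \<one>\<^bsub>G\<^esub> l = \<zero>\<^bsub>k\<^esub>" if "\<And>i. l i \<in> carrier k" for l using that
    by (simp add: quad_def \<chi>_one pick_rules)
  have f1: "f \<one>\<^bsub>G\<^esub> = \<zero>\<^bsub>k\<^esub>" using df[of "\<one>\<^bsub>G\<^esub>" "\<one>\<^bsub>G\<^esub>"] f[of "\<one>\<^bsub>G\<^esub>"] by (simp add: q1 \<chi>_one K_self)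
  have M: "kG_module k G ?M"
  proof (rule kG_moduleI)
    show "module k ?M" by (rule module_with_act[OF mV])
    show "act ?M v g \<in> carrier ?M" if "v \<in> carrier ?M" "g \<in> carrier G" for v g
      using that by (cases v) (auto simp: with_act_simps Vs \<alpha>_def \<chi>_rules f qc)
    show "act ?M (u \<oplus>\<^bsub>?M\<^esub> v) g = act ?M u g \<oplus>\<^bsub>?M\<^esub> act ?M v g" if "u \<in> carrier ?M" "v \<in> carrier ?M"
      "g \<in> carrier G" for u v g
      using that by (cases u; cases v) (auto simp: with_act_simps Vs \<alpha>_def \<chi>_rules f qc qa K.r_distr kk)
    show "act ?M (x \<odot>\<^bsub>?M\<^esub> v) g = x \<odot>\<^bsub>?M\<^esub> act ?M v g" if "x \<in> carrier k" "v \<in> carrier ?M" "g \<in> carrier G"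
      for x v g
      using that by (cases v) (auto simp: with_act_simps Vs \<alpha>_def \<chi>_rules f qc qs K.r_distr K.m_lcomm)
    show "act ?M v \<one>\<^bsub>G\<^esub> = v" if "v \<in> carrier ?M" for v
      using that by (cases v) (auto simp: with_act_simps Vs \<alpha>_def \<chi>_one q1 f1)
    \<comment> \<open>In the last coordinate, compatibility with products is the coboundary
      condition \<open>df\<close>.\<close>
    show "act ?M v (g \<otimes>\<^bsub>G\<^esub> h) = act ?M (act ?M v g) h" if "v \<in> carrier ?M" "g \<in> carrier G" "h \<in> carrier G"
      for v g h
      using that by (cases v) (auto simp: with_act_simps Vs \<alpha>_def \<chi>_rules f qc qa qs' qg df K.l_distr kk)
  qed
  have q: "(\<lambda>m\<in>carrier ?M. fst m) \<in> kG_homs k G ?M T"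
  proof (rule kG_homsI)
    have mM: "module k ?M" by (rule module_with_act[OF mV])
    show "(\<lambda>m\<in>carrier ?M. fst m) (u \<oplus>\<^bsub>?M\<^esub> v) = (\<lambda>m\<in>carrier ?M. fst m) u \<oplus>\<^bsub>T\<^esub> (\<lambda>m\<in>carrier ?M. fst m) v"
      if "u \<in> carrier ?M" "v \<in> carrier ?M" for u v
      using that add_closed[OF mM that] by (cases u; cases v) (simp add: with_act_simps Vs)
    show "(\<lambda>m\<in>carrier ?M. fst m) (x \<odot>\<^bsub>?M\<^esub> v) = x \<odot>\<^bsub>T\<^esub> (\<lambda>m\<in>carrier ?M. fst m) v" if "x \<in> carrier k"
      "v \<in> carrier ?M" for x v
      using that smult_closed[OF mM that] by (cases v) (simp add: with_act_simps Vs)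
    show "(\<lambda>m\<in>carrier ?M. fst m) (act ?M v g) = act T ((\<lambda>m\<in>carrier ?M. fst m) v) g" if "g \<in> carrier G"
      "v \<in> carrier ?M" for g v
      using that act_closed[OF M that(2,1)] by (cases v) (simp add: with_act_simps Vs \<alpha>_def)
  qed (auto simp: with_act_simps Vs)
  have "\<exists>l\<in>carrier ?M. (\<lambda>m\<in>carrier ?M. fst m) l = aug P v" if "v \<in> carrier (Ob 0)" for v
    using aug_rules(1)[OF that] by (intro bexI[of _ "(aug P v, \<lambda>_. \<zero>\<^bsub>k\<^esub>, \<zero>\<^bsub>k\<^esub>)"]) (auto simp: with_act_simps Vs)
  from projective_lift[OF Ob_projective M T_kG aug_hom q this]
  obtain h where h: "h \<in> kG_homs k G (Ob 0) ?M" "\<And>v. v \<in> carrier (Ob 0) \<Longrightarrow> (\<lambda>m\<in>carrier ?M. fst m) (h v) =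
      aug P v" by blast
  note hr = kG_homs_rules[OF h(1)]
  have hm: "\<exists>l F. h v = (aug P v, l, F) \<and> (\<forall>i. l i \<in> carrier k) \<and> F \<in> carrier k" if "v \<in> carrier (Ob 0)" for v
    using hr(1)[OF that] h(2)[OF that] by (cases "h v") (auto simp: with_act_simps Vs)
  define \<mu> F where "\<mu> i v = fst (snd (h v)) i" and "F v = snd (snd (h v))" for i v
  have hv: "h v = (aug P v, \<lambda>i. \<mu> i v, F v)" "\<mu> i v \<in> carrier k" "F v \<in> carrier k" if "v \<in> carrier (Ob 0)"
    for v i
    using hm[OF that] by (auto simp: \<mu>_def F_def)
  have add: "h (p \<oplus>\<^bsub>Ob 0\<^esub> q) = (aug P p \<oplus>\<^bsub>k\<^esub> aug P q, \<lambda>i. \<mu> i p \<oplus>\<^bsub>k\<^esub> \<mu> i q, F p \<oplus>\<^bsub>k\<^esub> F q)"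
    if "p \<in> carrier (Ob 0)" "q \<in> carrier (Ob 0)" for p q
    using hr(2)[OF that] unfolding hv(1)[OF that(1)] hv(1)[OF that(2)] by (simp add: with_act_simps Vs)
  have sm: "h (x \<odot>\<^bsub>Ob 0\<^esub> p) = (x \<otimes>\<^bsub>k\<^esub> aug P p, \<lambda>i. x \<otimes>\<^bsub>k\<^esub> \<mu> i p, x \<otimes>\<^bsub>k\<^esub> F p)" if "x \<in> carrier k"
    "p \<in> carrier (Ob 0)" for x p
    using hr(3)[OF that] unfolding hv(1)[OF that(2)] by (simp add: with_act_simps Vs)
  have ac: "h (act (Ob 0) p g) = \<alpha> (aug P p, \<lambda>i. \<mu> i p, F p) g" if "g \<in> carrier G" "p \<in> carrier (Ob 0)" for g p
    using hr(4)[OF that(2,1)] unfolding hv(1)[OF that(2)] by (simp add: with_act_simps)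
  have "\<mu> i (p \<oplus>\<^bsub>Ob 0\<^esub> q) = \<mu> i p \<oplus>\<^bsub>k\<^esub> \<mu> i q" "F (p \<oplus>\<^bsub>Ob 0\<^esub> q) = F p \<oplus>\<^bsub>k\<^esub> F q"
    if "p \<in> carrier (Ob 0)" "q \<in> carrier (Ob 0)" for i p q
    using add[OF that] by (simp_all add: \<mu>_def F_def)
  moreover have "\<mu> i (x \<odot>\<^bsub>Ob 0\<^esub> p) = x \<otimes>\<^bsub>k\<^esub> \<mu> i p" "F (x \<odot>\<^bsub>Ob 0\<^esub> p) = x \<otimes>\<^bsub>k\<^esub> F p"
    if "x \<in> carrier k" "p \<in> carrier (Ob 0)" for i x p
    using sm[OF that] by (simp_all add: \<mu>_def F_def)
  moreover have "\<mu> i (act (Ob 0) p g) = \<mu> i p \<oplus>\<^bsub>k\<^esub> \<chi> i g \<otimes>\<^bsub>k\<^esub> aug P p"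
    "F (act (Ob 0) p g) = F p \<oplus>\<^bsub>k\<^esub> (quad \<chi> c g (\<lambda>i. \<mu> i p) \<oplus>\<^bsub>k\<^esub> f g \<otimes>\<^bsub>k\<^esub> aug P p)"
    if "g \<in> carrier G" "p \<in> carrier (Ob 0)" for i g p
    using ac[OF that] by (simp_all add: \<mu>_def[of _ "act (Ob 0) p g"] F_def[of "act (Ob 0) p g"] \<alpha>_def)
  ultimately show ?thesis using hv(2,3) by (intro exI[of _ \<mu>] exI[of _ F]) simp
qed

text \<open>A primitive of the sum of products is the sum of the \<open>\<mu> s\<close> composed
  with the chain maps \<open>\<eta> t\<close>, corrected by \<open>F\<close> composed with the
  boundary. Neither part is equivariant; the defects of both are \<open>quad\<close>, evaluated at
  the boundary, and cancel.\<close>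

lemma quad_relation:
  "\<exists>\<eta>. (\<forall>i. \<eta> i \<in> Z 1 \<and> ecl 1 (\<eta> i) = hom_class k G P (\<chi> i) \<and>
     (\<forall>g\<in>carrier G. \<forall>p\<in>carrier (Ob 0). \<forall>q\<in>carrier (Ob 1). bd P 1 q = act (Ob 0) p g \<oplus>\<^bsub>Ob 0\<^esub> p \<longrightarrow>
       aug P (\<eta> i 0 q) = \<chi> i g \<otimes>\<^bsub>k\<^esub> aug P p))" (is ?A)
  "((if c False False then tact T 1 1 (hom_class k G P (\<chi> False)) (hom_class k G P (\<chi> False)) else \<zero>\<^bsub>H 2\<^esub>) \<oplus>\<^bsub>H
      2\<^esub>
    (if c False True then tact T 1 1 (hom_class k G P (\<chi> False)) (hom_class k G P (\<chi> True)) else \<zero>\<^bsub>H 2\<^esub>)) \<oplus>\<^bsub>H 2\<^esub>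
   ((if c True False then tact T 1 1 (hom_class k G P (\<chi> True)) (hom_class k G P (\<chi> False)) else \<zero>\<^bsub>H 2\<^esub>) \<oplus>\<^bsub>H 2\<^esub>
    (if c True True then tact T 1 1 (hom_class k G P (\<chi> True)) (hom_class k G P (\<chi> True)) else \<zero>\<^bsub>H 2\<^esub>)) = \<zero>\<^bsub>H
      2\<^esub>"
    (is ?B)
proof -
  note kk = K.a_assoc K.a_comm K.a_lcomm K_self K_self2
  obtain \<mu> F where q: "\<forall>p\<in>carrier (Ob 0). (\<forall>i. \<mu> i p \<in> carrier k) \<and> F p \<in> carrier k \<and>
     (\<forall>q\<in>carrier (Ob 0). (\<forall>i. \<mu> i (p \<oplus>\<^bsub>Ob 0\<^esub> q) = \<mu> i p \<oplus>\<^bsub>k\<^esub> \<mu> i q) \<and> F (p \<oplus>\<^bsub>Ob 0\<^esub> q) = F p \<oplus>\<^bsub>k\<^esub> F q) \<and>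
     (\<forall>x\<in>carrier k. (\<forall>i. \<mu> i (x \<odot>\<^bsub>Ob 0\<^esub> p) = x \<otimes>\<^bsub>k\<^esub> \<mu> i p) \<and> F (x \<odot>\<^bsub>Ob 0\<^esub> p) = x \<otimes>\<^bsub>k\<^esub> F p) \<and>
     (\<forall>g\<in>carrier G. (\<forall>i. \<mu> i (act (Ob 0) p g) = \<mu> i p \<oplus>\<^bsub>k\<^esub> \<chi> i g \<otimes>\<^bsub>k\<^esub> aug P p) \<and>
       F (act (Ob 0) p g) = F p \<oplus>\<^bsub>k\<^esub> (quad \<chi> c g (\<lambda>i. \<mu> i p) \<oplus>\<^bsub>k\<^esub> f g \<otimes>\<^bsub>k\<^esub> aug P p))"
    using quad_lift by (elim exE)
  have \<mu>: "\<And>i p. p \<in> carrier (Ob 0) \<Longrightarrow> \<mu> i p \<in> carrier k" "\<And>p. p \<in> carrier (Ob 0) \<Longrightarrow> F p \<in> carrier k"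
    "\<And>i p q. p \<in> carrier (Ob 0) \<Longrightarrow> q \<in> carrier (Ob 0) \<Longrightarrow> \<mu> i (p \<oplus>\<^bsub>Ob 0\<^esub> q) = \<mu> i p \<oplus>\<^bsub>k\<^esub> \<mu> i q"
    "\<And>p q. p \<in> carrier (Ob 0) \<Longrightarrow> q \<in> carrier (Ob 0) \<Longrightarrow> F (p \<oplus>\<^bsub>Ob 0\<^esub> q) = F p \<oplus>\<^bsub>k\<^esub> F q"
    "\<And>i x p. x \<in> carrier k \<Longrightarrow> p \<in> carrier (Ob 0) \<Longrightarrow> \<mu> i (x \<odot>\<^bsub>Ob 0\<^esub> p) = x \<otimes>\<^bsub>k\<^esub> \<mu> i p"
    "\<And>x p. x \<in> carrier k \<Longrightarrow> p \<in> carrier (Ob 0) \<Longrightarrow> F (x \<odot>\<^bsub>Ob 0\<^esub> p) = x \<otimes>\<^bsub>k\<^esub> F p"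
    "\<And>i g p. g \<in> carrier G \<Longrightarrow> p \<in> carrier (Ob 0) \<Longrightarrow> \<mu> i (act (Ob 0) p g) = \<mu> i p \<oplus>\<^bsub>k\<^esub> \<chi> i g \<otimes>\<^bsub>k\<^esub> aug P p"
    "\<And>g p. g \<in> carrier G \<Longrightarrow> p \<in> carrier (Ob 0) \<Longrightarrow> F (act (Ob 0) p g) =
        F p \<oplus>\<^bsub>k\<^esub> (quad \<chi> c g (\<lambda>i. \<mu> i p) \<oplus>\<^bsub>k\<^esub> f g \<otimes>\<^bsub>k\<^esub> aug P p)"
    using q by simp_all
  have b1: "bd P 1 q \<in> carrier (Ob 0)" if "q \<in> carrier (Ob 1)" for q using that by (auto intro: bd_closed)
  have b2: "bd P 2 q \<in> carrier (Ob 1)" if "q \<in> carrier (Ob 2)" for q using that by (auto intro: bd_closed)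
  have ba: "x \<in> carrier (Ob 1) \<Longrightarrow> y \<in> carrier (Ob 1) \<Longrightarrow> bd P 1 (x \<oplus>\<^bsub>Ob 1\<^esub> y) = bd P 1 x \<oplus>\<^bsub>Ob 0\<^esub> bd P 1 y"
    "t \<in> carrier k \<Longrightarrow> x \<in> carrier (Ob 1) \<Longrightarrow> bd P 1 (t \<odot>\<^bsub>Ob 1\<^esub> x) = t \<odot>\<^bsub>Ob 0\<^esub> bd P 1 x"
    "x \<in> carrier (Ob 1) \<Longrightarrow> g \<in> carrier G \<Longrightarrow> bd P 1 (act (Ob 1) x g) = act (Ob 0) (bd P 1 x) g" for x y t g
    using bd_add[of x 1 y] bd_smult[of t x 1] bd_act[of x 1 g] by simp_all
  have ac: "x \<in> carrier (Ob n) \<Longrightarrow> g \<in> carrier G \<Longrightarrow> act (Ob n) x g \<in> carrier (Ob n)" for x n g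
    by (rule act_closed[OF Ob_kG])
  have \<mu>0: "\<mu> i \<zero>\<^bsub>Ob 0\<^esub> = \<zero>\<^bsub>k\<^esub>" for i
    using \<mu>(5)[OF K.zero_closed zero_closed[OF Ob_module], of i] \<mu>(1)[OF zero_closed[OF Ob_module]]
      by (simp add: smult_0 zero_closed)
  \<comment> \<open>The defect of equivariance of \<open>\<mu> i\<close> is a multiple of the
    augmentation, which vanishes on boundaries; composed with the boundary it becomes equivariant,
    and it represents the class of the homomorphism.\<close>
  define \<phi> where "\<phi> i = (\<lambda>q\<in>carrier (Ob 1). \<mu> i (bd P 1 q))" for i
  have \<phi>h: "\<phi> i \<in> kG_homs k G (Ob 1) T" for i
  proof (rule kG_homsI)
    show "\<phi> i \<in> extensional (carrier (Ob 1))" by (simp add: \<phi>_def)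
    show "\<phi> i v \<in> carrier T" if "v \<in> carrier (Ob 1)" for v using \<mu>(1)[OF b1[OF that]] that by (simp add: \<phi>_def)
    show "\<phi> i (u \<oplus>\<^bsub>Ob 1\<^esub> v) = \<phi> i u \<oplus>\<^bsub>T\<^esub> \<phi> i v" if "u \<in> carrier (Ob 1)" "v \<in> carrier (Ob 1)" for u v
      using that \<mu>(3)[OF b1[OF that(1)] b1[OF that(2)]] by (simp add: \<phi>_def ba(1) add_closed)
    show "\<phi> i (x \<odot>\<^bsub>Ob 1\<^esub> v) = x \<odot>\<^bsub>T\<^esub> \<phi> i v" if "x \<in> carrier k" "v \<in> carrier (Ob 1)" for x v
      using that \<mu>(5)[OF that(1) b1[OF that(2)]] by (simp add: \<phi>_def ba(2) smult_closed)
    show "\<phi> i (act (Ob 1) v g) = act T (\<phi> i v) g" if "g \<in> carrier G" "v \<in> carrier (Ob 1)" for g v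
      using that \<mu>(7)[OF that(1) b1[OF that(2)]] \<mu>(1)[OF b1[OF that(2)]] aug_bd[OF that(2)] ac[OF that(2,1)]
      by (simp add: \<phi>_def ba(3) \<chi>_rules(1))
  qed
  have "\<phi> i (bd P 2 v) = \<zero>\<^bsub>T\<^esub>" if "v \<in> carrier (Ob 2)" for i v
    using bd_bd[OF that, of 1 0] b2[OF that] by (simp add: \<phi>_def \<mu>0)
  then have \<phi>Z: "\<phi> i \<in> tate_cocycles k G P T 1" for i
    using \<phi>h[of i] by (simp add: tcocycle_iff)
  have val: "\<phi> i q = \<chi> i g \<otimes>\<^bsub>k\<^esub> aug P p"
    if "g \<in> carrier G" "p \<in> carrier (Ob 0)" "q \<in> carrier (Ob 1)" "bd P 1 q = act (Ob 0) p g \<oplus>\<^bsub>Ob 0\<^esub> p"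
      for i g p q
    using that by (simp add: \<phi>_def \<mu> ac aug_rules \<chi>_rules kk)
  have X: "hom_class k G P (\<chi> i) = tcl T 1 (\<phi> i)" for i by (rule hom_class_eq[OF \<phi>Z val])
  have "\<exists>\<eta>. \<eta> \<in> Z 1 \<and> ecl 1 \<eta> = tcl T 1 (\<phi> i) \<and> (\<forall>v\<in>carrier (Ob 1). aug P (\<eta> 0 v) = \<phi> i v)" for i
    using cocycle_lift[OF \<phi>Z] by blast
  then obtain \<eta> where \<eta>: "\<And>i. \<eta> i \<in> Z 1" "\<And>i. ecl 1 (\<eta> i) = tcl T 1 (\<phi> i)" "\<And>i v. v \<in> carrier (Ob 1) \<Longrightarrow>
      aug P (\<eta> i 0 v) = \<phi> i v"
    by metis
  show ?A by (rule exI[of _ \<eta>]) (use \<eta> X val in auto)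
  have \<eta>c: "\<eta> i 0 q \<in> carrier (Ob 0)" if "q \<in> carrier (Ob 1)" for i q
    using endo_closed[OF cocycle_endo[OF \<eta>(1)], of q 0] that by simp
  have \<eta>c1: "\<eta> i 1 q \<in> carrier (Ob 1)" if "q \<in> carrier (Ob 2)" for i q
    using endo_closed[OF cocycle_endo[OF \<eta>(1)], of q 1] that by simp
  have \<eta>b: "bd P 1 (\<eta> i 1 q) = \<eta> i 0 (bd P 2 q)" if "q \<in> carrier (Ob 2)" for i q
    using cocycle_bd[OF \<eta>(1) that, of 1 0] by simp
  have \<eta>r: "x \<in> carrier (Ob 1) \<Longrightarrow> y \<in> carrier (Ob 1) \<Longrightarrow> \<eta> i 0 (x \<oplus>\<^bsub>Ob 1\<^esub> y) = \<eta> i 0 x \<oplus>\<^bsub>Ob 0\<^esub> \<eta> i 0 y"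
    "t \<in> carrier k \<Longrightarrow> x \<in> carrier (Ob 1) \<Longrightarrow> \<eta> i 0 (t \<odot>\<^bsub>Ob 1\<^esub> x) = t \<odot>\<^bsub>Ob 0\<^esub> \<eta> i 0 x"
    "x \<in> carrier (Ob 1) \<Longrightarrow> g \<in> carrier G \<Longrightarrow> \<eta> i 0 (act (Ob 1) x g) = act (Ob 0) (\<eta> i 0 x) g" for x y t g i
    using endo_add[OF cocycle_endo[OF \<eta>(1)], of x 0 y 1] endo_smult[OF cocycle_endo[OF \<eta>(1)], of t x 0 1]
      endo_act[OF cocycle_endo[OF \<eta>(1)], of x 0 g 1] by simp_all
  define \<Psi> where "\<Psi> s t = (if c s t then compose (carrier (Ob 2)) (\<phi> s) (\<eta> t 1) else (\<lambda>v\<in>carrier (Ob 2). \<zero>\<^bsub>T\<^esub>))"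
    for s t
  have cz: "compose (carrier (Ob 2)) (\<phi> s) (\<eta> t 1) \<in> tate_cocycles k G P T 2" for s t
    by (rule pull_closed[OF T_kG \<phi>Z \<eta>(1)]) simp
  have zz: "(\<lambda>v\<in>carrier (Ob 2). \<zero>\<^bsub>T\<^esub>) \<in> tate_cocycles k G P T 2"
    using zero_closed[OF TZ_module[OF T_kG], of 2] by (simp add: hom_module_def)
  have \<Psi>Z: "\<Psi> s t \<in> tate_cocycles k G P T 2" for s t unfolding \<Psi>_def using cz zz by simp
  have \<Psi>X: "(if c s t then tact T 1 1 (hom_class k G P (\<chi> s)) (hom_class k G P (\<chi> t)) else \<zero>\<^bsub>H 2\<^esub>) =
      tcl T 2 (\<Psi> s t)" for s t
    using tact_eq[OF T_kG \<phi>Z \<eta>(1), of s t] tcl_zero[OF T_kG, of 2] unfolding X \<eta>(2)[symmetric, of t] \<Psi>_def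
      by simp
  define Y where "Y s = (\<lambda>v\<in>carrier (Ob 2). \<Psi> s False v \<oplus>\<^bsub>T\<^esub> \<Psi> s True v)" for s
  have YZ: "Y s \<in> tate_cocycles k G P T 2" for s unfolding Y_def by (rule tcl_sum_cocycle[OF T_kG \<Psi>Z \<Psi>Z])
  \<comment> \<open>Translation by \<open>g\<close> changes \<open>\<mu> s (\<eta> t 0 q)\<close> by
    \<open>\<chi> s g\<close> times \<open>\<phi> t q\<close>, and summing gives \<open>quad\<close>
    at the boundary of \<open>q\<close>, the same amount by which \<open>F\<close> changes. On
    boundaries the term with \<open>F\<close> vanishes.\<close>
  define \<psi> where "\<psi> = (\<lambda>q\<in>carrier (Ob 1).
      ((pick (c False False) (\<mu> False (\<eta> False 0 q)) \<oplus>\<^bsub>k\<^esub> pick (c False True) (\<mu> False (\<eta> True 0 q))) \<oplus>\<^bsub>k\<^esub>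
    (pick (c True False) (\<mu> True (\<eta> False 0 q)) \<oplus>\<^bsub>k\<^esub> pick (c True True) (\<mu> True (\<eta> True 0 q)))) \<oplus>\<^bsub>k\<^esub> F (bd P 1
      q))"
  have \<psi>h: "\<psi> \<in> kG_homs k G (Ob (2 - 1)) T"
  proof -
    have "\<psi> \<in> kG_homs k G (Ob 1) T"
    proof (rule kG_homsI)
      show "\<psi> v \<in> carrier T" if "v \<in> carrier (Ob 1)" for v using that by (simp add: \<psi>_def pick_rules \<mu> \<eta>c b1)
      show "\<psi> \<in> extensional (carrier (Ob 1))" by (simp add: \<psi>_def)
      show "\<psi> (u \<oplus>\<^bsub>Ob 1\<^esub> v) = \<psi> u \<oplus>\<^bsub>T\<^esub> \<psi> v" if "u \<in> carrier (Ob 1)" "v \<in> carrier (Ob 1)" for u v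
        using that by (simp add: \<psi>_def pick_rules \<mu> \<eta>c \<eta>r b1 ba vs_closed kk)
      show "\<psi> (x \<odot>\<^bsub>Ob 1\<^esub> v) = x \<odot>\<^bsub>T\<^esub> \<psi> v" if "x \<in> carrier k" "v \<in> carrier (Ob 1)" for x v
        using that by (simp add: \<psi>_def pick_rules \<mu> \<eta>c \<eta>r b1 ba vs_closed K.r_distr)
      show "\<psi> (act (Ob 1) v g) = act T (\<psi> v) g" if g: "g \<in> carrier G" and v: "v \<in> carrier (Ob 1)" for g v
        using g v \<mu>(1)[OF b1[OF v]]
        by (simp add: \<psi>_def pick_rules \<mu> \<eta>c \<eta>r b1 ba ac \<chi>_rules \<eta>(3) \<phi>_def aug_bd f quad_def K.r_distr kk)
    qed
    then show ?thesis by simp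
  qed
  have \<Psi>v: "\<Psi> s t v = pick (c s t) (\<mu> s (\<eta> t 0 (bd P 2 v)))" if "v \<in> carrier (Ob 2)" for s t v
    using that \<eta>c1[OF that] \<eta>b[OF that] by (simp add: \<Psi>_def pick_def compose_def \<phi>_def)
  have F0: "F \<zero>\<^bsub>Ob 0\<^esub> = \<zero>\<^bsub>k\<^esub>"
    using \<mu>(6)[OF K.zero_closed zero_closed[OF Ob_module]] \<mu>(2)[OF zero_closed[OF Ob_module]]
      by (simp add: smult_0 zero_closed)
  have "(\<lambda>v\<in>carrier (Ob 2). Y False v \<oplus>\<^bsub>T\<^esub> Y True v) v = \<psi> (bd P 2 v)" if v: "v \<in> carrier (Ob 2)" for v
  proof -
    have m: "pick (c s t) (\<mu> s (\<eta> t 0 (bd P 2 v))) \<in> carrier k" for s t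
      by (rule pick_rules(1), rule \<mu>(1), rule \<eta>c, rule b2, rule v)
    have "Y s v = pick (c s False) (\<mu> s (\<eta> False 0 (bd P 2 v))) \<oplus>\<^bsub>k\<^esub> pick (c s True)
        (\<mu> s (\<eta> True 0 (bd P 2 v)))" for s
      unfolding Y_def using v \<Psi>v[OF v] by simp
    then show ?thesis unfolding \<psi>_def using v b2[OF v] bd_bd[OF v, of 1 0] m F0 by simp
  qed
  from tcl_zeroI[OF T_kG tcl_sum_cocycle[OF T_kG YZ YZ] \<psi>h this] show ?B
    unfolding \<Psi>X tcl_add[OF T_kG \<Psi>Z \<Psi>Z] Y_def[symmetric] tcl_add[OF T_kG YZ YZ] .
qed

end

end

section \<open>The quaternion group\<close>

text \<open>The normal form z^e I^i J^j, where z = I I and the exponents are truth values.\<close>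

definition quaternion_element :: "('g, 'b) monoid_scheme \<Rightarrow> 'g \<Rightarrow> 'g \<Rightarrow> bool \<Rightarrow> bool \<Rightarrow> bool \<Rightarrow> 'g" where
  "quaternion_element G I J e i j =
     (if e then I \<otimes>\<^bsub>G\<^esub> I else \<one>\<^bsub>G\<^esub>) \<otimes>\<^bsub>G\<^esub> ((if i then I else \<one>\<^bsub>G\<^esub>) \<otimes>\<^bsub>G\<^esub> (if j then J else \<one>\<^bsub>G\<^esub>))"

context
  fixes G :: "('g, 'b) monoid_scheme" (structure) and I J K
  assumes Q: "quaternion_group G I J K"
begin

interpretation group G using Q by (simp add: quaternion_group_def)

abbreviation "qel \<equiv> quaternion_element G I J"

lemma quaternion_generators: "I \<in> carrier G" "J \<in> carrier G" "J \<otimes> J = I \<otimes> I" "(I \<otimes> J) \<otimes> (I \<otimes> J) = J \<otimes> J"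
  using Q by (auto simp: quaternion_group_def)

lemma quaternion_closed: "qel e i j \<in> carrier G"
  by (simp add: quaternion_element_def quaternion_generators)

text \<open>The correction to the exponent of z collects j i' from moving J past I by J I = z I J, i
  i' from I I = z and j j' from J J = z.\<close>

lemma quaternion_mult:
  "qel e i j \<otimes> qel e' i' j' = qel (e \<noteq> (e' \<noteq> ((j \<and> i') \<noteq> ((i \<and> i') \<noteq> (j \<and> j'))))) (i \<noteq> i') (j \<noteq> j')"
proof -
  note IJ = quaternion_generators
  define z where "z = I \<otimes> I"
  have z: "z \<in> carrier G" "I \<otimes> I = z" "J \<otimes> J = z" using IJ by (simp_all add: z_def)
  have Iz: "I \<otimes> z = z \<otimes> I" using IJ unfolding z_def by (simp add: m_assoc)
  have Jz: "J \<otimes> z = z \<otimes> J" using IJ(2) z(3)[symmetric] by (simp add: m_assoc)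
  have "(I \<otimes> (J \<otimes> I)) \<otimes> J = J \<otimes> J" using IJ(1,2,4) by (simp add: m_assoc)
  \<comment> \<open>Cancelling \<open>J\<close> in the relation for the square of
    \<open>I J\<close>; this identity yields both the commutation rule and the order of
    \<open>z\<close>.\<close>
  then have IJI: "I \<otimes> (J \<otimes> I) = J" using IJ(1,2) right_cancel[of J "I \<otimes> (J \<otimes> I)" J] by simp
  have left: "a \<in> carrier G \<Longrightarrow> b \<in> carrier G \<Longrightarrow> a \<otimes> b = c \<Longrightarrow> w \<in> carrier G \<Longrightarrow> a \<otimes> (b \<otimes> w) = c \<otimes> w" for a b c w
    using m_assoc by metis
  note lz = left[OF IJ(1) IJ(1) z(2)] left[OF IJ(2) IJ(2) z(3)] left[OF IJ(1) z(1) Iz] left[OF IJ(2) z(1) Jz]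
  have "z \<otimes> (J \<otimes> I) = I \<otimes> (I \<otimes> (J \<otimes> I))" using IJ z by (simp add: lz)
  then have IJz: "z \<otimes> (J \<otimes> I) = I \<otimes> J" by (simp add: IJI)
  \<comment> \<open>Squaring \<open>I J I = J\<close> gives z = z z z, so z z is the neutral
    element.\<close>
  have "z = (I \<otimes> (J \<otimes> I)) \<otimes> (I \<otimes> (J \<otimes> I))" by (simp add: IJI z)
  also have "\<dots> = z \<otimes> (z \<otimes> z)" using IJ(1,2) z Iz Jz by (simp add: m_assoc lz)
  finally have "z \<otimes> \<one> = z \<otimes> (z \<otimes> z)" using z(1) by simp
  then have zz: "z \<otimes> z = \<one>" using z(1) l_cancel[of z \<one> "z \<otimes> z"] by simp
  have JI: "J \<otimes> I = z \<otimes> (I \<otimes> J)" using left[OF z(1) z(1) zz, of "J \<otimes> I"] IJ z by (simp flip: IJz)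
  have lJI: "J \<otimes> (I \<otimes> w) = z \<otimes> (I \<otimes> (J \<otimes> w))" if "w \<in> carrier G" for w
    using left[OF IJ(2,1) JI that] that IJ z by (simp add: m_assoc)
  have lzz: "z \<otimes> (z \<otimes> w) = w" if "w \<in> carrier G" for w using left[OF z(1) z(1) zz that] that by simp
  show ?thesis
    unfolding quaternion_element_def z(2)
    by (cases e; cases e'; cases i; cases i'; cases j; cases j')
      (simp_all add: z IJ(1,2) Iz Jz JI zz m_assoc lz lJI lzz)
qed

text \<open>The normal forms contain the generators, and by the multiplication rule they are closed
  under products and inverses.\<close>

lemma quaternion_carrier: "carrier G = range (\<lambda>(e, i, j). qel e i j)"
proof
  note IJ = quaternion_generators
  have one: "\<one> = qel False False False" by (simp add: quaternion_element_def)
  have gen: "I = qel False True False" "J = qel False False True" "I \<otimes> J = qel False True True"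
    by (simp_all add: quaternion_element_def IJ)
  \<comment> \<open>The exponent of z is chosen to absorb the correction j i + i i + j j that the
    product with the original element creates.\<close>
  have inv: "inv (qel e i j) = qel (e \<noteq> ((j \<and> i) \<noteq> (i \<noteq> j))) i j" for e i j
    by (rule inv_equality[OF _ quaternion_closed quaternion_closed]) (auto simp: quaternion_mult one)
  have "\<exists>e i j. g = qel e i j" if "g \<in> generate G {I, J, K}" for g
    using that
  proof induction
    case one
    then show ?case using \<open>\<one> = qel False False False\<close> by blast
  next
    case (incl h)
    have "K = I \<otimes> J" using Q by (simp add: quaternion_group_def)
    then show ?case using incl gen by blast
  next
    case (inv h)
    have "K = I \<otimes> J" using Q by (simp add: quaternion_group_def)
    then obtain e i j where "h = qel e i j" using inv gen by blast
    then show ?case using \<open>\<And>e i j. inv (qel e i j) = _ e i j\<close> by blast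
  next
    case (eng h1 h2)
    then show ?case by (metis quaternion_mult)
  qed
  moreover have "generate G {I, J, K} = carrier G" using Q by (simp add: quaternion_group_def)
  ultimately show "carrier G \<subseteq> range (\<lambda>(e, i, j). qel e i j)"
    by (auto simp: image_def)
qed (auto simp: quaternion_closed)

lemma quaternion_finite: "finite (carrier G)"
  unfolding quaternion_carrier by simp

text \<open>The eight triples of exponents map onto a group of order eight, hence injectively. This
  makes the exponent of z a well defined function on the group.\<close>

lemma quaternion_inj: "qel e i j = qel e' i' j' \<longleftrightarrow> e = e' \<and> i = i' \<and> j = j'"
proof -
  have "card ((\<lambda>(e, i, j). qel e i j) ` UNIV) = 8" using Q
    unfolding quaternion_group_def order_def quaternion_carrier by simp
  then have "inj (\<lambda>(e, i, j). qel e i j)"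
    by (intro eq_card_imp_inj_on) (simp_all add: card_cartesian_product flip: UNIV_Times_UNIV)
  from inj_eq[OF this, of "(e, i, j)" "(e', i', j')"] show ?thesis by simp
qed

end

context tate
begin

lemma quaternion_main:
  fixes R :: "('k, ('p \<Rightarrow> 'k) set, 'r) graded_mod"
  assumes Q: "quaternion_group G I J K"
    and x: "\<chi>x \<in> hom G (add_monoid k)" "\<chi>x I = \<one>\<^bsub>k\<^esub>" "\<chi>x J = \<zero>\<^bsub>k\<^esub>"
    and y: "\<chi>y \<in> hom G (add_monoid k)" "\<chi>y I = \<zero>\<^bsub>k\<^esub>" "\<chi>y J = \<one>\<^bsub>k\<^esub>"
  defines "x \<equiv> hom_class k G P \<chi>x" and "y \<equiv> hom_class k G P \<chi>y"
  shows "x \<in> carrier (H 1)" "y \<in> carrier (H 1)"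
    and "canonical_class k G P \<noteq> \<zero>\<^bsub>HH k L 3 (-1)\<^esub>"
    and "realisable TYPE('m) k G P R \<Longrightarrow> \<not> direct_summand k L (C y (x \<oplus>\<^bsub>H 1\<^esub> y) x y) R"
proof -
  let ?q = "quaternion_element G I J"
  note IJ = quaternion_generators[OF Q]
  define \<chi> where "\<chi> i = (if i then \<chi>y else \<chi>x)" for i :: bool
  have \<chi>: "\<chi> i \<in> hom G (add_monoid k)" for i using x y by (simp add: \<chi>_def)
  have \<chi>r: "g \<in> carrier G \<Longrightarrow> \<chi> i g \<in> carrier k" "g \<in> carrier G \<Longrightarrow> h \<in> carrier G \<Longrightarrow> \<chi> i (g \<otimes>\<^bsub>G\<^esub> h) =
      \<chi> i g \<oplus>\<^bsub>k\<^esub> \<chi> i h" for i g h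
    using \<chi>[of i] by (auto simp: hom_def)
  have \<chi>1: "\<chi> i \<one>\<^bsub>G\<^esub> = \<zero>\<^bsub>k\<^esub>" for i using \<chi>r(2)[of "\<one>\<^bsub>G\<^esub>" "\<one>\<^bsub>G\<^esub>" i] \<chi>r(1)[of "\<one>\<^bsub>G\<^esub>" i] by (simp add: K_self)
  have \<chi>IJ: "\<chi> False I = \<one>\<^bsub>k\<^esub>" "\<chi> False J = \<zero>\<^bsub>k\<^esub>" "\<chi> True I = \<zero>\<^bsub>k\<^esub>" "\<chi> True J = \<one>\<^bsub>k\<^esub>"
    using x y by (simp_all add: \<chi>_def)
  have \<chi>q: "\<chi> False (?q e i j) = (if i then \<one>\<^bsub>k\<^esub> else \<zero>\<^bsub>k\<^esub>)" "\<chi> True (?q e i j) = (if j then \<one>\<^bsub>k\<^esub> else \<zero>\<^bsub>k\<^esub>)"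
    for e i j
    unfolding quaternion_element_def using IJ(1,2) by (simp_all add: \<chi>r(2) \<chi>1 \<chi>IJ K_self)
  have H2: "module k (H 2)" by simp
  have X: "hom_class k G P (\<chi> False) = x" "hom_class k G P (\<chi> True) = y" by (simp_all add: \<chi>_def x_def y_def)
  \<comment> \<open>The pointwise product \<open>f1\<close> of the two homomorphisms has as
    coboundary the sum of their cup products in both orders; this gives commutativity of
    \<open>x\<close> and \<open>y\<close>.\<close>
  define c1 where "c1 s t \<longleftrightarrow> s \<noteq> t" for s t :: bool
  define f1 where "f1 g = \<chi> False g \<otimes>\<^bsub>k\<^esub> \<chi> True g" for g
  have f1: "g \<in> carrier G \<Longrightarrow> f1 g \<in> carrier k"
    "g \<in> carrier G \<Longrightarrow> h \<in> carrier G \<Longrightarrow> f1 (g \<otimes>\<^bsub>G\<^esub> h) = f1 g \<oplus>\<^bsub>k\<^esub> (f1 h \<oplus>\<^bsub>k\<^esub> quad \<chi> c1 h (\<lambda>i. \<chi> i g))" for g h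
    by (simp_all add: f1_def c1_def quad_def pick_def \<chi>r K.l_distr K.r_distr K.a_ac K.m_comm)
  \<comment> \<open>The pattern x x + x y + y y. It is the class of the central extension of the
    Klein four group by the group generated by z, and it dies on the quaternion group.\<close>
  define c2 where "c2 s t \<longleftrightarrow> \<not> s \<or> t" for s t :: bool
  \<comment> \<open>The exponent of z in the normal form. Its coboundary, by the multiplication
    rule, is i i' + j i' + j j', the bilinear form with pattern \<open>c2\<close>.\<close>
  define f2 where "f2 g = (if \<exists>i j. g = ?q True i j then \<one>\<^bsub>k\<^esub> else \<zero>\<^bsub>k\<^esub>)" for g
  have f2q: "f2 (?q e i j) = (if e then \<one>\<^bsub>k\<^esub> else \<zero>\<^bsub>k\<^esub>)" for e i j by (simp add: f2_def quaternion_inj[OF Q])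
  have f2: "f2 g \<in> carrier k" for g by (simp add: f2_def)
  have df2: "f2 (g \<otimes>\<^bsub>G\<^esub> h) = f2 g \<oplus>\<^bsub>k\<^esub> (f2 h \<oplus>\<^bsub>k\<^esub> quad \<chi> c2 h (\<lambda>i. \<chi> i g))" if "g \<in> carrier G" "h \<in> carrier G"
    for g h
  proof -
    obtain e i j e' i' j' where gh: "g = ?q e i j" "h = ?q e' i' j'" using \<open>g \<in> carrier G\<close> \<open>h \<in> carrier G\<close>
      unfolding quaternion_carrier[OF Q] by auto
    have a: "\<one>\<^bsub>k\<^esub> \<oplus>\<^bsub>k\<^esub> \<one>\<^bsub>k\<^esub> = \<zero>\<^bsub>k\<^esub>" by (simp add: K_self)
    have b: "\<one>\<^bsub>k\<^esub> \<oplus>\<^bsub>k\<^esub> (\<one>\<^bsub>k\<^esub> \<oplus>\<^bsub>k\<^esub> u) = u" if "u \<in> carrier k" for u by (simp add: K_self2 that)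
    show ?thesis unfolding gh quaternion_mult[OF Q] f2q quad_def \<chi>q
      by (cases e; cases e'; cases i; cases i'; cases j; cases j') (simp_all add: c2_def pick_def a b K.a_assoc)
  qed
  obtain \<eta> where \<eta>: "\<And>i. \<eta> i \<in> Z 1" "\<And>i. ecl 1 (\<eta> i) = hom_class k G P (\<chi> i)"
    "\<And>i g p q. g \<in> carrier G \<Longrightarrow> p \<in> carrier (Ob 0) \<Longrightarrow> q \<in> carrier (Ob 1) \<Longrightarrow> bd P 1 q = act (Ob 0) p g \<oplus>\<^bsub>Ob 0\<^esub> p \<Longrightarrow>
      aug P (\<eta> i 0 q) = \<chi> i g \<otimes>\<^bsub>k\<^esub> aug P p"
    using quad_relation(1)[of \<chi> f1 c1, OF \<chi> f1] by blast
  have xH: "x \<in> carrier (H 1)" and yH: "y \<in> carrier (H 1)"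
    using ecl_closed[OF \<eta>(1), of False] ecl_closed[OF \<eta>(1), of True] unfolding \<eta>(2) X .
  then show "x \<in> carrier (H 1)" "y \<in> carrier (H 1)" .
  let ?m = "tact T 1 1"
  have mc: "?m u v \<in> carrier (H 2)" if "u \<in> carrier (H 1)" "v \<in> carrier (H 1)" for u v
    using tact_closed[OF T_kG that] by simp
  note mc = mc[OF xH xH] mc[OF xH yH] mc[OF yH xH] mc[OF yH yH]
  have R1: "?m x y \<oplus>\<^bsub>H 2\<^esub> ?m y x = \<zero>\<^bsub>H 2\<^esub>"
    using quad_relation(2)[of \<chi> f1 c1, OF \<chi> f1] mc unfolding X
      by (simp add: c1_def vs_r_zero[OF H2] vs_l_zero[OF H2])
  have R2: "?m x x \<oplus>\<^bsub>H 2\<^esub> (?m x y \<oplus>\<^bsub>H 2\<^esub> ?m y y) = \<zero>\<^bsub>H 2\<^esub>"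
    using quad_relation(2)[of \<chi> f2 c2, OF \<chi> f2 df2] mc unfolding X
      by (simp add: c2_def vs_ac[OF H2] vs_r_zero[OF H2] vs_l_zero[OF H2])
  have yx: "?m y x = ?m x y" using vs_eq[OF H2 mc(2,3)] R1 by simp
  \<comment> \<open>\<open>False\<close> is the first index: the rows are \<open>y\<close>,
    \<open>x + y\<close> and \<open>x\<close>, \<open>y\<close>.\<close>
  define B where "B i l = (if i = l then y else if i then x else x \<oplus>\<^bsub>H 1\<^esub> y)" for i l
  have xy: "x \<oplus>\<^bsub>H 1\<^esub> y \<in> carrier (H 1)" using xH yH by (simp add: add_closed)
  have B: "B i l \<in> carrier (H 1)" for i l using xH yH xy by (simp add: B_def)
  have ml: "?m (x \<oplus>\<^bsub>H 1\<^esub> y) v = ?m x v \<oplus>\<^bsub>H 2\<^esub> ?m y v" "?m v (x \<oplus>\<^bsub>H 1\<^esub> y) = ?m v x \<oplus>\<^bsub>H 2\<^esub> ?m v y"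
    if "v \<in> carrier (H 1)" for v
    using tact_add_left[OF T_kG xH yH that] tact_add_right[OF T_kG that xH yH] by simp_all
  have BB: "?m (B i False) (B False l) \<oplus>\<^bsub>H 2\<^esub> ?m (B i True) (B True l) = \<zero>\<^bsub>H 2\<^esub>" for i l
    using R2 mc by (cases i; cases l) (simp_all add: B_def ml xH yH yx vs_ac[OF H2] vs_self[OF H2]
      vs_self2[OF H2])
  \<comment> \<open>Both claims end here: each would produce a matrix of cocycles representing
    \<open>B\<close> whose threefold Massey product contains zero.\<close>
  have no: False if ex: "\<exists>b. (\<forall>i l. b i l \<in> Z 1 \<and> ecl 1 (b i l) = B i l) \<and> massey_vanishes b"
  proof -
    obtain b where b: "\<And>i l. b i l \<in> Z 1" "\<And>i l. ecl 1 (b i l) = B i l" and mv: "massey_vanishes b" using ex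
      by blast
    \<comment> \<open>A second matrix of representatives, built from cocycles with known values at
      group elements. The values pass to the given \<open>b\<close> through
      \<open>class_value\<close>, since both represent \<open>B\<close>.\<close>
    define \<beta> where "\<beta> i l = (if i = l then \<eta> True else if i then \<eta> False else \<eta> False \<oplus>\<^bsub>E 1\<^esub> \<eta> True)" for i l
    have \<beta>: "\<beta> i l \<in> Z 1" "ecl 1 (b i l) = ecl 1 (\<beta> i l)" for i l
      using \<eta>(1) cocycle_add[OF \<eta>(1) \<eta>(1), of False True] ecl_add[OF \<eta>(1) \<eta>(1), of False True] unfolding b(2)
      by (simp_all add: B_def \<beta>_def \<eta>(2) X)
    have val: "aug P (b i l 0 q) = (if i = l then \<chi> True g else if i then \<chi> False g else \<chi> False g \<oplus>\<^bsub>k\<^esub> \<chi>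
        True g) \<otimes>\<^bsub>k\<^esub> aug P p"
      if g: "g \<in> carrier G" and p: "p \<in> carrier (Ob 0)" and q: "q \<in> carrier (Ob 1)" "bd P 1 q =
          act (Ob 0) p g \<oplus>\<^bsub>Ob 0\<^esub> p" for i l g p q
    proof -
      have c: "\<eta> i 0 q \<in> carrier (Ob 0)" for i using endo_closed[OF cocycle_endo[OF \<eta>(1)], of q 0] q by simp
      have s: "(\<eta> False \<oplus>\<^bsub>E 1\<^esub> \<eta> True) 0 q = \<eta> False 0 q \<oplus>\<^bsub>Ob 0\<^esub> \<eta> True 0 q" using q by (simp add: endo_add_app)
      show ?thesis unfolding class_value[OF b(1) \<beta>(1) \<beta>(2) g p q]
        using aug_rules(2)[OF c c, of False True] aug_rules(1)[OF p] \<chi>r(1)[OF g]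
          by (simp add: \<beta>_def s \<eta>(3)[OF g p q] K.l_distr)
    qed
    have "\<not> massey_vanishes b"
    proof (rule not_massey_vanishes[OF b(1) IJ(1,2) IJ(3)[symmetric] IJ(4)])
      show "aug P (b i l 0 q) = (if i = l then \<zero>\<^bsub>k\<^esub> else aug P p)"
        if "p \<in> carrier (Ob 0)" "q \<in> carrier (Ob 1)" "bd P 1 q = act (Ob 0) p I \<oplus>\<^bsub>Ob 0\<^esub> p" for i l p q
        using val[OF IJ(1) that] aug_rules(1)[OF that(1)] by (simp add: \<chi>IJ)
      show "aug P (b i l 0 q) = (if i \<and> \<not> l then \<zero>\<^bsub>k\<^esub> else aug P p)"
        if "p \<in> carrier (Ob 0)" "q \<in> carrier (Ob 1)" "bd P 1 q = act (Ob 0) p J \<oplus>\<^bsub>Ob 0\<^esub> p" for i l p q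
        using val[OF IJ(2) that] aug_rules(1)[OF that(1)] by (simp add: \<chi>IJ)
    qed
    then show False using mv by simp
  qed
  show "canonical_class k G P \<noteq> \<zero>\<^bsub>HH k L 3 (-1)\<^esub>"
    using massey_of_canonical_class_zero[of B, OF B BB] no by blast
  show "\<not> direct_summand k L (C y (x \<oplus>\<^bsub>H 1\<^esub> y) x y) R" if real: "realisable TYPE('m) k G P R"
  proof
    assume d: "direct_summand k L (C y (x \<oplus>\<^bsub>H 1\<^esub> y) x y) R"
    have "direct_summand k L (C (B False False) (B False True) (B True False) (B True True)) R" using d
      by (simp add: B_def)
    from no[OF massey_of_summand[of B, OF B BB this real]] show False .
  qed
qed

end

theorem theorem2p1:
  fixes k :: "('k, 'c) ring_scheme"
    and Q :: "('g, 'b) monoid_scheme"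
    and I J K :: 'g
    and P :: "('k, 'p, 'g) kG_complex"
    and \<chi>x \<chi>y :: "'g \<Rightarrow> 'k"
  assumes k: "field k" and char2: "\<one>\<^bsub>k\<^esub> \<oplus>\<^bsub>k\<^esub> \<one>\<^bsub>k\<^esub> = \<zero>\<^bsub>k\<^esub>"
    and Q: "quaternion_group Q I J K"
    and P: "complete_resolution k Q P"
    and \<chi>x: "\<chi>x \<in> hom Q (add_monoid k)" "\<chi>x I = \<one>\<^bsub>k\<^esub>" "\<chi>x J = \<zero>\<^bsub>k\<^esub>"
    and \<chi>y: "\<chi>y \<in> hom Q (add_monoid k)" "\<chi>y I = \<zero>\<^bsub>k\<^esub>" "\<chi>y J = \<one>\<^bsub>k\<^esub>"
  defines "H \<equiv> tate_algebra k Q P"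
  defines "x \<equiv> hom_class k Q P \<chi>x"
  defines "y \<equiv> hom_class k Q P \<chi>y"
  defines "F \<equiv> graded_sum (regular_module H) (regular_module H)"
  defines "F' \<equiv> graded_sum (shift (-1) (regular_module H)) (shift (-1) (regular_module H))"
  defines "f \<equiv> (\<lambda>j (u, v).
      (alg_mult H 1 (j - 1) y u \<oplus>\<^bsub>alg_piece H j\<^esub> alg_mult H 1 (j - 1) (x \<oplus>\<^bsub>alg_piece H 1\<^esub> y) v,
       alg_mult H 1 (j - 1) x u \<oplus>\<^bsub>alg_piece H j\<^esub> alg_mult H 1 (j - 1) y v))"
  defines "C \<equiv> cokernel F' F f"
  shows "canonical_class k Q P \<in> carrier (HH k H 3 (-1))
       \<and> canonical_class k Q P \<noteq> \<zero>\<^bsub>HH k H 3 (-1)\<^esub>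
       \<and> graded_module k H C
       \<and> (\<forall>R :: ('k, ('p \<Rightarrow> 'k) set, 'r) graded_mod.
            realisable TYPE('m) k Q P R \<longrightarrow> \<not> direct_summand k H C R)"
proof -
  interpret tate k Q P
  proof (intro tate.intro char2_group.intro char2.intro char2_group_axioms.intro tate_axioms.intro)
    show "group Q" using Q by (simp add: quaternion_group_def)
  qed (use k char2 P quaternion_finite[OF Q] in auto)
  note main = quaternion_main[OF Q \<chi>x \<chi>y, folded x_def y_def]
  let ?xy = "x \<oplus>\<^bsub>tate_cohomology k Q P (trivial_kG k) 1\<^esub> y"
  have "?xy \<in> carrier (tate_cohomology k Q P (trivial_kG k) 1)" by (intro add_closed H_module main)
  note mem = main(2) this main(1,2)
  \<comment> \<open>The map in the statement is the matrix map with rows \<open>y\<close>,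
    \<open>x + y\<close> and \<open>x\<close>, \<open>y\<close>, so the results about its cokernel
    apply.\<close>
  have f: "f = matrix_map y ?xy x y"
    unfolding f_def by (simp add: fun_eq_iff matrix_map_def[OF mem] H_def L_simps)
  show ?thesis
    using canonical_class_closed main(3,4) C_graded[OF mem]
    unfolding C_def F_def F'_def f H_def[symmetric] by blast
qed

end
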